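(* Let $d\ge2$ be an integer, $\nu\in[0,+\infty)$, $u_0\in\mathbb{H}^\infty_{\Sigma 0}$, and let $u\in C^\infty([0,T),\mathbb{H}^\infty_{\Sigma 0})$ ($T\in(0,+\infty]$) be the maximal solution of the Navier-Stokes Cauchy problem with zero forcing $$\frac{du}{dt}=\nu\Delta u+\mathscr{P}(u,u),\qquad u(0)=u_0 .$$ Let $G_n$, $G_{pn}$ be constants as in the context. For $t\in[0,+\infty)$ put $e_\nu(t):=\frac{1-e^{-\nu t}}{\nu}$ if $\nu>0$ and $e_\nu(t):=t$ if $\nu=0$. Fix a real $n>d/2+1$ and put $$T_c:=\begin{cases}+\infty&\text{if }\nu>0,\ \|u_0\|_n\le\nu/G_n,\\[4pt] -\dfrac1\nu\log\Big(1-\dfrac{\nu}{G_n\|u_0\|_n}\Big)&\text{if }\nu>0,\ \|u_0\|_n>\nu/G_n,\\[8pt] \dfrac{1}{G_n\|u_0\|_n}&\text{if }\nu=0\end{cases}$$ (intending $1/(G_n\|u_0\|_n):=+\infty$ if $u_0=0$). Then $$T\ge T_c,$$ $$\|u(t)\|_p\ \le\ \frac{\|u_0\|_p\,e^{-\nu t}}{\big[1-G_n\|u_0\|_n\,e_\nu(t)\big]^{G_{pn}/G_n}}\qquad\text{for all real }p\ge n\text{ and all }t\in[0,T_c).$$ (So, if $\|u_0\|_n\le\nu/G_n$, then $u$ is global, i.e. $T=+\infty$, and its norm $\|u(t)\|_p$ of any Sobolev order $p$ decays exponentially for $t\to+\infty$.)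
   Context: **Spaces.** $\mathbb{T}^d:=(\mathbb{R}/2\pi\mathbb{Z})^d$. Every $\mathbb{R}^d$-valued distribution $v$ on $\mathbb{T}^d$ has a Fourier expansion $v=(2\pi)^{-d/2}\sum_{k\in\mathbb{Z}^d}v_k e^{ik\cdot x}$ with $v_k=\overline{v_{-k}}\in\mathbb{C}^d$. For $n\in\mathbb{R}$, $\mathbb{H}^n_{\Sigma 0}$ is the Sobolev space of those $v$ with zero divergence and zero mean ($k\cdot v_k=0$ for all $k$, $v_0=0$) such that $\sum_{k\ne0}|k|^{2n}|v_k|^2<+\infty$. It carries the inner product $\langle v|w\rangle_n:=\sum_{k\in\mathbb{Z}^d\setminus\{0\}}|k|^{2n}\,\overline{v_k}\cdot w_k$ and the norm $\|v\|_n:=\sqrt{\langle v|v\rangle_n}$. $\mathbb{H}^\infty_{\Sigma 0}:=\bigcap_{p\in\mathbb{R}}\mathbb{H}^p_{\Sigma 0}$ is a Fréchet space with the topology defined by all norms $\|\cdot\|_p$; it coincides with the space of $C^\infty$ vector fields $\mathbb{T}^d\to\mathbb{R}^d$ with zero divergence and zero mean. **Bilinear map.** $\mathscr{P}(v,w):=-\mathfrak{L}(v\cdot\partial w)$, where $(v\cdot\partial w)_r=\sum_{s=1}^d v_s\partial_s w_r$ and $\mathfrak{L}$ is the Leray projection onto divergence free vector fields (in Fourier terms, $(\mathfrak{L}z)_k$ is the orthogonal projection of $z_k$ onto $k^\perp$ in $\mathbb{C}^d$). $\mathscr{P}$ maps $\mathbb{H}^\infty_{\Sigma 0}\times\mathbb{H}^\infty_{\Sigma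 0}$ continuously to $\mathbb{H}^\infty_{\Sigma 0}$. **Constants.** It is known that there are constants $G_n,G_{pn}\in(0,+\infty)$ (depending also on $d$) such that: - $|\langle\mathscr{P}(v,w)|w\rangle_n|\le G_n\|v\|_n\|w\|_n^2$ for real $n>d/2+1$, $v\in\mathbb{H}^n_{\Sigma 0}$, $w\in\mathbb{H}^{n+1}_{\Sigma 0}$; - $|\langle\mathscr{P}(v,w)|w\rangle_p|\le\frac12 G_{pn}(\|v\|_p\|w\|_n+\|v\|_n\|w\|_p)\|w\|_p$ for real $p\ge n>d/2+1$, $v\in\mathbb{H}^p_{\Sigma 0}$, $w\in\mathbb{H}^{p+1}_{\Sigma 0}$. Any such constants are fixed, with $G_{nn}=G_n$. **Cauchy problem.** A solution is a function $u\in C^\infty([0,T),\mathbb{H}^\infty_{\Sigma 0})$, for some $T\in(0,+\infty]$ depending on $u$, satisfying the differential equation on $[0,T)$ and the initial condition. It is known that there is a unique maximal (not extendable) solution, of which every solution is a restriction. *)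

theory Defs
  imports "HOL-Analysis.Analysis" "HOL-Library.Extended_Real"
begin

(* Vector fields on the torus (R/2 pi Z)^d are functions on R^d that are 2 pi periodic in each
   variable; d is CARD('d). *)

type_synonym 'd vfield = "real^'d \<Rightarrow> real^'d"

definition torus_periodic :: "('d::finite) vfield \<Rightarrow> bool" where
  "torus_periodic v \<longleftrightarrow> (\<forall>x j. v (x + axis j (2 * pi)) = v x)"

definition wavevec :: "int^'d \<Rightarrow> real^('d::finite)" where
  "wavevec k = (\<chi> j. real_of_int (k $ j))"

(* Normalised so that v = (2 pi)^(-d/2) * (sum over k of v_k e^(i k.x)). *)
definition fourier_coeff :: "('d::finite) vfield \<Rightarrow> int^'d \<Rightarrow> complex^'d" where
  "fourier_coeff v k =
     (\<chi> r. complex_of_real ((2 * pi) powr (- (real CARD('d) / 2))) *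
           integral (cbox 0 (\<chi> j. 2 * pi))
             (\<lambda>x. cis (- (wavevec k \<bullet> x)) * complex_of_real (v x $ r)))"

definition wave_dot :: "int^'d \<Rightarrow> complex^'d \<Rightarrow> complex" where
  "wave_dot k z = (\<Sum>j\<in>(UNIV::('d::finite) set). of_int (k $ j) * z $ j)"

(* For n > d/2 every distribution in the Sobolev space of order n has exactly one continuous
   representative, so this is then the full Sobolev space of divergence free, mean zero fields.
   For n <= d/2 it contains only the continuous elements of that space. *)
definition Sob :: "real \<Rightarrow> ('d::finite) vfield set" where
  "Sob n = {v. continuous_on UNIV v \<and> torus_periodic v \<and>
               (\<forall>k. wave_dot k (fourier_coeff v k) = 0) \<and> fourier_coeff v 0 = 0 \<and>
               (\<lambda>k. norm (wavevec k) powr (2 * n) * (norm (fourier_coeff v k))\<^sup>2)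
                  summable_on (UNIV - {0})}"

definition Sob_inf :: "('d::finite) vfield set" where
  "Sob_inf = (\<Inter>p. Sob p)"

definition sob_inner :: "real \<Rightarrow> ('d::finite) vfield \<Rightarrow> 'd vfield \<Rightarrow> complex" where
  "sob_inner n v w =
     (\<Sum>\<^sub>\<infinity>k\<in>UNIV - {0}. complex_of_real (norm (wavevec k) powr (2 * n)) *
        (\<Sum>r\<in>UNIV. cnj (fourier_coeff v k $ r) * fourier_coeff w k $ r))"

definition sob_norm :: "real \<Rightarrow> ('d::finite) vfield \<Rightarrow> real" where
  "sob_norm n v = sqrt (Re (sob_inner n v v))"

definition partial :: "'d \<Rightarrow> (real^('d::finite) \<Rightarrow> real) \<Rightarrow> real^'d \<Rightarrow> real" where
  "partial s f x = frechet_derivative f (at x) (axis s 1)"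

definition advect :: "('d::finite) vfield \<Rightarrow> 'd vfield \<Rightarrow> 'd vfield" where
  "advect v w x = (\<chi> r. \<Sum>s\<in>UNIV. v x $ s * partial s (\<lambda>y. w y $ r) x)"

definition laplacian :: "('d::finite) vfield \<Rightarrow> 'd vfield" where
  "laplacian v x = (\<chi> r. \<Sum>s\<in>UNIV. partial s (partial s (\<lambda>y. v y $ r)) x)"

(* Orthogonal projection of C^d onto the orthogonal complement of k. For k = 0 the quotient is
   0 / 0 = 0 and the map is the identity. *)
definition proj_perp :: "int^'d \<Rightarrow> complex^'d \<Rightarrow> complex^('d::finite)" where
  "proj_perp k z =
     (\<chi> j. z $ j - wave_dot k z / complex_of_real ((norm (wavevec k))\<^sup>2) * of_int (k $ j))"

(* A continuous periodic field is determined by its Fourier coefficients. *)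
definition leray :: "('d::finite) vfield \<Rightarrow> 'd vfield" where
  "leray z = (THE g. continuous_on UNIV g \<and> torus_periodic g \<and>
                (\<forall>k. fourier_coeff g k = proj_perp k (fourier_coeff z k)))"

definition NS_bilin :: "('d::finite) vfield \<Rightarrow> 'd vfield \<Rightarrow> 'd vfield" where
  "NS_bilin v w = (\<lambda>x. - leray (advect v w) x)"

definition time_dom :: "ereal \<Rightarrow> real set" where
  "time_dom T = {t. 0 \<le> t \<and> ereal t < T}"

(* Derivative in the Frechet space Sob_inf, relative to the set I of times. *)
definition has_Sob_inf_derivative ::
    "(real \<Rightarrow> ('d::finite) vfield) \<Rightarrow> 'd vfield \<Rightarrow> real \<Rightarrow> real set \<Rightarrow> bool" where
  "has_Sob_inf_derivative u u' t I \<longleftrightarrow>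
     u' \<in> Sob_inf \<and>
     (\<forall>p. ((\<lambda>s. sob_norm p (\<lambda>x. (1 / (s - t)) *\<^sub>R (u s x - u t x) - u' x)) \<longlongrightarrow> 0)
            (at t within I))"

(* U j is the j-th time derivative of u. *)
definition smooth_curve :: "real set \<Rightarrow> (real \<Rightarrow> ('d::finite) vfield) \<Rightarrow> bool" where
  "smooth_curve I u \<longleftrightarrow>
     (\<forall>t\<in>I. u t \<in> Sob_inf) \<and>
     (\<exists>U :: nat \<Rightarrow> real \<Rightarrow> 'd vfield. U 0 = u \<and>
        (\<forall>j. \<forall>t\<in>I. has_Sob_inf_derivative (U j) (U (Suc j) t) t I))"

definition NS_solution ::
    "real \<Rightarrow> ('d::finite) vfield \<Rightarrow> ereal \<Rightarrow> (real \<Rightarrow> 'd vfield) \<Rightarrow> bool" where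
  "NS_solution \<nu> u0 T u \<longleftrightarrow>
     0 < T \<and> smooth_curve (time_dom T) u \<and> u 0 = u0 \<and>
     (\<forall>t\<in>time_dom T.
        has_Sob_inf_derivative u
          (\<lambda>x. \<nu> *\<^sub>R laplacian (u t) x + NS_bilin (u t) (u t) x) t (time_dom T))"

(* Maximal means not extendable. The values of u outside [0,T) are irrelevant. *)
definition NS_maximal_solution ::
    "real \<Rightarrow> ('d::finite) vfield \<Rightarrow> ereal \<Rightarrow> (real \<Rightarrow> 'd vfield) \<Rightarrow> bool" where
  "NS_maximal_solution \<nu> u0 T u \<longleftrightarrow>
     NS_solution \<nu> u0 T u \<and>
     \<not> (\<exists>T' u'. T < T' \<and> NS_solution \<nu> u0 T' u' \<and> (\<forall>t\<in>time_dom T. u' t = u t))"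

definition e_visc :: "real \<Rightarrow> real \<Rightarrow> real" where
  "e_visc \<nu> t = (if \<nu> > 0 then (1 - exp (- \<nu> * t)) / \<nu> else t)"

definition T_crit :: "real \<Rightarrow> real \<Rightarrow> real \<Rightarrow> ('d::finite) vfield \<Rightarrow> ereal" where
  "T_crit \<nu> G n u0 =
     (if \<nu> > 0 then
        (if sob_norm n u0 \<le> \<nu> / G then \<infinity>
         else ereal (- (1 / \<nu>) * ln (1 - \<nu> / (G * sob_norm n u0))))
      else if u0 = (\<lambda>x. 0) then \<infinity>
      else ereal (1 / (G * sob_norm n u0)))"

end

(* Taking the inner product of the equation with u in the Sobolev spaces of orders n and p, and using
   the two inequalities with v = w = u, one obtains for the norms the Riccati inequality
   x' <= - nu x + G_n x^2 and the linear inequality y' <= - nu y + G_pn x y; integrating them gives the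
   asserted bounds. The Galerkin approximations satisfy the same bounds, uniformly in the truncation,
   on every interval [0,tau] with tau < T_c. Since the trilinear form vanishes at order 0, they form a
   Cauchy sequence in L^2, so they converge to a solution on [0,tau]; a bootstrap shows that it is smooth
   in time. Uniqueness in L^2 identifies it with u, and maximality of u then forces T >= T_c.
   In the borderline case G_n x(0) = nu > 0 the bound only says that x <= nu / G_n. Write |.|_q for the
   norms of u. Since |k|^2 = 1 or |k|^2 >= 2 for k nonzero, 2 |.|_n^2 <= |.|_(n+1)^2 + |.|_0^2, and hence
   the derivative of |.|_n^2 + |.|_0^2 is at most - 2 nu |.|_n^2. So x cannot stay at nu / G_n forever, and
   from the time it drops below this value the bound gives exponential decay. *)

theory Submission imports Defs begin

section \<open>Fourier series on the torus\<close>

text \<open>Everything is carried out on Fourier coefficients: fields of \<open>Sob_inf\<close>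
  correspond to the families in \<open>ns_coeffs\<close>. There the Laplacian and the Leray
  projection act mode by mode, and truncation is symmetric for the inner products of all orders at
  once, so Galerkin solutions obey the energy inequalities with the very constants
  \<open>G n\<close> and \<open>GG p n\<close>. Solutions are constructed up to any time below
  \<open>T_crit\<close> in one go: no continuation criterion is at hand, and maximality can only be
  contradicted by an actual solution on a longer interval. L^2 is the level at which the difference
  of two solutions satisfies a Gronwall estimate without loss of derivatives; the higher norms enter
  convergence only as uniform bounds. This suffices because on sets bounded in all norms convergence
  of each coefficient implies convergence in every Sobolev norm. The same principle turns
  derivatives of single coefficients into derivatives in the Frechet space. The exponent
  \<open>GG p n / G n\<close> arises by integrating the linear inequality along the explicit
  majorant of the Riccati inequality.\<close>

definition tchar :: "int^'d \<Rightarrow> real^('d::finite) \<Rightarrow> complex" where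
  "tchar k x = cis (wavevec k \<bullet> x)"

abbreviation tbox :: "(real^('d::finite)) set" where
  "tbox \<equiv> cbox 0 (\<chi> j. 2 * pi)"

lemma wavevec_nth [simp]: "wavevec k $ j = real_of_int (k $ j)"
  by (simp add: wavevec_def)

lemma wavevec_add: "wavevec (k + l) = wavevec k + wavevec l"
  by (simp add: vec_eq_iff)

lemma wavevec_minus: "wavevec (- k) = - wavevec k"
  by (simp add: vec_eq_iff)

lemma wavevec_zero [simp]: "wavevec 0 = 0"
  by (simp add: vec_eq_iff)

lemma wavevec_eq_0_iff [simp]: "wavevec k = 0 \<longleftrightarrow> k = 0"
  by (simp add: vec_eq_iff)

lemma component_le_norm_wavevec: "\<bar>real_of_int (k $ j)\<bar> \<le> norm (wavevec k)"
  using component_le_norm_cart[of "wavevec k" j] by simp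

lemma norm_wavevec_ge_1:
  assumes "k \<noteq> 0" shows "1 \<le> norm (wavevec k)"
proof -
  obtain j where "k $ j \<noteq> 0" using assms by (auto simp: vec_eq_iff)
  hence "1 \<le> \<bar>k $ j\<bar>" by linarith
  hence "1 \<le> \<bar>real_of_int (k $ j)\<bar>" by linarith
  thus ?thesis using component_le_norm_wavevec[of k j] by linarith
qed

lemma tchar_zero [simp]: "tchar 0 x = 1"
  by (simp add: tchar_def)

lemma tchar_add: "tchar (k + l) x = tchar k x * tchar l x"
  by (simp add: tchar_def wavevec_add inner_add_left cis_mult)

lemma tchar_minus: "tchar (- k) x = cnj (tchar k x)"
  by (simp add: tchar_def wavevec_minus cis_cnj)

lemma norm_tchar [simp]: "norm (tchar k x) = 1"
  by (simp add: tchar_def)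

lemma continuous_on_tchar [continuous_intros]: "continuous_on A (tchar k)"
  unfolding tchar_def cis_conv_exp by (intro continuous_intros)

section \<open>Orthogonality of the characters on the period cell\<close>

lemma tchar_shift: "tchar k (x + axis j s) = tchar k x * cis (real_of_int (k $ j) * s)"
  by (simp add: tchar_def inner_add_right inner_axis cis_mult mult.commute)

lemma cis_int_2pi: "cis (real_of_int n * (2 * pi)) = 1"
  using cis_multiple_2pi[of "real_of_int n"] by (simp add: mult_ac)

lemma tchar_periodic: "tchar k (x + axis j (2 * pi)) = tchar k x"
  by (simp add: tchar_shift cis_int_2pi)

text \<open>The translated cell sticks out of the original one by a slab of width \<open>s\<close>;
  periodicity moves this slab back to the part that was left uncovered.\<close>

lemma integral_tbox_shift:
  fixes F :: "real^('d::finite) \<Rightarrow> 'b::euclidean_space"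
  assumes F: "continuous_on UNIV F" and per: "\<And>x. F (x + axis j (2 * pi)) = F x"
    and s: "0 \<le> s" "s \<le> 2 * pi"
  shows "integral tbox (\<lambda>x. F (x + axis j s)) = integral tbox F"
proof -
  let ?b = "(\<chi> j. 2 * pi) :: real^'d"
  have int: "F integrable_on cbox a c" for a c
    by (rule integrable_continuous) (rule continuous_on_subset[OF F], simp)
  have B: "axis j (1::real) \<in> Basis" by (simp add: axis_in_Basis_iff)
  have 1: "integral tbox (\<lambda>x. F (x + axis j s)) = integral (cbox (axis j s) (?b + axis j s)) F"
    using integral_shift_cbox[of "axis j s" "axis j s" "?b + axis j s" F] by simp
  have nth: "x \<bullet> axis j 1 = x $ j" for x :: "real^'d" by (simp add: inner_axis)
  have mem: "x \<in> cbox (axis j p) (?b + axis j q) \<longleftrightarrow>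
      (\<forall>i. i \<noteq> j \<longrightarrow> 0 \<le> x $ i \<and> x $ i \<le> 2 * pi) \<and> p \<le> x $ j \<and> x $ j \<le> 2 * pi + q" for x p q
    by (auto simp: mem_box_cart axis_def)
  have ax0: "axis j (0::real) = (0::real^'d)" by (simp add: vec_eq_iff axis_def)
  \<comment> \<open>The hyperplane \<open>x $ j = 2 * pi\<close> cuts the shifted cell and
    \<open>x $ j = s\<close> cuts the original one; the slab between these hyperplanes belongs to
    both cells, and the two remaining pieces differ by one period.\<close>
  have sp1: "cbox (axis j s) (?b + axis j s) \<inter> {x. x \<bullet> axis j 1 \<le> 2 * pi} = cbox (axis j s) ?b"
    using s mem[of _ s s] mem[of _ s 0] by (auto simp: set_eq_iff nth ax0)
  have sp2: "cbox (axis j s) (?b + axis j s) \<inter> {x. x \<bullet> axis j 1 \<ge> 2 * pi} = cbox (axis j (2 * pi)) (?b + axis j s)"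
    using s mem[of _ s s] mem[of _ "2 * pi" s] by (auto simp: set_eq_iff nth ax0)
  have sp3: "cbox 0 ?b \<inter> {x. x \<bullet> axis j 1 \<le> s} = cbox 0 (?b + axis j (s - 2 * pi))"
    using s mem[of _ 0 0] mem[of _ 0 "s - 2 * pi"] by (auto simp: set_eq_iff nth ax0)
  have sp4: "cbox 0 ?b \<inter> {x. x \<bullet> axis j 1 \<ge> s} = cbox (axis j s) ?b"
    using s mem[of _ 0 0] mem[of _ s 0] by (auto simp: set_eq_iff nth ax0)
  have ax: "axis j s - axis j (2 * pi) = (axis j (s - 2 * pi) :: real^'d)"
    by (simp add: vec_eq_iff axis_def)
  have "integral (cbox (axis j (2 * pi)) (?b + axis j s)) F
      = integral (cbox 0 (?b + axis j (s - 2 * pi))) (\<lambda>x. F (x + axis j (2 * pi)))"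
    using integral_shift_cbox[of "axis j (2 * pi)" "axis j (2 * pi)" "?b + axis j s" F]
    by (simp add: add_diff_eq[symmetric] ax)
  also have "\<dots> = integral (cbox 0 (?b + axis j (s - 2 * pi))) F"
    by (simp add: per)
  finally have 2: "integral (cbox (axis j (2 * pi)) (?b + axis j s)) F = integral (cbox 0 (?b + axis j (s - 2 * pi))) F" .
  have "integral (cbox (axis j s) (?b + axis j s)) F = integral (cbox (axis j s) ?b) F
      + integral (cbox 0 (?b + axis j (s - 2 * pi))) F"
    using integral_split[OF int B, of "axis j s" "?b + axis j s" "2 * pi"] unfolding sp1 sp2 2 .
  moreover have "integral tbox F = integral (cbox 0 (?b + axis j (s - 2 * pi))) F + integral (cbox (axis j s) ?b) F"
    using integral_split[OF int B, of 0 ?b s] unfolding sp3 sp4 .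
  ultimately show ?thesis unfolding 1 by simp
qed

text \<open>Translating by half a wavelength along a coordinate with \<open>k $ j \<noteq> 0\<close>
  multiplies the character by -1, so that the integral equals its own negative.\<close>

lemma integral_tchar:
  "integral tbox (tchar (k :: int^'d)) = (if k = 0 then of_real ((2 * pi) ^ CARD('d::finite)) else 0)"
proof (cases "k = 0")
  case True
  have "tchar (0 :: int^'d) = (\<lambda>x. 1)" by auto
  moreover have "measure lborel (tbox :: (real^'d) set) = (2 * pi) ^ CARD('d)"
  proof (subst content_cbox_cart)
    have "(0 :: real^'d) \<in> tbox" by (simp add: mem_box_cart)
    thus "(tbox :: (real^'d) set) \<noteq> {}" by blast
  qed simp
  ultimately show ?thesis using True by (simp add: scaleR_conv_of_real)
next
  case False
  then obtain j where j: "k $ j \<noteq> 0" by (auto simp: vec_eq_iff)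
  \<comment> \<open>Half a wavelength; as \<open>k $ j\<close> is a nonzero integer it is at most
    \<open>pi\<close>, hence within the range allowed for translations.\<close>
  define s where "s = pi / \<bar>real_of_int (k $ j)\<bar>"
  have "1 \<le> \<bar>real_of_int (k $ j)\<bar>" using j by linarith
  hence "s \<le> pi / 1" unfolding s_def by (intro divide_left_mono) auto
  moreover have "0 \<le> s" by (simp add: s_def)
  ultimately have s: "0 \<le> s" "s \<le> 2 * pi" using pi_gt_zero by linarith+
  have "real_of_int (k $ j) * s = pi \<or> real_of_int (k $ j) * s = - pi"
    using j by (auto simp: s_def abs_if)
  hence c: "cis (real_of_int (k $ j) * s) = -1" by (auto simp: complex_eq_iff)
  have "integral tbox (\<lambda>x. tchar k (x + axis j s)) = integral tbox (tchar k)"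
    by (rule integral_tbox_shift[OF continuous_on_tchar tchar_periodic s])
  hence "- integral tbox (tchar k) = integral tbox (tchar k)"
    by (simp add: tchar_shift c)
  thus ?thesis using False by (simp add: equation_minus_iff)
qed

text \<open>The factor (2 pi)^(-d/2) as a complex number; the argument only carries the
  dimension.\<close>

definition cvol :: "('d::finite) itself \<Rightarrow> complex" where
  "cvol _ = complex_of_real ((2 * pi) powr (- (real CARD('d) / 2)))"

lemma cvol_sq: "cvol TYPE('d::finite) * cvol TYPE('d) * of_real ((2 * pi) ^ CARD('d)) = 1"
proof -
  have "(2 * pi) powr (- (real CARD('d) / 2)) * (2 * pi) powr (- (real CARD('d) / 2)) * (2 * pi) ^ CARD('d)
      = (2 * pi) powr (- (real CARD('d) / 2) + - (real CARD('d) / 2) + real CARD('d))"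
    by (simp only: powr_add powr_realpow[symmetric] mult_pos_pos[OF zero_less_numeral pi_gt_zero])
  also have "\<dots> = 1" by simp
  finally show ?thesis unfolding cvol_def of_real_mult[symmetric] by simp
qed

lemma cvol_nonzero: "cvol TYPE('d::finite) \<noteq> 0"
  using cvol_sq[where 'd='d] by auto

lemma cnj_cvol [simp]: "cnj (cvol TYPE('d::finite)) = cvol TYPE('d)"
  by (simp add: cvol_def)

section \<open>Scalar Fourier coefficients and absolutely convergent Fourier series\<close>

definition fcoef :: "(real^'d \<Rightarrow> complex) \<Rightarrow> int^('d::finite) \<Rightarrow> complex" where
  "fcoef f k = cvol TYPE('d) * integral tbox (\<lambda>x. tchar (- k) x * f x)"

definition ser :: "(int^'d \<Rightarrow> complex) \<Rightarrow> real^('d::finite) \<Rightarrow> complex" where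
  "ser c x = cvol TYPE('d) * (\<Sum>\<^sub>\<infinity>k. c k * tchar k x)"

lemma fourier_coeff_eq_fcoef: "fourier_coeff v k $ r = fcoef (\<lambda>x. complex_of_real (v x $ r)) k"
  by (simp add: fourier_coeff_def fcoef_def cvol_def tchar_def wavevec_minus)

lemma summable_ser:
  assumes "(\<lambda>k. norm (c k)) summable_on UNIV"
  shows "(\<lambda>k. c k * tchar k x) summable_on UNIV"
  by (rule abs_summable_summable) (use assms in \<open>simp add: norm_mult\<close>)

lemma uniform_limit_ser:
  assumes "(\<lambda>k. norm (c k)) summable_on UNIV"
  shows "uniform_limit UNIV (\<lambda>X x. cvol TYPE('d) * (\<Sum>k\<in>X. c k * tchar k x))
           (ser (c :: int^('d::finite) \<Rightarrow> complex)) (finite_subsets_at_top UNIV)"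
  unfolding ser_def
  by (intro bounded_linear.uniform_limit[OF bounded_linear_mult_right] Weierstrass_m_test_general[where M = "\<lambda>k. norm (c k)"])
     (use assms in \<open>auto simp: norm_mult\<close>)

lemma continuous_on_ser:
  assumes "(\<lambda>k. norm (c k)) summable_on UNIV"
  shows "continuous_on A (ser c)"
proof (rule continuous_on_subset)
  show "continuous_on UNIV (ser c)"
    by (rule uniform_limit_theorem[OF _ uniform_limit_ser[OF assms]]) (auto intro!: always_eventually continuous_intros)
qed simp

lemma ser_periodic: "ser c (x + axis j (2 * pi)) = ser c x"
  by (simp add: ser_def tchar_periodic)

text \<open>Absolute summability of \<open>c\<close> makes the series converge uniformly on the
  compact cell (Weierstrass M-test), so it may be integrated term by term against the continuous
  factor \<open>g\<close>.\<close>

lemma has_sum_integral_ser_mult: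
  fixes c :: "int^('d::finite) \<Rightarrow> complex"
  assumes c: "(\<lambda>k. norm (c k)) summable_on UNIV" and g: "continuous_on UNIV g"
  shows "((\<lambda>k. c k * (cvol TYPE('d) * integral tbox (\<lambda>x. tchar k x * g x))) has_sum integral tbox (\<lambda>x. ser c x * g x)) UNIV"
proof -
  have "bounded (g ` tbox)"
    by (intro compact_imp_bounded compact_continuous_image continuous_on_subset[OF g]) auto
  then obtain B where B: "\<And>x. x \<in> tbox \<Longrightarrow> norm (g x) \<le> B"
    unfolding bounded_iff by blast
  have B0: "0 \<le> B" using order_trans[OF norm_ge_zero B[of 0]] by (simp add: mem_box_cart)
  have ser: "ser c x * g x = (\<Sum>\<^sub>\<infinity>k. c k * (cvol TYPE('d) * (tchar k x * g x)))" for x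
  proof -
    have "(\<Sum>\<^sub>\<infinity>k. c k * (cvol TYPE('d) * (tchar k x * g x))) = (\<Sum>\<^sub>\<infinity>k. (c k * tchar k x) * (cvol TYPE('d) * g x))"
      by (rule infsum_cong) (simp add: mult_ac)
    also have "\<dots> = (\<Sum>\<^sub>\<infinity>k. c k * tchar k x) * (cvol TYPE('d) * g x)"
      by (rule infsum_cmult_left')
    finally show ?thesis by (simp only: ser_def mult_ac)
  qed
  have u: "uniform_limit tbox (\<lambda>X x. \<Sum>k\<in>X. c k * (cvol TYPE('d) * (tchar k x * g x))) (\<lambda>x. ser c x * g x) (finite_subsets_at_top UNIV)"
    unfolding ser
  proof (rule Weierstrass_m_test_general[where M = "\<lambda>k. norm (c k) * (norm (cvol TYPE('d)) * B)"])
    show "(\<lambda>k. cmod (c k) * (cmod (cvol TYPE('d)) * B)) summable_on UNIV"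
      by (rule summable_on_cmult_left[OF c])
  qed (auto simp: norm_mult intro!: mult_left_mono B)
  have "\<exists>I J. (\<forall>X. ((\<lambda>x. \<Sum>k\<in>X. c k * (cvol TYPE('d) * (tchar k x * g x))) has_integral I X) tbox) \<and>
      ((\<lambda>x. ser c x * g x) has_integral J) tbox \<and> (I \<longlongrightarrow> J) (finite_subsets_at_top UNIV)"
  proof (rule uniform_limit_integral_cbox[OF u])
    show "continuous_on tbox (\<lambda>x. \<Sum>k\<in>X. c k * (cvol TYPE('d) * (tchar k x * g x)))" for X
      by (intro continuous_intros continuous_on_subset[OF g]) simp
    show "finite_subsets_at_top (UNIV :: (int^'d) set) \<noteq> bot" by simp
  qed (intro exI conjI allI)
  then obtain I J where I: "\<forall>X. ((\<lambda>x. \<Sum>k\<in>X. c k * (cvol TYPE('d) * (tchar k x * g x))) has_integral I X) tbox"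
    and J: "((\<lambda>x. ser c x * g x) has_integral J) tbox" and IJ: "(I \<longlongrightarrow> J) (finite_subsets_at_top UNIV)"
    by (elim exE conjE)
  have gi: "(\<lambda>x. tchar k x * g x) integrable_on tbox" for k
    by (intro integrable_continuous continuous_intros continuous_on_subset[OF g]) simp
  have 3: "((\<lambda>x. \<Sum>k\<in>X. c k * (cvol TYPE('d) * (tchar k x * g x))) has_integral
      (\<Sum>k\<in>X. c k * (cvol TYPE('d) * integral tbox (\<lambda>x. tchar k x * g x)))) tbox" if "finite X" for X
    by (intro has_integral_sum has_integral_mult_right that integrable_integral gi)
  have "(\<Sum>k\<in>X. c k * (cvol TYPE('d) * integral tbox (\<lambda>x. tchar k x * g x))) = I X" if "finite X" for X
    by (rule has_integral_unique[OF _ I[rule_format]]) (rule 3[OF that])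
  hence "eventually (\<lambda>X. (\<Sum>k\<in>X. c k * (cvol TYPE('d) * integral tbox (\<lambda>x. tchar k x * g x))) = I X) (finite_subsets_at_top UNIV)"
    by (intro eventually_finite_subsets_at_top_weakI)
  from iffD2[OF tendsto_cong[OF this] IJ]
  have "((\<lambda>X. \<Sum>k\<in>X. c k * (cvol TYPE('d) * integral tbox (\<lambda>x. tchar k x * g x))) \<longlongrightarrow> J) (finite_subsets_at_top UNIV)" .
  thus ?thesis using J by (simp add: has_sum_def integral_unique)
qed

text \<open>The convolution formula for a product. One factor is an absolutely convergent series
  while \<open>g\<close> is merely continuous, so that the case \<open>g = 1\<close> yields
  \<open>fcoef_ser\<close>.\<close>

lemma fcoef_ser_mult:
  fixes c :: "int^('d::finite) \<Rightarrow> complex"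
  assumes c: "(\<lambda>k. norm (c k)) summable_on UNIV" and g: "continuous_on UNIV g"
  shows "fcoef (\<lambda>x. ser c x * g x) k = cvol TYPE('d) * (\<Sum>\<^sub>\<infinity>h. c h * fcoef g (k - h))"
proof -
  have "integral tbox (\<lambda>x. ser c x * (tchar (- k) x * g x)) = (\<Sum>\<^sub>\<infinity>h. c h * (cvol TYPE('d) * integral tbox (\<lambda>x. tchar h x * (tchar (- k) x * g x))))"
    by (intro infsumI[symmetric] has_sum_integral_ser_mult c continuous_intros g)
  also have "\<dots> = (\<Sum>\<^sub>\<infinity>h. c h * fcoef g (k - h))"
  proof (rule infsum_cong)
    fix h
    have "tchar h x * (tchar (- k) x * g x) = tchar (- (k - h)) x * g x" for x
      using tchar_add[of h "- k" x] by (simp add: mult.assoc)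
    hence "(\<lambda>x. tchar h x * (tchar (- k) x * g x)) = (\<lambda>x. tchar (- (k - h)) x * g x)" by blast
    thus "c h * (cvol TYPE('d) * integral tbox (\<lambda>x. tchar h x * (tchar (- k) x * g x))) = c h * fcoef g (k - h)"
      unfolding fcoef_def by simp
  qed
  finally have "integral tbox (\<lambda>x. ser c x * (tchar (- k) x * g x)) = (\<Sum>\<^sub>\<infinity>h. c h * fcoef g (k - h))" .
  moreover have "(\<lambda>x. tchar (- k) x * (ser c x * g x)) = (\<lambda>x. ser c x * (tchar (- k) x * g x))"
    by (auto simp: mult_ac)
  ultimately show ?thesis unfolding fcoef_def by simp
qed

lemma fcoef_tchar: "fcoef (\<lambda>x. 1) k = (if k = 0 then inverse (cvol TYPE('d::finite)) else 0)" for k :: "int^'d"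
proof -
  have 1: "fcoef (\<lambda>x. 1) k = cvol TYPE('d) * integral tbox (tchar (- k))"
    by (simp add: fcoef_def)
  have "cvol TYPE('d) * complex_of_real ((2 * pi) ^ CARD('d)) = inverse (cvol TYPE('d))"
    by (rule inverse_unique[symmetric]) (use cvol_sq[where 'd='d] in \<open>simp only: mult_ac\<close>)
  thus ?thesis unfolding 1 integral_tchar by auto
qed

lemma fcoef_ser:
  fixes c :: "int^('d::finite) \<Rightarrow> complex"
  assumes c: "(\<lambda>k. norm (c k)) summable_on UNIV"
  shows "fcoef (ser c) k = c k"
proof -
  have "fcoef (\<lambda>x. ser c x * 1) k = cvol TYPE('d) * (\<Sum>\<^sub>\<infinity>h. c h * fcoef (\<lambda>x. 1) (k - h))"
    by (rule fcoef_ser_mult[OF c]) simp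
  also have "(\<Sum>\<^sub>\<infinity>h. c h * fcoef (\<lambda>x. 1) (k - h)) = (\<Sum>\<^sub>\<infinity>h\<in>{k}. c h * fcoef (\<lambda>x. 1) (k - h))"
    by (rule infsum_cong_neutral) (auto simp: fcoef_tchar)
  finally show ?thesis using cvol_nonzero[where 'd='d] by (simp add: fcoef_tchar)
qed

section \<open>Uniqueness of Fourier coefficients\<close>

lemma periodic_shift_int:
  fixes f :: "real^('d::finite) \<Rightarrow> 'b"
  assumes per: "\<And>x j. f (x + axis j (2 * pi)) = f x"
  shows "f (x + (2 * pi) *\<^sub>R wavevec n) = f x"
proof -
  have nat: "f (x + axis j (2 * pi * real m)) = f x" for x j and m :: nat
  proof (induction m)
    case (Suc m)
    have "x + axis j (2 * pi * real (Suc m)) = (x + axis j (2 * pi * real m)) + axis j (2 * pi)"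
      by (simp add: vec_eq_iff axis_def algebra_simps)
    thus ?case using per[of "x + axis j (2 * pi * real m)" j] Suc by (simp only:)
  qed (simp add: axis_def vec_eq_iff zero_vec_def[symmetric])
  have int: "f (x + axis j (2 * pi * real_of_int m)) = f x" for x j m
  proof (cases "m \<ge> 0")
    case True
    thus ?thesis using nat[of x j "nat m"] by simp
  next
    case False
    have "x = (x + axis j (2 * pi * real_of_int m)) + axis j (2 * pi * real (nat (- m)))"
      using False by (simp add: vec_eq_iff axis_def algebra_simps)
    from arg_cong[OF this, of f] show ?thesis
      unfolding nat[of "x + axis j (2 * pi * real_of_int m)" j "nat (- m)"] by (rule sym)
  qed
  have fin: "f (x + (\<Sum>j\<in>A. axis j (2 * pi * real_of_int (n $ j)))) = f x" if "finite A" for A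
    using that
  proof (induction A)
    case (insert j A)
    have "f (x + (\<Sum>j\<in>insert j A. axis j (2 * pi * real_of_int (n $ j))))
        = f ((x + (\<Sum>j\<in>A. axis j (2 * pi * real_of_int (n $ j)))) + axis j (2 * pi * real_of_int (n $ j)))"
      using insert by (simp add: add_ac)
    also have "\<dots> = f (x + (\<Sum>j\<in>A. axis j (2 * pi * real_of_int (n $ j))))" by (rule int)
    also have "\<dots> = f x" by (rule insert.IH)
    finally show ?case .
  qed simp
  have "(\<Sum>j\<in>UNIV. axis j (2 * pi * real_of_int (n $ j))) = (2 * pi) *\<^sub>R wavevec n"
    by (simp add: vec_eq_iff axis_def sum.delta)
  with fin[of UNIV] show ?thesis by simp
qed

text \<open>The torus is realised as a product of unit circles in complex space, a compact set to
  which Stone-Weierstrass applies; \<open>texp\<close> is the covering map and \<open>targ\<close> a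
  discontinuous right inverse with values in the period cell.\<close>

definition texp :: "real^'d \<Rightarrow> complex^('d::finite)" where
  "texp x = (\<chi> j. cis (x $ j))"

definition targ :: "complex^'d \<Rightarrow> real^('d::finite)" where
  "targ z = (\<chi> j. Arg2pi (z $ j))"

abbreviation torus :: "(complex^('d::finite)) set" where
  "torus \<equiv> {z. \<forall>j. norm (z $ j) = 1}"

lemma texp_in_torus: "texp x \<in> torus"
  by (simp add: texp_def)

lemma continuous_on_texp: "continuous_on A texp"
  unfolding texp_def cis_conv_exp by (intro continuous_intros)

lemma targ_in_tbox: "targ z \<in> tbox"
  unfolding targ_def mem_box_cart by (simp add: Arg2pi_ge_0 order.strict_implies_order[OF Arg2pi_lt_2pi])

lemma texp_targ:
  assumes "z \<in> torus" shows "texp (targ z) = z"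
proof -
  have "cis (Arg2pi (z $ j)) = z $ j" for j
  proof -
    have "norm (z $ j) = 1" using assms by blast
    hence "complex_of_real (norm (z $ j)) * exp (\<i> * complex_of_real (Arg2pi (z $ j))) = cis (Arg2pi (z $ j))"
      by (simp add: cis_conv_exp)
    thus ?thesis using Arg2pi_eq[of "z $ j"] by (rule trans[OF sym sym])
  qed
  thus ?thesis by (simp add: texp_def targ_def vec_eq_iff)
qed

lemma texp_image: "texp ` tbox = torus"
proof
  show "texp ` tbox \<subseteq> torus" by (rule image_subsetI) (rule texp_in_torus)
  show "torus \<subseteq> texp ` tbox" 
  proof
    fix z :: "complex^'d" assume "z \<in> torus"
    from texp_targ[OF this, symmetric] targ_in_tbox[of z] show "z \<in> texp ` tbox" by (rule image_eqI)
  qed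
qed

lemma compact_torus: "compact (torus :: (complex^('d::finite)) set)"
proof -
  have "compact (texp ` (tbox :: (real^'d) set))"
    by (intro compact_continuous_image continuous_on_texp compact_cbox)
  thus ?thesis by (simp only: texp_image)
qed

lemma texp_eq_imp:
  assumes "texp x = texp y"
  obtains n where "y = x + (2 * pi) *\<^sub>R wavevec n"
proof -
  have "\<exists>n. y $ j = x $ j + 2 * pi * real_of_int n" for j
  proof -
    have "cis (x $ j) = cis (y $ j)" using assms by (simp add: texp_def vec_eq_iff)
    hence "cos (y $ j) = cos (x $ j)" "sin (y $ j) = sin (x $ j)" by (simp_all add: complex_eq_iff)
    thus ?thesis using sin_cos_eq_iff[of "y $ j" "x $ j"] by simp
  qed
  then obtain n where "\<And>j. y $ j = x $ j + 2 * pi * real_of_int (n j)" by metis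
  hence "y = x + (2 * pi) *\<^sub>R wavevec (\<chi> j. n j)" by (simp add: vec_eq_iff)
  thus ?thesis using that by blast
qed

text \<open>Finite sums of characters, generated inductively so that closure under products reduces
  to \<open>tchar_add\<close>.\<close>

inductive_set trig_poly :: "(real^('d::finite) \<Rightarrow> complex) set" where
  char: "(\<lambda>x. a * tchar k x) \<in> trig_poly"
| add: "p \<in> trig_poly \<Longrightarrow> q \<in> trig_poly \<Longrightarrow> (\<lambda>x. p x + q x) \<in> trig_poly"

lemma continuous_on_trig_poly: "p \<in> trig_poly \<Longrightarrow> continuous_on A p"
  by (induction rule: trig_poly.induct) (intro continuous_intros, assumption?)+

lemma trig_poly_mult:
  assumes "p \<in> trig_poly" "q \<in> trig_poly"
  shows "(\<lambda>x. p x * q x) \<in> trig_poly"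
  using assms
proof (induction arbitrary: q rule: trig_poly.induct)
  case (char a k)
  from char show ?case
  proof (induction rule: trig_poly.induct)
    case (char b l)
    have "(\<lambda>x. a * tchar k x * (b * tchar l x)) = (\<lambda>x. (a * b) * tchar (k + l) x)"
      by (auto simp: tchar_add mult_ac)
    thus ?case by (simp add: trig_poly.char)
  next
    case (add p q)
    thus ?case by (simp add: distrib_left trig_poly.add)
  qed
next
  case (add p1 p2)
  thus ?case by (simp add: distrib_right trig_poly.add)
qed

lemma integral_trig_poly_mult:
  assumes "p \<in> trig_poly" and f: "continuous_on UNIV f" and "\<And>k. fcoef f k = 0"
  shows "integral tbox (\<lambda>x. p x * f x) = 0"
  using assms(1)
proof (induction rule: trig_poly.induct)
  case (char a k)
  have "integral tbox (\<lambda>x. tchar k x * f x) = 0"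
    using assms(3)[of "- k"] cvol_nonzero by (auto simp: fcoef_def)
  thus ?case by (simp add: mult.assoc)
next
  case (add p q)
  have "(\<lambda>x. r x * f x) integrable_on tbox" if "r \<in> trig_poly" for r
    by (rule integrable_continuous)
      (intro continuous_intros continuous_on_trig_poly that continuous_on_subset[OF f] subset_UNIV)
  thus ?case using add by (simp add: distrib_right integral_add)
qed

text \<open>Stone-Weierstrass approximates \<open>f\<close> uniformly by trigonometric polynomials,
  all of which are orthogonal to \<open>f\<close>; hence the integral of the square of
  \<open>f\<close> vanishes, and continuity gives \<open>f = 0\<close> on the cell.\<close>

lemma fcoef_zero_imp_zero:
  fixes f :: "real^('d::finite) \<Rightarrow> real"
  assumes f: "continuous_on UNIV f" and per: "\<And>x j. f (x + axis j (2 * pi)) = f x"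
    and z: "\<And>k. fcoef (\<lambda>x. complex_of_real (f x)) k = 0"
  shows "f x = 0"
proof -
  have inv: "f x = f y" if "texp x = texp y" for x y
    using texp_eq_imp[OF that] periodic_shift_int[of f, OF per] by metis
  \<comment> \<open>By periodicity \<open>f\<close> descends to a function \<open>g\<close> on the
    torus with \<open>f x = g (texp x)\<close>.\<close>
  define g where "g = (\<lambda>z. f (targ z))"
  have g: "g (texp x) = f x" for x
    unfolding g_def by (rule inv) (simp add: texp_targ[OF texp_in_torus])
  \<comment> \<open>As \<open>targ\<close> is not continuous, continuity of \<open>g\<close> is read
    off from \<open>texp\<close>: a continuous map from the compact cell onto the Hausdorff torus is
    a quotient map.\<close>
  have cg: "continuous_on torus g"
  proof (subst continuous_on_open_gen[where T = UNIV])
    show "\<forall>U. openin (top_of_set UNIV) U \<longrightarrow> openin (top_of_set torus) (torus \<inter> g -` U)"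
    proof (intro allI impI)
      fix U :: "real set" assume "openin (top_of_set UNIV) U"
      hence U: "open U" by simp
      have "tbox \<inter> texp -` (torus \<inter> g -` U) = tbox \<inter> f -` U"
        using texp_in_torus g by auto
      hence "openin (top_of_set tbox) (tbox \<inter> texp -` (torus \<inter> g -` U))"
        using continuous_openin_preimage_gen[OF continuous_on_subset[OF f subset_UNIV] U] by simp
      thus "openin (top_of_set torus) (torus \<inter> g -` U)"
        using Abstract_Topology_2.continuous_imp_quotient_map[OF continuous_on_texp texp_image compact_cbox, of "torus \<inter> g -` U"] by simp
    qed
  qed simp
  \<comment> \<open>The algebra for Stone-Weierstrass: continuous functions on the torus whose
    pullback is a trigonometric polynomial. Real and imaginary parts of the coordinates belong to it
    and separate points.\<close>
  define R where "R = {q. continuous_on torus q \<and> (\<lambda>x. complex_of_real (q (texp x))) \<in> (trig_poly :: (real^'d \<Rightarrow> complex) set)}"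
  have tcos: "(\<lambda>x. complex_of_real (Re (texp x $ j))) \<in> trig_poly"
    and tsin: "(\<lambda>x. complex_of_real (Im (texp x $ j))) \<in> trig_poly" for j :: 'd
  proof -
    have t: "tchar (axis j 1) x = cis (x $ j)" for x
    proof -
      have "wavevec (axis j 1) = axis j 1" by (simp add: vec_eq_iff axis_def)
      thus ?thesis by (simp add: tchar_def inner_axis')
    qed
    have "(\<lambda>x. (1/2) * tchar (axis j 1) x + (1/2) * tchar (- axis j 1) x) \<in> trig_poly"
      by (intro trig_poly.intros)
    moreover have "(\<lambda>x. (1/2) * tchar (axis j 1) x + (1/2) * tchar (- axis j 1) x) = (\<lambda>x. complex_of_real (Re (texp x $ j)))"
      by (auto simp: tchar_minus t texp_def complex_eq_iff)
    ultimately show "(\<lambda>x. complex_of_real (Re (texp x $ j))) \<in> trig_poly" by simp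
    have "(\<lambda>x. (-\<i>/2) * tchar (axis j 1) x + (\<i>/2) * tchar (- axis j 1) x) \<in> trig_poly"
      by (intro trig_poly.intros)
    moreover have "(\<lambda>x. (-\<i>/2) * tchar (axis j 1) x + (\<i>/2) * tchar (- axis j 1) x) = (\<lambda>x. complex_of_real (Im (texp x $ j)))"
      by (auto simp: tchar_minus t texp_def complex_eq_iff)
    ultimately show "(\<lambda>x. complex_of_real (Im (texp x $ j))) \<in> trig_poly" by simp
  qed
  interpret function_ring_on R torus
  proof
    show "compact (torus :: (complex^'d) set)" by (rule compact_torus)
  next
    fix c :: real
    have "(\<lambda>x. complex_of_real c * tchar 0 x) \<in> (trig_poly :: (real^'d \<Rightarrow> complex) set)" by (rule trig_poly.char)
    thus "(\<lambda>_. c) \<in> R" by (simp add: R_def)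
  next
    fix z w :: "complex^'d" assume "z \<in> torus" "w \<in> torus" "z \<noteq> w"
    then obtain j where "z $ j \<noteq> w $ j" by (auto simp: vec_eq_iff)
    hence ne: "Re (z $ j) \<noteq> Re (w $ j) \<or> Im (z $ j) \<noteq> Im (w $ j)" by (simp add: complex_eq_iff)
    have "continuous_on torus (\<lambda>z :: complex^'d. Re (z $ j))" by (intro continuous_intros)
    hence re: "(\<lambda>z. Re (z $ j)) \<in> R" unfolding R_def using tcos[of j] by (intro CollectI conjI)
    have "continuous_on torus (\<lambda>z :: complex^'d. Im (z $ j))" by (intro continuous_intros)
    hence im: "(\<lambda>z. Im (z $ j)) \<in> R" unfolding R_def using tsin[of j] by (intro CollectI conjI)
    from ne show "\<exists>f\<in>R. f z \<noteq> f w"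
    proof
      assume "Re (z $ j) \<noteq> Re (w $ j)"
      thus ?thesis by (intro bexI[OF _ re])
    next
      assume "Im (z $ j) \<noteq> Im (w $ j)"
      thus ?thesis by (intro bexI[OF _ im])
    qed
  next
    fix f g assume fg: "f \<in> R" "g \<in> R"
    from fg have "continuous_on torus (\<lambda>x. f x + g x)" "continuous_on torus (\<lambda>x. f x * g x)"
      unfolding R_def by (auto intro: continuous_on_add continuous_on_mult)
    moreover have "(\<lambda>x. complex_of_real (f (texp x) + g (texp x))) \<in> trig_poly"
      using trig_poly.add[of "\<lambda>x. complex_of_real (f (texp x))" "\<lambda>x. complex_of_real (g (texp x))"] fg
      unfolding R_def by simp
    moreover have "(\<lambda>x. complex_of_real (f (texp x) * g (texp x))) \<in> trig_poly"
      using trig_poly_mult[of "\<lambda>x. complex_of_real (f (texp x))" "\<lambda>x. complex_of_real (g (texp x))"] fg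
      unfolding R_def by simp
    ultimately show "(\<lambda>x. f x + g x) \<in> R" "(\<lambda>x. f x * g x) \<in> R"
      unfolding R_def by simp_all
  qed (simp add: R_def)
  have fi: "continuous_on tbox f" by (rule continuous_on_subset[OF f]) simp
  have ff: "(\<lambda>x. f x * f x) integrable_on tbox"
    by (intro integrable_continuous continuous_intros fi)
  \<comment> \<open>The approximation \<open>q\<close> is orthogonal to \<open>f\<close>, so one
    factor \<open>f\<close> may be replaced by its difference from \<open>q\<close>, which is
    smaller than \<open>e\<close>.\<close>
  have le: "integral tbox (\<lambda>x. f x * f x) \<le> e * integral tbox (\<lambda>x. \<bar>f x\<bar>)" if e: "e > 0" for e
  proof -
    obtain q where q: "q \<in> R" "\<And>z. z \<in> torus \<Longrightarrow> \<bar>g z - q z\<bar> < e"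
      using Stone_Weierstrass_basic[OF cg e] by blast
    have cq: "continuous_on A (\<lambda>x. q (texp x))" for A :: "(real^'d) set"
    proof (rule continuous_on_compose2[OF _ continuous_on_texp, of torus q])
      show "continuous_on torus q" using q(1) by (simp add: R_def)
      show "texp ` A \<subseteq> torus" by (rule image_subsetI) (rule texp_in_torus)
    qed
    have qi: "(\<lambda>x. q (texp x) * f x) integrable_on tbox"
      by (intro integrable_continuous continuous_intros fi cq)
    have "complex_of_real (integral tbox (\<lambda>x. q (texp x) * f x)) = integral tbox (\<lambda>x. complex_of_real (q (texp x)) * complex_of_real (f x))"
      using integral_linear[OF qi, of complex_of_real, OF bounded_linear_of_real] by (simp add: o_def)
    also have "\<dots> = 0"
    proof (rule integral_trig_poly_mult)
      show "(\<lambda>x. complex_of_real (q (texp x))) \<in> trig_poly" using q(1) by (simp add: R_def)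
      show "continuous_on UNIV (\<lambda>x. complex_of_real (f x))" by (intro continuous_intros f)
    qed (rule z)
    finally have 0: "integral tbox (\<lambda>x. q (texp x) * f x) = 0" by simp
    have "integral tbox (\<lambda>x. f x * f x) = integral tbox (\<lambda>x. f x * f x) - integral tbox (\<lambda>x. q (texp x) * f x)"
      using 0 by simp
    also have "\<dots> = integral tbox (\<lambda>x. f x * f x - q (texp x) * f x)"
      by (rule integral_diff[OF ff qi, symmetric])
    also have "\<dots> \<le> integral tbox (\<lambda>x. e * \<bar>f x\<bar>)"
    proof (rule integral_le)
      fix x assume "x \<in> (tbox :: (real^'d) set)"
      have "f x * f x - q (texp x) * f x = (g (texp x) - q (texp x)) * f x" by (simp add: g left_diff_distrib)
      also have "\<dots> \<le> \<bar>g (texp x) - q (texp x)\<bar> * \<bar>f x\<bar>" by (metis abs_ge_self abs_mult)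
      also have "\<dots> \<le> e * \<bar>f x\<bar>"
        using q(2)[OF texp_in_torus, of x] by (intro mult_right_mono) auto
      finally show "f x * f x - q (texp x) * f x \<le> e * \<bar>f x\<bar>" .
    qed (intro integrable_continuous continuous_intros fi cq)+
    finally show ?thesis by simp
  qed
  have "integral tbox (\<lambda>x. f x * f x) \<le> 0"
  proof (rule ccontr)
    assume "\<not> ?thesis"
    hence pos: "integral tbox (\<lambda>x. f x * f x) > 0" by simp
    define A where "A = integral tbox (\<lambda>x. \<bar>f x\<bar>)"
    have A: "A \<ge> 0" unfolding A_def by (intro integral_nonneg integrable_continuous continuous_intros fi) auto
    \<comment> \<open>Here \<open>e\<close> is the integral divided by twice \<open>A + 1\<close>;
      the summand 1 keeps the quotient meaningful when \<open>A = 0\<close>.\<close>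
    have "integral tbox (\<lambda>x. f x * f x) \<le> (integral tbox (\<lambda>x. f x * f x) / (2 * (A + 1))) * A"
      unfolding A_def[symmetric] by (rule le[folded A_def]) (use pos A in auto)
    also have "\<dots> < integral tbox (\<lambda>x. f x * f x)"
    proof -
      define J where "J = integral (tbox :: (real^'d) set) (\<lambda>x. f x * f x)"
      have "J > 0" using pos by (simp add: J_def)
      hence "J * A < J * (2 * (A + 1))" using A by (intro mult_strict_left_mono) auto
      thus ?thesis unfolding J_def[symmetric] using A by (simp add: field_simps)
    qed
    finally show False by simp
  qed
  moreover have "integral tbox (\<lambda>x. f x * f x) \<ge> 0"
    by (intro integral_nonneg ff) auto
  ultimately have "integral tbox (\<lambda>x. f x * f x) = 0" by simp
  with integrable_integral[OF ff] have hi: "((\<lambda>x. f x * f x) has_integral 0) tbox" by simp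
  have "f y * f y = 0" if "y \<in> tbox" for y
  proof (rule has_integral_0_cbox_imp_0[where f = "\<lambda>x. f x * f x" and x = y])
    show "continuous_on tbox (\<lambda>x. f x * f x)" by (intro continuous_intros fi)
    have "(\<chi> j. 1) \<in> (box 0 (\<chi> j. 2 * pi) :: (real^'d) set)"
      using pi_gt3 by (simp add: mem_box_cart)
    thus "box 0 (\<chi> j. 2 * pi) \<noteq> ({} :: (real^'d) set)" by (simp only: ex_in_conv[symmetric]) (rule exI)
    show "((\<lambda>x. f x * f x) has_integral 0) tbox" by (rule hi)
  qed (use that in simp_all)
  from this[OF targ_in_tbox, of "texp x"] g[of x] show ?thesis unfolding g_def by simp
qed

section \<open>Rapidly decreasing coefficients\<close>

text \<open>A weight that behaves like |k| for large k but is at least 1 everywhere, so that index 0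
  causes no exception and the weight is submultiplicative; \<open>wt\<close> is an inverse power of
  it that is summable over the lattice.\<close>

definition br :: "int^('d::finite) \<Rightarrow> real" where
  "br k = 1 + norm (wavevec k)"

definition wt :: "int^('d::finite) \<Rightarrow> real" where
  "wt k = inverse (br k ^ (2 * CARD('d)))"

lemma br_ge_1: "1 \<le> br k"
  by (simp add: br_def)

lemma br_pos: "0 < br k"
  using br_ge_1[of k] by linarith

text \<open>This inequality distributes a power of the weight at \<open>k\<close> over the two
  factors of a convolution.\<close>

lemma br_add_le: "br (h + l) \<le> br h * br l"
proof -
  have "norm (wavevec (h + l)) \<le> norm (wavevec h) + norm (wavevec l)"
    by (simp add: wavevec_add norm_triangle_ineq)
  moreover have "0 \<le> norm (wavevec h) * norm (wavevec l)" by simp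
  moreover have "br h * br l = 1 + norm (wavevec h) + norm (wavevec l) + norm (wavevec h) * norm (wavevec l)"
    by (simp add: br_def algebra_simps)
  ultimately show ?thesis unfolding br_def[of "h + l"] by linarith
qed

lemma norm_wavevec_le_br: "norm (wavevec k) \<le> br k"
  by (simp add: br_def)

lemma wt_pos: "0 < wt k"
  by (simp add: wt_def br_pos)

text \<open>Real exponents, negative ones included, are dominated by natural powers:
  \<open>norm (wavevec k) \<ge> 1\<close> off the origin, and \<open>0 powr s = 0\<close> at the
  origin.\<close>

lemma br_powr_bound: "norm (wavevec k) powr s \<le> br k ^ nat \<lceil>\<bar>s\<bar>\<rceil>"
proof (cases "k = 0")
  case True
  thus ?thesis using br_pos[of k] by (simp add: less_imp_le)
next
  case False
  let ?x = "norm (wavevec k)"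
  have x: "1 \<le> ?x" by (rule norm_wavevec_ge_1[OF False])
  have "?x powr s \<le> ?x powr (real (nat \<lceil>\<bar>s\<bar>\<rceil>))"
    using x by (intro powr_mono) linarith+
  also have "\<dots> = ?x ^ nat \<lceil>\<bar>s\<bar>\<rceil>"
    using x by (intro powr_realpow) linarith
  also have "\<dots> \<le> br k ^ nat \<lceil>\<bar>s\<bar>\<rceil>"
    by (intro power_mono norm_wavevec_le_br) simp
  finally show ?thesis .
qed

text \<open>Telescoping: the two new terms, at m + 1 and -(m + 1), contribute 2 / (m + 2)^2, which
  is at most 2 / (m + 1) - 2 / (m + 2).\<close>

lemma sum_inverse_square_int_le:
  "(\<Sum>i\<in>{- int m..int m}. inverse ((1 + \<bar>real_of_int i\<bar>)\<^sup>2)) \<le> 3 - 2 / (real m + 1)"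
proof (induction m)
  case (Suc m)
  have "{- int (Suc m)..int (Suc m)} = insert (- int (Suc m)) (insert (int (Suc m)) {- int m..int m})"
    by auto
  hence "(\<Sum>i\<in>{- int (Suc m)..int (Suc m)}. inverse ((1 + \<bar>real_of_int i\<bar>)\<^sup>2))
      = 2 * inverse ((real m + 2)\<^sup>2) + (\<Sum>i\<in>{- int m..int m}. inverse ((1 + \<bar>real_of_int i\<bar>)\<^sup>2))"
    by (simp add: add_ac)
  also have "\<dots> \<le> 2 * inverse ((real m + 2)\<^sup>2) + (3 - 2 / (real m + 1))"
    using Suc by simp
  also have "2 * inverse ((real m + 2)\<^sup>2) \<le> 2 / (real m + 1) - 2 / (real m + 2)"
  proof -
    have "2 / (real m + 1) - 2 / (real m + 2) = 2 * inverse ((real m + 1) * (real m + 2))"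
      by (simp add: field_simps)
    moreover have "inverse ((real m + 2)\<^sup>2) \<le> inverse ((real m + 1) * (real m + 2))"
      by (intro le_imp_inverse_le) (auto simp: power2_eq_square)
    ultimately show ?thesis by simp
  qed
  finally show ?case by (simp add: add_ac)
qed simp

text \<open>The weight \<open>br k\<close> dominates each 1 + |k_j|, hence \<open>wt\<close> is at
  most a product of one-dimensional terms 1 / (1 + |k_j|)^2, and every finite partial sum is at most
  3^d.\<close>

lemma summable_wt: "(wt :: int^('d::finite) \<Rightarrow> real) summable_on UNIV"
proof (rule nonneg_bdd_above_summable_on)
  define q where "q = (\<lambda>i::int. inverse ((1 + \<bar>real_of_int i\<bar>)\<^sup>2))"
  have q0: "0 \<le> q i" for i by (simp add: q_def)
  have wt_le: "wt k \<le> (\<Prod>j\<in>UNIV. q (k $ j))" for k :: "int^'d"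
  proof -
    have "(\<Prod>j\<in>UNIV. (1 + \<bar>real_of_int (k $ j)\<bar>)\<^sup>2) \<le> (\<Prod>j\<in>(UNIV::'d set). (br k)\<^sup>2)"
      by (intro prod_mono conjI power_mono) (auto simp: br_def component_le_norm_wavevec)
    also have "\<dots> = br k ^ (2 * CARD('d))" by (simp add: power_mult)
    finally have "inverse (br k ^ (2 * CARD('d))) \<le> inverse (\<Prod>j\<in>UNIV. (1 + \<bar>real_of_int (k $ j)\<bar>)\<^sup>2)"
      by (intro le_imp_inverse_le prod_pos) (auto simp: zero_less_power2)
    thus ?thesis by (simp add: wt_def q_def prod_inversef[symmetric] o_def)
  qed
  show "bdd_above (sum (wt :: int^'d \<Rightarrow> real) ` {F. F \<subseteq> UNIV \<and> finite F})"
  proof (rule bdd_aboveI2)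
    fix F :: "(int^'d) set" assume "F \<in> {F. F \<subseteq> UNIV \<and> finite F}"
    hence F: "finite F" by simp
    \<comment> \<open>Any \<open>m\<close> for which the cube [-m, m]^d contains \<open>F\<close>
      would do; the sum of the absolute values of all coordinates is a convenient one.\<close>
    define m where "m = (\<Sum>k\<in>F. \<Sum>j\<in>UNIV. nat \<bar>k $ j\<bar>)"
    have km: "k $ j \<in> {- int m..int m}" if "k \<in> F" for k j
    proof -
      have "nat \<bar>k $ j\<bar> \<le> (\<Sum>j\<in>UNIV. nat \<bar>k $ j\<bar>)" by (rule member_le_sum) auto
      also have "\<dots> \<le> m" unfolding m_def using that F by (intro member_le_sum) auto
      finally show ?thesis by auto
    qed
    have inj: "inj_on (\<lambda>k. (\<lambda>j. k $ j)) F" by (auto simp: inj_on_def vec_eq_iff fun_eq_iff)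
    have "sum wt F \<le> (\<Sum>k\<in>F. \<Prod>j\<in>UNIV. q (k $ j))" by (intro sum_mono wt_le)
    also have "\<dots> = (\<Sum>f\<in>(\<lambda>k. (\<lambda>j. k $ j)) ` F. \<Prod>j\<in>UNIV. q (f j))"
      by (subst sum.reindex[OF inj]) simp
    also have "\<dots> \<le> (\<Sum>f\<in>PiE UNIV (\<lambda>_. {- int m..int m}). \<Prod>j\<in>(UNIV::'d set). q (f j))"
      by (intro sum_mono2 finite_PiE image_subsetI prod_nonneg q0) (use km in \<open>auto simp: PiE_def\<close>)
    also have "\<dots> = (\<Prod>j\<in>(UNIV::'d set). \<Sum>i\<in>{- int m..int m}. q i)"
      by (rule prod_sum_PiE[symmetric]) auto
    also have "\<dots> \<le> (\<Prod>j\<in>(UNIV::'d set). 3)"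
    proof (intro prod_mono conjI sum_nonneg q0)
      have "(\<Sum>i\<in>{- int m..int m}. q i) \<le> 3 - 2 / (real m + 1)"
        unfolding q_def by (rule sum_inverse_square_int_le)
      also have "\<dots> \<le> 3" by simp
      finally show "(\<Sum>i\<in>{- int m..int m}. q i) \<le> 3" .
    qed
    finally show "sum wt F \<le> (\<Prod>j\<in>(UNIV::'d set). 3)" .
  qed
qed (simp add: less_imp_le[OF wt_pos])

text \<open>\<open>rapid S\<close> means that \<open>S\<close> is a bounded subset of the Frechet space of rapidly decreasing families.\<close>

definition rapid :: "(int^('d::finite) \<Rightarrow> 'b::real_normed_vector) set \<Rightarrow> bool" where
  "rapid S \<longleftrightarrow> (\<forall>r. \<exists>M. \<forall>a\<in>S. \<forall>k. br k ^ r * norm (a k) \<le> M)"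

lemma rapid_subset: "rapid S \<Longrightarrow> S' \<subseteq> S \<Longrightarrow> rapid S'"
  unfolding rapid_def by (meson subsetD)

lemma rapid_single: "rapid S \<Longrightarrow> a \<in> S \<Longrightarrow> rapid {a}"
  by (rule rapid_subset) simp_all

lemma rapidD:
  fixes S :: "(int^('d::finite) \<Rightarrow> 'b::real_normed_vector) set"
  assumes "rapid S"
  obtains M where "M \<ge> 0" "\<And>a k. a \<in> S \<Longrightarrow> br k ^ r * norm (a k) \<le> M"
proof -
  obtain M where M: "\<forall>a\<in>S. \<forall>k. br k ^ r * norm (a k) \<le> M" using assms unfolding rapid_def by meson
  show ?thesis
  proof (rule that[of "max M 0"])
    fix a k assume "a \<in> S"
    with M have "br k ^ r * norm (a k) \<le> M" by blast
    thus "br k ^ r * norm (a k) \<le> max M 0" by simp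
  qed simp
qed

text \<open>Spending \<open>2 * CARD('d)\<close> further powers of the weight turns a uniform bound
  into a summable majorant.\<close>

lemma rapid_wtD:
  fixes S :: "(int^('d::finite) \<Rightarrow> 'b::real_normed_vector) set"
  assumes "rapid S"
  obtains M where "M \<ge> 0" "\<And>a k. a \<in> S \<Longrightarrow> br k ^ r * norm (a k) \<le> M * wt k"
proof -
  obtain M where M: "M \<ge> 0" "\<And>a k. a \<in> S \<Longrightarrow> br k ^ (r + 2 * CARD('d)) * norm (a k) \<le> M"
    using rapidD[OF assms, of "r + 2 * CARD('d)"] by blast
  show ?thesis
  proof (rule that[OF M(1)])
    fix a k assume a: "a \<in> S"
    have "br k ^ r * norm (a k) = (br k ^ (r + 2 * CARD('d)) * norm (a k)) * wt k"
      using br_pos[of k] by (simp add: wt_def power_add field_simps)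
    also have "\<dots> \<le> M * wt k"
      by (intro mult_right_mono M(2)[OF a] less_imp_le[OF wt_pos])
    finally show "br k ^ r * norm (a k) \<le> M * wt k" .
  qed
qed

lemma rapid_single_wtD:
  assumes "rapid {a}"
  obtains M where "M \<ge> 0" "\<And>k. br k ^ r * norm (a k) \<le> M * wt k"
proof -
  obtain M where "M \<ge> 0" "\<And>b k. b \<in> {a} \<Longrightarrow> br k ^ r * norm (b k) \<le> M * wt k"
    using rapid_wtD[OF assms, of r] by blast
  from this(1) this(2)[OF singletonI] show ?thesis by (rule that)
qed

lemma rapid_singleD:
  assumes "rapid {a}"
  obtains M where "M \<ge> 0" "\<And>k. br k ^ r * norm (a k) \<le> M"
proof -
  obtain M where "M \<ge> 0" "\<And>b k. b \<in> {a} \<Longrightarrow> br k ^ r * norm (b k) \<le> M"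
    using rapidD[OF assms, of r] by blast
  from this(1) this(2)[OF singletonI] show ?thesis by (rule that)
qed

text \<open>A loss of \<open>q\<close> powers of the weight is harmless since \<open>S\<close> is
  bounded in all orders. Differentiation, scalar multiples and truncation are instances.\<close>

lemma rapidI_mult:
  assumes "rapid S" and "\<And>b. b \<in> S' \<Longrightarrow> \<exists>a\<in>S. \<forall>k. norm (b k) \<le> C * br k ^ q * norm (a k)" and C: "C \<ge> 0"
  shows "rapid S'"
  unfolding rapid_def
proof
  fix r
  obtain M where M: "\<And>a k. a \<in> S \<Longrightarrow> br k ^ (r + q) * norm (a k) \<le> M"
    using rapidD[OF assms(1)] by blast
  show "\<exists>M. \<forall>a\<in>S'. \<forall>k. br k ^ r * norm (a k) \<le> M"
  proof (intro exI ballI allI)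
    fix b k assume "b \<in> S'"
    then obtain a where a: "a \<in> S" "norm (b k) \<le> C * br k ^ q * norm (a k)" using assms(2) by blast
    have "br k ^ r * norm (b k) \<le> br k ^ r * (C * br k ^ q * norm (a k))"
      by (intro mult_left_mono a(2)) (simp add: br_pos less_imp_le)
    also have "\<dots> = C * (br k ^ (r + q) * norm (a k))" by (simp add: power_add mult_ac)
    also have "\<dots> \<le> C * M" by (intro mult_left_mono M a C)
    finally show "br k ^ r * norm (b k) \<le> C * M" .
  qed
qed

lemma rapidI_add:
  assumes "rapid S1" "rapid S2" and "\<And>b. b \<in> S' \<Longrightarrow> \<exists>a1\<in>S1. \<exists>a2\<in>S2. \<forall>k. norm (b k) \<le> norm (a1 k) + norm (a2 k)"
  shows "rapid S'"
  unfolding rapid_def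
proof
  fix r
  obtain M1 where M1: "\<And>a k. a \<in> S1 \<Longrightarrow> br k ^ r * norm (a k) \<le> M1"
    using rapidD[OF assms(1)] by blast
  obtain M2 where M2: "\<And>a k. a \<in> S2 \<Longrightarrow> br k ^ r * norm (a k) \<le> M2"
    using rapidD[OF assms(2)] by blast
  show "\<exists>M. \<forall>a\<in>S'. \<forall>k. br k ^ r * norm (a k) \<le> M"
  proof (intro exI ballI allI)
    fix b k assume "b \<in> S'"
    then obtain a1 a2 where a: "a1 \<in> S1" "a2 \<in> S2" "norm (b k) \<le> norm (a1 k) + norm (a2 k)" using assms(3) by blast
    have "br k ^ r * norm (b k) \<le> br k ^ r * (norm (a1 k) + norm (a2 k))"
      by (intro mult_left_mono a(3)) (simp add: br_pos less_imp_le)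
    also have "\<dots> \<le> M1 + M2" using M1[OF a(1), of k] M2[OF a(2), of k] by (simp add: distrib_left)
    finally show "br k ^ r * norm (b k) \<le> M1 + M2" .
  qed
qed

text \<open>By submultiplicativity the power of \<open>br k\<close> splits into powers of
  \<open>br h\<close> and \<open>br (k - h)\<close>; one factor supplies the summable weight, the
  other only a bound.\<close>

lemma wt_conv_bound:
  fixes f g :: "int^('d::finite) \<Rightarrow> real"
  assumes f: "\<And>k. 0 \<le> f k" "\<And>k. br k ^ r * f k \<le> M1 * wt k"
    and g: "\<And>k. 0 \<le> g k" "\<And>k. br k ^ r * g k \<le> M2" and M: "M1 \<ge> 0" "M2 \<ge> 0"
  shows "(\<lambda>h. f h * g (k - h)) summable_on UNIV"
    and "br k ^ r * (\<Sum>\<^sub>\<infinity>h. f h * g (k - h)) \<le> M1 * M2 * (\<Sum>\<^sub>\<infinity>h. wt (h :: int^'d))"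
proof -
  have g1: "g k \<le> M2" for k
  proof -
    have "g k \<le> br k ^ r * g k" using g(1)[of k] br_ge_1[of k] by (simp add: mult_le_cancel_right1)
    thus ?thesis using g(2)[of k] by linarith
  qed
  have f1: "f k \<le> M1 * wt k" for k
  proof -
    have "f k \<le> br k ^ r * f k" using f(1)[of k] br_ge_1[of k] by (simp add: mult_le_cancel_right1)
    thus ?thesis using f(2)[of k] by linarith
  qed
  have S: "(\<lambda>h. M1 * M2 * wt (h :: int^'d)) summable_on UNIV"
    by (intro summable_on_cmult_right summable_wt)
  show s: "(\<lambda>h. f h * g (k - h)) summable_on UNIV"
  proof (rule summable_on_comparison_test[OF S])
    fix h show "f h * g (k - h) \<le> M1 * M2 * wt h"
      using mult_mono[OF f1[of h] g1[of "k - h"]] g(1) M less_imp_le[OF wt_pos[of h]]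
      by (simp add: mult_ac)
  qed (simp add: f(1) g(1))
  have "br k ^ r * (\<Sum>\<^sub>\<infinity>h. f h * g (k - h)) = (\<Sum>\<^sub>\<infinity>h. br k ^ r * (f h * g (k - h)))"
    by (rule infsum_cmult_right'[symmetric])
  also have "\<dots> \<le> (\<Sum>\<^sub>\<infinity>h. M1 * M2 * wt (h :: int^'d))"
  proof (rule infsum_mono)
    show "(\<lambda>h. br k ^ r * (f h * g (k - h))) summable_on UNIV" by (intro summable_on_cmult_right s)
    fix h
    have "br k ^ r \<le> (br h * br (k - h)) ^ r"
      using br_add_le[of h "k - h"] br_pos[of k] by (intro power_mono) auto
    hence "br k ^ r * (f h * g (k - h)) \<le> (br h * br (k - h)) ^ r * (f h * g (k - h))"
      by (intro mult_right_mono mult_nonneg_nonneg f g)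
    also have "\<dots> = (br h ^ r * f h) * (br (k - h) ^ r * g (k - h))" by (simp add: power_mult_distrib mult_ac)
    also have "\<dots> \<le> (M1 * wt h) * M2"
      by (intro mult_mono f g mult_nonneg_nonneg M less_imp_le[OF wt_pos]) (simp add: less_imp_le[OF br_pos])
    finally show "br k ^ r * (f h * g (k - h)) \<le> M1 * M2 * wt h" by (simp add: mult_ac)
  qed (rule S)
  also have "\<dots> = M1 * M2 * (\<Sum>\<^sub>\<infinity>h. wt (h :: int^'d))" by (rule infsum_cmult_right')
  finally show "br k ^ r * (\<Sum>\<^sub>\<infinity>h. f h * g (k - h)) \<le> M1 * M2 * (\<Sum>\<^sub>\<infinity>h. wt (h :: int^'d))" .
qed

lemma rapid_conv_summable:
  assumes "rapid {a}" "rapid {b}"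
  shows "(\<lambda>h. norm (a h) * norm (b (k - h))) summable_on UNIV"
proof -
  obtain M1 where M1: "M1 \<ge> 0" "\<And>k. br k ^ 0 * norm (a k) \<le> M1 * wt k"
    using rapid_single_wtD[OF assms(1), of 0] by blast
  obtain M2 where M2: "M2 \<ge> 0" "\<And>k. br k ^ 0 * norm (b k) \<le> M2"
    using rapid_singleD[OF assms(2), of 0] by blast
  show ?thesis
    by (rule wt_conv_bound(1)[OF norm_ge_zero M1(2) norm_ge_zero M2(2) M1(1) M2(1)])
qed

lemma rapidI_conv:
  assumes "rapid S1" "rapid S2" and C: "C \<ge> 0"
    and "\<And>b. b \<in> S' \<Longrightarrow> \<exists>a1\<in>S1. \<exists>a2\<in>S2. \<forall>k. norm (b k) \<le> C * br k ^ q * (\<Sum>\<^sub>\<infinity>h. norm (a1 h) * norm (a2 (k - h)))"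
  shows "rapid (S' :: (int^('d::finite) \<Rightarrow> _) set)"
  unfolding rapid_def
proof
  fix r
  obtain M1 where M1: "M1 \<ge> 0" "\<And>a k. a \<in> S1 \<Longrightarrow> br k ^ (r + q) * norm (a k) \<le> M1 * wt k"
    using rapid_wtD[OF assms(1), of "r + q"] by blast
  obtain M2 where M2: "M2 \<ge> 0" "\<And>a k. a \<in> S2 \<Longrightarrow> br k ^ (r + q) * norm (a k) \<le> M2"
    using rapidD[OF assms(2), of "r + q"] by blast
  show "\<exists>M. \<forall>a\<in>S'. \<forall>k. br k ^ r * norm (a k) \<le> M"
  proof (intro exI ballI allI)
    fix b k assume "b \<in> S'"
    then obtain a1 a2 where a: "a1 \<in> S1" "a2 \<in> S2"
      "norm (b k) \<le> C * br k ^ q * (\<Sum>\<^sub>\<infinity>h. norm (a1 h) * norm (a2 (k - h)))" using assms(4) by blast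
    have "br k ^ r * norm (b k) \<le> br k ^ r * (C * br k ^ q * (\<Sum>\<^sub>\<infinity>h. norm (a1 h) * norm (a2 (k - h))))"
      by (intro mult_left_mono a(3)) (simp add: br_pos less_imp_le)
    also have "\<dots> = C * (br k ^ (r + q) * (\<Sum>\<^sub>\<infinity>h. norm (a1 h) * norm (a2 (k - h))))"
      by (simp add: power_add mult_ac)
    also have "\<dots> \<le> C * (M1 * M2 * (\<Sum>\<^sub>\<infinity>h. wt (h :: int^'d)))"
      by (intro mult_left_mono C wt_conv_bound(2) M1 M2 a) auto
    finally show "br k ^ r * norm (b k) \<le> C * (M1 * M2 * (\<Sum>\<^sub>\<infinity>h. wt (h :: int^'d)))" .
  qed
qed

lemma rapid_summable:
  assumes "rapid {a}"
  shows "(\<lambda>k. br k ^ r * norm (a k)) summable_on UNIV"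
proof -
  obtain M where M: "M \<ge> 0" "\<And>k. br k ^ r * norm (a k) \<le> M * wt k"
    using rapid_single_wtD[OF assms, of r] by blast
  show ?thesis
    by (rule summable_on_comparison_test[OF summable_on_cmult_right[OF summable_wt, of M]])
       (use M(2) in \<open>auto intro!: mult_nonneg_nonneg zero_le_power simp: less_imp_le[OF br_pos]\<close>)
qed

lemma rapid_abs_summable:
  assumes "rapid {a}"
  shows "(\<lambda>k. norm (a k)) summable_on UNIV"
  using rapid_summable[OF assms, of 0] by simp

lemma rapid_infsum_mono:
  fixes S :: "(int^('d::finite) \<Rightarrow> 'b::real_normed_vector) set"
  assumes "rapid S"
  obtains M where "M \<ge> 0" "\<And>a. a \<in> S \<Longrightarrow> (\<Sum>\<^sub>\<infinity>k. br k ^ r * norm (a k)) \<le> M"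
proof -
  obtain M where M: "M \<ge> 0" "\<And>a k. a \<in> S \<Longrightarrow> br k ^ r * norm (a k) \<le> M * wt k"
    using rapid_wtD[OF assms, of r] by blast
  show ?thesis
  proof (rule that)
    fix a assume a: "a \<in> S"
    show "(\<Sum>\<^sub>\<infinity>k. br k ^ r * norm (a k)) \<le> (\<Sum>\<^sub>\<infinity>k. M * wt (k :: int^'d))"
      by (intro infsum_mono rapid_summable rapid_single[OF assms a] summable_on_cmult_right summable_wt M(2) a)
  next
    show "0 \<le> (\<Sum>\<^sub>\<infinity>k. M * wt (k :: int^'d))"
      by (intro infsum_nonneg mult_nonneg_nonneg M(1) less_imp_le[OF wt_pos])
  qed
qed

text \<open>Dominated convergence for unordered sums along an arbitrary filter. The M-test makes the
  finite partial sums converge uniformly over all families dominated by \<open>g\<close>, which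
  reduces the claim to a finite sum.\<close>

lemma tendsto_infsum_dominated:
  fixes f :: "'s \<Rightarrow> 'i \<Rightarrow> 'b::banach"
  assumes lim: "\<And>k. ((\<lambda>s. f s k) \<longlongrightarrow> l k) F"
    and dom: "eventually (\<lambda>s. \<forall>k. norm (f s k) \<le> g k) F" and g: "g summable_on UNIV"
  shows "((\<lambda>s. \<Sum>\<^sub>\<infinity>k. f s k) \<longlongrightarrow> (\<Sum>\<^sub>\<infinity>k. l k)) F"
proof (cases "F = bot")
  case False
  define Y where "Y = {\<phi> :: 'i \<Rightarrow> 'b. \<forall>k. norm (\<phi> k) \<le> g k}"
  have l: "l \<in> Y"
    unfolding Y_def
  proof (intro CollectI allI)
    fix k
    show "norm (l k) \<le> g k"
      by (rule tendsto_upperbound[OF tendsto_norm[OF lim] _ False]) (use dom in eventually_elim, blast)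
  qed
  have u: "uniform_limit Y (\<lambda>X \<phi>. \<Sum>k\<in>X. \<phi> k) (\<lambda>\<phi>. \<Sum>\<^sub>\<infinity>k. \<phi> k) (finite_subsets_at_top UNIV)"
    by (rule Weierstrass_m_test_general[OF _ g]) (simp add: Y_def)
  show ?thesis
  proof (rule tendstoI)
    fix e :: real assume e: "e > 0"
    hence "eventually (\<lambda>X. \<forall>\<phi>\<in>Y. dist (\<Sum>k\<in>X. \<phi> k) (\<Sum>\<^sub>\<infinity>k. \<phi> k) < e / 3) (finite_subsets_at_top UNIV)"
      using uniform_limitD[OF u, of "e / 3"] by simp
    then obtain X where X: "\<And>\<phi>. \<phi> \<in> Y \<Longrightarrow> dist (\<Sum>k\<in>X. \<phi> k) (\<Sum>\<^sub>\<infinity>k. \<phi> k) < e / 3"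
      using eventually_happens[of _ "finite_subsets_at_top UNIV"] by fastforce
    have "((\<lambda>s. \<Sum>k\<in>X. f s k) \<longlongrightarrow> (\<Sum>k\<in>X. l k)) F" by (intro tendsto_sum lim)
    hence "eventually (\<lambda>s. dist (\<Sum>k\<in>X. f s k) (\<Sum>k\<in>X. l k) < e / 3) F"
      using e by (intro tendstoD) auto
    with dom show "eventually (\<lambda>s. dist (\<Sum>\<^sub>\<infinity>k. f s k) (\<Sum>\<^sub>\<infinity>k. l k) < e) F"
    proof eventually_elim
      case (elim s)
      hence "f s \<in> Y" by (simp add: Y_def)
      from X[OF this] X[OF l] elim(2) show ?case
        using dist_triangle[of "\<Sum>\<^sub>\<infinity>k. f s k" "\<Sum>\<^sub>\<infinity>k. l k" "\<Sum>k\<in>X. f s k"]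
          dist_triangle[of "\<Sum>k\<in>X. f s k" "\<Sum>\<^sub>\<infinity>k. l k" "\<Sum>k\<in>X. l k"]
        by (simp add: dist_commute)
    qed
  qed
qed simp

section \<open>Sobolev inner products of coefficient families\<close>

lemma infsum_Cauchy_Schwarz:
  fixes f g :: "'i \<Rightarrow> real"
  assumes f: "(\<lambda>i. (f i)\<^sup>2) summable_on A" and g: "(\<lambda>i. (g i)\<^sup>2) summable_on A"
  shows "(\<lambda>i. \<bar>f i * g i\<bar>) summable_on A"
    and "(\<Sum>\<^sub>\<infinity>i\<in>A. \<bar>f i * g i\<bar>) \<le> sqrt (\<Sum>\<^sub>\<infinity>i\<in>A. (f i)\<^sup>2) * sqrt (\<Sum>\<^sub>\<infinity>i\<in>A. (g i)\<^sup>2)"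
proof -
  show s: "(\<lambda>i. \<bar>f i * g i\<bar>) summable_on A"
  proof (rule summable_on_comparison_test[OF summable_on_add[OF f g]])
    fix i
    show "\<bar>f i * g i\<bar> \<le> (f i)\<^sup>2 + (g i)\<^sup>2"
    proof -
      have "2 * (\<bar>f i\<bar> * \<bar>g i\<bar>) \<le> (f i)\<^sup>2 + (g i)\<^sup>2"
        using sum_squares_bound[of "\<bar>f i\<bar>" "\<bar>g i\<bar>"] by (simp add: mult.assoc)
      moreover have "0 \<le> \<bar>f i\<bar> * \<bar>g i\<bar>" by simp
      ultimately show ?thesis unfolding abs_mult by linarith
    qed
  qed simp
  show "(\<Sum>\<^sub>\<infinity>i\<in>A. \<bar>f i * g i\<bar>) \<le> sqrt (\<Sum>\<^sub>\<infinity>i\<in>A. (f i)\<^sup>2) * sqrt (\<Sum>\<^sub>\<infinity>i\<in>A. (g i)\<^sup>2)"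
  proof (rule infsum_le_finite_sums[OF s])
    fix F assume F: "finite F" "F \<subseteq> A"
    have "(\<Sum>i\<in>F. \<bar>f i * g i\<bar>) \<le> L2_set f F * L2_set g F"
      using L2_set_mult_ineq[of f g F] by (simp add: abs_mult)
    also have "\<dots> \<le> sqrt (\<Sum>\<^sub>\<infinity>i\<in>A. (f i)\<^sup>2) * sqrt (\<Sum>\<^sub>\<infinity>i\<in>A. (g i)\<^sup>2)"
      unfolding L2_set_def
      by (intro mult_mono real_sqrt_le_mono finite_sum_le_infsum f g F real_sqrt_ge_zero sum_nonneg infsum_nonneg) simp_all
    finally show "(\<Sum>i\<in>F. \<bar>f i * g i\<bar>) \<le> sqrt (\<Sum>\<^sub>\<infinity>i\<in>A. (f i)\<^sup>2) * sqrt (\<Sum>\<^sub>\<infinity>i\<in>A. (g i)\<^sup>2)" .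
  qed
qed

text \<open>On coefficient families of real fields this is the real part of the Sobolev inner product; the index 0 drops out
  because \<open>0 powr x = 0\<close>.\<close>

definition inn :: "real \<Rightarrow> (int^('d::finite) \<Rightarrow> 'b::real_inner) \<Rightarrow> (int^'d \<Rightarrow> 'b) \<Rightarrow> real" where
  "inn p a b = (\<Sum>\<^sub>\<infinity>k. norm (wavevec k) powr (2 * p) * (a k \<bullet> b k))"

definition nrm :: "real \<Rightarrow> (int^('d::finite) \<Rightarrow> 'b::real_inner) \<Rightarrow> real" where
  "nrm p a = sqrt (inn p a a)"

lemma summable_inn:
  fixes a b :: "int^('d::finite) \<Rightarrow> 'b::real_inner"
  assumes "rapid {a}" "rapid {b}"
  shows "(\<lambda>k. norm (wavevec k) powr (2 * p) * (a k \<bullet> b k)) summable_on UNIV"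
proof (rule abs_summable_summable)
  let ?m = "nat \<lceil>\<bar>2 * p\<bar>\<rceil>"
  obtain M1 where M1: "M1 \<ge> 0" "\<And>k. br k ^ ?m * norm (a k) \<le> M1 * wt k"
    using rapid_single_wtD[OF assms(1)] by blast
  obtain M2 where M2: "M2 \<ge> 0" "\<And>k. br k ^ 0 * norm (b k) \<le> M2"
    using rapid_singleD[OF assms(2)] by blast
  show "(\<lambda>k. norm (norm (wavevec k) powr (2 * p) * (a k \<bullet> b k))) summable_on UNIV"
  proof (rule summable_on_comparison_test[OF summable_on_cmult_right[OF summable_wt, of "M1 * M2"]])
    fix k :: "int^'d"
    have "norm (norm (wavevec k) powr (2 * p) * (a k \<bullet> b k)) \<le> br k ^ ?m * (norm (a k) * norm (b k))"
      unfolding norm_mult by (intro mult_mono) (auto simp: br_powr_bound Cauchy_Schwarz_ineq2 zero_le_power less_imp_le[OF br_pos])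
    also have "\<dots> = (br k ^ ?m * norm (a k)) * norm (b k)" by simp
    also have "\<dots> \<le> (M1 * wt k) * M2"
      by (intro mult_mono M1) (use M2(2)[of k] M1(1) wt_pos[of k] in auto)
    finally show "norm (norm (wavevec k) powr (2 * p) * (a k \<bullet> b k)) \<le> M1 * M2 * wt k" by (simp add: mult_ac)
  qed simp
qed

lemma inn_commute: "inn p a b = inn p b a"
  by (simp add: inn_def inner_commute)

lemma rapid_add:
  assumes "rapid {a}" "rapid {b}" shows "rapid {\<lambda>k. a k + b k}"
  by (rule rapidI_add[OF assms]) (auto intro: norm_triangle_ineq)

lemma rapid_scaleR:
  assumes "rapid {a}" shows "rapid {\<lambda>k. c *\<^sub>R a k}"
  by (rule rapidI_mult[OF assms, where C = "\<bar>c\<bar>" and q = 0]) auto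

lemma rapid_diff:
  assumes "rapid {a}" "rapid {b}" shows "rapid {\<lambda>k. a k - b k}"
  by (rule rapidI_add[OF assms]) (auto intro: norm_triangle_ineq4)

lemma inn_add_right:
  assumes "rapid {a}" "rapid {b}" "rapid {c}"
  shows "inn p a (\<lambda>k. b k + c k) = inn p a b + inn p a c"
  unfolding inn_def
  by (subst infsum_add[symmetric]) (simp_all add: summable_inn assms inner_add_right distrib_left)

lemma inn_diff_right:
  assumes "rapid {a}" "rapid {b}" "rapid {c}"
  shows "inn p a (\<lambda>k. b k - c k) = inn p a b - inn p a c"
  using inn_add_right[OF assms(1) rapid_diff[OF assms(2,3)] assms(3), of p] by simp

lemma inn_scaleR_right: "inn p a (\<lambda>k. t *\<^sub>R b k) = t * inn p a b"
  unfolding inn_def by (subst infsum_cmult_right'[symmetric]) (simp add: mult_ac)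

lemma inn_add_left:
  assumes "rapid {a}" "rapid {b}" "rapid {c}"
  shows "inn p (\<lambda>k. b k + c k) a = inn p b a + inn p c a"
  using inn_add_right[OF assms] by (simp add: inn_commute)

lemma inn_scaleR_left: "inn p (\<lambda>k. t *\<^sub>R b k) a = t * inn p b a"
  using inn_scaleR_right by (metis inn_commute)

lemma inn_self_nonneg: "0 \<le> inn p a a"
  unfolding inn_def by (intro infsum_nonneg) simp

lemma nrm_sq: "(nrm p a)\<^sup>2 = inn p a a"
  by (simp add: nrm_def inn_self_nonneg)

lemma nrm_nonneg: "0 \<le> nrm p a"
  by (simp add: nrm_def inn_self_nonneg)

lemma inn_Cauchy_Schwarz:
  fixes a b :: "int^('d::finite) \<Rightarrow> 'b::real_inner"
  assumes "rapid {a}" "rapid {b}"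
  shows "\<bar>inn p a b\<bar> \<le> nrm p a * nrm p b"
proof -
  define x where "x = (\<lambda>k. norm (wavevec k) powr p * norm (a k))"
  define y where "y = (\<lambda>k. norm (wavevec k) powr p * norm (b k))"
  have pw: "norm (wavevec k) powr (2 * p) = norm (wavevec k) powr p * norm (wavevec k) powr p" for k :: "int^'d"
    by (simp add: powr_add[symmetric])
  have x2: "(x k)\<^sup>2 = norm (wavevec k) powr (2 * p) * (a k \<bullet> a k)" for k
    by (simp add: x_def pw power2_eq_square dot_square_norm) 
  have y2: "(y k)\<^sup>2 = norm (wavevec k) powr (2 * p) * (b k \<bullet> b k)" for k
    by (simp add: y_def pw power2_eq_square dot_square_norm)
  have sx: "(\<lambda>k. (x k)\<^sup>2) summable_on UNIV" and sy: "(\<lambda>k. (y k)\<^sup>2) summable_on UNIV"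
    unfolding x2 y2 by (intro summable_inn assms)+
  have le: "norm (norm (wavevec k) powr (2 * p) * (a k \<bullet> b k)) \<le> \<bar>x k * y k\<bar>" for k
  proof -
    have "norm (norm (wavevec k) powr (2 * p) * (a k \<bullet> b k)) \<le> norm (wavevec k) powr (2 * p) * (norm (a k) * norm (b k))"
      unfolding norm_mult by (intro mult_mono) (auto simp: Cauchy_Schwarz_ineq2)
    moreover have "\<bar>x k * y k\<bar> = norm (wavevec k) powr (2 * p) * (norm (a k) * norm (b k))"
      unfolding pw by (simp add: x_def y_def abs_mult mult_ac)
    ultimately show ?thesis by simp
  qed
  have "\<bar>inn p a b\<bar> \<le> (\<Sum>\<^sub>\<infinity>k. \<bar>x k * y k\<bar>)"
    using norm_infsum_le[OF has_sum_infsum[OF summable_inn[OF assms, of p]] has_sum_infsum[OF infsum_Cauchy_Schwarz(1)[OF sx sy]] le]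
    unfolding inn_def by simp
  also have "\<dots> \<le> sqrt (\<Sum>\<^sub>\<infinity>k. (x k)\<^sup>2) * sqrt (\<Sum>\<^sub>\<infinity>k. (y k)\<^sup>2)"
    by (rule infsum_Cauchy_Schwarz(2)[OF sx sy])
  also have "\<dots> = nrm p a * nrm p b"
    by (simp only: x2 y2 nrm_def inn_def)
  finally show ?thesis .
qed

lemma inn_mono:
  fixes a :: "int^('d::finite) \<Rightarrow> 'b::real_inner"
  assumes "rapid {a}" "p \<le> q"
  shows "inn p a a \<le> inn q a a"
  unfolding inn_def
proof (rule infsum_mono)
  fix k :: "int^'d"
  show "norm (wavevec k) powr (2 * p) * (a k \<bullet> a k) \<le> norm (wavevec k) powr (2 * q) * (a k \<bullet> a k)"
  proof (cases "k = 0")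
    case False
    from norm_wavevec_ge_1[OF this] assms(2) show ?thesis
      by (intro mult_right_mono powr_mono) auto
  qed simp
qed (intro summable_inn assms)+

lemma nrm_mono: "rapid {a} \<Longrightarrow> p \<le> q \<Longrightarrow> nrm p a \<le> nrm q a"
  unfolding nrm_def by (intro real_sqrt_le_mono inn_mono)

lemma component_le_nrm_general:
  fixes a :: "int^('d::finite) \<Rightarrow> 'b::real_inner"
  assumes "(\<lambda>k. norm (wavevec k) powr (2 * p) * (a k \<bullet> a k)) summable_on UNIV"
  shows "norm (wavevec k) powr p * norm (a k) \<le> nrm p a"
proof -
  have "(\<Sum>k\<in>{k}. norm (wavevec k) powr (2 * p) * (a k \<bullet> a k)) \<le> inn p a a"
    unfolding inn_def by (rule finite_sum_le_infsum[OF assms]) auto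
  moreover have "(norm (wavevec k) powr p * norm (a k))\<^sup>2 = norm (wavevec k) powr (2 * p) * (a k \<bullet> a k)"
    by (simp add: power2_norm_eq_inner[symmetric] power2_eq_square powr_add[symmetric] mult_ac)
  ultimately have "(norm (wavevec k) powr p * norm (a k))\<^sup>2 \<le> (nrm p a)\<^sup>2"
    by (simp add: nrm_sq)
  thus ?thesis by (rule power2_le_imp_le) (rule nrm_nonneg)
qed

text \<open>Index 0 has to be controlled by hypothesis because \<open>inn\<close> does not see
  it.\<close>

lemma component_le_nrm0:
  assumes "rapid {a}" "a 0 = 0"
  shows "norm (a k) \<le> nrm 0 a"
proof (cases "k = 0")
  case False
  have "wavevec k \<noteq> 0" using False by simp
  thus ?thesis using component_le_nrm_general[OF summable_inn[OF assms(1,1), of 0], where k = k] by simp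
qed (simp add: assms nrm_nonneg)

lemma nrm0_infsum:
  assumes "rapid {a}" "a 0 = 0"
  shows "nrm 0 a = sqrt (\<Sum>\<^sub>\<infinity>k. (norm (a k))\<^sup>2)" "(\<lambda>k. (norm (a k))\<^sup>2) summable_on UNIV"
proof -
  have eq: "norm (wavevec k) powr (2 * 0) * (a k \<bullet> a k) = (norm (a k))\<^sup>2" for k
    by (cases "k = 0") (simp_all add: assms(2) power2_norm_eq_inner)
  show "nrm 0 a = sqrt (\<Sum>\<^sub>\<infinity>k. (norm (a k))\<^sup>2)" unfolding nrm_def inn_def eq ..
  show "(\<lambda>k. (norm (a k))\<^sup>2) summable_on UNIV"
    using summable_inn[OF assms(1,1), of 0] unfolding eq .
qed

lemma nrm_bounded:
  fixes S :: "(int^('d::finite) \<Rightarrow> 'b::real_inner) set"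
  assumes "rapid S"
  obtains M where "M \<ge> 0" "\<And>a. a \<in> S \<Longrightarrow> nrm p a \<le> M"
proof -
  let ?m = "nat \<lceil>\<bar>2 * p\<bar>\<rceil>"
  obtain M1 where M1: "M1 \<ge> 0" "\<And>a k. a \<in> S \<Longrightarrow> br k ^ ?m * norm (a k) \<le> M1 * wt k"
    using rapid_wtD[OF assms] by blast
  obtain M2 where M2: "M2 \<ge> 0" "\<And>a k. a \<in> S \<Longrightarrow> br k ^ 0 * norm (a k) \<le> M2"
    using rapidD[OF assms] by blast
  show ?thesis
  proof (rule that)
    fix a assume a: "a \<in> S"
    have "inn p a a \<le> (\<Sum>\<^sub>\<infinity>k. M1 * M2 * wt (k :: int^'d))"
      unfolding inn_def
    proof (rule infsum_mono)
      show "(\<lambda>k. norm (wavevec k) powr (2 * p) * (a k \<bullet> a k)) summable_on UNIV"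
        by (intro summable_inn rapid_single[OF assms a])
      fix k :: "int^'d"
      have "norm (wavevec k) powr (2 * p) * (a k \<bullet> a k) \<le> br k ^ ?m * (norm (a k) * norm (a k))"
        by (intro mult_mono) (auto simp: br_powr_bound zero_le_power less_imp_le[OF br_pos] dot_square_norm power2_eq_square)
      also have "\<dots> = (br k ^ ?m * norm (a k)) * norm (a k)" by simp
      also have "\<dots> \<le> (M1 * wt k) * M2"
        by (intro mult_mono M1 a) (use M2(2)[OF a, of k] M1(1) wt_pos[of k] in auto)
      finally show "norm (wavevec k) powr (2 * p) * (a k \<bullet> a k) \<le> M1 * M2 * wt k" by (simp add: mult_ac)
    qed (intro summable_on_cmult_right summable_wt)
    thus "nrm p a \<le> sqrt (\<Sum>\<^sub>\<infinity>k. M1 * M2 * wt (k :: int^'d))"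
      unfolding nrm_def by (rule real_sqrt_le_mono)
  next
    show "0 \<le> sqrt (\<Sum>\<^sub>\<infinity>k. M1 * M2 * wt (k :: int^'d))"
      by (intro real_sqrt_ge_zero infsum_nonneg mult_nonneg_nonneg M1 M2 less_imp_le[OF wt_pos])
  qed
qed

text \<open>The norm of order r controls each single term |k|^r |a_k|, and \<open>br k\<close> is at
  most 2 |k| off the origin; so bounds in all Sobolev norms are bounds in all weighted sup
  norms.\<close>

lemma rapid_of_nrm:
  fixes S :: "(int^('d::finite) \<Rightarrow> 'b::real_inner) set"
  assumes s: "\<And>a p. a \<in> S \<Longrightarrow> (\<lambda>k. norm (wavevec k) powr (2 * p) * (a k \<bullet> a k)) summable_on UNIV"
    and b: "\<And>p. \<exists>M. \<forall>a\<in>S. nrm p a \<le> M" and z: "\<And>a. a \<in> S \<Longrightarrow> a 0 = 0"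
  shows "rapid S"
  unfolding rapid_def
proof
  fix r
  obtain M where M: "\<And>a. a \<in> S \<Longrightarrow> nrm (real r) a \<le> M" using b by blast
  show "\<exists>M. \<forall>a\<in>S. \<forall>k. br k ^ r * norm (a k) \<le> M"
  proof (intro exI ballI allI)
    fix a k assume a: "a \<in> S"
    have M0: "0 \<le> M" using M[OF a] nrm_nonneg[of "real r" a] by linarith
    show "br k ^ r * norm (a k) \<le> 2 ^ r * M"
    proof (cases "k = 0")
      case True
      thus ?thesis using z[OF a] M0 by simp
    next
      case False
      let ?x = "norm (wavevec k)"
      have x: "1 \<le> ?x" by (rule norm_wavevec_ge_1[OF False])
      have "br k ^ r \<le> (2 * ?x) ^ r" using x by (intro power_mono) (auto simp: br_def)
      also have "\<dots> = 2 ^ r * ?x powr real r" using x by (subst powr_realpow) (auto simp: power_mult_distrib)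
      finally have "br k ^ r * norm (a k) \<le> 2 ^ r * ?x powr real r * norm (a k)" by (intro mult_right_mono) auto
      also have "\<dots> = 2 ^ r * (?x powr real r * norm (a k))" by simp
      also have "\<dots> \<le> 2 ^ r * nrm (real r) a"
        by (intro mult_left_mono component_le_nrm_general s a) simp
      also have "\<dots> \<le> 2 ^ r * M" by (intro mult_left_mono M a) simp
      finally show ?thesis .
    qed
  qed
qed

text \<open>Boundedness in all orders supplies a summable majorant, so dominated convergence
  applies. This is how limits of single coefficients are upgraded to limits in Sobolev
  norms.\<close>

lemma nrm_tendsto_0:
  fixes f :: "'s \<Rightarrow> int^('d::finite) \<Rightarrow> 'b::real_inner"
  assumes lim: "\<And>k. ((\<lambda>s. f s k) \<longlongrightarrow> 0) F"
    and ev: "eventually (\<lambda>s. f s \<in> S) F" and S: "rapid S"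
  shows "((\<lambda>s. nrm p (f s)) \<longlongrightarrow> 0) F"
proof -
  let ?m = "nat \<lceil>\<bar>2 * p\<bar>\<rceil>"
  obtain M1 where M1: "M1 \<ge> 0" "\<And>a k. a \<in> S \<Longrightarrow> br k ^ ?m * norm (a k) \<le> M1 * wt k"
    using rapid_wtD[OF S] by blast
  obtain M2 where M2: "M2 \<ge> 0" "\<And>a k. a \<in> S \<Longrightarrow> br k ^ 0 * norm (a k) \<le> M2"
    using rapidD[OF S] by blast
  have dom: "norm (norm (wavevec k) powr (2 * p) * (a k \<bullet> a k)) \<le> M1 * M2 * wt k" if a: "a \<in> S" for a k
  proof -
    have "norm (norm (wavevec k) powr (2 * p) * (a k \<bullet> a k)) \<le> br k ^ ?m * (norm (a k) * norm (a k))"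
      unfolding norm_mult by (intro mult_mono) (auto simp: br_powr_bound zero_le_power less_imp_le[OF br_pos] dot_square_norm power2_eq_square)
    also have "\<dots> = (br k ^ ?m * norm (a k)) * norm (a k)" by simp
    also have "\<dots> \<le> (M1 * wt k) * M2"
      by (intro mult_mono M1 a) (use M2(2)[OF a, of k] M1(1) wt_pos[of k] in auto)
    finally show ?thesis by (simp add: mult_ac)
  qed
  have "((\<lambda>s. \<Sum>\<^sub>\<infinity>k. norm (wavevec k) powr (2 * p) * (f s k \<bullet> f s k)) \<longlongrightarrow> (\<Sum>\<^sub>\<infinity>k::int^'d. 0)) F"
  proof (rule tendsto_infsum_dominated)
    show "((\<lambda>s. norm (wavevec k) powr (2 * p) * (f s k \<bullet> f s k)) \<longlongrightarrow> 0) F" for k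
      using tendsto_mult[OF tendsto_const tendsto_inner[OF lim lim], of "norm (wavevec k) powr (2 * p)" k k] by simp
    show "eventually (\<lambda>s. \<forall>k. norm (norm (wavevec k) powr (2 * p) * (f s k \<bullet> f s k)) \<le> M1 * M2 * wt k) F"
      using ev by eventually_elim (use dom in blast)
  qed (intro summable_on_cmult_right summable_wt)
  hence "((\<lambda>s. inn p (f s) (f s)) \<longlongrightarrow> 0) F" by (simp add: inn_def)
  from tendsto_real_sqrt[OF this] show ?thesis by (simp add: nrm_def)
qed

section \<open>Complex vectors, the projection onto the complement of k, and conjugation\<close>

lemma norm_smult_vec: "norm (c *s (x :: complex^'d)) = cmod c * norm x"
  by (simp add: norm_vec_def norm_mult L2_set_right_distrib)

lemma inner_vec_complex: "(x :: complex^'d) \<bullet> y = Re (\<Sum>r\<in>UNIV. cnj (x $ r) * y $ r)"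
  by (simp add: inner_vec_def inner_complex_def Re_sum)

lemma bounded_linear_smult_vec: "bounded_linear (\<lambda>x :: complex^'d. c *s x)"
  by (rule bounded_linear_intro[where K = "cmod c"])
    (auto simp: vec_eq_iff norm_smult_vec algebra_simps)

lemma bounded_linear_smult_vec_left: "bounded_linear (\<lambda>c. c *s (x :: complex^'d))"
  by (rule bounded_linear_intro[where K = "norm x"])
    (auto simp: vec_eq_iff norm_smult_vec algebra_simps)

lemma wave_dot_add: "wave_dot k (x + y) = wave_dot k x + wave_dot k y"
  by (simp add: wave_dot_def sum.distrib distrib_left)

lemma wave_dot_scaleR: "wave_dot k (t *\<^sub>R x) = t *\<^sub>R wave_dot k x"
  by (simp add: wave_dot_def scaleR_sum_right)

lemma wave_dot_minus: "wave_dot k (- x) = - wave_dot k x"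
  by (simp add: wave_dot_def sum_negf)

lemma wave_dot_zero [simp]: "wave_dot k 0 = 0" "wave_dot 0 x = 0"
  by (simp_all add: wave_dot_def)

lemma wave_dot_diff_left: "wave_dot (k - l) x = wave_dot k x - wave_dot l x"
  by (simp add: wave_dot_def sum_subtractf left_diff_distrib)

lemma wave_dot_add_left: "wave_dot (k + l) x = wave_dot k x + wave_dot l x"
  by (simp add: wave_dot_def sum.distrib distrib_right)

lemma wave_dot_minus_left: "wave_dot (- k) x = - wave_dot k x"
  by (simp add: wave_dot_def sum_negf)

lemma norm_wave_dot_le: "cmod (wave_dot k x) \<le> norm (wavevec k) * norm x"
proof -
  have "cmod (wave_dot k x) \<le> (\<Sum>j\<in>UNIV. cmod (of_int (k $ j) * x $ j))"
    unfolding wave_dot_def by (rule norm_sum)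
  also have "\<dots> = (\<Sum>j\<in>UNIV. \<bar>wavevec k $ j\<bar> * \<bar>cmod (x $ j)\<bar>)"
    by (simp add: norm_mult)
  also have "\<dots> \<le> L2_set (\<lambda>j. wavevec k $ j) UNIV * L2_set (\<lambda>j. cmod (x $ j)) UNIV"
    by (rule L2_set_mult_ineq)
  also have "\<dots> = norm (wavevec k) * norm x"
    by (simp add: norm_vec_def L2_set_def)
  finally show ?thesis .
qed

lemma norm_wavevec_sq: "complex_of_real ((norm (wavevec k))\<^sup>2) = (\<Sum>j\<in>UNIV. of_int (k $ j) * of_int (k $ j))"
  by (simp add: power2_norm_eq_inner inner_vec_def)

lemma wave_dot_proj_perp: "wave_dot k (proj_perp k z) = 0"
proof (cases "k = 0")
  case False
  hence "norm (wavevec k) \<noteq> 0" by simp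
  hence nz: "complex_of_real ((norm (wavevec k))\<^sup>2) \<noteq> 0" by simp
  define l where "l = wave_dot k z / complex_of_real ((norm (wavevec k))\<^sup>2)"
  have pp: "proj_perp k z $ j = z $ j - l * of_int (k $ j)" for j
    by (simp add: proj_perp_def l_def)
  have "wave_dot k (proj_perp k z) = wave_dot k z - l * (\<Sum>j\<in>UNIV. of_int (k $ j) * of_int (k $ j))"
    unfolding wave_dot_def pp by (simp add: sum_subtractf right_diff_distrib sum_distrib_left mult_ac)
  also have "\<dots> = 0" unfolding norm_wavevec_sq[symmetric] l_def using nz by simp
  finally show ?thesis .
qed simp

lemma proj_perp_fixed: "wave_dot k z = 0 \<Longrightarrow> proj_perp k z = z"
  by (simp add: proj_perp_def vec_eq_iff)

lemma proj_perp_zero [simp]: "proj_perp 0 z = z"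
  by (simp add: proj_perp_fixed)

text \<open>The part removed by the projection is a multiple of \<open>k\<close>, and
  \<open>wave_dot k y = 0\<close> says that \<open>y\<close> is orthogonal to it.\<close>

lemma inner_proj_perp:
  assumes "wave_dot k y = 0" shows "proj_perp k z \<bullet> y = z \<bullet> y"
proof -
  define l where "l = wave_dot k z / complex_of_real ((norm (wavevec k))\<^sup>2)"
  have pp: "proj_perp k z $ j = z $ j - l * of_int (k $ j)" for j
    by (simp add: proj_perp_def l_def)
  have "(\<Sum>r\<in>UNIV. cnj (proj_perp k z $ r) * y $ r) = (\<Sum>r\<in>UNIV. cnj (z $ r) * y $ r) - cnj l * wave_dot k y"
    unfolding wave_dot_def pp by (simp add: sum_subtractf left_diff_distrib right_diff_distrib sum_distrib_left mult_ac)
  thus ?thesis using assms by (simp add: inner_vec_complex)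
qed

lemma norm_proj_perp_le: "norm (proj_perp k z) \<le> norm z"
proof -
  have "norm (proj_perp k z) * norm (proj_perp k z) = z \<bullet> proj_perp k z"
    using inner_proj_perp[OF wave_dot_proj_perp, of k z z] by (simp add: dot_square_norm power2_eq_square)
  also have "\<dots> \<le> norm z * norm (proj_perp k z)" by (rule norm_cauchy_schwarz)
  finally show ?thesis
    by (cases "norm (proj_perp k z) = 0") simp_all
qed

lemma proj_perp_add: "proj_perp k (x + y) = proj_perp k x + proj_perp k y"
  by (simp add: proj_perp_def vec_eq_iff wave_dot_add add_divide_distrib distrib_right)

lemma proj_perp_scaleR: "proj_perp k (t *\<^sub>R x) = t *\<^sub>R proj_perp k x"
  by (simp add: proj_perp_def vec_eq_iff wave_dot_scaleR scaleR_conv_of_real[where 'a = complex] algebra_simps)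

lemma bounded_linear_proj_perp: "bounded_linear (proj_perp k)"
  by (rule bounded_linear_intro[where K = 1])
    (auto simp: proj_perp_add proj_perp_scaleR norm_proj_perp_le)

lemma proj_perp_diff: "proj_perp k (x - y) = proj_perp k x - proj_perp k y"
  by (rule linear_diff[OF bounded_linear.linear[OF bounded_linear_proj_perp]])

definition cnjv :: "complex^'d \<Rightarrow> complex^'d" where
  "cnjv z = (\<chi> r. cnj (z $ r))"

lemma cnjv_nth [simp]: "cnjv z $ r = cnj (z $ r)"
  by (simp add: cnjv_def)

lemma norm_cnjv [simp]: "norm (cnjv z) = norm z"
  by (simp add: norm_vec_def)

lemma bounded_linear_cnjv: "bounded_linear cnjv"
  by (rule bounded_linear_intro[where K = 1]) (auto simp: vec_eq_iff)

lemma cnjv_cnjv [simp]: "cnjv (cnjv z) = z"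
  by (simp add: vec_eq_iff)

lemma wave_dot_cnjv: "wave_dot k (cnjv z) = cnj (wave_dot k z)"
  by (simp add: wave_dot_def)

lemma proj_perp_cnjv: "proj_perp (- k) (cnjv z) = cnjv (proj_perp k z)"
  by (simp add: vec_eq_iff proj_perp_def wave_dot_minus_left wave_dot_cnjv wavevec_minus)

text \<open>Exactly the coefficient families of fields in \<open>Sob_inf\<close>; the condition at
  \<open>- k\<close> expresses that the field is real.\<close>

definition ns_coeffs :: "(int^'d \<Rightarrow> complex^('d::finite)) set" where
  "ns_coeffs = {a. rapid {a} \<and> (\<forall>k. a (- k) = cnjv (a k)) \<and> (\<forall>k. wave_dot k (a k) = 0) \<and> a 0 = 0}"

lemma ns_coeffsD:
  assumes "a \<in> ns_coeffs"
  shows "rapid {a}" "a (- k) = cnjv (a k)" "wave_dot k (a k) = 0" "a 0 = 0"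
  using assms by (auto simp: ns_coeffs_def)

lemma ns_coeffs_add:
  assumes "a \<in> ns_coeffs" "b \<in> ns_coeffs" shows "(\<lambda>k. a k + b k) \<in> ns_coeffs"
  using rapid_add[OF ns_coeffsD(1)[OF assms(1)] ns_coeffsD(1)[OF assms(2)]] ns_coeffsD(2-4)[OF assms(1)] ns_coeffsD(2-4)[OF assms(2)]
  by (simp add: ns_coeffs_def wave_dot_add vec_eq_iff)

lemma ns_coeffs_scaleR:
  assumes "a \<in> ns_coeffs" shows "(\<lambda>k. t *\<^sub>R a k) \<in> ns_coeffs"
  using rapid_scaleR[OF ns_coeffsD(1)[OF assms(1)]] ns_coeffsD(2-4)[OF assms(1)]
  by (simp add: ns_coeffs_def wave_dot_scaleR vec_eq_iff)

lemma ns_coeffs_diff: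
  assumes "a \<in> ns_coeffs" "b \<in> ns_coeffs" shows "(\<lambda>k. a k - b k) \<in> ns_coeffs"
  using ns_coeffs_add[OF assms(1) ns_coeffs_scaleR[OF assms(2), of "- 1"]] by simp

section \<open>The Laplacian and the bilinear map on coefficients\<close>

definition lapl :: "(int^'d \<Rightarrow> complex^('d::finite)) \<Rightarrow> int^'d \<Rightarrow> complex^'d" where
  "lapl a k = - ((norm (wavevec k))\<^sup>2 *\<^sub>R a k)"

lemma norm_lapl_le: "norm (lapl a k) \<le> 1 * br k ^ 2 * norm (a k)"
  unfolding lapl_def by (auto intro!: mult_right_mono power_mono simp: norm_wavevec_le_br)

lemma ns_coeffs_lapl:
  assumes "a \<in> ns_coeffs" shows "lapl a \<in> ns_coeffs"
proof -
  have "rapid {lapl a}"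
    by (rule rapidI_mult[OF ns_coeffsD(1)[OF assms], where C = 1 and q = 2]) (use norm_lapl_le[of a] in auto)
  thus ?thesis using ns_coeffsD(2-4)[OF assms]
    by (simp add: ns_coeffs_def lapl_def wave_dot_minus wave_dot_scaleR vec_eq_iff wavevec_minus)
qed

lemma inn_lapl: "inn p (lapl a) a = - inn (p + 1) a a"
proof -
  have "norm (wavevec k) powr (2 * p) * (lapl a k \<bullet> a k) = - (norm (wavevec k) powr (2 * (p + 1)) * (a k \<bullet> a k))" for k
  proof (cases "k = 0")
    case False
    hence "norm (wavevec k) > 0" by simp
    hence "(norm (wavevec k))\<^sup>2 = norm (wavevec k) powr 2" by simp
    thus ?thesis by (simp add: lapl_def distrib_left powr_add)
  qed simp
  thus ?thesis by (simp add: inn_def infsum_uminus)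
qed

text \<open>The gradient of the second factor produces \<open>wave_dot (k - h) (a h)\<close>; for
  divergence free \<open>a\<close> this equals \<open>wave_dot k (a h)\<close>. The form chosen puts
  the derivative outside the sum: it costs a factor depending on \<open>k\<close> only and leaves a
  plain product of coefficients.\<close>

definition conv :: "(int^'d \<Rightarrow> complex^('d::finite)) \<Rightarrow> (int^'d \<Rightarrow> complex^'d) \<Rightarrow> int^'d \<Rightarrow> complex^'d" where
  "conv a b k = (\<Sum>\<^sub>\<infinity>h. wave_dot k (a h) *s b (k - h))"

text \<open>The factor i stems from the derivative and \<open>cvol\<close> from the normalisation of
  products; the sign is that of \<open>NS_bilin\<close>.\<close>

definition Bil :: "(int^'d \<Rightarrow> complex^('d::finite)) \<Rightarrow> (int^'d \<Rightarrow> complex^'d) \<Rightarrow> int^'d \<Rightarrow> complex^'d" where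
  "Bil a b k = - proj_perp k ((\<i> * cvol TYPE('d)) *s conv a b k)"

lemma conv_term_le: "norm (wave_dot k (a h) *s b (k - h)) \<le> norm (wavevec k) * (norm (a h) * norm (b (k - h)))"
  unfolding norm_smult_vec mult.assoc[symmetric]
  by (intro mult_right_mono norm_wave_dot_le) simp

lemma summable_conv:
  assumes "rapid {a}" "rapid {b}"
  shows "(\<lambda>h. wave_dot k (a h) *s b (k - h)) summable_on UNIV"
  by (rule abs_summable_summable, rule summable_on_comparison_test[OF summable_on_cmult_right[OF rapid_conv_summable[OF assms]]])
    (rule conv_term_le, simp)

lemma norm_conv_le:
  assumes "rapid {a}" "rapid {b}"
  shows "norm (conv a b k) \<le> norm (wavevec k) * (\<Sum>\<^sub>\<infinity>h. norm (a h) * norm (b (k - h)))"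
proof -
  have "norm (conv a b k) \<le> (\<Sum>\<^sub>\<infinity>h. norm (wavevec k) * (norm (a h) * norm (b (k - h))))"
    unfolding conv_def
  proof (rule norm_infsum_le[OF has_sum_infsum has_sum_infsum])
    show "(\<lambda>h. norm (wavevec k) * (norm (a h) * norm (b (k - h)))) summable_on UNIV"
      by (intro summable_on_cmult_right rapid_conv_summable assms)
  qed (intro summable_conv assms conv_term_le)+
  thus ?thesis by (simp add: infsum_cmult_right')
qed

lemma norm_Bil_le_conv: "norm (Bil a b k) \<le> cmod (cvol TYPE('d)) * norm (conv a b k)" for k :: "int^('d::finite)"
proof -
  have "norm (Bil a b k) \<le> norm ((\<i> * cvol TYPE('d)) *s conv a b k)"
    unfolding Bil_def norm_minus_cancel by (rule norm_proj_perp_le)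
  thus ?thesis by (simp add: norm_smult_vec norm_mult)
qed

lemma norm_Bil_le:
  fixes a b :: "int^('d::finite) \<Rightarrow> complex^'d"
  assumes "rapid {a}" "rapid {b}"
  shows "norm (Bil a b k) \<le> cmod (cvol TYPE('d)) * br k ^ 1 * (\<Sum>\<^sub>\<infinity>h. norm (a h) * norm (b (k - h)))"
proof -
  have "norm (conv a b k) \<le> br k * (\<Sum>\<^sub>\<infinity>h. norm (a h) * norm (b (k - h)))"
    by (rule order_trans[OF norm_conv_le[OF assms]]) (intro mult_right_mono norm_wavevec_le_br infsum_nonneg, simp)
  hence "cmod (cvol TYPE('d)) * norm (conv a b k) \<le> cmod (cvol TYPE('d)) * (br k * (\<Sum>\<^sub>\<infinity>h. norm (a h) * norm (b (k - h))))"
    by (intro mult_left_mono) simp_all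
  thus ?thesis using norm_Bil_le_conv[of a b k] by (simp add: mult_ac)
qed

lemma rapid_Bil:
  fixes S1 S2 :: "(int^('d::finite) \<Rightarrow> complex^'d) set"
  assumes "rapid S1" "rapid S2"
  shows "rapid {Bil a b |a b. a \<in> S1 \<and> b \<in> S2}"
proof (rule rapidI_conv[OF assms, where C = "cmod (cvol TYPE('d))" and q = 1])
  fix c assume "c \<in> {Bil a b |a b. a \<in> S1 \<and> b \<in> S2}"
  then obtain a b where ab: "a \<in> S1" "b \<in> S2" "c = Bil a b" by blast
  show "\<exists>a1\<in>S1. \<exists>a2\<in>S2. \<forall>k. norm (c k) \<le> cmod (cvol TYPE('d)) * br k ^ 1 * (\<Sum>\<^sub>\<infinity>h. norm (a1 h) * norm (a2 (k - h)))"
    using norm_Bil_le[OF rapid_single[OF assms(1) ab(1)] rapid_single[OF assms(2) ab(2)]] ab by blast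
qed simp

lemma rapid_Bil_single:
  assumes "rapid {a}" "rapid {b}" shows "rapid {Bil a b}"
  by (rule rapid_single[OF rapid_Bil[OF assms]]) blast

lemma Bil_zero: "Bil a b 0 = 0"
  by (simp add: Bil_def conv_def)

lemma wave_dot_Bil: "wave_dot k (Bil a b k) = 0"
  by (simp add: Bil_def wave_dot_minus wave_dot_proj_perp)

text \<open>The summation index is reflected from \<open>h\<close> to \<open>- h\<close>. The minus
  sign is compensated by the conjugation of the factor i in \<open>Bil\<close>.\<close>

lemma conv_herm:
  assumes "\<And>k. a (- k) = cnjv (a k)" "\<And>k. b (- k) = cnjv (b k)" "rapid {a}" "rapid {b}"
  shows "conv a b (- k) = - cnjv (conv a b k)"
proof -
  have "conv a b (- k) = (\<Sum>\<^sub>\<infinity>h. wave_dot (- k) (a (- h)) *s b (- k - - h))"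
    unfolding conv_def by (rule infsum_reindex_bij_betw[symmetric, of uminus]) (auto intro!: bij_betwI[of _ _ _ uminus])
  also have "\<dots> = (\<Sum>\<^sub>\<infinity>h. - cnjv (wave_dot k (a h) *s b (k - h)))"
  proof (rule infsum_cong)
    fix h
    have "b (- k - - h) = cnjv (b (k - h))" using assms(2)[of "k - h"] by simp
    thus "wave_dot (- k) (a (- h)) *s b (- k - - h) = - cnjv (wave_dot k (a h) *s b (k - h))"
      by (simp add: assms(1) wave_dot_minus_left wave_dot_cnjv vec_eq_iff)
  qed
  also have "\<dots> = - (\<Sum>\<^sub>\<infinity>h. cnjv (wave_dot k (a h) *s b (k - h)))"
    by (rule infsum_uminus)
  also have "(\<Sum>\<^sub>\<infinity>h. cnjv (wave_dot k (a h) *s b (k - h))) = cnjv (conv a b k)"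
    unfolding conv_def by (rule infsumI[OF has_sum_bounded_linear[OF bounded_linear_cnjv has_sum_infsum[OF summable_conv[OF assms(3,4)]]]])
  finally show ?thesis .
qed

lemma ns_coeffs_Bil:
  assumes "a \<in> ns_coeffs" "b \<in> ns_coeffs" shows "Bil a b \<in> ns_coeffs"
proof -
  note a = ns_coeffsD[OF assms(1)] and b = ns_coeffsD[OF assms(2)]
  have "Bil a b (- k) = cnjv (Bil a b k)" for k
  proof -
    have "(\<i> * cvol TYPE('a)) *s (- cnjv z) = cnjv ((\<i> * cvol TYPE('a)) *s z)" for z :: "complex^'a"
      by (simp add: vec_eq_iff)
    hence "Bil a b (- k) = - proj_perp (- k) (cnjv ((\<i> * cvol TYPE('a)) *s conv a b k))"
      unfolding Bil_def conv_herm[OF a(2) b(2) a(1) b(1)] by simp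
    thus ?thesis by (simp add: proj_perp_cnjv Bil_def vec_eq_iff)
  qed
  thus ?thesis using rapid_Bil_single[OF a(1) b(1)] by (simp add: ns_coeffs_def wave_dot_Bil Bil_zero)
qed

lemma Bil_add_left:
  assumes "rapid {a}" "rapid {a'}" "rapid {b}"
  shows "Bil (\<lambda>k. a k + a' k) b k = Bil a b k + Bil a' b k"
proof -
  have "conv (\<lambda>k. a k + a' k) b k = conv a b k + conv a' b k"
    unfolding conv_def
    by (subst infsum_add[symmetric]) (simp_all add: summable_conv assms wave_dot_add vec_eq_iff distrib_right)
  thus ?thesis by (simp add: Bil_def vector_add_ldistrib proj_perp_add)
qed

lemma Bil_add_right:
  assumes "rapid {a}" "rapid {b}" "rapid {b'}"
  shows "Bil a (\<lambda>k. b k + b' k) k = Bil a b k + Bil a b' k"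
proof -
  have "conv a (\<lambda>k. b k + b' k) k = conv a b k + conv a b' k"
    unfolding conv_def
    by (subst infsum_add[symmetric]) (simp_all add: summable_conv assms vector_add_ldistrib)
  thus ?thesis by (simp add: Bil_def vector_add_ldistrib proj_perp_add)
qed

lemma smult_scaleR_right: "c *s (t *\<^sub>R (x :: complex^'d)) = t *\<^sub>R (c *s x)"
  by (simp add: vec_eq_iff)

lemma Bil_scaleR_left: "Bil (\<lambda>k. t *\<^sub>R a k) b k = t *\<^sub>R Bil a b k"
proof -
  have "(t *\<^sub>R c) *s x = t *\<^sub>R (c *s x)" for c and x :: "complex^'a"
    by (rule linear_scale[OF bounded_linear.linear[OF bounded_linear_smult_vec_left]])
  hence "conv (\<lambda>k. t *\<^sub>R a k) b k = t *\<^sub>R conv a b k"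
    unfolding conv_def infsum_scaleR_right[symmetric] by (simp only: wave_dot_scaleR)
  thus ?thesis by (simp add: Bil_def smult_scaleR_right proj_perp_scaleR)
qed

lemma Bil_scaleR_right: "Bil a (\<lambda>k. t *\<^sub>R b k) k = t *\<^sub>R Bil a b k"
proof -
  have "conv a (\<lambda>k. t *\<^sub>R b k) k = t *\<^sub>R conv a b k"
    unfolding conv_def infsum_scaleR_right[symmetric] by (simp add: smult_scaleR_right)
  thus ?thesis by (simp add: Bil_def smult_scaleR_right proj_perp_scaleR)
qed

lemma Bil_diff_left:
  assumes "rapid {a}" "rapid {a'}" "rapid {b}"
  shows "Bil (\<lambda>k. a k - a' k) b k = Bil a b k - Bil a' b k"
  using Bil_add_left[OF assms(1) rapid_scaleR[OF assms(2), of "- 1"] assms(3), of k]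
  unfolding Bil_scaleR_left by simp

lemma Bil_diff_right:
  assumes "rapid {a}" "rapid {b}" "rapid {b'}"
  shows "Bil a (\<lambda>k. b k - b' k) k = Bil a b k - Bil a b' k"
  using Bil_add_right[OF assms(1,2) rapid_scaleR[OF assms(3), of "- 1"], of k]
  unfolding Bil_scaleR_right by simp

text \<open>The product weight is summable over pairs of indices; this majorant justifies the
  exchanges of double sums in the energy estimates.\<close>

lemma summable_double_wt:
  fixes f :: "int^('d::finite) \<Rightarrow> int^'d \<Rightarrow> 'b::banach"
  assumes "\<And>k h. norm (f k h) \<le> C * (wt k * wt h)"
  shows "(\<lambda>(k, h). f k h) summable_on UNIV \<times> UNIV"
proof (rule abs_summable_summable, rule summable_on_comparison_test)
  have hs: "((\<lambda>h :: int^'d. wt k * wt h) has_sum (wt k * (\<Sum>\<^sub>\<infinity>h. wt (h :: int^'d)))) UNIV" for k :: "int^'d"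
    by (rule has_sum_cmult_right[OF has_sum_infsum[OF summable_wt]])
  have "(\<lambda>(k :: int^'d, h :: int^'d). wt k * wt h) summable_on UNIV \<times> UNIV"
  proof (rule summable_on_SigmaI)
    show "((\<lambda>y :: int^'d. case (x, y) of (k, h) \<Rightarrow> wt k * wt h) has_sum (wt x * (\<Sum>\<^sub>\<infinity>h. wt (h :: int^'d)))) UNIV" for x :: "int^'d"
      using hs by simp
    show "(\<lambda>x. wt x * (\<Sum>\<^sub>\<infinity>h. wt (h :: int^'d))) summable_on (UNIV :: (int^'d) set)"
      by (intro summable_on_cmult_left summable_wt)
  qed (simp add: less_imp_le[OF wt_pos])
  thus "(\<lambda>x. C * (case x of (k :: int^'d, h :: int^'d) \<Rightarrow> wt k * wt h)) summable_on UNIV \<times> UNIV"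
    by (rule summable_on_cmult_right)
qed (auto simp: assms)

lemma infsum_shift_reindex: "(\<Sum>\<^sub>\<infinity>k. f (k - l)) = (\<Sum>\<^sub>\<infinity>k. f (k :: int^('d::finite)))"
  by (rule infsum_reindex_bij_betw) (auto intro!: bij_betwI[of _ _ _ "\<lambda>k. k + l"])

lemma infsum_reflect_reindex: "(\<Sum>\<^sub>\<infinity>h. f (k - h)) = (\<Sum>\<^sub>\<infinity>h. f (h :: int^('d::finite)))"
  by (rule infsum_reindex_bij_betw) (auto intro!: bij_betwI[of _ _ _ "\<lambda>h. k - h"])

lemma summable_reflect_reindex: "(\<lambda>h. f (k - h)) summable_on UNIV \<longleftrightarrow> f summable_on (UNIV :: (int^('d::finite)) set)"
  by (rule summable_on_reindex_bij_betw) (auto intro!: bij_betwI[of _ _ _ "\<lambda>h. k - h"])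

lemma summable_shift_reindex: "(\<lambda>h. f (h - k)) summable_on UNIV \<longleftrightarrow> f summable_on (UNIV :: (int^('d::finite)) set)"
  by (rule summable_on_reindex_bij_betw) (auto intro!: bij_betwI[of _ _ _ "\<lambda>h. h + k"])

lemma inn0_eq:
  assumes "b 0 = 0"
  shows "inn 0 a b = (\<Sum>\<^sub>\<infinity>k. a k \<bullet> b k)"
proof -
  have "norm (wavevec k) powr (2 * 0) * (a k \<bullet> b k) = a k \<bullet> b k" for k
    by (cases "k = 0") (simp_all add: assms)
  thus ?thesis unfolding inn_def by (simp only:)
qed

text \<open>For fixed \<open>h\<close> the trilinear summand is antisymmetric under the exchange of
  \<open>l\<close> and \<open>- h - l\<close>, because \<open>wave_dot h (a h) = 0\<close>; so the
  sum over \<open>l\<close> vanishes. This is integration by parts against a divergence free field,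
  written in coefficients.\<close>

lemma Bil_cancel:
  fixes a b :: "int^('d::finite) \<Rightarrow> complex^'d"
  assumes "a \<in> ns_coeffs" "b \<in> ns_coeffs"
  shows "inn 0 (Bil a b) b = 0"
proof -
  note a = ns_coeffsD[OF assms(1)] and b = ns_coeffsD[OF assms(2)]
  define c where "c = \<i> * cvol TYPE('d)"
  \<comment> \<open>The summand with \<open>k = h + l\<close>. Reality turns the conjugate of
    \<open>b k\<close> into \<open>b (- (h + l))\<close>, and the two factors \<open>b\<close>
    change places when \<open>l\<close> is replaced by \<open>- h - l\<close>.\<close>
  define T where "T = (\<lambda>h l. c * wave_dot l (a h) * (\<Sum>r\<in>UNIV. b l $ r * b (- (h + l)) $ r))"
  have wd: "wave_dot (h + l) (a h) = wave_dot l (a h)" for h l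
    by (simp add: wave_dot_add_left a(3))
  have trm: "(c *s (wave_dot k (a h) *s b (k - h))) \<bullet> b k = Re (T h (k - h))" for k h
  proof -
    have bk: "b (- k) $ r = cnj (b k $ r)" for r using b(2)[of k] by simp
    have "(c *s (wave_dot k (a h) *s b (k - h))) \<bullet> b k = b k \<bullet> (c *s (wave_dot k (a h) *s b (k - h)))"
      by (rule inner_commute)
    also have "\<dots> = Re (\<Sum>r\<in>UNIV. c * wave_dot k (a h) * (b (k - h) $ r * b (- k) $ r))"
      by (simp add: inner_vec_complex bk mult_ac)
    also have "\<dots> = Re (T h (k - h))"
      using wd[of h "k - h"] by (simp add: T_def sum_distrib_left)
    finally show ?thesis .
  qed
  \<comment> \<open>The factor |k| of the summand is given to \<open>b k\<close>, whose rapid decay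
    yields the weight in \<open>k\<close>; the weight in \<open>h\<close> comes from
    \<open>a h\<close>.\<close>
  have bound: "\<exists>C. \<forall>k h. norm (Re (T h (k - h))) \<le> C * (wt k * wt h)"
  proof -
    obtain M1 where M1: "M1 \<ge> 0" "\<And>k. br k ^ 0 * norm (a k) \<le> M1 * wt k"
      using rapid_single_wtD[OF a(1)] by blast
    obtain M2 where M2: "M2 \<ge> 0" "\<And>k. br k ^ 0 * norm (b k) \<le> M2"
      using rapid_singleD[OF b(1)] by blast
    obtain M3 where M3: "M3 \<ge> 0" "\<And>k. br k ^ 1 * norm (b k) \<le> M3 * wt k"
      using rapid_single_wtD[OF b(1)] by blast
    have "norm (Re (T h (k - h))) \<le> cmod c * M1 * M2 * M3 * (wt k * wt h)" for k h
    proof -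
      have "norm (Re (T h (k - h))) \<le> norm (c *s (wave_dot k (a h) *s b (k - h))) * norm (b k)"
        unfolding trm[symmetric] real_norm_def by (rule Cauchy_Schwarz_ineq2)
      also have "norm (c *s (wave_dot k (a h) *s b (k - h))) \<le> cmod c * (norm (wavevec k) * (norm (a h) * norm (b (k - h))))"
        unfolding norm_smult_vec[of c] by (intro mult_left_mono conv_term_le) simp
      also have "cmod c * (norm (wavevec k) * (norm (a h) * norm (b (k - h)))) * norm (b k)
          = cmod c * (norm (a h) * norm (b (k - h)) * (norm (wavevec k) * norm (b k)))" by (simp add: mult_ac)
      also have "\<dots> \<le> cmod c * ((M1 * wt h) * M2 * (M3 * wt k))"
      proof -
        have 1: "norm (a h) \<le> M1 * wt h" and 2: "norm (b (k - h)) \<le> M2" using M1(2)[of h] M2(2)[of "k - h"] by simp_all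
        have "norm (wavevec k) * norm (b k) \<le> br k * norm (b k)"
          by (intro mult_right_mono norm_wavevec_le_br) simp
        hence 3: "norm (wavevec k) * norm (b k) \<le> M3 * wt k" using M3(2)[of k] by simp
        have p: "0 \<le> M1 * wt h" using M1(1) wt_pos[of h] by simp
        show ?thesis
          by (rule mult_left_mono[OF mult_mono[OF mult_mono[OF 1 2] 3]]) (simp_all add: p M2(1))
      qed
      finally show ?thesis by (simp add: mult_ac mult_right_mono)
    qed
    thus ?thesis by blast
  qed
  then obtain C where C: "\<And>k h. norm (Re (T h (k - h))) \<le> C * (wt k * wt h)" by blast
  have zero: "(\<Sum>\<^sub>\<infinity>l. Re (T h l)) = 0" for h
  proof -
    have "T h (- h - l) = - T h l" for l
    proof -
      have "wave_dot (- h - l) (a h) = - wave_dot l (a h)"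
        using a(3)[of h] by (simp add: wave_dot_diff_left wave_dot_minus_left)
      thus ?thesis by (simp add: T_def mult.commute)
    qed
    hence "(\<Sum>\<^sub>\<infinity>l. Re (T h l)) = (\<Sum>\<^sub>\<infinity>l. - Re (T h l))"
      using infsum_reflect_reindex[of "\<lambda>l. Re (T h l)" "- h"] by simp
    thus ?thesis by (simp add: infsum_uminus)
  qed
  have "inn 0 (Bil a b) b = (\<Sum>\<^sub>\<infinity>k. Bil a b k \<bullet> b k)"
    by (rule inn0_eq) (rule b(4))
  also have "\<dots> = (\<Sum>\<^sub>\<infinity>k. - (\<Sum>\<^sub>\<infinity>h. Re (T h (k - h))))"
  proof (rule infsum_cong)
    fix k
    have bl: "bounded_linear (\<lambda>x. (c *s x) \<bullet> b k)"
      by (rule bounded_linear_compose[OF bounded_linear_inner_left bounded_linear_smult_vec])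
    have "Bil a b k \<bullet> b k = - ((c *s conv a b k) \<bullet> b k)"
      unfolding Bil_def c_def[symmetric] by (simp add: inner_proj_perp[OF b(3)])
    also have "(c *s conv a b k) \<bullet> b k = (\<Sum>\<^sub>\<infinity>h. (c *s (wave_dot k (a h) *s b (k - h))) \<bullet> b k)"
      unfolding conv_def
      by (rule infsumI[OF has_sum_bounded_linear[OF bl has_sum_infsum[OF summable_conv[OF a(1) b(1)]]], symmetric])
    finally show "Bil a b k \<bullet> b k = - (\<Sum>\<^sub>\<infinity>h. Re (T h (k - h)))" by (simp only: trm)
  qed
  also have "\<dots> = - (\<Sum>\<^sub>\<infinity>k. \<Sum>\<^sub>\<infinity>h. Re (T h (k - h)))" by (rule infsum_uminus)
  also have "(\<Sum>\<^sub>\<infinity>k. \<Sum>\<^sub>\<infinity>h. Re (T h (k - h))) = (\<Sum>\<^sub>\<infinity>h. \<Sum>\<^sub>\<infinity>k. Re (T h (k - h)))"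
    by (rule infsum_swap_banach) (rule summable_double_wt[OF C])
  also have "\<dots> = (\<Sum>\<^sub>\<infinity>h. \<Sum>\<^sub>\<infinity>l. Re (T h l))"
    by (rule infsum_cong) (rule infsum_shift_reindex)
  also have "\<dots> = 0" by (simp add: zero)
  finally show ?thesis by simp
qed

lemma nrm0_shift:
  assumes "rapid {a}" "a 0 = 0"
  shows "(\<lambda>k. (norm (a (k - l)))\<^sup>2) summable_on UNIV" "sqrt (\<Sum>\<^sub>\<infinity>k. (norm (a (k - l)))\<^sup>2) = nrm 0 a"
    "(\<lambda>k. (norm (a (l - k)))\<^sup>2) summable_on UNIV" "sqrt (\<Sum>\<^sub>\<infinity>k. (norm (a (l - k)))\<^sup>2) = nrm 0 a"
  using nrm0_infsum[OF assms] infsum_shift_reindex[of "\<lambda>k. (norm (a k))\<^sup>2" l]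
    summable_shift_reindex[of "\<lambda>k. (norm (a k))\<^sup>2" l] infsum_reflect_reindex[of "\<lambda>k. (norm (a k))\<^sup>2" l]
    summable_reflect_reindex[of "\<lambda>k. (norm (a k))\<^sup>2" l] by simp_all

text \<open>Cauchy-Schwarz for the convolution sum. At a fixed mode the bilinear map is thus
  continuous for the L^2 norm in both arguments, which suffices for limits and derivatives taken
  coefficient by coefficient.\<close>

lemma norm_Bil_le_nrm0:
  fixes a b :: "int^('d::finite) \<Rightarrow> complex^'d"
  assumes "rapid {a}" "a 0 = 0" "rapid {b}" "b 0 = 0"
  shows "norm (Bil a b k) \<le> cmod (cvol TYPE('d)) * br k * (nrm 0 a * nrm 0 b)"
proof -
  have "(\<Sum>\<^sub>\<infinity>h. \<bar>norm (a h) * norm (b (k - h))\<bar>) \<le> nrm 0 a * nrm 0 b"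
    using infsum_Cauchy_Schwarz(2)[OF nrm0_infsum(2)[OF assms(1,2)] nrm0_shift(3)[OF assms(3,4), of k]]
    unfolding nrm0_shift(4)[OF assms(3,4)] nrm0_infsum(1)[OF assms(1,2), symmetric] .
  hence "(\<Sum>\<^sub>\<infinity>h. norm (a h) * norm (b (k - h))) \<le> nrm 0 a * nrm 0 b" by simp
  hence "cmod (cvol TYPE('d)) * br k ^ 1 * (\<Sum>\<^sub>\<infinity>h. norm (a h) * norm (b (k - h)))
      \<le> cmod (cvol TYPE('d)) * br k ^ 1 * (nrm 0 a * nrm 0 b)"
    by (intro mult_left_mono) (simp_all add: less_imp_le[OF br_pos])
  thus ?thesis using norm_Bil_le[OF assms(1,3), of k] by simp
qed

text \<open>A bound for the sup norm of the gradient of the field with coefficients \<open>b\<close>.\<close>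

definition lip1 :: "(int^'d \<Rightarrow> complex^('d::finite)) \<Rightarrow> real" where
  "lip1 b = cmod (cvol TYPE('d)) * (\<Sum>\<^sub>\<infinity>l. br l ^ 1 * norm (b l))"

text \<open>The derivative is moved onto \<open>b\<close>, so that no derivative of \<open>w\<close>
  appears: for each \<open>l\<close>, Cauchy-Schwarz in \<open>k\<close> bounds the sum of |w_(k -
  l)| |w_k| by the squared L^2 norm of \<open>w\<close>, and summing over \<open>l\<close> against
  \<open>br l * norm (b l)\<close> gives \<open>lip1 b\<close>.\<close>

lemma inn0_Bil_le:
  fixes w b :: "int^('d::finite) \<Rightarrow> complex^'d"
  assumes "w \<in> ns_coeffs" "rapid {b}"
  shows "\<bar>inn 0 (Bil w b) w\<bar> \<le> lip1 b * (nrm 0 w)\<^sup>2"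
proof -
  note w = ns_coeffsD[OF assms(1)]
  let ?c = "cmod (cvol TYPE('d))"
  define \<beta> where "\<beta> = (\<lambda>l. br l ^ 1 * norm (b l))"
  have \<beta>0: "0 \<le> \<beta> l" for l by (simp add: \<beta>_def less_imp_le[OF br_pos])
  have sB: "\<beta> summable_on UNIV" unfolding \<beta>_def by (rule rapid_summable[OF assms(2)])
  obtain M1 where M1: "M1 \<ge> 0" "\<And>k. br k ^ 0 * norm (w k) \<le> M1 * wt k"
    using rapid_single_wtD[OF w(1)] by blast
  obtain M2 where M2: "M2 \<ge> 0" "\<And>k. br k ^ 0 * norm (w k) \<le> M2"
    using rapid_singleD[OF w(1)] by blast
  obtain M3 where M3: "M3 \<ge> 0" "\<And>k. br k ^ 1 * norm (b k) \<le> M3 * wt k"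
    using rapid_single_wtD[OF assms(2)] by blast
  have dbl: "norm (\<beta> l * (norm (w (k - l)) * norm (w k))) \<le> M3 * M2 * M1 * (wt k * wt l)" for k l
  proof -
    have "\<beta> l * (norm (w (k - l)) * norm (w k)) \<le> (M3 * wt l) * (M2 * (M1 * wt k))"
      by (intro mult_mono) (use M1 M2 M3 wt_pos[of l] \<beta>0 in \<open>auto simp: \<beta>_def intro!: mult_nonneg_nonneg\<close>)
    moreover have "norm (\<beta> l * (norm (w (k - l)) * norm (w k))) = \<beta> l * (norm (w (k - l)) * norm (w k))"
      using \<beta>0[of l] by simp
    ultimately show ?thesis by (simp add: mult_ac)
  qed
  have sd: "(\<lambda>(k, l). \<beta> l * (norm (w (k - l)) * norm (w k))) summable_on UNIV \<times> UNIV"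
    by (rule summable_double_wt[OF dbl])
  have sk: "(\<lambda>l. \<beta> l * (norm (w (k - l)) * norm (w k))) summable_on UNIV" for k
    using summable_on_SigmaD1[OF sd, of k] by simp
  have s1: "(\<lambda>k. \<Sum>\<^sub>\<infinity>l. \<beta> l * (norm (w (k - l)) * norm (w k))) summable_on UNIV"
    using summable_on_Sigma_banach[OF sd] .
  have pt: "norm (Bil w b k \<bullet> w k) \<le> ?c * (\<Sum>\<^sub>\<infinity>l. \<beta> l * (norm (w (k - l)) * norm (w k)))" for k
  proof -
    have le1: "norm (wave_dot k (w h) *s b (k - h)) \<le> \<beta> (k - h) * norm (w h)" for h
    proof -
      \<comment> \<open>As \<open>w\<close> is divergence free, \<open>k\<close> may be exchanged
        for \<open>k - h\<close>, the frequency of the factor \<open>b\<close>.\<close>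
      have "wave_dot k (w h) = wave_dot (k - h) (w h)" by (simp add: wave_dot_diff_left w(3))
      hence "norm (wave_dot k (w h) *s b (k - h)) \<le> (norm (wavevec (k - h)) * norm (w h)) * norm (b (k - h))"
        unfolding norm_smult_vec by (intro mult_right_mono) (simp_all add: norm_wave_dot_le)
      also have "\<dots> \<le> (br (k - h) * norm (w h)) * norm (b (k - h))"
        by (intro mult_right_mono norm_wavevec_le_br) simp_all
      finally show ?thesis by (simp add: \<beta>_def mult_ac)
    qed
    have sum0: "(\<lambda>h. \<beta> (k - h) * norm (w h)) summable_on UNIV"
    proof -
      have "(\<lambda>l. \<beta> l * norm (w (k - l))) summable_on UNIV"
        by (rule summable_on_comparison_test[OF summable_on_cmult_left[OF sB, of M2]])
          (use M2 \<beta>0 in \<open>auto intro!: mult_left_mono\<close>)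
      thus ?thesis using summable_reflect_reindex[of "\<lambda>l. \<beta> l * norm (w (k - l))" k] by simp
    qed
    have "norm (conv w b k) \<le> (\<Sum>\<^sub>\<infinity>h. \<beta> (k - h) * norm (w h))"
      unfolding conv_def
      by (rule norm_infsum_le[OF has_sum_infsum[OF summable_conv[OF w(1) assms(2)]] has_sum_infsum[OF sum0] le1])
    also have "\<dots> = (\<Sum>\<^sub>\<infinity>l. \<beta> l * norm (w (k - l)))"
      using infsum_reflect_reindex[of "\<lambda>l. \<beta> l * norm (w (k - l))" k] by simp
    finally have cv: "norm (conv w b k) \<le> (\<Sum>\<^sub>\<infinity>l. \<beta> l * norm (w (k - l)))" .
    have "norm (Bil w b k \<bullet> w k) \<le> norm (Bil w b k) * norm (w k)"
      unfolding real_norm_def by (rule Cauchy_Schwarz_ineq2)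
    also have "\<dots> \<le> (?c * (\<Sum>\<^sub>\<infinity>l. \<beta> l * norm (w (k - l)))) * norm (w k)"
      by (intro mult_right_mono order_trans[OF norm_Bil_le_conv] mult_left_mono cv) simp_all
    also have "\<dots> = ?c * ((\<Sum>\<^sub>\<infinity>l. \<beta> l * norm (w (k - l))) * norm (w k))" by simp
    also have "(\<Sum>\<^sub>\<infinity>l. \<beta> l * norm (w (k - l))) * norm (w k) = (\<Sum>\<^sub>\<infinity>l. \<beta> l * (norm (w (k - l)) * norm (w k)))"
      by (subst infsum_cmult_left'[symmetric]) (simp add: mult_ac)
    finally show ?thesis .
  qed
  have "\<bar>inn 0 (Bil w b) w\<bar> \<le> (\<Sum>\<^sub>\<infinity>k. ?c * (\<Sum>\<^sub>\<infinity>l. \<beta> l * (norm (w (k - l)) * norm (w k))))"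
    unfolding inn0_eq[of w "Bil w b", OF w(4)] real_norm_def[symmetric]
  proof (rule norm_infsum_le[OF has_sum_infsum has_sum_infsum pt])
    have "norm (wavevec k) powr (2 * 0) * (Bil w b k \<bullet> w k) = Bil w b k \<bullet> w k" for k
      by (cases "k = 0") (simp_all add: w(4))
    thus "(\<lambda>k. Bil w b k \<bullet> w k) summable_on UNIV"
      using summable_inn[OF rapid_Bil_single[OF w(1) assms(2)] w(1), of 0] by (simp only:)
  qed (intro summable_on_cmult_right s1)
  also have "\<dots> = ?c * (\<Sum>\<^sub>\<infinity>k. \<Sum>\<^sub>\<infinity>l. \<beta> l * (norm (w (k - l)) * norm (w k)))"
    by (rule infsum_cmult_right')
  also have "(\<Sum>\<^sub>\<infinity>k. \<Sum>\<^sub>\<infinity>l. \<beta> l * (norm (w (k - l)) * norm (w k)))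
      = (\<Sum>\<^sub>\<infinity>l. \<Sum>\<^sub>\<infinity>k. \<beta> l * (norm (w (k - l)) * norm (w k)))"
    by (rule infsum_swap_banach[OF sd])
  also have "\<dots> = (\<Sum>\<^sub>\<infinity>l. \<beta> l * (\<Sum>\<^sub>\<infinity>k. norm (w (k - l)) * norm (w k)))"
    by (simp only: infsum_cmult_right')
  also have "\<dots> \<le> (\<Sum>\<^sub>\<infinity>l. \<beta> l * (nrm 0 w)\<^sup>2)"
  proof (rule infsum_mono)
    have cs: "(\<Sum>\<^sub>\<infinity>k. norm (w (k - l)) * norm (w k)) \<le> (nrm 0 w)\<^sup>2" for l
      using infsum_Cauchy_Schwarz(2)[OF nrm0_shift(1)[OF w(1,4), of l] nrm0_infsum(2)[OF w(1,4)]]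
      unfolding nrm0_shift(2)[OF w(1,4)] nrm0_infsum(1)[OF w(1,4), symmetric] by (simp add: power2_eq_square)
    show "\<beta> l * (\<Sum>\<^sub>\<infinity>k. norm (w (k - l)) * norm (w k)) \<le> \<beta> l * (nrm 0 w)\<^sup>2" for l
      by (intro mult_left_mono cs \<beta>0)
    show sR: "(\<lambda>l. \<beta> l * (nrm 0 w)\<^sup>2) summable_on UNIV" by (intro summable_on_cmult_left sB)
    show "(\<lambda>l. \<beta> l * (\<Sum>\<^sub>\<infinity>k. norm (w (k - l)) * norm (w k))) summable_on UNIV"
      by (rule summable_on_comparison_test[OF sR])
        (intro mult_left_mono cs \<beta>0 mult_nonneg_nonneg infsum_nonneg norm_ge_zero)+
  qed
  also have "\<dots> = (\<Sum>\<^sub>\<infinity>l. \<beta> l) * (nrm 0 w)\<^sup>2" by (rule infsum_cmult_left')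
  finally have "\<bar>inn 0 (Bil w b) w\<bar> \<le> ?c * ((\<Sum>\<^sub>\<infinity>l. \<beta> l) * (nrm 0 w)\<^sup>2)"
    by (simp add: mult_left_mono)
  thus ?thesis by (simp add: lip1_def \<beta>_def mult_ac)
qed

lemma lip1_bounded:
  fixes S :: "(int^('d::finite) \<Rightarrow> complex^'d) set"
  assumes "rapid S"
  obtains L where "L \<ge> 0" "\<And>b. b \<in> S \<Longrightarrow> lip1 b \<le> L"
proof -
  obtain M where M: "M \<ge> 0" "\<And>b. b \<in> S \<Longrightarrow> (\<Sum>\<^sub>\<infinity>k. br k ^ 1 * norm (b k)) \<le> M"
    using rapid_infsum_mono[OF assms, of 1] by blast
  show ?thesis
  proof (rule that[of "cmod (cvol TYPE('d)) * M"])
    show "0 \<le> cmod (cvol TYPE('d)) * M" by (intro mult_nonneg_nonneg M(1)) simp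
    fix b assume "b \<in> S"
    thus "lip1 b \<le> cmod (cvol TYPE('d)) * M" unfolding lip1_def by (intro mult_left_mono M(2)) simp_all
  qed
qed

text \<open>The difference splits as \<open>Bil a w\<close> plus \<open>Bil w b\<close>, and the
  first part is killed by \<open>Bil_cancel\<close>. Hence the constant depends on \<open>b\<close>
  alone, not on \<open>a\<close>.\<close>

lemma inn0_Bil_diff_le:
  fixes a b :: "int^('d::finite) \<Rightarrow> complex^'d"
  assumes "a \<in> ns_coeffs" "b \<in> ns_coeffs"
  defines "w \<equiv> \<lambda>k. a k - b k"
  shows "inn 0 (\<lambda>k. Bil a a k - Bil b b k) w \<le> lip1 b * (nrm 0 w)\<^sup>2"
proof -
  note a = ns_coeffsD[OF assms(1)] and b = ns_coeffsD[OF assms(2)]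
  have w: "w \<in> ns_coeffs" unfolding w_def by (rule ns_coeffs_diff[OF assms(1,2)])
  note w' = ns_coeffsD[OF w]
  have "Bil a a k - Bil b b k = Bil a w k + Bil w b k" for k
    unfolding w_def by (simp add: Bil_diff_left Bil_diff_right a(1) b(1))
  hence "inn 0 (\<lambda>k. Bil a a k - Bil b b k) w = inn 0 (Bil a w) w + inn 0 (Bil w b) w"
    using inn_add_left[OF w'(1) rapid_Bil_single[OF a(1) w'(1)] rapid_Bil_single[OF w'(1) b(1)], of 0] by simp
  also have "\<dots> \<le> lip1 b * (nrm 0 w)\<^sup>2"
    using inn0_Bil_le[OF w b(1)] Bil_cancel[OF assms(1) w] by simp
  finally show ?thesis .
qed

section \<open>Termwise differentiation of Fourier series\<close>

lemma rapid_nth: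
  fixes a :: "int^'d \<Rightarrow> complex^('d::finite)"
  assumes "rapid {a}" shows "rapid {\<lambda>k. a k $ r}"
  by (rule rapidI_mult[OF assms, where C = 1 and q = 0]) (simp_all add: Finite_Cartesian_Product.norm_nth_le)

lemma rapid_mult_int:
  fixes c :: "int^('d::finite) \<Rightarrow> complex"
  assumes "rapid {c}" shows "rapid {\<lambda>k. \<i> * of_int (k $ s) * c k}"
proof (rule rapidI_mult[OF assms, where C = 1 and q = 1])
  have "\<bar>real_of_int (k $ s)\<bar> \<le> br k" for k :: "int^'d"
    using component_le_norm_wavevec[of k s] norm_wavevec_le_br[of k] by linarith
  hence "norm (\<i> * of_int (k $ s) * c k) \<le> 1 * br k ^ 1 * norm (c k)" for k
    by (simp add: norm_mult mult_right_mono)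
  thus "b \<in> {\<lambda>k. \<i> * of_int (k $ s) * c k} \<Longrightarrow> \<exists>a\<in>{c}. \<forall>k. norm (b k) \<le> 1 * br k ^ 1 * norm (a k)" for b
    by simp
qed simp

lemma summable_ser_rapid: "rapid {c} \<Longrightarrow> (\<lambda>k. c k * tchar k x) summable_on UNIV"
  by (rule summable_ser) (rule rapid_abs_summable)

lemma ser_add:
  assumes "rapid {c}" "rapid {d}"
  shows "ser (\<lambda>k. c k + d k) x = ser c x + ser d x"
  unfolding ser_def
  by (simp add: distrib_right infsum_add summable_ser_rapid assms distrib_left)

lemma ser_cmult: "ser (\<lambda>k. z * c k) x = z * ser c x"
  unfolding ser_def mult.assoc infsum_cmult_right' by simp

lemma ser_sum:
  fixes c :: "'s \<Rightarrow> int^('d::finite) \<Rightarrow> complex"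
  assumes "finite A" "\<And>s. s \<in> A \<Longrightarrow> rapid {c s}"
  shows "rapid {\<lambda>k. \<Sum>s\<in>A. c s k} \<and> ser (\<lambda>k. \<Sum>s\<in>A. c s k) x = (\<Sum>s\<in>A. ser (c s) x)"
  using assms
proof (induction A)
  case empty
  have "rapid {\<lambda>k :: int^'d. 0 :: complex}" by (auto simp: rapid_def)
  thus ?case by (simp add: ser_def)
next
  case (insert s A)
  hence r: "rapid {\<lambda>k. \<Sum>s\<in>A. c s k}" and e: "ser (\<lambda>k. \<Sum>s\<in>A. c s k) x = (\<Sum>s\<in>A. ser (c s) x)"
    and rs: "rapid {c s}" by blast+
  show ?case using rapid_add[OF rs r] ser_add[OF rs r, of x] e insert.hyps by simp
qed

lemma ser_real:
  fixes c :: "int^('d::finite) \<Rightarrow> complex"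
  assumes "\<And>k. c (- k) = cnj (c k)"
  shows "complex_of_real (Re (ser c x)) = ser c x"
proof -
  have "cnj (ser c x) = cvol TYPE('d) * (\<Sum>\<^sub>\<infinity>k. cnj (c k * tchar k x))"
    by (simp add: ser_def del: complex_cnj_mult) (simp add: infsum_cnj[symmetric])
  also have "(\<Sum>\<^sub>\<infinity>k. cnj (c k * tchar k x)) = (\<Sum>\<^sub>\<infinity>k. c (0 - k) * tchar (0 - k) x)"
    by (simp add: assms tchar_minus)
  also have "\<dots> = (\<Sum>\<^sub>\<infinity>k. c k * tchar k x)" by (rule infsum_reflect_reindex)
  finally have "cnj (ser c x) = ser c x" by (simp add: ser_def)
  thus ?thesis by (metis Reals_cnj_iff of_real_Re)
qed

text \<open>One t^2 each for the cosine and the sine; the bound for \<open>cos s - 1\<close> also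
  serves as the derivative bound for \<open>sin t - t\<close>.\<close>

lemma cis_remainder: "cmod (cis t - 1 - \<i> * complex_of_real t) \<le> 2 * t\<^sup>2"
proof -
  have c1: "\<bar>cos s - 1\<bar> \<le> \<bar>s\<bar> \<and> \<bar>cos s - 1\<bar> \<le> s\<^sup>2" for s :: real
  proof -
    have e: "\<bar>cos s - 1\<bar> = 2 * (\<bar>sin (s / 2)\<bar> * \<bar>sin (s / 2)\<bar>)"
      using cos_double_sin[of "s / 2"] by (simp add: power2_eq_square abs_mult[symmetric])
    have s: "\<bar>sin (s / 2)\<bar> \<le> \<bar>s\<bar> / 2" using abs_sin_x_le_abs_x[of "s / 2"] by simp
    have "\<bar>sin (s / 2)\<bar> * \<bar>sin (s / 2)\<bar> \<le> (\<bar>s\<bar> / 2) * 1" by (intro mult_mono s) simp_all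
    moreover have "\<bar>sin (s / 2)\<bar> * \<bar>sin (s / 2)\<bar> \<le> (\<bar>s\<bar> / 2) * (\<bar>s\<bar> / 2)" by (intro mult_mono s) simp_all
    moreover have "(\<bar>s\<bar> / 2) * (\<bar>s\<bar> / 2) = s\<^sup>2 / 4" by (simp add: power2_eq_square)
    moreover have "0 \<le> s\<^sup>2" by simp
    ultimately show ?thesis using e by linarith
  qed
  have "norm ((sin t - t) - (sin 0 - 0)) \<le> \<bar>t\<bar> * norm (t - 0)"
  proof (rule field_differentiable_bound[of "{- \<bar>t\<bar>..\<bar>t\<bar>}"])
    show "((\<lambda>t. sin t - t) has_field_derivative (cos z - 1)) (at z within {- \<bar>t\<bar>..\<bar>t\<bar>})" for z :: real
      by (auto intro!: derivative_eq_intros)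
    show "norm (cos z - 1) \<le> \<bar>t\<bar>" if "z \<in> {- \<bar>t\<bar>..\<bar>t\<bar>}" for z :: real
    proof -
      have "\<bar>z\<bar> \<le> \<bar>t\<bar>" using that by (simp add: abs_le_iff)
      thus ?thesis using c1[of z] by simp
    qed
  qed auto
  hence "\<bar>sin t - t\<bar> \<le> t\<^sup>2" by (simp add: power2_eq_square abs_mult[symmetric])
  moreover have "cmod (cis t - 1 - \<i> * complex_of_real t) \<le> \<bar>cos t - 1\<bar> + \<bar>sin t - t\<bar>"
    using cmod_le[of "cis t - 1 - \<i> * complex_of_real t"] by simp
  ultimately show ?thesis using c1[of t] by linarith
qed

text \<open>The first-order Taylor remainders of the characters are at most
  \<open>2 * (br k * norm h)^2\<close>, which is summable against \<open>c\<close>; so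
  differentiability comes with a quadratic error, directly from the definition.\<close>

lemma ser_has_derivative:
  fixes c :: "int^('d::finite) \<Rightarrow> complex"
  assumes c: "rapid {c}"
  shows "(ser c has_derivative (\<lambda>h. cvol TYPE('d) * (\<Sum>\<^sub>\<infinity>k. c k * (\<i> * complex_of_real (wavevec k \<bullet> h)) * tchar k x))) (at x)"
proof -
  let ?D = "\<lambda>h. cvol TYPE('d) * (\<Sum>\<^sub>\<infinity>k. c k * (\<i> * complex_of_real (wavevec k \<bullet> h)) * tchar k x)"
  let ?C = "\<lambda>r. (\<Sum>\<^sub>\<infinity>k. br k ^ r * norm (c k))"
  have le1: "norm (c k * (\<i> * complex_of_real (wavevec k \<bullet> h)) * tchar k x) \<le> br k ^ 1 * norm (c k) * norm h" for k h
  proof -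
    have "\<bar>wavevec k \<bullet> h\<bar> \<le> br k * norm h"
      by (rule order_trans[OF Cauchy_Schwarz_ineq2]) (intro mult_right_mono norm_wavevec_le_br, simp)
    hence "norm (c k) * \<bar>wavevec k \<bullet> h\<bar> \<le> norm (c k) * (br k * norm h)" by (rule mult_left_mono) simp
    thus ?thesis by (simp add: norm_mult mult_ac)
  qed
  have s1: "(\<lambda>k. br k ^ 1 * norm (c k) * norm h) summable_on UNIV" for h :: "real^'d"
    by (intro summable_on_cmult_left rapid_summable c)
  have sD: "(\<lambda>k. c k * (\<i> * complex_of_real (wavevec k \<bullet> h)) * tchar k x) summable_on UNIV" for h
    by (rule abs_summable_summable, rule summable_on_comparison_test[OF s1]) (rule le1, simp)
  have bl: "bounded_linear ?D"
  proof (rule bounded_linear_intro[where K = "cmod (cvol TYPE('d)) * ?C 1"])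
    fix h h' :: "real^'d" and t :: real
    have "(\<Sum>\<^sub>\<infinity>k. c k * (\<i> * complex_of_real (wavevec k \<bullet> (h + h'))) * tchar k x)
        = (\<Sum>\<^sub>\<infinity>k. c k * (\<i> * complex_of_real (wavevec k \<bullet> h)) * tchar k x) + (\<Sum>\<^sub>\<infinity>k. c k * (\<i> * complex_of_real (wavevec k \<bullet> h')) * tchar k x)"
      by (subst infsum_add[symmetric, OF sD sD]) (simp add: inner_add_right algebra_simps)
    thus "?D (h + h') = ?D h + ?D h'" by (simp add: distrib_left)
    have "(\<Sum>\<^sub>\<infinity>k. c k * (\<i> * complex_of_real (wavevec k \<bullet> (t *\<^sub>R h))) * tchar k x)
        = complex_of_real t * (\<Sum>\<^sub>\<infinity>k. c k * (\<i> * complex_of_real (wavevec k \<bullet> h)) * tchar k x)"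
      by (subst infsum_cmult_right'[symmetric]) (simp add: mult_ac)
    thus "?D (t *\<^sub>R h) = t *\<^sub>R ?D h" by (simp add: scaleR_conv_of_real)
    have "norm (\<Sum>\<^sub>\<infinity>k. c k * (\<i> * complex_of_real (wavevec k \<bullet> h)) * tchar k x) \<le> (\<Sum>\<^sub>\<infinity>k. br k ^ 1 * norm (c k) * norm h)"
      by (rule norm_infsum_le[OF has_sum_infsum[OF sD] has_sum_infsum[OF s1] le1])
    also have "\<dots> = ?C 1 * norm h" by (rule infsum_cmult_left')
    finally have "cmod (cvol TYPE('d)) * norm (\<Sum>\<^sub>\<infinity>k. c k * (\<i> * complex_of_real (wavevec k \<bullet> h)) * tchar k x) \<le> cmod (cvol TYPE('d)) * (?C 1 * norm h)"
      by (rule mult_left_mono) simp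
    thus "norm (?D h) \<le> norm h * (cmod (cvol TYPE('d)) * ?C 1)" by (simp add: norm_mult mult_ac)
  qed
  define K where "K = cmod (cvol TYPE('d)) * (2 * ?C 2)"
  have rem: "norm (ser c y - ser c x - ?D (y - x)) \<le> K * (norm (y - x))\<^sup>2" for y
  proof -
    define h where "h = y - x"
    have hs: "((\<lambda>k. c k * tchar k y + - (c k * tchar k x) + - (c k * (\<i> * complex_of_real (wavevec k \<bullet> h)) * tchar k x)) has_sum
        ((\<Sum>\<^sub>\<infinity>k. c k * tchar k y) + - (\<Sum>\<^sub>\<infinity>k. c k * tchar k x) + - (\<Sum>\<^sub>\<infinity>k. c k * (\<i> * complex_of_real (wavevec k \<bullet> h)) * tchar k x))) UNIV"
      by (intro has_sum_add has_sum_uminusI has_sum_infsum summable_ser_rapid c sD)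
    have le2: "norm (c k * tchar k y + - (c k * tchar k x) + - (c k * (\<i> * complex_of_real (wavevec k \<bullet> h)) * tchar k x))
        \<le> 2 * (norm h)\<^sup>2 * (br k ^ 2 * norm (c k))" for k
    proof -
      have "tchar k y = cis (wavevec k \<bullet> h) * tchar k x"
        by (simp add: tchar_def h_def cis_mult inner_diff_right)
      hence "c k * tchar k y + - (c k * tchar k x) + - (c k * (\<i> * complex_of_real (wavevec k \<bullet> h)) * tchar k x)
          = c k * tchar k x * (cis (wavevec k \<bullet> h) - 1 - \<i> * complex_of_real (wavevec k \<bullet> h))"
        by (simp add: algebra_simps)
      hence "norm (c k * tchar k y + - (c k * tchar k x) + - (c k * (\<i> * complex_of_real (wavevec k \<bullet> h)) * tchar k x))
          = norm (c k) * cmod (cis (wavevec k \<bullet> h) - 1 - \<i> * complex_of_real (wavevec k \<bullet> h))"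
        by (simp only: norm_mult norm_tchar mult_1_right)
      also have "\<dots> \<le> norm (c k) * (2 * (wavevec k \<bullet> h)\<^sup>2)"
        by (intro mult_left_mono cis_remainder) simp
      also have "\<dots> \<le> norm (c k) * (2 * (br k * norm h)\<^sup>2)"
      proof -
        have "\<bar>wavevec k \<bullet> h\<bar> \<le> br k * norm h"
          by (rule order_trans[OF Cauchy_Schwarz_ineq2]) (intro mult_right_mono norm_wavevec_le_br, simp)
        hence "\<bar>wavevec k \<bullet> h\<bar>\<^sup>2 \<le> (br k * norm h)\<^sup>2" by (intro power_mono) simp_all
        thus ?thesis by (intro mult_left_mono) simp_all
      qed
      finally show ?thesis by (simp add: power_mult_distrib mult_ac)
    qed
    have s2: "(\<lambda>k. 2 * (norm h)\<^sup>2 * (br k ^ 2 * norm (c k))) summable_on UNIV"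
      by (intro summable_on_cmult_right rapid_summable c)
    have "norm (ser c y - ser c x - ?D h) = cmod (cvol TYPE('d)) * norm ((\<Sum>\<^sub>\<infinity>k. c k * tchar k y) + - (\<Sum>\<^sub>\<infinity>k. c k * tchar k x) + - (\<Sum>\<^sub>\<infinity>k. c k * (\<i> * complex_of_real (wavevec k \<bullet> h)) * tchar k x))"
      unfolding ser_def norm_mult[symmetric] by (rule arg_cong[of _ _ norm]) (simp add: algebra_simps)
    also have "\<dots> \<le> cmod (cvol TYPE('d)) * (\<Sum>\<^sub>\<infinity>k. 2 * (norm h)\<^sup>2 * (br k ^ 2 * norm (c k)))"
      by (intro mult_left_mono norm_infsum_le[OF hs has_sum_infsum[OF s2] le2]) simp
    also have "\<dots> = K * (norm h)\<^sup>2"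
      unfolding K_def infsum_cmult_right' by (simp add: mult_ac)
    finally show ?thesis by (simp only: h_def)
  qed
  show ?thesis
  proof (rule has_derivativeI_sandwich[where e = 1 and H = "\<lambda>y. K * norm (y - x)"])
    show "((\<lambda>y. K * norm (y - x)) \<longlongrightarrow> 0) (at x)"
      by (rule tendsto_eq_intros refl | simp)+
    fix y assume "y \<noteq> x"
    thus "norm (ser c y - ser c x - ?D (y - x)) / norm (y - x) \<le> K * norm (y - x)"
      using rem[of y] by (simp add: divide_le_eq power2_eq_square mult_ac)
  qed (use bl in simp_all)
qed

lemma partial_ser:
  fixes c :: "int^('d::finite) \<Rightarrow> complex"
  assumes c: "rapid {c}"
  shows "partial s (\<lambda>y. Re (ser c y)) x = Re (ser (\<lambda>k. \<i> * of_int (k $ s) * c k) x)"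
proof -
  have "((\<lambda>y. Re (ser c y)) has_derivative (\<lambda>h. Re (cvol TYPE('d) * (\<Sum>\<^sub>\<infinity>k. c k * (\<i> * complex_of_real (wavevec k \<bullet> h)) * tchar k x)))) (at x)"
    by (rule bounded_linear.has_derivative[OF bounded_linear_Re ser_has_derivative[OF c]])
  from frechet_derivative_at[OF this, symmetric]
  have "partial s (\<lambda>y. Re (ser c y)) x = Re (cvol TYPE('d) * (\<Sum>\<^sub>\<infinity>k. c k * (\<i> * complex_of_real (wavevec k \<bullet> axis s 1)) * tchar k x))"
    by (simp add: partial_def)
  thus ?thesis by (simp add: ser_def inner_axis mult_ac)
qed

section \<open>Fields and their coefficients\<close>

text \<open>Taking real parts makes the result a real field for every family; on Hermitian families
  with summable coefficients the series is already real and nothing is lost.\<close>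

definition synth :: "(int^'d \<Rightarrow> complex^('d::finite)) \<Rightarrow> 'd vfield" where
  "synth a x = (\<chi> r. Re (ser (\<lambda>k. a k $ r) x))"

lemma continuous_on_synth:
  assumes "rapid {a}" shows "continuous_on A (synth a)"
  unfolding synth_def
  by (intro continuous_intros continuous_on_ser rapid_abs_summable rapid_nth assms)

lemma torus_periodic_synth: "torus_periodic (synth a)"
  by (simp add: torus_periodic_def synth_def ser_periodic)

lemma fourier_coeff_synth:
  assumes "rapid {a}" "\<And>k. a (- k) = cnjv (a k)"
  shows "fourier_coeff (synth a) = a"
proof
  fix k
  have "fourier_coeff (synth a) k $ r = a k $ r" for r
  proof -
    have "complex_of_real (Re (ser (\<lambda>k. a k $ r) x)) = ser (\<lambda>k. a k $ r) x" for x
      by (rule ser_real) (simp add: assms(2))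
    thus ?thesis
      using fcoef_ser[OF rapid_abs_summable[OF rapid_nth[OF assms(1)]], of r k]
      by (simp add: fourier_coeff_eq_fcoef synth_def)
  qed
  thus "fourier_coeff (synth a) k = a k" by (simp add: vec_eq_iff)
qed

lemma fourier_coeff_inj:
  fixes v w :: "('d::finite) vfield"
  assumes "continuous_on UNIV v" "torus_periodic v" "continuous_on UNIV w" "torus_periodic w"
    and eq: "\<And>k. fourier_coeff v k = fourier_coeff w k"
  shows "v = w"
proof
  fix x
  have "v x $ r - w x $ r = 0" for r
  proof (rule fcoef_zero_imp_zero[where f = "\<lambda>x. v x $ r - w x $ r"])
    show "continuous_on UNIV (\<lambda>x. v x $ r - w x $ r)" by (intro continuous_intros assms)
    show "v (x + axis j (2 * pi)) $ r - w (x + axis j (2 * pi)) $ r = v x $ r - w x $ r" for x j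
      using assms(2,4) by (simp add: torus_periodic_def)
    fix k
    have i: "(\<lambda>x. tchar (- k) x * complex_of_real (u x $ r)) integrable_on tbox" if "continuous_on UNIV u" for u :: "'d vfield"
      by (intro integrable_continuous continuous_intros continuous_on_subset[OF that] subset_UNIV)
    have "fcoef (\<lambda>x. complex_of_real (v x $ r - w x $ r)) k = fourier_coeff v k $ r - fourier_coeff w k $ r"
      unfolding fourier_coeff_eq_fcoef fcoef_def
      by (simp add: right_diff_distrib integral_diff[OF i[OF assms(1)] i[OF assms(3)]])
    thus "fcoef (\<lambda>x. complex_of_real (v x $ r - w x $ r)) k = 0" by (simp add: eq)
  qed
  thus "v x = w x" by (simp add: vec_eq_iff)
qed

lemma fourier_coeff_minus_index: "fourier_coeff v (- k) = cnjv (fourier_coeff v k)"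
proof -
  have "fourier_coeff v (- k) $ r = cnj (fourier_coeff v k $ r)" for r
    unfolding fourier_coeff_eq_fcoef fcoef_def
    by (simp add: Henstock_Kurzweil_Integration.integral_cnj tchar_minus)
  thus ?thesis by (simp add: vec_eq_iff)
qed

lemma synth_in_Sob:
  fixes a :: "int^'d \<Rightarrow> complex^('d::finite)"
  assumes "a \<in> ns_coeffs" shows "synth a \<in> Sob_inf" "synth a \<in> Sob p"
proof -
  note a = ns_coeffsD[OF assms]
  have *: "synth a \<in> Sob p" for p
  proof -
    have "(\<lambda>k. norm (wavevec k) powr (2 * p) * (norm (a k))\<^sup>2) summable_on (UNIV - {0})"
      using summable_on_subset_banach[OF summable_inn[OF a(1) a(1), of p], of "UNIV - {0}"]
      by (simp add: power2_norm_eq_inner)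
    thus ?thesis using a
      by (simp add: Sob_def continuous_on_synth torus_periodic_synth fourier_coeff_synth)
  qed
  show "synth a \<in> Sob_inf" "synth a \<in> Sob p" using * by (auto simp: Sob_inf_def)
qed

text \<open>Finiteness of all Sobolev norms gives rapid decay, and then uniqueness of Fourier
  coefficients identifies the synthesised field with \<open>v\<close>.\<close>

lemma Sob_inf_coeffs:
  fixes v :: "('d::finite) vfield"
  assumes v: "v \<in> Sob_inf"
  shows "fourier_coeff v \<in> ns_coeffs" "synth (fourier_coeff v) = v"
proof -
  have S: "v \<in> Sob p" for p using v by (auto simp: Sob_inf_def)
  have 0: "fourier_coeff v 0 = 0" using S[of 0] by (simp add: Sob_def)
  have "rapid {fourier_coeff v}"
  proof (rule rapid_of_nrm)
    show "(\<lambda>k. norm (wavevec k) powr (2 * p) * (a k \<bullet> a k)) summable_on UNIV" if "a \<in> {fourier_coeff v}" for a p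
    proof -
      have "(\<lambda>k. norm (wavevec k) powr (2 * p) * (norm (fourier_coeff v k))\<^sup>2) summable_on (UNIV - {0})"
        using S[of p] by (simp add: Sob_def)
      also have "?this \<longleftrightarrow> (\<lambda>k. norm (wavevec k) powr (2 * p) * (a k \<bullet> a k)) summable_on UNIV"
        by (rule summable_on_cong_neutral) (use that in \<open>auto simp: power2_norm_eq_inner\<close>)
      finally show ?thesis .
    qed
  qed (use 0 in auto)
  thus n: "fourier_coeff v \<in> ns_coeffs"
    using 0 S[of 0] fourier_coeff_minus_index[of v] by (simp add: ns_coeffs_def Sob_def)
  show "synth (fourier_coeff v) = v"
    by (rule fourier_coeff_inj)
      (use S[of 0] in \<open>simp_all add: Sob_def continuous_on_synth torus_periodic_synth fourier_coeff_synth ns_coeffsD[OF n]\<close>)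
qed

lemma synth_add:
  assumes "rapid {a}" "rapid {b}" shows "synth (\<lambda>k. a k + b k) x = synth a x + synth b x"
  by (simp add: synth_def vec_eq_iff ser_add rapid_nth assms)

lemma synth_scaleR: "synth (\<lambda>k. t *\<^sub>R a k) x = t *\<^sub>R synth a x"
  by (simp add: synth_def vec_eq_iff scaleR_conv_of_real[where 'a = complex] ser_cmult)

lemma synth_diff:
  assumes "rapid {a}" "rapid {b}" shows "synth (\<lambda>k. a k - b k) x = synth a x - synth b x"
  using synth_add[OF assms(1) rapid_scaleR[OF assms(2), of "-1"], of x] synth_scaleR[of "-1" b x] by simp

lemma laplacian_synth:
  assumes "rapid {a}" shows "laplacian (synth a) = synth (lapl a)"
proof (rule ext, subst vec_eq_iff, rule allI)
  fix x r
  define c where "c = (\<lambda>k. a k $ r)"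
  have c: "rapid {c}" unfolding c_def by (rule rapid_nth[OF assms])
  note cs = rapid_mult_int[OF c]
  have "laplacian (synth a) x $ r = (\<Sum>s\<in>UNIV. partial s (partial s (\<lambda>y. Re (ser c y))) x)"
    by (simp add: laplacian_def synth_def c_def)
  also have "\<dots> = (\<Sum>s\<in>UNIV. Re (ser (\<lambda>k. \<i> * of_int (k $ s) * (\<i> * of_int (k $ s) * c k)) x))"
  proof -
    have "partial s (\<lambda>y. Re (ser c y)) = (\<lambda>x. Re (ser (\<lambda>k. \<i> * of_int (k $ s) * c k) x))" for s
      by (rule ext) (rule partial_ser[OF c])
    thus ?thesis by (simp only: partial_ser[OF cs])
  qed
  also have "\<dots> = Re (ser (\<lambda>k. \<Sum>s\<in>UNIV. \<i> * of_int (k $ s) * (\<i> * of_int (k $ s) * c k)) x)"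
    using ser_sum[of UNIV "\<lambda>s k. \<i> * of_int (k $ s) * (\<i> * of_int (k $ s) * c k)" x] rapid_mult_int[OF cs]
    by (simp add: Re_sum)
  also have "(\<lambda>k. \<Sum>s\<in>UNIV. \<i> * of_int (k $ s) * (\<i> * of_int (k $ s) * c k)) = (\<lambda>k. lapl a k $ r)"
  proof
    fix k
    have "(\<Sum>s\<in>UNIV. \<i> * of_int (k $ s) * (\<i> * of_int (k $ s) * c k)) = - (\<Sum>s\<in>UNIV. of_int (k $ s) * of_int (k $ s)) * c k"
      unfolding sum_negf[symmetric] sum_distrib_right by (rule sum.cong) (simp_all add: algebra_simps)
    also have "\<dots> = lapl a k $ r"
      unfolding norm_wavevec_sq[symmetric] by (simp add: lapl_def c_def scaleR_conv_of_real[where 'a = complex])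
    finally show "(\<Sum>s\<in>UNIV. \<i> * of_int (k $ s) * (\<i> * of_int (k $ s) * c k)) = lapl a k $ r" .
  qed
  finally show "laplacian (synth a) x $ r = synth (lapl a) x $ r" by (simp add: synth_def[of "lapl a"])
qed

lemma has_sum_finite_sum:
  fixes f :: "'s \<Rightarrow> 'i \<Rightarrow> 'b::topological_comm_monoid_add"
  assumes "finite A" "\<And>s. s \<in> A \<Longrightarrow> (f s has_sum l s) U"
  shows "((\<lambda>h. \<Sum>s\<in>A. f s h) has_sum (\<Sum>s\<in>A. l s)) U"
  using assms by (induction A) (simp_all add: has_sum_add)

text \<open>Termwise differentiation followed by the convolution formula for products; as
  \<open>a\<close> is divergence free, \<open>k - h\<close> becomes \<open>k\<close> in the scalar
  product, which is the form used in \<open>conv\<close>.\<close>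

lemma fourier_coeff_advect_synth:
  fixes a b :: "int^('d::finite) \<Rightarrow> complex^'d"
  assumes "a \<in> ns_coeffs" "b \<in> ns_coeffs"
  shows "fourier_coeff (advect (synth a) (synth b)) k = (\<i> * cvol TYPE('d)) *s conv a b k"
proof (subst vec_eq_iff, rule allI)
  fix r
  note a = ns_coeffsD[OF assms(1)] and b = ns_coeffsD[OF assms(2)]
  define A where "A = (\<lambda>s k. a k $ s)"
  define B where "B = (\<lambda>s k. \<i> * of_int (k $ s) * b k $ r)"
  have rA: "rapid {A s}" for s unfolding A_def by (rule rapid_nth[OF a(1)])
  have rB: "rapid {B s}" for s unfolding B_def by (rule rapid_mult_int[OF rapid_nth[OF b(1)]])
  have sA: "(\<lambda>k. norm (A s k)) summable_on UNIV" and sB: "(\<lambda>k. norm (B s k)) summable_on UNIV" for s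
    by (intro rapid_abs_summable rA rB)+
  have reA: "complex_of_real (Re (ser (A s) x)) = ser (A s) x" for s x
    by (rule ser_real) (simp add: A_def a(2))
  have reB: "complex_of_real (Re (ser (B s) x)) = ser (B s) x" for s x
    by (rule ser_real) (simp add: B_def b(2))
  have adv: "complex_of_real (advect (synth a) (synth b) x $ r) = (\<Sum>s\<in>UNIV. ser (A s) x * ser (B s) x)" for x
  proof -
    have "advect (synth a) (synth b) x $ r = (\<Sum>s\<in>UNIV. Re (ser (A s) x) * Re (ser (B s) x))"
      by (simp add: advect_def synth_def partial_ser[OF rapid_nth[OF b(1)]] A_def B_def)
    thus ?thesis by (simp add: reA reB)
  qed
  have int: "(\<lambda>x. tchar (- k) x * (ser (A s) x * ser (B s) x)) integrable_on tbox" for s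
    by (intro integrable_continuous continuous_intros continuous_on_ser sA sB)
  have prod: "cvol TYPE('d) * integral tbox (\<lambda>x. tchar (- k) x * (ser (A s) x * ser (B s) x)) = cvol TYPE('d) * (\<Sum>\<^sub>\<infinity>h. A s h * B s (k - h))" for s
    using fcoef_ser_mult[OF sA[of s] continuous_on_ser[OF sB[of s]], of k] unfolding fcoef_ser[OF sB[of s]] unfolding fcoef_def .
  have sAB: "(\<lambda>h. A s h * B s (k - h)) summable_on UNIV" for s
    by (rule abs_summable_summable) (simp add: norm_mult rapid_conv_summable[OF rA rB])
  have "fourier_coeff (advect (synth a) (synth b)) k $ r
      = cvol TYPE('d) * integral tbox (\<lambda>x. \<Sum>s\<in>UNIV. tchar (- k) x * (ser (A s) x * ser (B s) x))"
    unfolding fourier_coeff_eq_fcoef fcoef_def adv sum_distrib_left ..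
  also have "\<dots> = (\<Sum>s\<in>UNIV. cvol TYPE('d) * (\<Sum>\<^sub>\<infinity>h. A s h * B s (k - h)))"
    by (simp add: integral_sum int sum_distrib_left prod del: mult_cancel_left)
  also have "\<dots> = cvol TYPE('d) * (\<Sum>s\<in>UNIV. \<Sum>\<^sub>\<infinity>h. A s h * B s (k - h))" by (rule sum_distrib_left[symmetric])
  also have "(\<Sum>s\<in>UNIV. \<Sum>\<^sub>\<infinity>h. A s h * B s (k - h)) = (\<Sum>\<^sub>\<infinity>h. \<Sum>s\<in>UNIV. A s h * B s (k - h))"
    by (rule infsumI[symmetric]) (intro has_sum_finite_sum finite_class.finite_UNIV has_sum_infsum sAB)
  also have "(\<Sum>\<^sub>\<infinity>h. \<Sum>s\<in>UNIV. A s h * B s (k - h)) = (\<Sum>\<^sub>\<infinity>h. \<i> * (wave_dot k (a h) *s b (k - h)) $ r)"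
  proof (rule infsum_cong)
    fix h
    have "wave_dot k (a h) = wave_dot (k - h) (a h)" by (simp add: wave_dot_diff_left a(3))
    thus "(\<Sum>s\<in>UNIV. A s h * B s (k - h)) = \<i> * (wave_dot k (a h) *s b (k - h)) $ r"
      by (simp add: A_def B_def wave_dot_def sum_distrib_left sum_distrib_right mult_ac)
  qed
  also have "\<dots> = \<i> * conv a b k $ r"
    unfolding infsum_cmult_right' conv_def
    by (subst infsumI[OF has_sum_bounded_linear[OF bounded_linear_vec_nth has_sum_infsum[OF summable_conv[OF a(1) b(1)]]]]) simp
  finally show "fourier_coeff (advect (synth a) (synth b)) k $ r = ((\<i> * cvol TYPE('d)) *s conv a b k) $ r"
    by (simp add: mult_ac)
qed

text \<open>\<open>leray\<close> is a definite description; the field synthesised from the negative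
  of \<open>Bil a b\<close> is a witness, and uniqueness of Fourier coefficients makes it the only
  one.\<close>

lemma NS_bilin_synth:
  fixes a b :: "int^('d::finite) \<Rightarrow> complex^'d"
  assumes "a \<in> ns_coeffs" "b \<in> ns_coeffs"
  shows "NS_bilin (synth a) (synth b) = synth (Bil a b)"
proof -
  define g where "g = synth (\<lambda>k. (- 1) *\<^sub>R Bil a b k)"
  note B = ns_coeffsD[OF ns_coeffs_scaleR[OF ns_coeffs_Bil[OF assms], of "- 1"]]
  have fg: "fourier_coeff g k = proj_perp k (fourier_coeff (advect (synth a) (synth b)) k)" for k
    unfolding g_def fourier_coeff_synth[OF B(1,2)] fourier_coeff_advect_synth[OF assms] by (simp add: Bil_def)
  have cg: "continuous_on UNIV g" and pg: "torus_periodic g"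
    unfolding g_def by (rule continuous_on_synth[OF B(1)], rule torus_periodic_synth)
  have "leray (advect (synth a) (synth b)) = g"
    unfolding leray_def
  proof (rule the_equality)
    fix g' assume "continuous_on UNIV g' \<and> torus_periodic g' \<and> (\<forall>k. fourier_coeff g' k = proj_perp k (fourier_coeff (advect (synth a) (synth b)) k))"
    thus "g' = g" using fg cg pg by (intro fourier_coeff_inj) auto
  qed (use fg cg pg in blast)
  thus ?thesis unfolding NS_bilin_def g_def synth_scaleR by simp
qed

lemma sob_inner_Re:
  fixes v w :: "('d::finite) vfield"
  assumes "rapid {fourier_coeff v}" "rapid {fourier_coeff w}"
  shows "Re (sob_inner p v w) = inn p (fourier_coeff v) (fourier_coeff w)"
proof -
  define a where "a = fourier_coeff v"
  define b where "b = fourier_coeff w"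
  define f where "f = (\<lambda>k. complex_of_real (norm (wavevec k) powr (2 * p)) * (\<Sum>r\<in>UNIV. cnj (a k $ r) * b k $ r))"
  have ra: "rapid {\<lambda>k. norm (a k)}" and rb: "rapid {\<lambda>k. norm (b k)}"
    by (rule rapidI_mult[OF assms(1), where C = 1 and q = 0], simp_all add: a_def)
       (rule rapidI_mult[OF assms(2), where C = 1 and q = 0], simp_all add: b_def)
  have "norm (f k) \<le> norm (wavevec k) powr (2 * p) * (norm (a k) \<bullet> norm (b k))" for k
  proof -
    have "cmod (\<Sum>r\<in>UNIV. cnj (a k $ r) * b k $ r) \<le> (\<Sum>r\<in>UNIV. \<bar>cmod (a k $ r)\<bar> * \<bar>cmod (b k $ r)\<bar>)"
      by (rule order_trans[OF norm_sum]) (simp add: norm_mult)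
    also have "\<dots> \<le> L2_set (\<lambda>r. cmod (a k $ r)) UNIV * L2_set (\<lambda>r. cmod (b k $ r)) UNIV" by (rule L2_set_mult_ineq)
    finally have "cmod (\<Sum>r\<in>UNIV. cnj (a k $ r) * b k $ r) \<le> norm (a k) * norm (b k)" by (simp add: norm_vec_def)
    thus ?thesis by (simp add: f_def norm_mult mult_left_mono)
  qed
  hence sf: "f summable_on UNIV"
    by (rule abs_summable_summable[OF summable_on_comparison_test[OF summable_inn[OF ra rb, of p]]]) simp_all
  have "sob_inner p v w = (\<Sum>\<^sub>\<infinity>k\<in>UNIV - {0}. f k)"
    by (simp add: sob_inner_def f_def a_def b_def)
  also have "\<dots> = (\<Sum>\<^sub>\<infinity>k. f k)"
    by (rule infsum_cong_neutral) (auto simp: f_def)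
  finally have "Re (sob_inner p v w) = (\<Sum>\<^sub>\<infinity>k. Re (f k))"
    using infsum_Re[OF sf] by simp
  also have "\<dots> = inn p a b"
    unfolding inn_def f_def by (simp add: inner_vec_complex)
  finally show ?thesis by (simp add: a_def b_def)
qed

lemma sob_norm_eq_nrm:
  assumes "rapid {fourier_coeff v}" shows "sob_norm p v = nrm p (fourier_coeff v)"
  by (simp add: sob_norm_def nrm_def sob_inner_Re assms)

section \<open>Global existence for finite Lipschitz systems\<close>

lemma tendsto_sum_norm_diff:
  assumes "finite K" "\<And>i. i \<in> K \<Longrightarrow> ((\<lambda>s. x s i) \<longlongrightarrow> y i) F"
  shows "((\<lambda>s. C * (\<Sum>i\<in>K. norm (x s i - y i))) \<longlongrightarrow> 0) F"
proof -
  have "((\<lambda>s. \<Sum>i\<in>K. norm (x s i - y i)) \<longlongrightarrow> (\<Sum>i\<in>K. norm (y i - y i))) F"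
    by (intro tendsto_sum tendsto_norm tendsto_diff assms tendsto_const)
  from tendsto_mult_left[OF this, of C] show ?thesis by simp
qed

lemma continuous_on_lipschitz_rhs:
  fixes f :: "('i \<Rightarrow> 'b::real_normed_vector) \<Rightarrow> 'i \<Rightarrow> 'b"
  assumes "finite K" and i: "i \<in> K"
    and lip: "\<And>x y. (\<Sum>i\<in>K. norm (f x i - f y i)) \<le> L * (\<Sum>i\<in>K. norm (x i - y i))"
    and x: "\<And>j. j \<in> K \<Longrightarrow> continuous_on S (\<lambda>s. x s j)"
  shows "continuous_on S (\<lambda>s. f (x s) i)"
  unfolding continuous_on_def
proof
  fix t assume t: "t \<in> S"
  have "((\<lambda>s. L * (\<Sum>j\<in>K. norm (x s j - x t j))) \<longlongrightarrow> 0) (at t within S)"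
    by (rule tendsto_sum_norm_diff[OF assms(1)]) (use x t in \<open>auto simp: continuous_on_def\<close>)
  hence "((\<lambda>s. f (x s) i - f (x t) i) \<longlongrightarrow> 0) (at t within S)"
  proof (rule Lim_null_comparison[rotated], intro always_eventually allI)
    fix s
    have "norm (f (x s) i - f (x t) i) \<le> (\<Sum>j\<in>K. norm (f (x s) j - f (x t) j))"
      by (rule member_le_sum) (use i assms(1) in auto)
    thus "norm (f (x s) i - f (x t) i) \<le> L * (\<Sum>j\<in>K. norm (x s j - x t j))"
      using lip[of "x s" "x t"] by linarith
  qed
  thus "((\<lambda>s. f (x s) i) \<longlongrightarrow> f (x t) i) (at t within S)" by (rule LIM_zero_cancel)
qed

text \<open>By \<open>lip\<close> the components of \<open>f\<close> in \<open>K\<close> depend only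
  on the components of the argument in \<open>K\<close>. The iteration converges on all of
  \<open>{0..\<tau>}\<close> at once because the increments are measured with the growing weight
  \<open>exp (2 * L * t)\<close>: integrating this weight gains \<open>1 / (2 * L)\<close>, so each
  step halves them.\<close>

lemma picard_finite:
  fixes f :: "('i \<Rightarrow> 'b::banach) \<Rightarrow> 'i \<Rightarrow> 'b" and \<tau> :: real
  assumes K: "finite K" and L: "L > 0" and \<tau>: "\<tau> \<ge> 0"
    and lip: "\<And>x y. (\<Sum>i\<in>K. norm (f x i - f y i)) \<le> L * (\<Sum>i\<in>K. norm (x i - y i))"
  obtains x where "\<And>i. i \<in> K \<Longrightarrow> x 0 i = x0 i"
    "\<And>t i. t \<in> {0..\<tau>} \<Longrightarrow> i \<in> K \<Longrightarrow> ((\<lambda>s. x s i) has_vector_derivative f (x t) i) (at t within {0..\<tau>})"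
proof -
  define X where "X = rec_nat (\<lambda>t::real. x0) (\<lambda>n Xn t i. x0 i + integral {0..t} (\<lambda>s. f (Xn s) i))"
  have X0: "X 0 t = x0" and XS: "X (Suc n) t i = x0 i + integral {0..t} (\<lambda>s. f (X n s) i)" for n t i
    by (simp_all add: X_def)
  have cont: "\<forall>i\<in>K. continuous_on {0..\<tau>} (\<lambda>t. X n t i)" for n
  proof (induction n)
    case (Suc n)
    show ?case unfolding XS
      by (intro ballI continuous_intros indefinite_integral_continuous_1 integrable_continuous_real
          continuous_on_lipschitz_rhs[OF K _ lip]) (use Suc in auto)
  qed (simp add: X0)
  have cf: "continuous_on {0..\<tau>} (\<lambda>s. f (X n s) i)" if "i \<in> K" for n i
    by (rule continuous_on_lipschitz_rhs[OF K that lip]) (use cont in blast)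
  \<comment> \<open>Bounds the first increment, which is \<open>t * norm (f x0 i)\<close> summed
    over \<open>K\<close>.\<close>
  define M where "M = \<tau> * (\<Sum>i\<in>K. norm (f x0 i))"
  have M0: "M \<ge> 0" unfolding M_def by (intro mult_nonneg_nonneg \<tau> sum_nonneg) simp
  have sub: "{0..t} \<subseteq> {0..\<tau>}" if "t \<in> {0..\<tau>}" for t :: real using that by auto
  have D: "\<forall>t\<in>{0..\<tau>}. (\<Sum>i\<in>K. norm (X (Suc n) t i - X n t i)) \<le> M * exp (2 * L * t) / 2 ^ n" for n
  proof (induction n)
    case 0
    show ?case
    proof
      fix t assume t: "t \<in> {0..\<tau>}"
      have "(\<Sum>i\<in>K. norm (X (Suc 0) t i - X 0 t i)) = (\<Sum>i\<in>K. t * norm (f x0 i))"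
        using t by (simp add: XS X0)
      also have "\<dots> \<le> M" unfolding M_def sum_distrib_left
        using t by (intro sum_mono mult_right_mono) auto
      also have "\<dots> \<le> M * exp (2 * L * t)"
        using M0 t L by (intro mult_le_cancel_left1[THEN iffD2]) auto
      finally show "(\<Sum>i\<in>K. norm (X (Suc 0) t i - X 0 t i)) \<le> M * exp (2 * L * t) / 2 ^ 0" by simp
    qed
  next
    case (Suc n)
    show ?case
    proof
      fix t assume t: "t \<in> {0..\<tau>}"
      have int: "(\<lambda>s. f (X m s) i) integrable_on {0..t}" if "i \<in> K" for m i
        by (intro integrable_continuous_real continuous_on_subset[OF cf[OF that] sub[OF t]])
      have ci: "(\<lambda>s. norm (f (X (Suc n) s) i - f (X n s) i)) integrable_on {0..t}" if "i \<in> K" for i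
        by (intro integrable_continuous_real continuous_intros continuous_on_subset[OF cf[OF that] sub[OF t]])
      have "((\<lambda>s. exp (2 * L * s)) has_integral (exp (2 * L * t) / (2 * L) - exp (2 * L * 0) / (2 * L))) {0..t}"
        using t L by (intro fundamental_theorem_of_calculus)
          (auto intro!: derivative_eq_intros simp: has_real_derivative_iff_has_vector_derivative[symmetric])
      from has_integral_mult_right[OF this, of "L * (M / 2 ^ n)"]
      have ei: "((\<lambda>s. L * (M / 2 ^ n) * exp (2 * L * s)) has_integral (L * (M / 2 ^ n) * (exp (2 * L * t) / (2 * L) - exp (2 * L * 0) / (2 * L)))) {0..t}" .
      have "(\<Sum>i\<in>K. norm (X (Suc (Suc n)) t i - X (Suc n) t i))
          = (\<Sum>i\<in>K. norm (integral {0..t} (\<lambda>s. f (X (Suc n) s) i - f (X n s) i)))"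
        by (intro sum.cong refl arg_cong[of _ _ norm]) (simp add: XS[of "Suc n"] XS[of n] integral_diff int)
      also have "\<dots> \<le> (\<Sum>i\<in>K. integral {0..t} (\<lambda>s. norm (f (X (Suc n) s) i - f (X n s) i)))"
        by (intro sum_mono integral_norm_bound_integral integrable_diff int ci) auto
      also have "\<dots> = integral {0..t} (\<lambda>s. \<Sum>i\<in>K. norm (f (X (Suc n) s) i - f (X n s) i))"
        by (rule integral_sum[symmetric, OF K ci])
      also have "\<dots> \<le> integral {0..t} (\<lambda>s. L * (M / 2 ^ n) * exp (2 * L * s))"
      proof (rule integral_le)
        show "(\<lambda>s. \<Sum>i\<in>K. norm (f (X (Suc n) s) i - f (X n s) i)) integrable_on {0..t}"
          by (intro integrable_sum K ci)
        show "(\<lambda>s. L * (M / 2 ^ n) * exp (2 * L * s)) integrable_on {0..t}" using ei by (rule has_integral_integrable)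
        fix s assume s: "s \<in> {0..t}"
        have "(\<Sum>i\<in>K. norm (f (X (Suc n) s) i - f (X n s) i)) \<le> L * (\<Sum>i\<in>K. norm (X (Suc n) s i - X n s i))"
          by (rule lip)
        also have "\<dots> \<le> L * (M * exp (2 * L * s) / 2 ^ n)"
          using Suc s t L by (intro mult_left_mono) auto
        finally show "(\<Sum>i\<in>K. norm (f (X (Suc n) s) i - f (X n s) i)) \<le> L * (M / 2 ^ n) * exp (2 * L * s)" by simp
      qed
      also have "\<dots> = L * (M / 2 ^ n) * (exp (2 * L * t) / (2 * L) - exp (2 * L * 0) / (2 * L))"
        using ei by (rule integral_unique)
      also have "\<dots> = (M / 2 ^ n) * (exp (2 * L * t) - 1) / 2" using L by (simp add: field_simps)
      also have "\<dots> \<le> (M / 2 ^ n) * exp (2 * L * t) / 2"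
        using M0 by (intro divide_right_mono mult_left_mono) auto
      finally show "(\<Sum>i\<in>K. norm (X (Suc (Suc n)) t i - X (Suc n) t i)) \<le> M * exp (2 * L * t) / 2 ^ Suc n" by (simp add: mult_ac)
    qed
  qed
  define C where "C = M * exp (2 * L * \<tau>)"
  have D1: "norm (X (Suc n) t i - X n t i) \<le> C * (1 / 2) ^ n" if t: "t \<in> {0..\<tau>}" and i: "i \<in> K" for n t i
  proof -
    have "norm (X (Suc n) t i - X n t i) \<le> (\<Sum>i\<in>K. norm (X (Suc n) t i - X n t i))"
      by (rule member_le_sum) (use i K in auto)
    also have "\<dots> \<le> M * exp (2 * L * t) / 2 ^ n" using D t by blast
    also have "\<dots> \<le> C / 2 ^ n" unfolding C_def
      using M0 t L by (intro divide_right_mono mult_left_mono) auto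
    finally show ?thesis by (simp add: power_divide)
  qed
  define x where "x = (\<lambda>t i. lim (\<lambda>n. X n t i))"
  have ul: "uniform_limit {0..\<tau>} (\<lambda>n t. X n t i) (\<lambda>t. x t i) sequentially" if i: "i \<in> K" for i
  proof -
    have "uniformly_convergent_on {0..\<tau>} (\<lambda>n t. \<Sum>k<n. X (Suc k) t i - X k t i)"
      by (rule Weierstrass_m_test'[OF D1[OF _ i]]) (auto intro!: summable_mult summable_geometric)
    moreover have "(\<Sum>k<n. X (Suc k) t i - X k t i) = X n t i - x0 i" for n t
      using sum_lessThan_telescope[of "\<lambda>k. X k t i" n] by (simp add: X0)
    ultimately have "uniformly_convergent_on {0..\<tau>} (\<lambda>n t. X n t i - x0 i)" by (simp only:)
    then obtain l where l: "uniform_limit {0..\<tau>} (\<lambda>n t. X n t i - x0 i) l sequentially"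
      unfolding uniformly_convergent_on_def by blast
    have "uniform_limit {0..\<tau>} (\<lambda>n t. (X n t i - x0 i) + x0 i) (\<lambda>t. l t + x0 i) sequentially"
      by (intro uniform_limit_add l uniform_limit_const)
    hence u: "uniform_limit {0..\<tau>} (\<lambda>n t. X n t i) (\<lambda>t. l t + x0 i) sequentially" by simp
    have "x t i = l t + x0 i" if "t \<in> {0..\<tau>}" for t
      unfolding x_def by (rule limI) (rule tendsto_uniform_limitI[OF u that])
    note xl = this
    show ?thesis
    proof (rule uniform_limitI)
      fix e :: real assume "e > 0"
      from uniform_limitD[OF u this] show "\<forall>\<^sub>F n in sequentially. \<forall>t\<in>{0..\<tau>}. dist (X n t i) (x t i) < e"
        by eventually_elim (simp add: xl)
    qed
  qed
  have cx: "continuous_on {0..\<tau>} (\<lambda>t. x t i)" if "i \<in> K" for i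
    by (rule uniform_limit_theorem[OF _ ul[OF that]]) (use cont that in \<open>auto intro!: always_eventually\<close>)
  have cfx: "continuous_on {0..\<tau>} (\<lambda>s. f (x s) i)" if "i \<in> K" for i
    by (rule continuous_on_lipschitz_rhs[OF K that lip cx])
  have ulf: "uniform_limit {0..\<tau>} (\<lambda>n s. f (X n s) i) (\<lambda>s. f (x s) i) sequentially" if i: "i \<in> K" for i
  proof (rule uniform_limitI)
    fix e :: real assume e: "e > 0"
    \<comment> \<open>The summand 1 makes the final inequality strict.\<close>
    define e' where "e' = e / (L * (real (card K) + 1))"
    have e': "e' > 0" using e L by (simp add: e'_def)
    have "eventually (\<lambda>n. \<forall>j\<in>K. \<forall>s\<in>{0..\<tau>}. dist (X n s j) (x s j) < e') sequentially"
      using uniform_limitD[OF ul e'] K by (intro eventually_ball_finite) auto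
    thus "eventually (\<lambda>n. \<forall>s\<in>{0..\<tau>}. dist (f (X n s) i) (f (x s) i) < e) sequentially"
    proof eventually_elim
      case (elim n)
      show ?case
      proof
        fix s assume s: "s \<in> {0..\<tau>}"
        have "dist (f (X n s) i) (f (x s) i) \<le> (\<Sum>j\<in>K. norm (f (X n s) j - f (x s) j))"
          unfolding dist_norm by (rule member_le_sum) (use i K in auto)
        also have "\<dots> \<le> L * (\<Sum>j\<in>K. norm (X n s j - x s j))" by (rule lip)
        also have "\<dots> \<le> L * (\<Sum>j\<in>K. e')"
          using elim s L by (intro mult_left_mono sum_mono) (auto simp: dist_norm less_imp_le)
        also have "\<dots> = L * (real (card K) * e')" by simp
        also have "\<dots> < L * ((real (card K) + 1) * e')" using e' L by simp
        also have "\<dots> = e" using L by (simp add: e'_def add_pos_pos less_imp_neq)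
        finally show "dist (f (X n s) i) (f (x s) i) < e" .
      qed
    qed
  qed
  \<comment> \<open>Passing to the limit in the recursion gives the integral equation, from which
    the derivative is read off.\<close>
  have ie: "x t i = x0 i + integral {0..t} (\<lambda>s. f (x s) i)" if t: "t \<in> {0..\<tau>}" and i: "i \<in> K" for t i
  proof -
    have u: "uniform_limit {0..t} (\<lambda>n s. f (X n s) i) (\<lambda>s. f (x s) i) sequentially"
      by (rule uniform_limit_on_subset[OF ulf[OF i] sub[OF t]])
    have "(\<lambda>n. integral {0..t} (\<lambda>s. f (X n s) i)) \<longlonglongrightarrow> integral {0..t} (\<lambda>s. f (x s) i)"
    proof (rule uniform_limit_integral[OF u])
      show "continuous_on {0..t} (\<lambda>s. f (X n s) i)" for n by (rule continuous_on_subset[OF cf[OF i] sub[OF t]])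
      fix I J assume IJ: "\<And>n. ((\<lambda>s. f (X n s) i) has_integral I n) {0..t}" "((\<lambda>s. f (x s) i) has_integral J) {0..t}" "I \<longlonglongrightarrow> J"
      show ?thesis unfolding integral_unique[OF IJ(1)] integral_unique[OF IJ(2)] by (rule IJ(3))
    qed simp
    hence "(\<lambda>n. X (Suc n) t i) \<longlonglongrightarrow> x0 i + integral {0..t} (\<lambda>s. f (x s) i)"
      unfolding XS by (intro tendsto_intros)
    moreover have "(\<lambda>n. X (Suc n) t i) \<longlonglongrightarrow> x t i"
      using tendsto_uniform_limitI[OF ul[OF i] t] by (rule LIMSEQ_Suc)
    ultimately show ?thesis by (rule LIMSEQ_unique[symmetric])
  qed
  show ?thesis
  proof (rule that)
    show "x 0 i = x0 i" if "i \<in> K" for i using ie[of 0 i] that \<tau> by simp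
    fix t i assume t: "t \<in> {0..\<tau>}" and i: "i \<in> K"
    have "((\<lambda>t. x0 i + integral {0..t} (\<lambda>s. f (x s) i)) has_vector_derivative 0 + f (x t) i) (at t within {0..\<tau>})"
      by (intro has_vector_derivative_add has_vector_derivative_const integral_has_vector_derivative cfx i t)
    thus "((\<lambda>s. x s i) has_vector_derivative f (x t) i) (at t within {0..\<tau>})"
      using ie[OF _ i] t by (auto intro: has_vector_derivative_transform)
  qed
qed

section \<open>Differential inequalities\<close>

lemma nonpos_derivative_imp_le:
  fixes f :: "real \<Rightarrow> real"
  assumes "0 \<le> t" and "\<And>s. s \<in> {0..t} \<Longrightarrow> (f has_real_derivative f' s) (at s within {0..t})"
    and "\<And>s. s \<in> {0..t} \<Longrightarrow> f' s \<le> 0"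
  shows "f t \<le> f 0"
proof (cases "t = 0")
  case False
  with assms(1) have "0 < t" by simp
  then obtain s where s: "s \<in> {0..t}" "f t - f 0 = f' s * (t - 0)"
    using mvt_very_simple[of 0 t f "\<lambda>s. (*) (f' s)"] assms(2) by (auto simp: has_field_derivative_def)
  have "f' s * t \<le> 0" using assms(1) assms(3)[OF s(1)] by (simp add: mult_nonpos_nonneg)
  thus ?thesis using s(2) by simp
qed simp

text \<open>The factor \<open>exp (- L * s)\<close> removes the linear term; it is at most 1, so the
  inhomogeneity contributes at most \<open>\<epsilon> * t\<close>.\<close>

lemma gronwall_le:
  fixes W :: "real \<Rightarrow> real"
  assumes t: "0 \<le> t" and d: "\<And>s. s \<in> {0..t} \<Longrightarrow> (W has_real_derivative W' s) (at s within {0..t})"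
    and le: "\<And>s. s \<in> {0..t} \<Longrightarrow> W' s \<le> L * W s + \<epsilon>" and L: "0 \<le> L" and e: "0 \<le> \<epsilon>"
  shows "W t \<le> (W 0 + \<epsilon> * t) * exp (L * t)"
proof -
  have "exp (- L * t) * W t - \<epsilon> * t \<le> exp (- L * 0) * W 0 - \<epsilon> * 0"
  proof (rule nonpos_derivative_imp_le[OF t])
    fix s assume s: "s \<in> {0..t}"
    show "((\<lambda>s. exp (- L * s) * W s - \<epsilon> * s) has_real_derivative (exp (- L * s) * (W' s - L * W s) - \<epsilon>)) (at s within {0..t})"
      by (auto intro!: derivative_eq_intros d[OF s] simp: algebra_simps)
    have "exp (- L * s) * (W' s - L * W s) \<le> exp (- L * s) * \<epsilon>"
      using le[OF s] by (intro mult_left_mono) auto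
    also have "\<dots> \<le> 1 * \<epsilon>" using s L e by (intro mult_right_mono) auto
    finally show "exp (- L * s) * (W' s - L * W s) - \<epsilon> \<le> 0" by simp
  qed
  hence "exp (- L * t) * W t \<le> W 0 + \<epsilon> * t" by simp
  hence "exp (L * t) * (exp (- L * t) * W t) \<le> exp (L * t) * (W 0 + \<epsilon> * t)" by (intro mult_left_mono) auto
  moreover have "exp (L * t) * (exp (- L * t) * W t) = W t"
    by (simp add: mult.assoc[symmetric] exp_add[symmetric])
  ultimately have "W t \<le> exp (L * t) * (W 0 + \<epsilon> * t)" by (simp only:)
  thus ?thesis by (simp only: mult.commute)
qed

lemma e_visc_has_derivative:
  assumes "0 \<le> \<nu>"
  shows "(e_visc \<nu> has_real_derivative exp (- \<nu> * s)) (at s within S)"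
proof (cases "\<nu> > 0")
  case True
  have "((\<lambda>t. (1 - exp (- \<nu> * t)) / \<nu>) has_real_derivative exp (- \<nu> * s)) (at s within S)"
    using True by (auto intro!: derivative_eq_intros)
  moreover have "e_visc \<nu> = (\<lambda>t. (1 - exp (- \<nu> * t)) / \<nu>)" using True by (auto simp: e_visc_def)
  ultimately show ?thesis by simp
next
  case False
  hence "\<nu> = 0" "e_visc \<nu> = (\<lambda>t. t)" using assms by (auto simp: e_visc_def)
  thus ?thesis by simp
qed

lemma e_visc_0 [simp]: "e_visc \<nu> 0 = 0"
  by (simp add: e_visc_def)

lemma e_visc_mono:
  assumes "0 \<le> \<nu>" "s \<le> t" shows "e_visc \<nu> s \<le> e_visc \<nu> t"
  using assms by (auto simp: e_visc_def intro!: divide_right_mono)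

lemma e_visc_nonneg: "0 \<le> \<nu> \<Longrightarrow> 0 \<le> t \<Longrightarrow> 0 \<le> e_visc \<nu> t"
  using e_visc_mono[of \<nu> 0 t] by simp

text \<open>With \<open>W = e\<^sup>2\<^sup>\<nu>\<^sup>s X + \<epsilon>\<close>, the differential inequality makes \<open>1 / sqrt W + G e\<^sub>\<nu>\<close> nondecreasing; the shift by
  \<open>\<epsilon>\<close> avoids dividing by zeros of \<open>X\<close>.\<close>

lemma riccati_le:
  fixes X :: "real \<Rightarrow> real"
  assumes t: "0 \<le> t" and d: "\<And>s. s \<in> {0..t} \<Longrightarrow> (X has_real_derivative X' s) (at s within {0..t})"
    and X0: "\<And>s. s \<in> {0..t} \<Longrightarrow> 0 \<le> X s"
    and le: "\<And>s. s \<in> {0..t} \<Longrightarrow> X' s \<le> - 2 * \<nu> * X s + 2 * G * sqrt (X s) * X s"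
    and init: "X 0 \<le> x0\<^sup>2" "0 \<le> x0" and nu: "0 \<le> \<nu>" and G: "0 < G" and small: "G * x0 * e_visc \<nu> t < 1"
  shows "sqrt (X t) \<le> x0 * exp (- \<nu> * t) / (1 - G * x0 * e_visc \<nu> t)"
proof -
  define z where "z = exp (\<nu> * t) * sqrt (X t)"
  define c where "c = G * e_visc \<nu> t * z"
  have z0: "0 \<le> z" using X0[of t] t by (simp add: z_def)
  have c0: "0 \<le> c" unfolding c_def by (intro mult_nonneg_nonneg e_visc_nonneg nu t z0) (use G in auto)
  \<comment> \<open>For \<open>\<epsilon>\<close> equal to \<open>x1^2 - x0^2\<close> the initial
    value of \<open>W\<close> is at most \<open>x1^2\<close>. The bound is stated as
    \<open>z \<le> x1 * (1 + c)\<close>, free of the reciprocals of \<open>x0\<close> and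
    \<open>z\<close>, both of which may vanish.\<close>
  have key: "z \<le> x1 * (1 + c)" if x1: "x1 > x0" for x1
  proof (cases "z = 0")
    case False
    hence zp: "0 < z" using z0 by simp
    define \<epsilon> where "\<epsilon> = x1\<^sup>2 - x0\<^sup>2"
    have x1p: "0 < x1" using x1 init by simp
    have e: "\<epsilon> > 0" using x1 init by (simp add: \<epsilon>_def power_strict_mono)
    define W where "W = (\<lambda>s. exp (2 * \<nu> * s) * X s + \<epsilon>)"
    have Wp: "0 < W s" if "s \<in> {0..t}" for s
      unfolding W_def using X0[OF that] e by (intro add_nonneg_pos mult_nonneg_nonneg) auto
    have "- (inverse (sqrt (W t)) + G * e_visc \<nu> t) \<le> - (inverse (sqrt (W 0)) + G * e_visc \<nu> 0)"
    proof (rule nonpos_derivative_imp_le[OF t])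
      fix s assume s: "s \<in> {0..t}"
      let ?w' = "exp (2 * \<nu> * s) * (2 * \<nu> * X s + X' s)"
      have dW: "(W has_real_derivative ?w') (at s within {0..t})"
        unfolding W_def by (auto intro!: derivative_eq_intros d[OF s] simp: algebra_simps)
      show "((\<lambda>s. - (inverse (sqrt (W s)) + G * e_visc \<nu> s)) has_real_derivative
          ?w' / (2 * (W s * sqrt (W s))) - G * exp (- \<nu> * s)) (at s within {0..t})"
        using Wp[OF s]
        by (auto intro!: derivative_eq_intros dW e_visc_has_derivative[OF nu] simp: field_simps power2_eq_square)
      define y where "y = exp (2 * \<nu> * s) * X s"
      have y0: "0 \<le> y" using X0[OF s] by (simp add: y_def)
      have sy: "sqrt y = exp (\<nu> * s) * sqrt (X s)"
      proof -
        have "exp (2 * \<nu> * s) = (exp (\<nu> * s))\<^sup>2" by (simp add: power2_eq_square exp_add[symmetric])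
        thus ?thesis by (simp add: y_def real_sqrt_mult)
      qed
      have "?w' \<le> exp (2 * \<nu> * s) * (2 * G * sqrt (X s) * X s)"
        using le[OF s] by (intro mult_left_mono) auto
      also have "\<dots> = 2 * G * exp (- \<nu> * s) * (y * sqrt y)"
      proof -
        have e: "exp (- \<nu> * s) * (exp (\<nu> * s) * sqrt (X s)) = sqrt (X s)"
          by (simp add: mult.assoc[symmetric] exp_add[symmetric])
        have "2 * G * exp (- \<nu> * s) * (y * sqrt y) = 2 * G * y * (exp (- \<nu> * s) * (exp (\<nu> * s) * sqrt (X s)))"
          by (simp only: sy mult_ac)
        also have "\<dots> = 2 * G * y * sqrt (X s)" by (simp only: e)
        also have "\<dots> = exp (2 * \<nu> * s) * (2 * G * sqrt (X s) * X s)" by (simp add: y_def)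
        finally show ?thesis by (rule sym)
      qed
      also have "\<dots> \<le> 2 * G * exp (- \<nu> * s) * (W s * sqrt (W s))"
        using y0 e G unfolding W_def y_def[symmetric] by (intro mult_left_mono mult_mono) auto
      finally show "?w' / (2 * (W s * sqrt (W s))) - G * exp (- \<nu> * s) \<le> 0"
        using Wp[OF s] by (simp add: divide_le_eq mult_ac)
    qed
    hence 1: "inverse (sqrt (W 0)) \<le> inverse (sqrt (W t)) + G * e_visc \<nu> t" by simp
    have "W 0 \<le> x1\<^sup>2" using init by (simp add: W_def \<epsilon>_def)
    hence "sqrt (W 0) \<le> x1" using x1p by (intro real_le_lsqrt) auto
    hence 2: "inverse x1 \<le> inverse (sqrt (W 0))" using Wp[of 0] t by (intro le_imp_inverse_le) auto
    have "z\<^sup>2 = exp (2 * \<nu> * t) * X t"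
    proof -
      have "(exp (\<nu> * t))\<^sup>2 = exp (2 * \<nu> * t)" by (simp add: power2_eq_square exp_add[symmetric])
      thus ?thesis using X0[of t] t by (simp add: z_def power_mult_distrib)
    qed
    hence "z\<^sup>2 \<le> W t" using e by (simp add: W_def)
    hence "z \<le> sqrt (W t)" by (rule real_le_rsqrt)
    hence "inverse (sqrt (W t)) \<le> inverse z" using zp by (rule le_imp_inverse_le)
    with 1 2 have "inverse x1 \<le> inverse z + G * e_visc \<nu> t" by linarith
    hence "(x1 * z) * inverse x1 \<le> (x1 * z) * (inverse z + G * e_visc \<nu> t)"
      using x1p zp by (intro mult_left_mono) auto
    moreover have "(x1 * z) * inverse x1 = z" using x1p by simp
    moreover have "(x1 * z) * (inverse z + G * e_visc \<nu> t) = x1 * (1 + c)"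
      using zp by (simp add: c_def algebra_simps)
    ultimately show ?thesis by (simp only:)
  qed (use x1 init c0 in auto)
  \<comment> \<open>Let \<open>x1\<close> decrease to \<open>x0\<close>.\<close>
  have "z \<le> x0 * (1 + c)"
  proof (rule ccontr)
    assume "\<not> ?thesis"
    hence "x0 < z / (1 + c)" using c0 by (simp add: pos_less_divide_eq)
    then obtain x1 where x1: "x0 < x1" "x1 < z / (1 + c)" using dense by blast
    hence "x1 * (1 + c) < z" using c0 by (simp add: pos_less_divide_eq)
    thus False using key[OF x1(1)] by simp
  qed
  hence "z * (1 - G * x0 * e_visc \<nu> t) \<le> x0" by (simp add: c_def algebra_simps)
  hence "z \<le> x0 / (1 - G * x0 * e_visc \<nu> t)" using small by (simp add: pos_le_divide_eq)
  hence "exp (- \<nu> * t) * z \<le> exp (- \<nu> * t) * (x0 / (1 - G * x0 * e_visc \<nu> t))" by (intro mult_left_mono) auto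
  moreover have "exp (- \<nu> * t) * z = sqrt (X t)"
    by (simp add: z_def mult.assoc[symmetric] exp_add[symmetric])
  ultimately show ?thesis by (simp add: mult_ac)
qed

text \<open>The derivative of the denominator \<open>q\<close> is
  \<open>- (G * x0 * exp (- \<nu> * s))\<close>, so the majorant of \<open>x\<close> is the negative
  logarithmic derivative of \<open>q\<close> divided by \<open>G\<close>. Hence
  \<open>exp (2 * \<nu> * s) * q s powr (2 * (H / G))\<close> is an integrating factor; this is the
  origin of the exponent \<open>H / G\<close>.\<close>

lemma linear_riccati_le:
  fixes Y :: "real \<Rightarrow> real"
  assumes t: "0 \<le> t" and d: "\<And>s. s \<in> {0..t} \<Longrightarrow> (Y has_real_derivative Y' s) (at s within {0..t})"
    and Y0: "\<And>s. s \<in> {0..t} \<Longrightarrow> 0 \<le> Y s"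
    and le: "\<And>s. s \<in> {0..t} \<Longrightarrow> Y' s \<le> - 2 * \<nu> * Y s + 2 * H * x s * Y s"
    and x: "\<And>s. s \<in> {0..t} \<Longrightarrow> x s \<le> x0 * exp (- \<nu> * s) / (1 - G * x0 * e_visc \<nu> s)"
    and init: "Y 0 \<le> y0\<^sup>2" "0 \<le> y0" "0 \<le> x0" and nu: "0 \<le> \<nu>" and G: "0 < G" "0 < H" and small: "G * x0 * e_visc \<nu> t < 1"
  shows "sqrt (Y t) \<le> y0 * exp (- \<nu> * t) / (1 - G * x0 * e_visc \<nu> t) powr (H / G)"
proof -
  define q where "q = (\<lambda>s. 1 - G * x0 * e_visc \<nu> s)"
  have q: "0 < q s" if "s \<in> {0..t}" for s
  proof -
    have "G * x0 * e_visc \<nu> s \<le> G * x0 * e_visc \<nu> t"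
      using that G init by (intro mult_left_mono e_visc_mono nu) auto
    thus ?thesis using small by (simp add: q_def)
  qed
  have dq: "(q has_real_derivative (- (G * x0 * exp (- \<nu> * s)))) (at s within S)" for s S
    unfolding q_def by (auto intro!: derivative_eq_intros e_visc_has_derivative[OF nu])
  have "exp (2 * \<nu> * t) * Y t * q t powr (2 * (H / G)) \<le> exp (2 * \<nu> * 0) * Y 0 * q 0 powr (2 * (H / G))"
  proof (rule nonpos_derivative_imp_le[OF t])
    fix s assume s: "s \<in> {0..t}"
    let ?E = "exp (2 * \<nu> * s) * q s powr (2 * (H / G))"
    have dp: "((\<lambda>s. q s powr (2 * (H / G))) has_real_derivative
        (q s powr (2 * (H / G)) * (2 * (H / G)) * (- (G * x0 * exp (- \<nu> * s))) / q s)) (at s within {0..t})"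
    proof -
      define r where "r = 2 * (H / G)"
      have "((\<lambda>s. q s powr r) has_real_derivative (r * q s powr (r - 1) * (- (G * x0 * exp (- \<nu> * s))))) (at s within {0..t})"
        by (rule DERIV_chain2[OF has_real_derivative_powr[OF q[OF s]] dq])
      moreover have "r * q s powr (r - 1) * (- (G * x0 * exp (- \<nu> * s))) = q s powr r * r * (- (G * x0 * exp (- \<nu> * s))) / q s"
        using q[OF s] by (simp add: powr_diff)
      ultimately show ?thesis unfolding r_def by simp
    qed
    show "((\<lambda>s. exp (2 * \<nu> * s) * Y s * q s powr (2 * (H / G))) has_real_derivative
        ?E * (2 * \<nu> * Y s + Y' s - 2 * H * (x0 * exp (- \<nu> * s) / q s) * Y s)) (at s within {0..t})"
    proof -
      have "((\<lambda>s. exp (2 * \<nu> * s) * Y s) has_real_derivative exp (2 * \<nu> * s) * (2 * \<nu> * Y s + Y' s)) (at s within {0..t})"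
        by (auto intro!: derivative_eq_intros d[OF s] simp: algebra_simps)
      from DERIV_mult[OF this dp] show ?thesis
        by (rule back_subst[of "\<lambda>D. (_ has_real_derivative D) _"]) (use G q[OF s] in \<open>simp add: field_simps\<close>)
    qed
    have "2 * H * x s * Y s \<le> 2 * H * (x0 * exp (- \<nu> * s) / q s) * Y s"
      using x[OF s] G Y0[OF s] unfolding q_def by (intro mult_right_mono mult_left_mono) auto
    hence "2 * \<nu> * Y s + Y' s - 2 * H * (x0 * exp (- \<nu> * s) / q s) * Y s \<le> 0" using le[OF s] by simp
    thus "?E * (2 * \<nu> * Y s + Y' s - 2 * H * (x0 * exp (- \<nu> * s) / q s) * Y s) \<le> 0"
      by (intro mult_nonneg_nonpos) auto
  qed
  also have "\<dots> \<le> y0\<^sup>2" using init by (simp add: q_def)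
  finally have "sqrt (exp (2 * \<nu> * t) * Y t * q t powr (2 * (H / G))) \<le> y0"
    using init by (intro real_le_lsqrt) auto
  moreover have "sqrt (exp (2 * \<nu> * t) * Y t * q t powr (2 * (H / G))) = exp (\<nu> * t) * sqrt (Y t) * q t powr (H / G)"
  proof -
    have "exp (2 * \<nu> * t) = (exp (\<nu> * t))\<^sup>2" by (simp add: power2_eq_square exp_add[symmetric])
    moreover have "q t powr (2 * (H / G)) = (q t powr (H / G))\<^sup>2" by (simp add: power2_eq_square powr_add[symmetric])
    ultimately show ?thesis by (simp add: real_sqrt_mult)
  qed
  ultimately have "exp (\<nu> * t) * sqrt (Y t) * q t powr (H / G) \<le> y0" by simp
  hence "exp (- \<nu> * t) * (exp (\<nu> * t) * sqrt (Y t) * q t powr (H / G)) \<le> exp (- \<nu> * t) * y0" by (intro mult_left_mono) auto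
  moreover have "exp (- \<nu> * t) * (exp (\<nu> * t) * sqrt (Y t) * q t powr (H / G)) = sqrt (Y t) * q t powr (H / G)"
    by (simp add: mult.assoc[symmetric] exp_add[symmetric])
  ultimately have "sqrt (Y t) * q t powr (H / G) \<le> exp (- \<nu> * t) * y0" by (simp only:)
  moreover have "0 < q t powr (H / G)" using q[of t] t by simp
  moreover have "1 - G * x0 * e_visc \<nu> t = q t" by (simp add: q_def)
  ultimately show ?thesis by (simp add: pos_le_divide_eq mult.commute)
qed

text \<open>The a priori bound is required for all nonnegative time-dependent multiples of \<open>f\<close> because it is applied
  to a cut-off of the equation.\<close>

lemma picard_cutoff:
  fixes f :: "('i \<Rightarrow> 'b::banach) \<Rightarrow> 'i \<Rightarrow> 'b" and \<tau> :: real
  assumes K: "finite K" and \<tau>: "\<tau> \<ge> 0" and C: "C \<ge> 0" and R: "R > 0"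
    and lip: "\<And>x y. (\<Sum>i\<in>K. norm (f x i - f y i))
        \<le> C * (1 + (\<Sum>i\<in>K. norm (x i)) + (\<Sum>i\<in>K. norm (y i))) * (\<Sum>i\<in>K. norm (x i - y i))"
    and apriori: "\<And>x \<theta> t. (\<And>i. i \<in> K \<Longrightarrow> x 0 i = x0 i) \<Longrightarrow>
        (\<And>t. t \<in> {0..\<tau>} \<Longrightarrow> 0 \<le> \<theta> t) \<Longrightarrow>
        (\<And>t i. t \<in> {0..\<tau>} \<Longrightarrow> i \<in> K \<Longrightarrow> ((\<lambda>s. x s i) has_vector_derivative \<theta> t *\<^sub>R f (x t) i) (at t within {0..\<tau>})) \<Longrightarrow>
        t \<in> {0..\<tau>} \<Longrightarrow> (\<Sum>i\<in>K. norm (x t i)) \<le> R"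
  obtains x where "\<And>i. i \<in> K \<Longrightarrow> x 0 i = x0 i"
    "\<And>t i. t \<in> {0..\<tau>} \<Longrightarrow> i \<in> K \<Longrightarrow> ((\<lambda>s. x s i) has_vector_derivative f (x t) i) (at t within {0..\<tau>})"
proof -
  define N where "N = (\<lambda>x :: 'i \<Rightarrow> 'b. \<Sum>i\<in>K. norm (x i))"
  \<comment> \<open>Cut-off equal to 1 up to \<open>R\<close> and to 0 beyond \<open>2 * R\<close>,
    with Lipschitz constant \<open>1 / R\<close>.\<close>
  define \<theta> where "\<theta> = (\<lambda>r :: real. max 0 (min 1 (2 - r / R)))"
  have \<theta>01: "0 \<le> \<theta> r" "\<theta> r \<le> 1" for r by (auto simp: \<theta>_def)
  have \<theta>lip: "\<bar>\<theta> r - \<theta> s\<bar> \<le> \<bar>r - s\<bar> / R" for r s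
  proof -
    have "\<bar>\<theta> r - \<theta> s\<bar> \<le> \<bar>r / R - s / R\<bar>" by (auto simp: \<theta>_def max_def min_def)
    thus ?thesis using R by (simp add: diff_divide_distrib[symmetric])
  qed
  have \<theta>0: "\<theta> r = 0" if "r > 2 * R" for r
  proof -
    have "2 < r / R" using that R by (simp add: pos_less_divide_eq)
    thus ?thesis by (simp add: \<theta>_def)
  qed
  have \<theta>1: "\<theta> r = 1" if "r \<le> R" for r
  proof -
    have "r / R \<le> 1" using that R by simp
    thus ?thesis by (simp add: \<theta>_def)
  qed
  \<comment> \<open>Bound for \<open>f\<close> on the ball of radius \<open>2 * R\<close>, by
    comparison with its value at the zero family.\<close>
  define F0 where "F0 = N (f (\<lambda>_. 0)) + C * (1 + 2 * R) * (2 * R)"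
  have F00: "F0 \<ge> 0" unfolding F0_def N_def using C R by (intro add_nonneg_nonneg mult_nonneg_nonneg sum_nonneg) auto
  have Nd: "N (\<lambda>i. x i - y i) \<ge> 0" for x y unfolding N_def by (intro sum_nonneg) simp
  have N0: "N x \<ge> 0" for x unfolding N_def by (intro sum_nonneg) simp
  have tri: "N (\<lambda>i. x i + y i) \<le> N x + N y" for x y
    unfolding N_def sum.distrib[symmetric] by (intro sum_mono norm_triangle_ineq)
  have Nsub: "\<bar>N x - N y\<bar> \<le> N (\<lambda>i. x i - y i)" for x y
  proof -
    have "N x \<le> N (\<lambda>i. x i - y i) + N y" using tri[of "\<lambda>i. x i - y i" y] by simp
    moreover have "N y \<le> N (\<lambda>i. y i - x i) + N x" using tri[of "\<lambda>i. y i - x i" x] by simp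
    moreover have "N (\<lambda>i. y i - x i) = N (\<lambda>i. x i - y i)" by (simp add: N_def norm_minus_commute)
    ultimately show ?thesis by linarith
  qed
  have FB: "N (f x) \<le> F0" if x: "N x \<le> 2 * R" for x
  proof -
    have "N (f x) \<le> N (\<lambda>i. f x i - f (\<lambda>_. 0) i) + N (f (\<lambda>_. 0))"
      using tri[of "\<lambda>i. f x i - f (\<lambda>_. 0) i" "f (\<lambda>_. 0)"] by simp
    also have "N (\<lambda>i. f x i - f (\<lambda>_. 0) i) \<le> C * (1 + N x) * N x"
      using lip[of x "\<lambda>_. 0"] by (simp add: N_def)
    also have "\<dots> \<le> C * (1 + 2 * R) * (2 * R)"
      using x N0[of x] C R by (intro mult_mono mult_nonneg_nonneg) auto
    finally show ?thesis by (simp add: F0_def)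
  qed
  define g where "g = (\<lambda>x i. \<theta> (N x) *\<^sub>R f x i)"
  define L where "L = F0 / R + C * (1 + 4 * R) + 1"
  have L: "L > 0" unfolding L_def using F00 R C by (intro add_nonneg_pos add_nonneg_nonneg divide_nonneg_pos mult_nonneg_nonneg) auto
  have split: "N (\<lambda>i. g x i - g y i) \<le> \<bar>\<theta> (N x) - \<theta> (N y)\<bar> * N (f x) + \<theta> (N y) * N (\<lambda>i. f x i - f y i)" for x y
  proof -
    have "g x i - g y i = (\<theta> (N x) - \<theta> (N y)) *\<^sub>R f x i + \<theta> (N y) *\<^sub>R (f x i - f y i)" for i
      by (simp add: g_def algebra_simps)
    hence "N (\<lambda>i. g x i - g y i) \<le> N (\<lambda>i. (\<theta> (N x) - \<theta> (N y)) *\<^sub>R f x i) + N (\<lambda>i. \<theta> (N y) *\<^sub>R (f x i - f y i))"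
      using tri by simp
    thus ?thesis using \<theta>01 by (simp add: N_def sum_distrib_left)
  qed
  \<comment> \<open>Only one of the two points has to lie in the ball: if \<open>y\<close> lies
    outside, its cut-off factor vanishes and the variation of the cut-off alone remains to be
    estimated.\<close>
  have half: "N (\<lambda>i. g x i - g y i) \<le> L * N (\<lambda>i. x i - y i)" if x: "N x \<le> 2 * R" for x y
  proof -
    have h1: "\<bar>\<theta> (N x) - \<theta> (N y)\<bar> * N (f x) \<le> (N (\<lambda>i. x i - y i) / R) * F0"
    proof (rule mult_mono)
      have "\<bar>\<theta> (N x) - \<theta> (N y)\<bar> \<le> \<bar>N x - N y\<bar> / R" by (rule \<theta>lip)
      also have "\<dots> \<le> N (\<lambda>i. x i - y i) / R" using R by (intro divide_right_mono Nsub) auto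
      finally show "\<bar>\<theta> (N x) - \<theta> (N y)\<bar> \<le> N (\<lambda>i. x i - y i) / R" .
    qed (use FB[OF x] Nd R N0 in auto)
    have h2: "\<theta> (N y) * N (\<lambda>i. f x i - f y i) \<le> C * (1 + 4 * R) * N (\<lambda>i. x i - y i)"
    proof (cases "N y > 2 * R")
      case True
      thus ?thesis using \<theta>0 Nd[of x y] C R by (simp add: mult_nonneg_nonneg)
    next
      case False
      have "\<theta> (N y) * N (\<lambda>i. f x i - f y i) \<le> 1 * (C * (1 + N x + N y) * N (\<lambda>i. x i - y i))"
        using lip[of x y] \<theta>01 Nd by (intro mult_mono) (auto simp: N_def sum_nonneg)
      also have "\<dots> \<le> C * (1 + 4 * R) * N (\<lambda>i. x i - y i)"
        using x False C Nd[of x y] by (simp, intro mult_right_mono mult_left_mono) auto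
      finally show ?thesis .
    qed
    have "N (\<lambda>i. g x i - g y i) \<le> (F0 / R + C * (1 + 4 * R)) * N (\<lambda>i. x i - y i)"
    proof -
      have "(F0 / R + C * (1 + 4 * R)) * N (\<lambda>i. x i - y i)
          = (N (\<lambda>i. x i - y i) / R) * F0 + C * (1 + 4 * R) * N (\<lambda>i. x i - y i)"
        unfolding distrib_right by simp
      with h1 h2 split[of x y] show ?thesis by linarith
    qed
    also have "\<dots> \<le> L * N (\<lambda>i. x i - y i)" using Nd by (intro mult_right_mono) (auto simp: L_def)
    finally show ?thesis .
  qed
  have glip: "N (\<lambda>i. g x i - g y i) \<le> L * N (\<lambda>i. x i - y i)" for x y
  proof (cases "N x \<le> 2 * R")
    case False
    show ?thesis
    proof (cases "N y \<le> 2 * R")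
      case True
      have "N (\<lambda>i. g x i - g y i) = N (\<lambda>i. g y i - g x i)" "N (\<lambda>i. x i - y i) = N (\<lambda>i. y i - x i)"
        by (simp_all add: N_def norm_minus_commute)
      thus ?thesis using half[OF True, of x] by simp
    next
      case F: False
      have "g x = (\<lambda>_. 0)" "g y = (\<lambda>_. 0)" using \<theta>0 False F by (auto simp: g_def)
      hence "N (\<lambda>i. g x i - g y i) = 0" by (simp add: N_def)
      thus ?thesis using Nd[of x y] L by simp
    qed
  qed (rule half)
  obtain x where x: "\<And>i. i \<in> K \<Longrightarrow> x 0 i = x0 i"
    "\<And>t i. t \<in> {0..\<tau>} \<Longrightarrow> i \<in> K \<Longrightarrow> ((\<lambda>s. x s i) has_vector_derivative g (x t) i) (at t within {0..\<tau>})"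
    using picard_finite[OF K L \<tau> glip[unfolded N_def], of x0] by blast
  \<comment> \<open>The solution of the cut-off system follows \<open>f\<close> with the multiplier
    \<open>\<theta> (N (x t))\<close>, so the a priori bound applies and shows that the cut-off was
    never active.\<close>
  have "N (x t) \<le> R" if "t \<in> {0..\<tau>}" for t
    unfolding N_def
    by (rule apriori[of x "\<lambda>t. \<theta> (N (x t))", OF x(1) \<theta>01(1) x(2)[unfolded g_def] that])
  hence "g (x t) i = f (x t) i" if "t \<in> {0..\<tau>}" for t i using \<theta>1 that by (simp add: g_def)
  thus ?thesis using x that by metis
qed

section \<open>Derivatives in time and the energy identity\<close>

definition has_cderiv :: "(real \<Rightarrow> int^('d::finite) \<Rightarrow> complex^'d) \<Rightarrow> (int^'d \<Rightarrow> complex^'d) \<Rightarrow> real \<Rightarrow> real set \<Rightarrow> bool" where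
  "has_cderiv A D t I \<longleftrightarrow>
     (\<forall>p. ((\<lambda>s. nrm p (\<lambda>k. (1 / (s - t)) *\<^sub>R (A s k - A t k) - D k)) \<longlongrightarrow> 0) (at t within I))"

lemma has_cderiv_subset: "has_cderiv A D t I \<Longrightarrow> J \<subseteq> I \<Longrightarrow> has_cderiv A D t J"
  unfolding has_cderiv_def using tendsto_within_subset by blast

text \<open>Brings the derivative of a single coefficient into the difference-quotient form used in
  \<open>has_Sob_inf_derivative\<close> and \<open>has_cderiv\<close>.\<close>

lemma has_vector_derivative_iff_quotient:
  "(f has_vector_derivative D) (at t within I) \<longleftrightarrow> ((\<lambda>s. (1 / (s - t)) *\<^sub>R (f s - f t) - D) \<longlongrightarrow> 0) (at t within I)"
proof -
  have "(f has_vector_derivative D) (at t within I) \<longleftrightarrow> ((\<lambda>s. (1 / norm (s - t)) *\<^sub>R (f s - (f t + (s - t) *\<^sub>R D))) \<longlongrightarrow> 0) (at t within I)"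
    unfolding has_vector_derivative_def has_derivative_within by (simp add: bounded_linear_scaleR_left)
  also have "\<dots> \<longleftrightarrow> ((\<lambda>s. norm ((1 / norm (s - t)) *\<^sub>R (f s - (f t + (s - t) *\<^sub>R D)))) \<longlongrightarrow> 0) (at t within I)"
    by (rule tendsto_norm_zero_iff[symmetric])
  also have "\<dots> \<longleftrightarrow> ((\<lambda>s. norm ((1 / (s - t)) *\<^sub>R (f s - f t) - D)) \<longlongrightarrow> 0) (at t within I)"
  proof (rule tendsto_cong)
    show "\<forall>\<^sub>F s in at t within I. norm ((1 / norm (s - t)) *\<^sub>R (f s - (f t + (s - t) *\<^sub>R D))) = norm ((1 / (s - t)) *\<^sub>R (f s - f t) - D)"
      unfolding eventually_at_filter
    proof (intro always_eventually allI impI)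
      fix s assume "s \<noteq> t"
      moreover have "f s - (f t + (s - t) *\<^sub>R D) = (f s - f t) - (s - t) *\<^sub>R D" by simp
      ultimately have "(1 / (s - t)) *\<^sub>R (f s - (f t + (s - t) *\<^sub>R D)) = (1 / (s - t)) *\<^sub>R (f s - f t) - D"
        by (simp only:) (simp add: scaleR_right_diff_distrib)
      moreover have "norm ((1 / norm (s - t)) *\<^sub>R (f s - (f t + (s - t) *\<^sub>R D))) = norm ((1 / (s - t)) *\<^sub>R (f s - (f t + (s - t) *\<^sub>R D)))"
        by simp
      ultimately show "norm ((1 / norm (s - t)) *\<^sub>R (f s - (f t + (s - t) *\<^sub>R D))) = norm ((1 / (s - t)) *\<^sub>R (f s - f t) - D)"
        by simp
    qed
  qed
  also have "\<dots> \<longleftrightarrow> ((\<lambda>s. (1 / (s - t)) *\<^sub>R (f s - f t) - D) \<longlongrightarrow> 0) (at t within I)"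
    by (rule tendsto_norm_zero_iff)
  finally show ?thesis .
qed

lemma rapid_quotient:
  assumes "rapid {a}" "rapid {b}" "rapid {d}"
  shows "rapid {\<lambda>k. c *\<^sub>R (a k - b k) - d k}"
  by (intro rapid_diff rapid_scaleR assms)

text \<open>The mean value inequality bounds the difference quotients in every weighted sup norm by
  the bounds of \<open>D\<close> on the convex set \<open>I\<close>; boundedness and convergence of
  each coefficient then give convergence in all Sobolev norms by
  \<open>nrm_tendsto_0\<close>.\<close>

lemma has_cderiv_of_components:
  fixes A D :: "real \<Rightarrow> int^('d::finite) \<Rightarrow> complex^'d"
  assumes I: "convex I" and t: "t \<in> I" and D: "rapid (D ` I)"
    and d: "\<And>s k. s \<in> I \<Longrightarrow> ((\<lambda>s. A s k) has_vector_derivative D s k) (at s within I)"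
  shows "has_cderiv A (D t) t I"
  unfolding has_cderiv_def
proof
  fix p
  define f where "f = (\<lambda>s k. (1 / (s - t)) *\<^sub>R (A s k - A t k) - D t k)"
  have "rapid (f ` (I - {t}))"
    unfolding rapid_def
  proof
    fix r
    obtain M where "M \<ge> 0" "\<And>a k. a \<in> D ` I \<Longrightarrow> br k ^ r * norm (a k) \<le> M"
      using rapidD[OF D, of r] by blast
    note M = this(1) this(2)[OF imageI]
    have "br k ^ r * norm (f s k) \<le> 2 * M" if s: "s \<in> I - {t}" for s k
    proof -
      define B where "B = M / br k ^ r"
      have bp: "0 < br k ^ r" by (simp add: br_pos)
      have DB: "norm (D s' k) \<le> B" if "s' \<in> I" for s'
        using M(2)[OF that, of k] bp by (simp add: B_def pos_le_divide_eq mult.commute)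
      have "norm (A s k - A t k) \<le> B * norm (s - t)"
      proof (rule differentiable_bound[OF I])
        show "((\<lambda>s. A s k) has_derivative (\<lambda>h. h *\<^sub>R D s' k)) (at s' within I)" if "s' \<in> I" for s'
          using d[OF that] by (simp add: has_vector_derivative_def)
        show "onorm (\<lambda>h. h *\<^sub>R D s' k) \<le> B" if "s' \<in> I" for s'
        proof (rule onorm_le)
          fix h :: real
          have "norm (D s' k) * \<bar>h\<bar> \<le> B * \<bar>h\<bar>" by (intro mult_right_mono DB that) simp
          thus "norm (h *\<^sub>R D s' k) \<le> B * norm h" by (simp add: mult.commute)
        qed
      qed (use s t in auto)
      hence "norm ((1 / (s - t)) *\<^sub>R (A s k - A t k)) \<le> B"
        using s by (simp add: divide_le_eq)
      hence "norm (f s k) \<le> 2 * B"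
        unfolding f_def using DB[OF t] norm_triangle_ineq4[of "(1 / (s - t)) *\<^sub>R (A s k - A t k)" "D t k"] by linarith
      hence "br k ^ r * norm (f s k) \<le> br k ^ r * (2 * B)" using bp by (intro mult_left_mono) auto
      also have "\<dots> = 2 * M" using br_pos[of k] by (simp add: B_def)
      finally show ?thesis .
    qed
    thus "\<exists>M. \<forall>a\<in>f ` (I - {t}). \<forall>k. br k ^ r * norm (a k) \<le> M" by blast
  qed
  moreover have "\<forall>\<^sub>F s in at t within I. f s \<in> f ` (I - {t})"
    unfolding eventually_at_filter by (intro always_eventually) auto
  moreover have "((\<lambda>s. f s k) \<longlongrightarrow> 0) (at t within I)" for k
    using d[OF t, of k] unfolding has_vector_derivative_iff_quotient f_def .
  ultimately have "((\<lambda>s. nrm p (f s)) \<longlongrightarrow> 0) (at t within I)" by (intro nrm_tendsto_0[of f])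
  thus "((\<lambda>s. nrm p (\<lambda>k. (1 / (s - t)) *\<^sub>R (A s k - A t k) - D t k)) \<longlongrightarrow> 0) (at t within I)"
    unfolding f_def .
qed

lemma inn_tendsto_0:
  assumes "((\<lambda>s. nrm p (e s)) \<longlongrightarrow> 0) F" "eventually (\<lambda>s. rapid {e s}) F" "rapid {a}"
  shows "((\<lambda>s. inn p a (e s)) \<longlongrightarrow> 0) F"
proof (rule Lim_null_comparison)
  show "\<forall>\<^sub>F s in F. norm (inn p a (e s)) \<le> nrm p a * nrm p (e s)"
    using assms(2) by eventually_elim (use inn_Cauchy_Schwarz[OF assms(3)] in auto)
  show "((\<lambda>s. nrm p a * nrm p (e s)) \<longlongrightarrow> 0) F"
    using tendsto_mult_left[OF assms(1), of "nrm p a"] by simp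
qed

text \<open>With \<open>A s\<close> written as \<open>A t\<close> plus \<open>s - t\<close> times
  \<open>D + e s\<close>, where \<open>e s\<close> tends to 0 in norm, the quadratic form expands
  exactly; all terms with \<open>e\<close> vanish in the limit by Cauchy-Schwarz.\<close>

lemma energy_has_derivative:
  fixes A :: "real \<Rightarrow> int^('d::finite) \<Rightarrow> complex^'d"
  assumes c: "has_cderiv A D t I" and A: "\<And>s. s \<in> I \<Longrightarrow> rapid {A s}" and t: "t \<in> I" and D: "rapid {D}"
  shows "((\<lambda>s. inn p (A s) (A s)) has_real_derivative 2 * inn p (A t) D) (at t within I)"
proof -
  define e where "e = (\<lambda>s k. (1 / (s - t)) *\<^sub>R (A s k - A t k) - D k)"
  have re: "rapid {e s}" if "s \<in> I" for s unfolding e_def by (rule rapid_quotient[OF A[OF that] A[OF t] D])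
  have ev: "\<forall>\<^sub>F s in at t within I. rapid {e s}"
    unfolding eventually_at_filter by (intro always_eventually) (use re in auto)
  have lim: "((\<lambda>s. nrm p (e s)) \<longlongrightarrow> 0) (at t within I)"
    using c unfolding has_cderiv_def e_def by blast
  have l1: "((\<lambda>s. inn p (A t) (e s)) \<longlongrightarrow> 0) (at t within I)"
    by (rule inn_tendsto_0[OF lim ev A[OF t]])
  have l2: "((\<lambda>s. inn p D (e s)) \<longlongrightarrow> 0) (at t within I)"
    by (rule inn_tendsto_0[OF lim ev D])
  have l3: "((\<lambda>s. inn p (e s) (e s)) \<longlongrightarrow> 0) (at t within I)"
    using tendsto_power[OF lim, of 2] by (simp add: nrm_sq)
  have l4: "((\<lambda>s. s - t) \<longlongrightarrow> 0) (at t within I)"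
  proof -
    have "((\<lambda>s. s - t) \<longlongrightarrow> t - t) (at t within I)" by (intro tendsto_intros)
    thus ?thesis by simp
  qed
  have "((\<lambda>s. 2 * inn p (A t) D + 2 * inn p (A t) (e s) + (s - t) * (inn p D D + 2 * inn p D (e s) + inn p (e s) (e s)))
      \<longlongrightarrow> 2 * inn p (A t) D + 2 * 0 + 0 * (inn p D D + 2 * 0 + 0)) (at t within I)"
    by (intro tendsto_intros l1 l2 l3 l4)
  moreover have "\<forall>\<^sub>F s in at t within I. 2 * inn p (A t) D + 2 * inn p (A t) (e s) + (s - t) * (inn p D D + 2 * inn p D (e s) + inn p (e s) (e s))
      = (inn p (A s) (A s) - inn p (A t) (A t)) / (s - t)"
    unfolding eventually_at_filter
  proof (intro always_eventually allI impI)
    fix s assume s: "s \<noteq> t" "s \<in> I"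
    define b where "b = (\<lambda>k. D k + e s k)"
    have rb: "rapid {b}" unfolding b_def by (rule rapid_add[OF D re[OF s(2)]])
    have rsb: "rapid {\<lambda>k. (s - t) *\<^sub>R b k}" by (rule rapid_scaleR[OF rb])
    have "A s k = A t k + (s - t) *\<^sub>R b k" for k
      using s(1) by (simp add: b_def e_def)
    hence As: "A s = (\<lambda>k. A t k + (s - t) *\<^sub>R b k)" by blast
    have "inn p (A s) (A s) = inn p (A t) (A t) + 2 * ((s - t) * inn p (A t) b) + (s - t) * ((s - t) * inn p b b)"
      unfolding As
      by (simp add: inn_add_left[OF rapid_add[OF A[OF t] rsb] A[OF t] rsb] inn_add_right[OF A[OF t] A[OF t] rsb]
          inn_add_right[OF rsb A[OF t] rsb] inn_scaleR_left inn_scaleR_right inn_commute[of p b "A t"])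
    hence "(inn p (A s) (A s) - inn p (A t) (A t)) / (s - t) = 2 * inn p (A t) b + (s - t) * inn p b b"
      using s(1) by (simp add: field_simps)
    moreover have "inn p (A t) b = inn p (A t) D + inn p (A t) (e s)"
      unfolding b_def by (rule inn_add_right[OF A[OF t] D re[OF s(2)]])
    moreover have "inn p b b = inn p D D + 2 * inn p D (e s) + inn p (e s) (e s)"
      using inn_add_left[OF rb D re[OF s(2)], of p] inn_add_right[OF D D re[OF s(2)], of p] inn_add_right[OF re[OF s(2)] D re[OF s(2)], of p]
      by (simp add: b_def[symmetric] inn_commute[of p "e s" D])
    ultimately show "2 * inn p (A t) D + 2 * inn p (A t) (e s) + (s - t) * (inn p D D + 2 * inn p D (e s) + inn p (e s) (e s))
      = (inn p (A s) (A s) - inn p (A t) (A t)) / (s - t)" by simp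
  qed
  ultimately show ?thesis
    unfolding has_field_derivative_iff by (simp add: tendsto_cong)
qed

text \<open>Formulated for any curve satisfying the energy inequality, so that it serves the
  truncated equation as well as the full one. \<open>x0\<close> and \<open>y0\<close> are upper
  bounds for the initial norms, which admits truncated data and, for the decay, the threshold value
  \<open>\<nu> / G\<close>.\<close>

lemma apriori_bound:
  fixes A D :: "real \<Rightarrow> int^('d::finite) \<Rightarrow> complex^'d"
  assumes t: "0 \<le> t" and A: "\<And>s. s \<in> {0..t} \<Longrightarrow> A s \<in> ns_coeffs" and D: "\<And>s. s \<in> {0..t} \<Longrightarrow> rapid {D s}"
    and c: "\<And>s. s \<in> {0..t} \<Longrightarrow> has_cderiv A (D s) s {0..t}"
    and energy: "\<And>s q. s \<in> {0..t} \<Longrightarrow> inn q (A s) (D s) \<le> - \<nu> * inn (q + 1) (A s) (A s) + inn q (Bil (A s) (A s)) (A s)"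
    and G: "\<And>a :: int^'d \<Rightarrow> complex^'d. a \<in> ns_coeffs \<Longrightarrow> \<bar>inn n (Bil a a) a\<bar> \<le> G * nrm n a * (nrm n a)\<^sup>2"
    and H: "\<And>a :: int^'d \<Rightarrow> complex^'d. a \<in> ns_coeffs \<Longrightarrow> \<bar>inn p (Bil a a) a\<bar> \<le> H * nrm n a * (nrm p a)\<^sup>2"
    and pos: "0 < G" "0 < H" and nu: "0 \<le> \<nu>"
    and init: "nrm n (A 0) \<le> x0" "nrm p (A 0) \<le> y0" and small: "G * x0 * e_visc \<nu> t < 1"
  shows "nrm n (A t) \<le> x0 * exp (- \<nu> * t) / (1 - G * x0 * e_visc \<nu> t)"
    and "nrm p (A t) \<le> y0 * exp (- \<nu> * t) / (1 - G * x0 * e_visc \<nu> t) powr (H / G)"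
proof -
  have x0: "0 \<le> x0" and y0: "0 \<le> y0" using init nrm_nonneg order_trans by blast+
  note rA = ns_coeffsD(1)[OF A]
  have der: "((\<lambda>s. inn q (A s) (A s)) has_real_derivative 2 * inn q (A s) (D s)) (at s within {0..t})" if "s \<in> {0..t}" for s q
    by (rule energy_has_derivative[OF c[OF that] rA that D[OF that]])
  have le: "2 * inn q (A s) (D s) \<le> - 2 * \<nu> * inn q (A s) (A s) + 2 * h * nrm n (A s) * inn q (A s) (A s)"
    if s: "s \<in> {0..t}" and h: "\<bar>inn q (Bil (A s) (A s)) (A s)\<bar> \<le> h * nrm n (A s) * (nrm q (A s))\<^sup>2" for s q h
  proof -
    \<comment> \<open>Poincare's inequality, from |k| \<ge> 1 for nonzero k; it produces the linear
      damping.\<close>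
    have "\<nu> * inn q (A s) (A s) \<le> \<nu> * inn (q + 1) (A s) (A s)"
      by (intro mult_left_mono nu inn_mono rA[OF s]) simp
    thus ?thesis using energy[OF s, of q] h unfolding nrm_sq by linarith
  qed
  have riccati: "nrm n (A s) \<le> x0 * exp (- \<nu> * s) / (1 - G * x0 * e_visc \<nu> s)" if s: "s \<in> {0..t}" for s
    unfolding nrm_def
  proof (rule riccati_le[where X' = "\<lambda>s. 2 * inn n (A s) (D s)", OF _ _ _ _ _ x0 nu pos(1)])
    show "0 \<le> s" using s by simp
    fix s' assume "s' \<in> {0..s}"
    hence s': "s' \<in> {0..t}" using s by auto
    show "((\<lambda>s. inn n (A s) (A s)) has_real_derivative 2 * inn n (A s') (D s')) (at s' within {0..s})"
      by (rule DERIV_subset[OF der[OF s']]) (use s in auto)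
    show "0 \<le> inn n (A s') (A s')" by (rule inn_self_nonneg)
    show "2 * inn n (A s') (D s') \<le> - 2 * \<nu> * inn n (A s') (A s') + 2 * G * sqrt (inn n (A s') (A s')) * inn n (A s') (A s')"
      using le[OF s' G[OF A[OF s']]] by (simp add: nrm_def)
  next
    have "(nrm n (A 0))\<^sup>2 \<le> x0\<^sup>2" using init nrm_nonneg by (intro power_mono) auto
    thus "inn n (A 0) (A 0) \<le> x0\<^sup>2" by (simp add: nrm_sq)
    have "G * x0 * e_visc \<nu> s \<le> G * x0 * e_visc \<nu> t"
      using s pos x0 by (intro mult_left_mono e_visc_mono nu) auto
    thus "G * x0 * e_visc \<nu> s < 1" using small by simp
  qed
  show "nrm n (A t) \<le> x0 * exp (- \<nu> * t) / (1 - G * x0 * e_visc \<nu> t)" using riccati[of t] t by simp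
  show "nrm p (A t) \<le> y0 * exp (- \<nu> * t) / (1 - G * x0 * e_visc \<nu> t) powr (H / G)"
    unfolding nrm_def[of p]
  proof (rule linear_riccati_le[where Y' = "\<lambda>s. 2 * inn p (A s) (D s)" and x = "\<lambda>s. nrm n (A s)", OF t der _ _ riccati _ y0 x0 nu pos small])
    fix s assume s: "s \<in> {0..t}"
    show "0 \<le> inn p (A s) (A s)" by (rule inn_self_nonneg)
    show "2 * inn p (A s) (D s) \<le> - 2 * \<nu> * inn p (A s) (A s) + 2 * H * nrm n (A s) * inn p (A s) (A s)"
      by (rule le[OF s H[OF A[OF s]]])
  next
    have "(nrm p (A 0))\<^sup>2 \<le> y0\<^sup>2" using init nrm_nonneg by (intro power_mono) auto
    thus "inn p (A 0) (A 0) \<le> y0\<^sup>2" by (simp add: nrm_sq)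
  qed
qed

section \<open>Galerkin approximation\<close>

definition nsrhs :: "real \<Rightarrow> (int^'d \<Rightarrow> complex^('d::finite)) \<Rightarrow> int^'d \<Rightarrow> complex^'d" where
  "nsrhs \<nu> a k = \<nu> *\<^sub>R lapl a k + Bil a a k"

lemma ns_coeffs_nsrhs: "a \<in> ns_coeffs \<Longrightarrow> nsrhs \<nu> a \<in> ns_coeffs"
  unfolding nsrhs_def[abs_def] by (intro ns_coeffs_add ns_coeffs_scaleR ns_coeffs_lapl ns_coeffs_Bil)

lemma inn_nsrhs:
  assumes "a \<in> ns_coeffs" shows "inn p (nsrhs \<nu> a) a = - \<nu> * inn (p + 1) a a + inn p (Bil a a) a"
proof -
  note a = ns_coeffsD(1)[OF assms]
  have "inn p (\<lambda>k. \<nu> *\<^sub>R lapl a k + Bil a a k) a = inn p (\<lambda>k. \<nu> *\<^sub>R lapl a k) a + inn p (Bil a a) a"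
    by (rule inn_add_left[OF a rapid_scaleR[OF ns_coeffsD(1)[OF ns_coeffs_lapl[OF assms]]] rapid_Bil_single[OF a a]])
  thus ?thesis by (simp add: nsrhs_def[abs_def] inn_scaleR_left inn_lapl)
qed

lemma rapid_lapl:
  assumes "rapid S" shows "rapid (lapl ` S)"
  by (rule rapidI_mult[OF assms, where C = 1 and q = 2]) (use norm_lapl_le in blast, simp)

lemma rapid_nsrhs:
  fixes S :: "(int^('d::finite) \<Rightarrow> complex^'d) set"
  assumes "rapid S" shows "rapid (nsrhs \<nu> ` S)"
proof (rule rapidI_add)
  show "rapid ((\<lambda>a k. \<nu> *\<^sub>R lapl a k) ` S)"
  proof (rule rapidI_mult[OF rapid_lapl[OF assms], where C = "\<bar>\<nu>\<bar>" and q = 0])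
    fix b assume "b \<in> (\<lambda>a k. \<nu> *\<^sub>R lapl a k) ` S"
    then obtain a where "a \<in> S" "b = (\<lambda>k. \<nu> *\<^sub>R lapl a k)" by blast
    thus "\<exists>a\<in>lapl ` S. \<forall>k. norm (b k) \<le> \<bar>\<nu>\<bar> * br k ^ 0 * norm (a k)" by auto
  qed simp
  show "rapid {Bil a b |a b. a \<in> S \<and> b \<in> S}" by (rule rapid_Bil[OF assms assms])
  fix b assume "b \<in> nsrhs \<nu> ` S"
  then obtain a where a: "a \<in> S" "b = nsrhs \<nu> a" by blast
  show "\<exists>a1\<in>(\<lambda>a k. \<nu> *\<^sub>R lapl a k) ` S. \<exists>a2\<in>{Bil a b |a b. a \<in> S \<and> b \<in> S}. \<forall>k. norm (b k) \<le> norm (a1 k) + norm (a2 k)"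
  proof (intro bexI allI)
    show "norm (b k) \<le> norm ((\<lambda>k. \<nu> *\<^sub>R lapl a k) k) + norm (Bil a a k)" for k
      unfolding a(2) nsrhs_def by (rule norm_triangle_ineq)
    show "Bil a a \<in> {Bil a b |a b. a \<in> S \<and> b \<in> S}" using a(1) by blast
    show "(\<lambda>k. \<nu> *\<^sub>R lapl a k) \<in> (\<lambda>a k. \<nu> *\<^sub>R lapl a k) ` S" using a(1) by blast
  qed
qed

text \<open>Symmetric under negation, so that truncation preserves reality; index 0 is left out
  because the fields have mean zero.\<close>

definition modes :: "nat \<Rightarrow> (int^('d::finite)) set" where
  "modes N = {k. k \<noteq> 0 \<and> norm (wavevec k) \<le> real N}"

definition trunc :: "nat \<Rightarrow> (int^('d::finite) \<Rightarrow> complex^'d) \<Rightarrow> int^'d \<Rightarrow> complex^'d" where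
  "trunc N a k = (if k \<in> modes N then a k else 0)"

lemma modes_minus [simp]: "- k \<in> modes N \<longleftrightarrow> k \<in> modes N"
  by (simp add: modes_def wavevec_minus)

lemma finite_modes: "finite (modes N :: (int^('d::finite)) set)"
proof -
  have inj: "inj_on (\<lambda>k. (\<lambda>j. k $ j)) (modes N :: (int^'d) set)" by (auto simp: inj_on_def vec_eq_iff fun_eq_iff)
  have "(\<lambda>k. (\<lambda>j. k $ j)) ` (modes N :: (int^'d) set) \<subseteq> PiE UNIV (\<lambda>_. {- int N..int N})"
  proof (rule image_subsetI)
    fix k :: "int^'d" assume "k \<in> modes N"
    hence "\<bar>real_of_int (k $ j)\<bar> \<le> real N" for j
      using component_le_norm_wavevec[of k j] by (simp add: modes_def)
    hence "k $ j \<in> {- int N..int N}" for j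
      by (smt (verit) atLeastAtMost_iff of_int_le_iff of_int_minus of_int_of_nat_eq)
    thus "(\<lambda>j. k $ j) \<in> PiE UNIV (\<lambda>_. {- int N..int N})" by auto
  qed
  moreover have "finite (PiE (UNIV :: 'd set) (\<lambda>_. {- int N..int N}))" by (intro finite_PiE) auto
  ultimately show ?thesis using finite_imageD[OF finite_subset inj] by blast
qed

lemma norm_trunc_le: "norm (trunc N a k) \<le> norm (a k)"
  by (simp add: trunc_def)

lemma rapid_trunc: "rapid {a} \<Longrightarrow> rapid {trunc N a}"
  by (rule rapidI_mult[where C = 1 and q = 0]) (auto simp: norm_trunc_le)

lemma rapid_trunc_image:
  assumes "rapid S" shows "rapid (trunc N ` S)"
proof (rule rapidI_mult[OF assms, where C = 1 and q = 0])
  fix b assume "b \<in> trunc N ` S"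
  then obtain a where "a \<in> S" "b = trunc N a" by blast
  thus "\<exists>a\<in>S. \<forall>k. norm (b k) \<le> 1 * br k ^ 0 * norm (a k)" using norm_trunc_le[of N a] by auto
qed simp

text \<open>Truncation is diagonal in \<open>k\<close>, hence symmetric for the inner products of
  all orders simultaneously; therefore the truncated right-hand side, tested against a truncated
  family, satisfies the energy identity of the full equation.\<close>

lemma inn_trunc_left:
  assumes "trunc N b = b" shows "inn p (trunc N a) b = inn p a b"
proof -
  have "trunc N a k \<bullet> b k = a k \<bullet> b k" for k
    using fun_cong[OF assms, of k] by (simp add: trunc_def split: if_splits)
  thus ?thesis by (simp add: inn_def)
qed

lemma rapid_finite_support:
  assumes "finite K" "\<And>a k. a \<in> S \<Longrightarrow> k \<notin> K \<Longrightarrow> a k = 0" and B: "\<And>a k. a \<in> S \<Longrightarrow> k \<in> K \<Longrightarrow> norm (a k) \<le> B k"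
  shows "rapid S"
  unfolding rapid_def
proof
  fix r
  show "\<exists>M. \<forall>a\<in>S. \<forall>k. br k ^ r * norm (a k) \<le> M"
  proof (intro exI ballI allI)
    fix a k assume a: "a \<in> S"
    show "br k ^ r * norm (a k) \<le> (\<Sum>k\<in>K. br k ^ r * \<bar>B k\<bar>)"
    proof (cases "k \<in> K")
      case True
      have "br k ^ r * norm (a k) \<le> br k ^ r * \<bar>B k\<bar>"
        using B[OF a True] by (intro mult_left_mono) (auto simp: less_imp_le[OF br_pos])
      also have "\<dots> \<le> (\<Sum>k\<in>K. br k ^ r * \<bar>B k\<bar>)"
        using True assms(1) by (intro member_le_sum) (auto intro!: mult_nonneg_nonneg simp: less_imp_le[OF br_pos])
      finally show ?thesis .
    next
      case False
      thus ?thesis using assms(2)[OF a] by (auto intro!: sum_nonneg mult_nonneg_nonneg simp: less_imp_le[OF br_pos])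
    qed
  qed
qed

text \<open>Orthogonal projection of arbitrary coefficient families onto the Galerkin space; it enforces the symmetry
  of real fields and the divergence condition, so the truncated system can be solved without constraints.\<close>

definition gproj :: "nat \<Rightarrow> (int^('d::finite) \<Rightarrow> complex^'d) \<Rightarrow> int^'d \<Rightarrow> complex^'d" where
  "gproj N x k = (if k \<in> modes N then proj_perp k ((1 / 2) *\<^sub>R (x k + cnjv (x (- k)))) else 0)"

lemma gproj_outside: "k \<notin> modes N \<Longrightarrow> gproj N x k = 0"
  by (simp add: gproj_def)

lemma zero_notin_modes: "0 \<notin> modes N"
  by (simp add: modes_def)

lemma ns_coeffs_gproj: "gproj N x \<in> ns_coeffs"
proof -
  have "rapid {gproj N x}"
    by (rule rapid_finite_support[OF finite_modes[of N], where B = "\<lambda>k. norm (gproj N x k)"]) (auto simp: gproj_outside)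
  moreover have "gproj N x (- k) = cnjv (gproj N x k)" for k
  proof (cases "k \<in> modes N")
    case True
    have "(1 / 2) *\<^sub>R (x (- k) + cnjv (x (- (- k)))) = cnjv ((1 / 2) *\<^sub>R (x k + cnjv (x (- k))))"
      by (simp add: vec_eq_iff)
    thus ?thesis using True by (simp only: gproj_def modes_minus if_True proj_perp_cnjv)
  qed (simp add: gproj_outside vec_eq_iff)
  moreover have "wave_dot k (gproj N x k) = 0" for k
    by (simp add: gproj_def wave_dot_proj_perp)
  ultimately show ?thesis by (simp add: ns_coeffs_def gproj_outside zero_notin_modes)
qed

lemma gproj_fixed:
  assumes "a \<in> ns_coeffs" "k \<in> modes N" shows "gproj N a k = a k"
proof -
  have "(1 / 2) *\<^sub>R (a k + cnjv (a (- k))) = a k"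
    using ns_coeffsD(2)[OF assms(1), of k] by (simp add: scaleR_2[symmetric])
  thus ?thesis using assms(2) ns_coeffsD(3)[OF assms(1), of k] by (simp add: gproj_def proj_perp_fixed)
qed

lemma gproj_cong: "(\<And>k. k \<in> modes N \<Longrightarrow> x k = y k) \<Longrightarrow> gproj N x = gproj N y"
  by (auto simp: gproj_def)

lemma trunc_gproj: "trunc N (gproj N x) = gproj N x"
  by (auto simp: trunc_def gproj_outside)

lemma gproj_diff: "gproj N (\<lambda>k. x k - y k) k = gproj N x k - gproj N y k"
proof -
  have "(1 / 2) *\<^sub>R ((x k - y k) + cnjv (x (- k) - y (- k)))
      = (1 / 2) *\<^sub>R (x k + cnjv (x (- k))) - (1 / 2) *\<^sub>R (y k + cnjv (y (- k)))"
    by (simp add: vec_eq_iff algebra_simps)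
  thus ?thesis by (simp only: gproj_def proj_perp_diff) simp
qed

lemma sum_norm_gproj_le:
  fixes x :: "int^('d::finite) \<Rightarrow> complex^'d"
  shows "(\<Sum>k\<in>modes N. norm (gproj N x k)) \<le> (\<Sum>k\<in>modes N. norm (x k))"
proof -
  have "(\<Sum>k\<in>modes N. norm (gproj N x k)) \<le> (\<Sum>k\<in>modes N. (norm (x k) + norm (x (- k))) / 2)"
  proof (rule sum_mono)
    fix k :: "int^'d" assume "k \<in> modes N"
    hence "norm (gproj N x k) \<le> norm ((1 / 2) *\<^sub>R (x k + cnjv (x (- k))))"
      using norm_proj_perp_le[of k "(1 / 2) *\<^sub>R (x k + cnjv (x (- k)))"] by (simp only: gproj_def if_True)
    also have "\<dots> \<le> (norm (x k) + norm (x (- k))) / 2"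
      using norm_triangle_ineq[of "x k" "cnjv (x (- k))"] by simp
    finally show "norm (gproj N x k) \<le> (norm (x k) + norm (x (- k))) / 2" .
  qed
  also have "\<dots> = ((\<Sum>k\<in>modes N. norm (x k)) + (\<Sum>k\<in>modes N. norm (x (- k)))) / 2"
    by (simp add: sum.distrib sum_divide_distrib[symmetric])
  also have "(\<Sum>k\<in>modes N. norm (x (- k))) = (\<Sum>k\<in>modes N. norm (x k))"
    by (rule sum.reindex_bij_witness[of _ uminus uminus]) auto
  finally show ?thesis by simp
qed

lemma nrm0_le_sum:
  assumes "rapid {a}" "\<And>k. k \<notin> modes N \<Longrightarrow> a k = 0"
  shows "nrm 0 a \<le> (\<Sum>k\<in>modes N. norm (a k))" "inn 0 a a = (\<Sum>k\<in>modes N. a k \<bullet> a k)"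
proof -
  have z: "a 0 = 0" using assms(2) zero_notin_modes by blast
  have "(\<Sum>\<^sub>\<infinity>k. (norm (a k))\<^sup>2) = (\<Sum>\<^sub>\<infinity>k\<in>modes N. (norm (a k))\<^sup>2)"
    by (rule infsum_cong_neutral) (auto simp: assms(2))
  hence e: "(\<Sum>\<^sub>\<infinity>k. (norm (a k))\<^sup>2) = (\<Sum>k\<in>modes N. (norm (a k))\<^sup>2)" by (simp add: finite_modes)
  have "nrm 0 a = L2_set (\<lambda>k. norm (a k)) (modes N)"
    using nrm0_infsum(1)[OF assms(1) z] by (simp add: e L2_set_def)
  also have "\<dots> \<le> (\<Sum>k\<in>modes N. norm (a k))" by (rule L2_set_le_sum) simp
  finally show "nrm 0 a \<le> (\<Sum>k\<in>modes N. norm (a k))" .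
  have "inn 0 a a = (\<Sum>\<^sub>\<infinity>k. a k \<bullet> a k)" by (rule inn0_eq[of a a, OF z])
  thus "inn 0 a a = (\<Sum>k\<in>modes N. a k \<bullet> a k)" using e by (simp add: power2_norm_eq_inner)
qed

text \<open>On modes with |k| \<le> N the Laplacian costs at most N^2, and the convolution at most 1
  + N for each mode, which explains \<open>C\<close>. The growth in the sizes of \<open>x\<close>
  and \<open>y\<close> has the shape required by \<open>picard_cutoff\<close>.\<close>

lemma galerkin_lipschitz:
  fixes x y :: "int^('d::finite) \<Rightarrow> complex^'d" and N :: nat
  assumes nu: "0 \<le> \<nu>"
  defines "C \<equiv> \<nu> * (real N)\<^sup>2 + real (card (modes N :: (int^'d) set)) * (cmod (cvol TYPE('d)) * (1 + real N))"
  shows "(\<Sum>k\<in>modes N. norm (nsrhs \<nu> (gproj N x) k - nsrhs \<nu> (gproj N y) k))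
    \<le> C * (1 + (\<Sum>k\<in>modes N. norm (x k)) + (\<Sum>k\<in>modes N. norm (y k))) * (\<Sum>k\<in>modes N. norm (x k - y k))"
proof -
  define a where "a = gproj N x"
  define b where "b = gproj N y"
  define d where "d = (\<lambda>k. a k - b k)"
  define s where "s = (\<lambda>x :: int^'d \<Rightarrow> complex^'d. \<Sum>k\<in>modes N. norm (x k))"
  let ?c = "cmod (cvol TYPE('d))"
  have a: "a \<in> ns_coeffs" and b: "b \<in> ns_coeffs" unfolding a_def b_def by (rule ns_coeffs_gproj)+
  have dg: "d = gproj N (\<lambda>k. x k - y k)" unfolding d_def a_def b_def gproj_diff ..
  have d: "d \<in> ns_coeffs" unfolding dg by (rule ns_coeffs_gproj)
  have n0: "nrm 0 (gproj N z) \<le> s z" for z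
    unfolding s_def
    by (rule order_trans[OF nrm0_le_sum(1)[where N = N] sum_norm_gproj_le]) (rule ns_coeffsD(1)[OF ns_coeffs_gproj], rule gproj_outside)
  have s0: "0 \<le> s z" for z by (simp add: s_def sum_nonneg)
  define e where "e = s (\<lambda>k. x k - y k)"
  have pt: "norm (nsrhs \<nu> a k - nsrhs \<nu> b k) \<le> \<nu> * (real N)\<^sup>2 * norm (d k) + ?c * (1 + real N) * ((s x + s y) * e)"
    if k: "k \<in> modes N" for k
  proof -
    have kN: "norm (wavevec k) \<le> real N" using k by (simp add: modes_def)
    have eq: "nsrhs \<nu> a k - nsrhs \<nu> b k = \<nu> *\<^sub>R lapl d k + (Bil a d k + Bil d b k)"
      unfolding d_def nsrhs_def lapl_def
      by (simp add: Bil_diff_left Bil_diff_right ns_coeffsD(1)[OF a] ns_coeffsD(1)[OF b] algebra_simps)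
    have "norm (\<nu> *\<^sub>R lapl d k) \<le> \<nu> * (real N)\<^sup>2 * norm (d k)"
    proof -
      have "(norm (wavevec k))\<^sup>2 \<le> (real N)\<^sup>2" using kN by (intro power_mono) auto
      hence "\<nu> * ((norm (wavevec k))\<^sup>2 * norm (d k)) \<le> \<nu> * ((real N)\<^sup>2 * norm (d k))"
        using nu by (intro mult_left_mono mult_right_mono) auto
      thus ?thesis using nu by (simp add: lapl_def mult.assoc)
    qed
    moreover have "norm (Bil u v k) \<le> ?c * (1 + real N) * (nrm 0 u * nrm 0 v)" if "u \<in> ns_coeffs" "v \<in> ns_coeffs" for u v
    proof -
      have "norm (Bil u v k) \<le> ?c * br k * (nrm 0 u * nrm 0 v)"
        by (rule norm_Bil_le_nrm0) (use that ns_coeffsD in blast)+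
      also have "\<dots> \<le> ?c * (1 + real N) * (nrm 0 u * nrm 0 v)"
        using kN by (intro mult_right_mono mult_left_mono mult_nonneg_nonneg nrm_nonneg) (auto simp: br_def)
      finally show ?thesis .
    qed
    note B = this
    have "norm (Bil a d k) \<le> ?c * (1 + real N) * (s x * e)"
    proof -
      have "nrm 0 a * nrm 0 d \<le> s x * e"
        unfolding dg a_def e_def by (intro mult_mono n0 s0 nrm_nonneg)
      hence "?c * (1 + real N) * (nrm 0 a * nrm 0 d) \<le> ?c * (1 + real N) * (s x * e)" by (intro mult_left_mono) auto
      thus ?thesis using B[OF a d] by linarith
    qed
    moreover have "norm (Bil d b k) \<le> ?c * (1 + real N) * (s y * e)"
    proof -
      have "nrm 0 d * nrm 0 b \<le> e * s y"
        unfolding dg b_def e_def by (intro mult_mono n0 s0 nrm_nonneg)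
      hence "?c * (1 + real N) * (nrm 0 d * nrm 0 b) \<le> ?c * (1 + real N) * (e * s y)" by (intro mult_left_mono) auto
      thus ?thesis using B[OF d b] by (simp add: mult.commute[of e])
    qed
    moreover have "norm (nsrhs \<nu> a k - nsrhs \<nu> b k) \<le> norm (\<nu> *\<^sub>R lapl d k) + (norm (Bil a d k) + norm (Bil d b k))"
      unfolding eq by (intro order_trans[OF norm_triangle_ineq] add_left_mono norm_triangle_ineq)
    moreover have "?c * (1 + real N) * ((s x + s y) * e) = ?c * (1 + real N) * (s x * e) + ?c * (1 + real N) * (s y * e)"
      by (simp only: distrib_left distrib_right)
    ultimately show ?thesis by linarith
  qed
  have de: "(\<Sum>k\<in>modes N. norm (d k)) \<le> e"
    unfolding dg e_def s_def by (rule sum_norm_gproj_le)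
  have e0: "0 \<le> e" unfolding e_def by (rule s0)
  have "(\<Sum>k\<in>modes N. norm (nsrhs \<nu> a k - nsrhs \<nu> b k))
      \<le> (\<Sum>k\<in>(modes N :: (int^'d) set). \<nu> * (real N)\<^sup>2 * norm (d k) + ?c * (1 + real N) * ((s x + s y) * e))"
    by (intro sum_mono pt)
  also have "\<dots> = \<nu> * (real N)\<^sup>2 * (\<Sum>k\<in>modes N. norm (d k))
      + real (card (modes N :: (int^'d) set)) * (?c * (1 + real N)) * ((s x + s y) * e)"
    by (simp add: sum.distrib sum_distrib_left)
  also have "\<dots> \<le> \<nu> * (real N)\<^sup>2 * ((1 + s x + s y) * e)
      + real (card (modes N :: (int^'d) set)) * (?c * (1 + real N)) * ((1 + s x + s y) * e)"
  proof (intro add_mono mult_left_mono)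
    have "1 * e \<le> (1 + s x + s y) * e" using s0[of x] s0[of y] e0 by (intro mult_right_mono) auto
    thus "(\<Sum>k\<in>modes N. norm (d k)) \<le> (1 + s x + s y) * e" using de by simp
    show "(s x + s y) * e \<le> (1 + s x + s y) * e" using e0 by (intro mult_right_mono) auto
  qed (use nu in auto)
  also have "\<dots> = C * (1 + s x + s y) * e" by (simp add: C_def distrib_right mult.assoc)
  finally show ?thesis by (simp only: a_def b_def s_def e_def)
qed

text \<open>The scalar \<open>c\<close> is the value of the cut-off multiplier. On the modes the
  projection fixes \<open>F\<close>, which already satisfies the constraints.\<close>

lemma has_vector_derivative_gproj:
  fixes X :: "real \<Rightarrow> int^('d::finite) \<Rightarrow> complex^'d"
  assumes d: "\<And>k. k \<in> modes N \<Longrightarrow> ((\<lambda>s. X s k) has_vector_derivative c *\<^sub>R F k) (at t within I)" and F: "F \<in> ns_coeffs"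
  shows "((\<lambda>s. gproj N (X s) k) has_vector_derivative c *\<^sub>R trunc N F k) (at t within I)"
proof (cases "k \<in> modes N")
  case True
  have "((\<lambda>s. proj_perp k ((1 / 2) *\<^sub>R (X s k + cnjv (X s (- k))))) has_vector_derivative
      proj_perp k ((1 / 2) *\<^sub>R (c *\<^sub>R F k + cnjv (c *\<^sub>R F (- k))))) (at t within I)"
    by (intro bounded_linear.has_vector_derivative[OF bounded_linear_proj_perp]
        bounded_linear.has_vector_derivative[OF bounded_linear_scaleR_right] has_vector_derivative_add
        bounded_linear.has_vector_derivative[OF bounded_linear_cnjv] d) (use True in simp_all)
  moreover have "proj_perp k ((1 / 2) *\<^sub>R (c *\<^sub>R F k + cnjv (c *\<^sub>R F (- k)))) = c *\<^sub>R trunc N F k"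
    using gproj_fixed[OF ns_coeffs_scaleR[OF F, of c] True] True by (simp add: gproj_def trunc_def del: scaleR_right_distrib)
  ultimately show ?thesis using True by (simp add: gproj_def)
next
  case False
  thus ?thesis by (simp add: gproj_outside trunc_def)
qed

text \<open>When the equation is tested with its solution at order 0, the convection term vanishes
  and viscosity only helps, so the L^2 norm does not grow, also if the right-hand side is multiplied
  by a nonnegative factor. This is the a priori bound that lets the finite system be solved on any
  interval.\<close>

lemma galerkin_exists:
  fixes a0 :: "int^('d::finite) \<Rightarrow> complex^'d" and \<nu> \<tau> :: real
  assumes nu: "0 \<le> \<nu>" and \<tau>: "0 \<le> \<tau>" and a0: "a0 \<in> ns_coeffs"
  obtains A where "\<And>t. A t \<in> ns_coeffs" "\<And>t. trunc N (A t) = A t" "A 0 = trunc N a0"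
    "\<And>t k. t \<in> {0..\<tau>} \<Longrightarrow> ((\<lambda>s. A s k) has_vector_derivative trunc N (nsrhs \<nu> (A t)) k) (at t within {0..\<tau>})"
proof -
  let ?K = "modes N :: (int^'d) set"
  define E0 where "E0 = (\<Sum>k\<in>?K. a0 k \<bullet> a0 k)"
  \<comment> \<open>Each of the finitely many coefficients is bounded by the L^2 norm
    \<open>sqrt E0\<close> of the truncated data; the summand 1 keeps \<open>R\<close>
    positive.\<close>
  define R where "R = real (card ?K) * sqrt E0 + 1"
  have E00: "0 \<le> E0" unfolding E0_def by (intro sum_nonneg) simp
  have R: "R > 0" unfolding R_def using E00 by (intro add_nonneg_pos mult_nonneg_nonneg) auto
  define C where "C = \<nu> * (real N)\<^sup>2 + real (card ?K) * (cmod (cvol TYPE('d)) * (1 + real N))"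
  have C: "C \<ge> 0" unfolding C_def using nu by (intro add_nonneg_nonneg mult_nonneg_nonneg) auto
  define f where "f = (\<lambda>x :: int^'d \<Rightarrow> complex^'d. nsrhs \<nu> (gproj N x))"
  have ff: "f x \<in> ns_coeffs" for x unfolding f_def by (intro ns_coeffs_nsrhs ns_coeffs_gproj)
  obtain X where X0: "\<And>k. k \<in> ?K \<Longrightarrow> X 0 k = a0 k"
    and dX: "\<And>t k. t \<in> {0..\<tau>} \<Longrightarrow> k \<in> ?K \<Longrightarrow> ((\<lambda>s. X s k) has_vector_derivative f (X t) k) (at t within {0..\<tau>})"
  proof (rule picard_cutoff[of ?K \<tau> C R f a0])
    show "finite ?K" by (rule finite_modes)
    show "(\<Sum>i\<in>?K. norm (f x i - f y i)) \<le> C * (1 + (\<Sum>i\<in>?K. norm (x i)) + (\<Sum>i\<in>?K. norm (y i))) * (\<Sum>i\<in>?K. norm (x i - y i))" for x y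
      unfolding f_def C_def by (rule galerkin_lipschitz[OF nu])
  next
    fix x :: "real \<Rightarrow> int^'d \<Rightarrow> complex^'d" and \<theta> :: "real \<Rightarrow> real" and t
    assume x0: "\<And>i. i \<in> ?K \<Longrightarrow> x 0 i = a0 i" and \<theta>: "\<And>t. t \<in> {0..\<tau>} \<Longrightarrow> 0 \<le> \<theta> t"
      and dx: "\<And>t i. t \<in> {0..\<tau>} \<Longrightarrow> i \<in> ?K \<Longrightarrow> ((\<lambda>s. x s i) has_vector_derivative \<theta> t *\<^sub>R f (x t) i) (at t within {0..\<tau>})"
      and t: "t \<in> {0..\<tau>}"
    define b where "b = (\<lambda>s. gproj N (x s))"
    have b: "b s \<in> ns_coeffs" for s unfolding b_def by (rule ns_coeffs_gproj)
    have db: "((\<lambda>s. b s k) has_vector_derivative \<theta> t *\<^sub>R trunc N (f (x t)) k) (at t within {0..\<tau>})" if "t \<in> {0..\<tau>}" for t k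
      unfolding b_def by (rule has_vector_derivative_gproj[OF dx[OF that] ff])
    \<comment> \<open>The right-hand side lies in the constrained space, so \<open>x\<close> and its
      projection have equal derivatives on the modes and equal initial values: the constraints are
      preserved.\<close>
    have xb: "x s k = b s k" if s: "s \<in> {0..\<tau>}" and k: "k \<in> ?K" for s k
    proof -
      have "((\<lambda>s. x s k - b s k) has_vector_derivative 0) (at r within {0..\<tau>})" if "r \<in> {0..\<tau>}" for r
        using has_vector_derivative_diff[OF dx[OF that k] db[OF that, of k]] k by (simp add: trunc_def)
      then obtain c where c: "\<And>r. r \<in> {0..\<tau>} \<Longrightarrow> x r k - b r k = c"
        using has_vector_derivative_zero_constant[of "{0..\<tau>}" "\<lambda>s. x s k - b s k"] by auto
      have "b 0 k = a0 k"
        using gproj_cong[of N "x 0" a0] x0 gproj_fixed[OF a0 k] by (simp add: b_def)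
      hence "c = 0" using c[of 0] x0[OF k] \<tau> by simp
      thus ?thesis using c[OF s] by simp
    qed
    have bout: "k \<notin> ?K \<Longrightarrow> b s k = 0" for s k by (simp add: b_def gproj_outside)
    have E: "inn 0 (b s) (b s) = (\<Sum>k\<in>?K. b s k \<bullet> b s k)" for s
      by (rule nrm0_le_sum(2)[OF ns_coeffsD(1)[OF b] bout])
    have "inn 0 (b t) (b t) \<le> inn 0 (b 0) (b 0)"
    proof (rule nonpos_derivative_imp_le)
      show "0 \<le> t" using t by simp
      fix s assume "s \<in> {0..t}"
      hence s: "s \<in> {0..\<tau>}" using t by auto
      have "((\<lambda>s. \<Sum>k\<in>?K. b s k \<bullet> b s k) has_vector_derivative
          (\<Sum>k\<in>?K. b s k \<bullet> (\<theta> s *\<^sub>R trunc N (f (x s)) k) + (\<theta> s *\<^sub>R trunc N (f (x s)) k) \<bullet> b s k)) (at s within {0..\<tau>})"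
        by (intro has_vector_derivative_sum bounded_bilinear.has_vector_derivative[OF bounded_bilinear_inner] db s)
      also have "(\<lambda>s. \<Sum>k\<in>?K. b s k \<bullet> b s k) = (\<lambda>s. inn 0 (b s) (b s))" using E by simp
      finally have "((\<lambda>s. inn 0 (b s) (b s)) has_real_derivative
          (\<Sum>k\<in>?K. b s k \<bullet> (\<theta> s *\<^sub>R trunc N (f (x s)) k) + (\<theta> s *\<^sub>R trunc N (f (x s)) k) \<bullet> b s k)) (at s within {0..\<tau>})"
        by (simp add: has_real_derivative_iff_has_vector_derivative)
      thus "((\<lambda>s. inn 0 (b s) (b s)) has_real_derivative
          (\<Sum>k\<in>?K. b s k \<bullet> (\<theta> s *\<^sub>R trunc N (f (x s)) k) + (\<theta> s *\<^sub>R trunc N (f (x s)) k) \<bullet> b s k)) (at s within {0..t})"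
        by (rule DERIV_subset) (use t in auto)
      have fb: "f (x s) = nsrhs \<nu> (b s)" by (simp add: f_def b_def)
      have bz: "b s 0 = 0" by (rule ns_coeffsD(4)[OF b])
      have "(\<Sum>k\<in>?K. b s k \<bullet> (\<theta> s *\<^sub>R trunc N (f (x s)) k) + (\<theta> s *\<^sub>R trunc N (f (x s)) k) \<bullet> b s k)
          = 2 * \<theta> s * (\<Sum>k\<in>?K. nsrhs \<nu> (b s) k \<bullet> b s k)"
        unfolding sum_distrib_left fb by (intro sum.cong) (simp_all add: trunc_def inner_commute)
      also have "(\<Sum>k\<in>?K. nsrhs \<nu> (b s) k \<bullet> b s k) = inn 0 (nsrhs \<nu> (b s)) (b s)"
      proof -
        have "(\<Sum>\<^sub>\<infinity>k. nsrhs \<nu> (b s) k \<bullet> b s k) = (\<Sum>\<^sub>\<infinity>k\<in>?K. nsrhs \<nu> (b s) k \<bullet> b s k)"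
          by (rule infsum_cong_neutral) (auto simp: bout)
        thus ?thesis by (simp add: inn0_eq[of "b s", OF bz] finite_modes)
      qed
      also have "\<dots> = - \<nu> * inn (0 + 1) (b s) (b s)"
        by (simp add: inn_nsrhs[OF b] Bil_cancel[OF b b])
      finally show "(\<Sum>k\<in>?K. b s k \<bullet> (\<theta> s *\<^sub>R trunc N (f (x s)) k) + (\<theta> s *\<^sub>R trunc N (f (x s)) k) \<bullet> b s k) \<le> 0"
        using \<theta>[OF s] nu inn_self_nonneg[of "0 + 1" "b s"] by (simp add: mult_nonneg_nonneg)
    qed
    also have "inn 0 (b 0) (b 0) = E0"
      unfolding E E0_def using xb[of 0] x0 \<tau> by (intro sum.cong refl) (metis atLeastAtMost_iff order_refl)
    finally have Et: "inn 0 (b t) (b t) \<le> E0" .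
    have "(\<Sum>k\<in>?K. norm (x t k)) \<le> (\<Sum>k\<in>?K. sqrt E0)"
    proof (rule sum_mono)
      fix k assume k: "k \<in> ?K"
      have "norm (b t k) \<le> nrm 0 (b t)" by (rule component_le_nrm0[OF ns_coeffsD(1)[OF b] ns_coeffsD(4)[OF b]])
      also have "\<dots> \<le> sqrt E0" unfolding nrm_def using Et by (rule real_sqrt_le_mono)
      finally show "norm (x t k) \<le> sqrt E0" using xb[OF t k] by simp
    qed
    thus "(\<Sum>k\<in>?K. norm (x t k)) \<le> R" by (simp add: R_def)
  qed (use \<tau> C R in auto)
  show ?thesis
  proof (rule that[of "\<lambda>t. gproj N (X t)"])
    show "gproj N (X 0) = trunc N a0"
    proof
      fix k
      show "gproj N (X 0) k = trunc N a0 k"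
        using gproj_cong[of N "X 0" a0] X0 gproj_fixed[OF a0] by (cases "k \<in> ?K") (simp_all add: trunc_def gproj_outside)
    qed
    fix t k assume t: "t \<in> {0..\<tau>}"
    have "((\<lambda>s. gproj N (X s) k) has_vector_derivative 1 *\<^sub>R trunc N (f (X t)) k) (at t within {0..\<tau>})"
      by (rule has_vector_derivative_gproj) (use dX[OF t] ff in simp_all)
    thus "((\<lambda>s. gproj N (X s) k) has_vector_derivative trunc N (nsrhs \<nu> (gproj N (X t))) k) (at t within {0..\<tau>})"
      by (simp add: f_def)
  qed (rule ns_coeffs_gproj, rule trunc_gproj)
qed

section \<open>Stability estimates in L^2 and the limit of the Galerkin solutions\<close>

lemma nrm_triangle:
  assumes "rapid {a}" "rapid {b}"
  shows "nrm p (\<lambda>k. a k + b k) \<le> nrm p a + nrm p b"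
proof (rule power2_le_imp_le)
  have "inn p (\<lambda>k. a k + b k) (\<lambda>k. a k + b k) = inn p a a + 2 * inn p a b + inn p b b"
    by (simp add: inn_add_left[OF rapid_add[OF assms] assms] inn_add_right assms inn_commute[of p b a])
  also have "\<dots> \<le> inn p a a + 2 * (nrm p a * nrm p b) + inn p b b"
    using inn_Cauchy_Schwarz[OF assms, of p] by linarith
  also have "\<dots> = (nrm p a + nrm p b)\<^sup>2"
    by (simp add: power2_sum nrm_sq)
  finally show "(nrm p (\<lambda>k. a k + b k))\<^sup>2 \<le> (nrm p a + nrm p b)\<^sup>2" by (simp add: nrm_sq)
qed (simp add: nrm_nonneg)

lemma nrm_trunc_le:
  assumes "rapid {a}" shows "nrm p (trunc N a) \<le> nrm p a"
  unfolding nrm_def inn_def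
  by (intro real_sqrt_le_mono infsum_mono summable_inn rapid_trunc assms) (simp add: trunc_def)

text \<open>Only modes with |k| > N survive, and one order of smoothness is traded for a factor 1 /
  N.\<close>

lemma nrm_tail_le:
  fixes a :: "int^('d::finite) \<Rightarrow> complex^'d"
  assumes "rapid {a}" "a 0 = 0" "0 < N"
  shows "nrm 0 (\<lambda>k. a k - trunc N a k) \<le> nrm 1 a / real N"
proof -
  have r: "rapid {\<lambda>k. a k - trunc N a k}" by (intro rapid_diff rapid_trunc assms)
  have "inn 0 (\<lambda>k. a k - trunc N a k) (\<lambda>k. a k - trunc N a k)
      \<le> (\<Sum>\<^sub>\<infinity>k. (1 / (real N)\<^sup>2) * (norm (wavevec k) powr (2 * 1) * (a k \<bullet> a k)))"
    unfolding inn_def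
  proof (rule infsum_mono[OF summable_inn[OF r r]])
    show "(\<lambda>k. (1 / (real N)\<^sup>2) * (norm (wavevec k) powr (2 * 1) * (a k \<bullet> a k))) summable_on UNIV"
      by (intro summable_on_cmult_right summable_inn assms)
    fix k :: "int^'d"
    show "norm (wavevec k) powr (2 * 0) * ((a k - trunc N a k) \<bullet> (a k - trunc N a k))
        \<le> (1 / (real N)\<^sup>2) * (norm (wavevec k) powr (2 * 1) * (a k \<bullet> a k))"
    proof (cases "k = 0 \<or> k \<in> modes N")
      case True
      hence "a k - trunc N a k = 0" using assms(2) by (auto simp: trunc_def)
      thus ?thesis by simp
    next
      case False
      hence k: "k \<noteq> 0" "real N < norm (wavevec k)" by (auto simp: modes_def)
      have "(real N)\<^sup>2 \<le> (norm (wavevec k))\<^sup>2" using k(2) by (intro power_mono) auto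
      hence "1 \<le> (1 / (real N)\<^sup>2) * (norm (wavevec k))\<^sup>2" using assms(3) by (simp add: pos_le_divide_eq)
      hence "1 * (a k \<bullet> a k) \<le> (1 / (real N)\<^sup>2) * (norm (wavevec k))\<^sup>2 * (a k \<bullet> a k)" by (intro mult_right_mono) auto
      moreover have "norm (wavevec k) powr (2 * 1) = (norm (wavevec k))\<^sup>2" using k by simp
      moreover have "norm (wavevec k) powr (2 * 0) = 1" using k(1) by simp
      moreover have "trunc N a k = 0" using False by (simp add: trunc_def)
      ultimately show ?thesis by simp
    qed
  qed
  also have "\<dots> = (1 / (real N)\<^sup>2) * inn 1 a a" unfolding inn_def by (rule infsum_cmult_right')
  also have "\<dots> = (nrm 1 a / real N)\<^sup>2" by (simp add: power_divide nrm_sq)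
  finally have "(nrm 0 (\<lambda>k. a k - trunc N a k))\<^sup>2 \<le> (nrm 1 a / real N)\<^sup>2" by (simp add: nrm_sq)
  thus ?thesis by (rule power2_le_imp_le) (simp add: nrm_nonneg)
qed

text \<open>The viscous term of the difference has a sign and is dropped, so the constant does not
  depend on \<open>\<nu>\<close>.\<close>

lemma inn0_nsrhs_diff_le:
  assumes "a \<in> ns_coeffs" "b \<in> ns_coeffs" "0 \<le> \<nu>"
  defines "w \<equiv> \<lambda>k. a k - b k"
  shows "inn 0 w (\<lambda>k. nsrhs \<nu> a k - nsrhs \<nu> b k) \<le> lip1 b * (nrm 0 w)\<^sup>2"
proof -
  have w: "w \<in> ns_coeffs" unfolding w_def by (rule ns_coeffs_diff[OF assms(1,2)])
  note r = ns_coeffsD(1)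
  have rB: "rapid {\<lambda>k. Bil a a k - Bil b b k}"
    by (intro rapid_diff rapid_Bil_single r assms(1,2))
  have "(\<lambda>k. nsrhs \<nu> a k - nsrhs \<nu> b k) = (\<lambda>k. \<nu> *\<^sub>R lapl w k + (Bil a a k - Bil b b k))"
    by (rule ext) (simp add: nsrhs_def lapl_def w_def scaleR_right_diff_distrib)
  hence "inn 0 w (\<lambda>k. nsrhs \<nu> a k - nsrhs \<nu> b k) = inn 0 w (\<lambda>k. \<nu> *\<^sub>R lapl w k) + inn 0 w (\<lambda>k. Bil a a k - Bil b b k)"
    using inn_add_right[OF r[OF w] rapid_scaleR[OF r[OF ns_coeffs_lapl[OF w]]] rB] by simp
  also have "inn 0 w (\<lambda>k. \<nu> *\<^sub>R lapl w k) = - (\<nu> * inn (0 + 1) w w)"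
    by (simp add: inn_scaleR_right inn_commute[of 0 w "lapl w"] inn_lapl)
  also have "\<dots> \<le> 0" using assms(3) inn_self_nonneg[of "0 + 1" w] by (simp add: mult_nonneg_nonneg)
  also have "inn 0 w (\<lambda>k. Bil a a k - Bil b b k) \<le> lip1 b * (nrm 0 w)\<^sup>2"
    using inn0_Bil_diff_le[OF assms(1,2)] by (simp add: w_def inn_commute)
  finally show ?thesis by simp
qed

text \<open>A bound in L^2 for each mode separately, growing with \<open>k\<close>; it is enough for
  passing to the limit in the equation coefficient by coefficient.\<close>

lemma norm_nsrhs_diff_le:
  fixes a b :: "int^('d::finite) \<Rightarrow> complex^'d"
  assumes "a \<in> ns_coeffs" "b \<in> ns_coeffs" "0 \<le> \<nu>"
  shows "norm (nsrhs \<nu> a k - nsrhs \<nu> b k)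
    \<le> (\<nu> * (norm (wavevec k))\<^sup>2 + cmod (cvol TYPE('d)) * br k * (nrm 0 a + nrm 0 b)) * nrm 0 (\<lambda>k. a k - b k)"
proof -
  define d where "d = (\<lambda>k. a k - b k)"
  have d: "d \<in> ns_coeffs" unfolding d_def by (rule ns_coeffs_diff[OF assms(1,2)])
  note D = ns_coeffsD
  have eq: "nsrhs \<nu> a k - nsrhs \<nu> b k = \<nu> *\<^sub>R lapl d k + (Bil a d k + Bil d b k)"
    unfolding d_def nsrhs_def lapl_def
    by (simp add: Bil_diff_left Bil_diff_right D(1)[OF assms(1)] D(1)[OF assms(2)] algebra_simps)
  have "norm (\<nu> *\<^sub>R lapl d k) = \<nu> * (norm (wavevec k))\<^sup>2 * norm (d k)" using assms(3) by (simp add: lapl_def)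
  also have "\<dots> \<le> \<nu> * (norm (wavevec k))\<^sup>2 * nrm 0 d"
    using assms(3) by (intro mult_left_mono component_le_nrm0 D[OF d]) auto
  finally have 1: "norm (\<nu> *\<^sub>R lapl d k) \<le> \<nu> * (norm (wavevec k))\<^sup>2 * nrm 0 d" .
  have 2: "norm (Bil a d k) \<le> cmod (cvol TYPE('d)) * br k * (nrm 0 a * nrm 0 d)"
    by (intro norm_Bil_le_nrm0 D[OF d] D[OF assms(1)])
  have 3: "norm (Bil d b k) \<le> cmod (cvol TYPE('d)) * br k * (nrm 0 d * nrm 0 b)"
    by (intro norm_Bil_le_nrm0 D[OF d] D[OF assms(2)])
  have "norm (nsrhs \<nu> a k - nsrhs \<nu> b k) \<le> norm (\<nu> *\<^sub>R lapl d k) + (norm (Bil a d k) + norm (Bil d b k))"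
    unfolding eq by (intro order_trans[OF norm_triangle_ineq] add_left_mono norm_triangle_ineq)
  also have "\<dots> \<le> \<nu> * (norm (wavevec k))\<^sup>2 * nrm 0 d + (cmod (cvol TYPE('d)) * br k * (nrm 0 a * nrm 0 d) + cmod (cvol TYPE('d)) * br k * (nrm 0 d * nrm 0 b))"
    by (intro add_mono 1 2 3)
  also have "\<dots> = (\<nu> * (norm (wavevec k))\<^sup>2 + cmod (cvol TYPE('d)) * br k * (nrm 0 a + nrm 0 b)) * nrm 0 d"
    by (simp add: algebra_simps)
  finally show ?thesis by (simp only: d_def)
qed

lemma difference_gronwall:
  fixes w D :: "real \<Rightarrow> int^('d::finite) \<Rightarrow> complex^'d"
  assumes t: "0 \<le> t" and w: "\<And>s. s \<in> {0..t} \<Longrightarrow> rapid {w s}" and D: "\<And>s. s \<in> {0..t} \<Longrightarrow> rapid {D s}"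
    and c: "\<And>s. s \<in> {0..t} \<Longrightarrow> has_cderiv w (D s) s {0..t}"
    and le: "\<And>s. s \<in> {0..t} \<Longrightarrow> inn 0 (w s) (D s) \<le> L * (nrm 0 (w s))\<^sup>2 + \<epsilon>" and L: "0 \<le> L" and e: "0 \<le> \<epsilon>"
  shows "(nrm 0 (w t))\<^sup>2 \<le> ((nrm 0 (w 0))\<^sup>2 + 2 * \<epsilon> * t) * exp (2 * L * t)"
  unfolding nrm_sq
proof (rule gronwall_le[OF t energy_has_derivative[OF c w _ D]])
  fix s assume "s \<in> {0..t}"
  from le[OF this] show "2 * inn 0 (w s) (D s) \<le> 2 * L * inn 0 (w s) (w s) + 2 * \<epsilon>"
    unfolding nrm_sq by simp
qed (use L e in auto)

text \<open>Smallness at the end time \<open>\<tau>\<close> spreads to the whole interval by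
  monotonicity of \<open>e_visc\<close> and yields bounds in all orders, uniform in the truncation.
  The limit inherits them, and the limit in the equation is taken one coefficient at a time.\<close>

lemma ns_coeffs_exists:
  fixes a0 :: "int^('d::finite) \<Rightarrow> complex^'d" and \<nu> \<tau> :: real
  assumes nu: "0 \<le> \<nu>" and \<tau>: "0 \<le> \<tau>" and a0: "a0 \<in> ns_coeffs"
    and Gpos: "0 < G" and G: "\<And>a :: int^'d \<Rightarrow> complex^'d. a \<in> ns_coeffs \<Longrightarrow> \<bar>inn n (Bil a a) a\<bar> \<le> G * nrm n a * (nrm n a)\<^sup>2"
    and Hpos: "\<And>p. n \<le> p \<Longrightarrow> 0 < H p"
    and H: "\<And>p (a :: int^'d \<Rightarrow> complex^'d). n \<le> p \<Longrightarrow> a \<in> ns_coeffs \<Longrightarrow> \<bar>inn p (Bil a a) a\<bar> \<le> H p * nrm n a * (nrm p a)\<^sup>2"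
    and small: "G * nrm n a0 * e_visc \<nu> \<tau> < 1"
  obtains A where "\<And>t. t \<in> {0..\<tau>} \<Longrightarrow> A t \<in> ns_coeffs" "rapid (A ` {0..\<tau>})" "A 0 = a0"
    "\<And>t k. t \<in> {0..\<tau>} \<Longrightarrow> ((\<lambda>s. A s k) has_vector_derivative nsrhs \<nu> (A t) k) (at t within {0..\<tau>})"
proof -
  let ?I = "{0..\<tau>}"
  have "\<forall>N. \<exists>A. (\<forall>t. A t \<in> ns_coeffs) \<and> (\<forall>t. trunc N (A t) = A t) \<and> A 0 = trunc N a0 \<and>
    (\<forall>t\<in>?I. \<forall>k. ((\<lambda>s. A s k) has_vector_derivative trunc N (nsrhs \<nu> (A t)) k) (at t within ?I))"
    using galerkin_exists[OF nu \<tau> a0] by metis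
  then obtain A where A: "\<And>N t. A N t \<in> ns_coeffs" and tA: "\<And>N t. trunc N (A N t) = A N t" and A0: "\<And>N. A N 0 = trunc N a0"
    and dA: "\<And>N t k. t \<in> ?I \<Longrightarrow> ((\<lambda>s. A N s k) has_vector_derivative trunc N (nsrhs \<nu> (A N t)) k) (at t within ?I)"
    by metis
  note rA = ns_coeffsD(1)[OF A]
  define D where "D = (\<lambda>N t. trunc N (nsrhs \<nu> (A N t)))"
  have rD: "rapid {D N t}" for N t unfolding D_def by (intro rapid_trunc ns_coeffsD(1) ns_coeffs_nsrhs A)
  \<comment> \<open>For a single \<open>N\<close> only, from finite support and continuity on a
    compact interval; it makes the curve differentiable in the Sobolev norms before any uniform
    bound is known.\<close>
  have rAI: "rapid (A N ` ?I)" for N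
  proof -
    have "\<exists>B. \<forall>t\<in>?I. norm (A N t k) \<le> B" for k
    proof -
      have "continuous_on ?I (\<lambda>t. A N t k)"
        by (rule continuous_on_vector_derivative[OF dA])
      hence "bounded ((\<lambda>t. A N t k) ` ?I)" by (intro compact_imp_bounded compact_continuous_image) auto
      thus ?thesis unfolding bounded_iff by blast
    qed
    then obtain B where B: "\<And>k t. t \<in> ?I \<Longrightarrow> norm (A N t k) \<le> B k" by metis
    show ?thesis
    proof (rule rapid_finite_support[OF finite_modes[of N], where B = B])
      fix a and k :: "int^'d" assume "a \<in> A N ` ?I" "k \<notin> modes N"
      then obtain t where "a = A N t" by blast
      hence "a k = trunc N (A N t) k" by (simp add: tA)
      thus "a k = 0" using \<open>k \<notin> modes N\<close> by (simp add: trunc_def)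
    qed (use B in auto)
  qed
  have rDI: "rapid (D N ` ?I)" for N
  proof -
    have "D N ` ?I = trunc N ` nsrhs \<nu> ` A N ` ?I" by (auto simp: D_def image_iff)
    thus ?thesis using rapid_trunc_image[OF rapid_nsrhs[OF rAI]] by simp
  qed
  have cA: "has_cderiv (A N) (D N t) t ?I" if "t \<in> ?I" for N t
    by (rule has_cderiv_of_components[OF _ that rDI]) (use dA in \<open>simp_all add: D_def\<close>)
  \<comment> \<open>The smallest value of the denominator on \<open>{0..\<tau>}\<close>.\<close>
  define q where "q = 1 - G * nrm n a0 * e_visc \<nu> \<tau>"
  have q: "0 < q" using small by (simp add: q_def)
  have bound: "nrm p (A N t) \<le> nrm p a0 / q powr (H p / G)" if p: "n \<le> p" and t: "t \<in> ?I" for p N t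
  proof -
    have sub: "{0..t} \<subseteq> ?I" using t by auto
    have Gle: "G * nrm n a0 * e_visc \<nu> t \<le> G * nrm n a0 * e_visc \<nu> \<tau>"
      using t Gpos nrm_nonneg[of n a0] by (intro mult_left_mono e_visc_mono nu) auto
    have "nrm p (A N t) \<le> nrm p a0 * exp (- \<nu> * t) / (1 - G * nrm n a0 * e_visc \<nu> t) powr (H p / G)"
    proof (rule apriori_bound(2)[where A = "A N" and D = "D N" and n = n])
      show "0 \<le> t" using t by simp
      show "has_cderiv (A N) (D N s) s {0..t}" if "s \<in> {0..t}" for s
        by (rule has_cderiv_subset[OF cA sub]) (use that t in auto)
      show "inn r (A N s) (D N s) \<le> - \<nu> * inn (r + 1) (A N s) (A N s) + inn r (Bil (A N s) (A N s)) (A N s)" for s r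
        unfolding D_def inn_commute[of r "A N s"] inn_trunc_left[OF tA] inn_nsrhs[OF A] by (simp add: inn_commute)
      show "nrm n (A N 0) \<le> nrm n a0" "nrm p (A N 0) \<le> nrm p a0"
        unfolding A0 by (rule nrm_trunc_le[OF ns_coeffsD(1)[OF a0]])+
      show "G * nrm n a0 * e_visc \<nu> t < 1" using Gle small by simp
    qed (use A rD G H[OF p] Hpos[OF p] Gpos nu in auto)
    also have "\<dots> \<le> nrm p a0 / q powr (H p / G)"
    proof (rule frac_le)
      have "nrm p a0 * exp (- \<nu> * t) \<le> nrm p a0 * 1"
        using t nu by (intro mult_left_mono nrm_nonneg) (auto simp: mult_nonneg_nonneg)
      thus "nrm p a0 * exp (- \<nu> * t) \<le> nrm p a0" by simp
      show "q powr (H p / G) \<le> (1 - G * nrm n a0 * e_visc \<nu> t) powr (H p / G)"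
        using q Gle Hpos[OF p] Gpos unfolding q_def by (intro powr_mono2) auto
    qed (use nrm_nonneg q in auto)
    finally show ?thesis .
  qed
  define S where "S = {A N t |N t. t \<in> ?I}"
  have SI: "A N t \<in> S" if "t \<in> ?I" for N t using that by (auto simp: S_def)
  have rS: "rapid S"
  proof (rule rapid_of_nrm)
    fix p
    show "\<exists>M. \<forall>a\<in>S. nrm p a \<le> M"
    proof (intro exI ballI)
      fix a assume "a \<in> S"
      then obtain N t where a: "a = A N t" "t \<in> ?I" by (auto simp: S_def)
      \<comment> \<open>The bounds are available from order \<open>n\<close> on; lower orders follow
        by monotonicity.\<close>
      have "nrm p a \<le> nrm (max p n) a" unfolding a(1) by (rule nrm_mono[OF rA]) simp
      also have "\<dots> \<le> nrm (max p n) a0 / q powr (H (max p n) / G)"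
        unfolding a(1) by (rule bound) (use a(2) in auto)
      finally show "nrm p a \<le> nrm (max p n) a0 / q powr (H (max p n) / G)" .
    qed
  next
    fix a p assume "a \<in> S"
    then obtain N t where a: "a = A N t" by (auto simp: S_def)
    show "(\<lambda>k. norm (wavevec k) powr (2 * p) * (a k \<bullet> a k)) summable_on UNIV"
      unfolding a by (rule summable_inn[OF rA rA])
    show "a 0 = 0" unfolding a by (rule ns_coeffsD(4)[OF A])
  qed
  obtain C0 where C0: "C0 \<ge> 0" "\<And>a. a \<in> S \<Longrightarrow> nrm 0 a \<le> C0" using nrm_bounded[OF rS, of 0] by blast
  obtain C1 where C1: "C1 \<ge> 0" "\<And>a. a \<in> nsrhs \<nu> ` S \<Longrightarrow> nrm 1 a \<le> C1" by (rule nrm_bounded[OF rapid_nsrhs[OF rS, of \<nu>], where p = 1]) (rule that)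
  obtain L where L: "L \<ge> 0" "\<And>b. b \<in> S \<Longrightarrow> lip1 b \<le> L" using lip1_bounded[OF rS] by blast
  \<comment> \<open>Bounds the squared L^2 distance between truncation \<open>M\<close> and all
    finer ones: the truncation error of the data, plus the contribution of the defect
    \<open>2 * C0 * (C1 / real M)\<close> of the coarser equation, amplified by Gronwall.\<close>
  define \<delta> where "\<delta> = (\<lambda>M. ((nrm 1 a0 / real M)\<^sup>2 + 2 * (2 * C0 * (C1 / real M)) * \<tau>) * exp (2 * L * \<tau>))"
  have diff: "(nrm 0 (\<lambda>k. A N t k - A M t k))\<^sup>2 \<le> \<delta> M" if t: "t \<in> ?I" and MN: "0 < M" "M \<le> N" for t M N
  proof -
    define w where "w = (\<lambda>t k. A N t k - A M t k)"
    have wn: "w s \<in> ns_coeffs" for s unfolding w_def by (rule ns_coeffs_diff[OF A A])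
    have mMN: "modes M \<subseteq> modes N" using MN by (auto simp: modes_def)
    \<comment> \<open>The difference lies in the finer Galerkin space, so truncation at
      \<open>N\<close> disappears when tested with it; the tail beyond \<open>M\<close> of the
      right-hand side at \<open>A M s\<close> is the only defect.\<close>
    have tw: "trunc N (w s) = w s" for s
    proof
      fix k
      have "A N s k = 0" "A M s k = 0" if "k \<notin> modes N"
      proof -
        have "k \<notin> modes M" using that mMN by blast
        thus "A N s k = 0" "A M s k = 0"
          using fun_cong[OF tA[of N s], of k] fun_cong[OF tA[of M s], of k] that by (simp_all add: trunc_def)
      qed
      thus "trunc N (w s) k = w s k" by (simp add: trunc_def w_def)
    qed
    define E where "E = (\<lambda>s k. D N s k - D M s k)"
    have rE: "rapid {E s}" for s unfolding E_def by (rule rapid_diff[OF rD rD])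
    have rEI: "rapid (E ` ?I)"
      by (rule rapidI_add[OF rDI[of N] rDI[of M]]) (auto simp: E_def intro!: norm_triangle_ineq4)
    have sub: "{0..t} \<subseteq> ?I" using t by auto
    have cw: "has_cderiv w (E s) s {0..t}" if "s \<in> {0..t}" for s
    proof (rule has_cderiv_subset[OF has_cderiv_of_components sub])
      show "rapid (E ` ?I)" by (rule rEI)
      show "((\<lambda>s. w s k) has_vector_derivative E r k) (at r within ?I)" if "r \<in> ?I" for r k
        unfolding w_def E_def D_def by (intro has_vector_derivative_diff dA that)
    qed (use that sub in auto)
    have "(nrm 0 (w t))\<^sup>2 \<le> ((nrm 0 (w 0))\<^sup>2 + 2 * (2 * C0 * (C1 / real M)) * t) * exp (2 * L * t)"
    proof (rule difference_gronwall[OF _ _ rE cw])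
      fix s assume "s \<in> {0..t}"
      hence s: "s \<in> ?I" using sub by blast
      define a where "a = A N s"
      define b where "b = A M s"
      define x where "x = nsrhs \<nu> b"
      have ab: "a \<in> ns_coeffs" "b \<in> ns_coeffs" "a \<in> S" "b \<in> S" using A SI[OF s] by (auto simp: a_def b_def)
      have wab: "w s = (\<lambda>k. a k - b k)" by (simp add: w_def a_def b_def)
      have x: "x \<in> ns_coeffs" unfolding x_def by (rule ns_coeffs_nsrhs[OF ab(2)])
      note rw = ns_coeffsD(1)[OF wn[of s]] and rx = ns_coeffsD(1)[OF x] and ra = ns_coeffsD(1)[OF ns_coeffs_nsrhs[OF ab(1)]]
      have "inn 0 (w s) (E s) = inn 0 (w s) (trunc N (nsrhs \<nu> a)) - inn 0 (w s) (trunc M x)"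
        unfolding E_def D_def a_def[symmetric] b_def[symmetric] x_def[symmetric]
        by (rule inn_diff_right[OF rw rapid_trunc[OF ra] rapid_trunc[OF rx]])
      also have "inn 0 (w s) (trunc N (nsrhs \<nu> a)) = inn 0 (w s) (nsrhs \<nu> a)"
        using inn_trunc_left[OF tw, of 0 "nsrhs \<nu> a" s] by (simp add: inn_commute)
      also have "inn 0 (w s) (trunc M x) = inn 0 (w s) x - inn 0 (w s) (\<lambda>k. x k - trunc M x k)"
        using inn_diff_right[OF rw rx rapid_trunc[OF rx], of 0] by simp
      also have "inn 0 (w s) (nsrhs \<nu> a) - (inn 0 (w s) x - inn 0 (w s) (\<lambda>k. x k - trunc M x k))
          = inn 0 (w s) (\<lambda>k. nsrhs \<nu> a k - x k) + inn 0 (w s) (\<lambda>k. x k - trunc M x k)"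
        using inn_diff_right[OF rw ra rx, of 0] by simp
      also have "\<dots> \<le> L * (nrm 0 (w s))\<^sup>2 + 2 * C0 * (C1 / real M)"
      proof (rule add_mono)
        have "inn 0 (w s) (\<lambda>k. nsrhs \<nu> a k - x k) \<le> lip1 b * (nrm 0 (w s))\<^sup>2"
          unfolding wab x_def by (rule inn0_nsrhs_diff_le[OF ab(1,2) nu])
        also have "\<dots> \<le> L * (nrm 0 (w s))\<^sup>2" by (intro mult_right_mono L ab) simp
        finally show "inn 0 (w s) (\<lambda>k. nsrhs \<nu> a k - x k) \<le> L * (nrm 0 (w s))\<^sup>2" .
        have "inn 0 (w s) (\<lambda>k. x k - trunc M x k) \<le> nrm 0 (w s) * nrm 0 (\<lambda>k. x k - trunc M x k)"
          using inn_Cauchy_Schwarz[OF rw rapid_diff[OF rx rapid_trunc[OF rx]], of 0 M] by linarith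
        also have "\<dots> \<le> (2 * C0) * (C1 / real M)"
        proof (intro mult_mono nrm_nonneg)
          have "nrm 0 (w s) \<le> nrm 0 a + nrm 0 (\<lambda>k. (- 1) *\<^sub>R b k)"
            using nrm_triangle[OF ns_coeffsD(1)[OF ab(1)] rapid_scaleR[OF ns_coeffsD(1)[OF ab(2)], of "- 1"], of 0] by (simp add: wab)
          also have "nrm 0 (\<lambda>k. (- 1) *\<^sub>R b k) = nrm 0 b"
            unfolding nrm_def inn_scaleR_left inn_scaleR_right by simp
          finally show "nrm 0 (w s) \<le> 2 * C0" using C0(2)[OF ab(3)] C0(2)[OF ab(4)] by simp
          have "nrm 0 (\<lambda>k. x k - trunc M x k) \<le> nrm 1 x / real M"
            by (rule nrm_tail_le[OF rx ns_coeffsD(4)[OF x] MN(1)])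
          also have "\<dots> \<le> C1 / real M" by (intro divide_right_mono C1) (use ab(4) in \<open>auto simp: x_def\<close>)
          finally show "nrm 0 (\<lambda>k. x k - trunc M x k) \<le> C1 / real M" .
        qed (use C0 in auto)
        finally show "inn 0 (w s) (\<lambda>k. x k - trunc M x k) \<le> 2 * C0 * (C1 / real M)" .
      qed
      finally show "inn 0 (w s) (E s) \<le> L * (nrm 0 (w s))\<^sup>2 + 2 * C0 * (C1 / real M)" .
    qed (use t ns_coeffsD(1)[OF wn] C0 C1 L in auto)
    also have "\<dots> \<le> \<delta> M"
      unfolding \<delta>_def
    proof (intro mult_mono add_mono)
      \<comment> \<open>The initial difference consists of the modes of \<open>a0\<close> between
        the two truncations.\<close>
      have "w 0 = trunc N (\<lambda>k. a0 k - trunc M a0 k)"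
      proof
        fix k show "w 0 k = trunc N (\<lambda>k. a0 k - trunc M a0 k) k" using mMN by (auto simp: w_def A0 trunc_def)
      qed
      hence "nrm 0 (w 0) \<le> nrm 0 (\<lambda>k. a0 k - trunc M a0 k)"
        using nrm_trunc_le[OF rapid_diff[OF ns_coeffsD(1)[OF a0] rapid_trunc[OF ns_coeffsD(1)[OF a0]]]] by simp
      also have "\<dots> \<le> nrm 1 a0 / real M" by (rule nrm_tail_le[OF ns_coeffsD(1,4)[OF a0] MN(1)])
      finally show "(nrm 0 (w 0))\<^sup>2 \<le> (nrm 1 a0 / real M)\<^sup>2" using nrm_nonneg by (intro power_mono) auto
      show "exp (2 * L * t) \<le> exp (2 * L * \<tau>)" using t L by (simp add: mult_left_mono)
    qed (use t C0 C1 in auto)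
    finally show ?thesis by (simp add: w_def)
  qed
  have \<delta>: "\<delta> \<longlonglongrightarrow> 0"
  proof -
    have i: "(\<lambda>M. c / real M) \<longlonglongrightarrow> 0" for c :: real by (rule lim_const_over_n)
    have "(\<lambda>M. ((nrm 1 a0 / real M)\<^sup>2 + 2 * (2 * C0 * (C1 / real M)) * \<tau>) * exp (2 * L * \<tau>)) \<longlonglongrightarrow> (0\<^sup>2 + 2 * (2 * C0 * 0) * \<tau>) * exp (2 * L * \<tau>)"
      by (intro tendsto_intros i)
    thus ?thesis by (simp add: \<delta>_def)
  qed
  define \<eta> where "\<eta> = (\<lambda>M. sqrt (\<delta> M))"
  have \<eta>: "\<eta> \<longlonglongrightarrow> 0" using tendsto_real_sqrt[OF \<delta>] by (simp add: \<eta>_def)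
  have diff': "nrm 0 (\<lambda>k. A N t k - A M t k) \<le> \<eta> M" if "t \<in> ?I" "0 < M" "M \<le> N" for t M N
    unfolding \<eta>_def by (rule real_le_rsqrt) (rule diff[OF that])
  have diffk: "norm (A N t k - A M t k) \<le> \<eta> M" if "t \<in> ?I" "0 < M" "M \<le> N" for t M N k
    by (rule order_trans[OF component_le_nrm0 diff'[OF that]]) (intro rapid_diff rA, simp add: ns_coeffsD(4)[OF A])
  define B where "B = (\<lambda>t k. lim (\<lambda>N. A N t k))"
  have conv: "(\<lambda>N. A N t k) \<longlonglongrightarrow> B t k" if t: "t \<in> ?I" for t k
  proof -
    have "Cauchy (\<lambda>N. A N t k)"
    proof (rule metric_CauchyI)
      fix e :: real assume "e > 0"
      hence "eventually (\<lambda>M. \<eta> M < e / 2) sequentially" using order_tendstoD(2)[OF \<eta>, of "e / 2"] by simp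
      then obtain M0 where M0: "\<And>M. M \<ge> M0 \<Longrightarrow> \<eta> M < e / 2" unfolding eventually_sequentially by blast
      define M where "M = Suc M0"
      have M: "\<eta> M < e / 2" "0 < M" using M0[of M] by (auto simp: M_def)
      show "\<exists>M. \<forall>m\<ge>M. \<forall>n\<ge>M. dist (A m t k) (A n t k) < e"
      proof (intro exI allI impI)
        fix m n assume "m \<ge> M" "n \<ge> M"
        hence "dist (A m t k) (A M t k) < e / 2" "dist (A n t k) (A M t k) < e / 2"
          using diffk[OF t M(2), of m k] diffk[OF t M(2), of n k] M(1) by (auto simp: dist_norm)
        thus "dist (A m t k) (A n t k) < e" by (rule dist_triangle_half_l)
      qed
    qed
    thus ?thesis unfolding B_def using Cauchy_convergent convergent_LIMSEQ_iff by blast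
  qed
  have rB: "rapid (B ` ?I)"
    unfolding rapid_def
  proof
    fix r
    obtain M where M: "M \<ge> 0" "\<And>a k. a \<in> S \<Longrightarrow> br k ^ r * norm (a k) \<le> M" using rapidD[OF rS, of r] by blast
    have "br k ^ r * norm (B t k) \<le> M" if t: "t \<in> ?I" for t k
    proof (rule LIMSEQ_le_const2)
      show "(\<lambda>N. br k ^ r * norm (A N t k)) \<longlonglongrightarrow> br k ^ r * norm (B t k)" by (intro tendsto_intros conv t)
    qed (use M(2) SI[OF t] in blast)
    thus "\<exists>M. \<forall>a\<in>B ` ?I. \<forall>k. br k ^ r * norm (a k) \<le> M" by blast
  qed
  have B: "B t \<in> ns_coeffs" if t: "t \<in> ?I" for t
  proof -
    have "rapid {B t}" using rB t by (rule rapid_single[OF _ imageI])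
    moreover have "B t (- k) = cnjv (B t k)" for k
    proof (rule LIMSEQ_unique[OF conv[OF t]])
      have "(\<lambda>N. cnjv (A N t k)) \<longlonglongrightarrow> cnjv (B t k)" by (rule bounded_linear.tendsto[OF bounded_linear_cnjv conv[OF t]])
      thus "(\<lambda>N. A N t (- k)) \<longlonglongrightarrow> cnjv (B t k)" by (simp add: ns_coeffsD(2)[OF A])
    qed
    moreover have "wave_dot k (B t k) = 0" for k
    proof (rule LIMSEQ_unique)
      show "(\<lambda>N. wave_dot k (A N t k)) \<longlonglongrightarrow> wave_dot k (B t k)"
        unfolding wave_dot_def by (intro tendsto_intros conv[OF t])
      show "(\<lambda>N. wave_dot k (A N t k)) \<longlonglongrightarrow> 0" by (simp add: ns_coeffsD(3)[OF A])
    qed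
    moreover have "B t 0 = 0"
    proof (rule LIMSEQ_unique[OF conv[OF t]])
      show "(\<lambda>N. A N t 0) \<longlonglongrightarrow> 0" by (simp add: ns_coeffsD(4)[OF A])
    qed
    ultimately show ?thesis by (simp add: ns_coeffs_def)
  qed
  note rBt = ns_coeffsD(1)[OF B]
  \<comment> \<open>Let the finer truncation tend to infinity in \<open>diff'\<close>; since
    \<open>S\<close> is bounded in all orders, the difference from the limit tends to 0 in L^2 at
    each fixed time.\<close>
  have diffB: "nrm 0 (\<lambda>k. A M t k - B t k) \<le> \<eta> M" if t: "t \<in> ?I" and M: "0 < M" for t M
  proof -
    have "(\<lambda>N. nrm 0 (\<lambda>k. A N t k - B t k)) \<longlonglongrightarrow> 0"
    proof (rule nrm_tendsto_0)
      show "(\<lambda>N. A N t k - B t k) \<longlonglongrightarrow> 0" for k using LIM_zero[OF conv[OF t]] .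
      show "rapid {\<lambda>k. a k - B t k |a. a \<in> S}"
        by (rule rapidI_add[OF rS rBt[OF t]]) (auto intro!: norm_triangle_ineq4 bexI)
      show "\<forall>\<^sub>F N in sequentially. (\<lambda>k. A N t k - B t k) \<in> {\<lambda>k. a k - B t k |a. a \<in> S}"
        using SI[OF t] by (intro always_eventually) blast
    qed
    hence "(\<lambda>N. \<eta> M + nrm 0 (\<lambda>k. A N t k - B t k)) \<longlonglongrightarrow> \<eta> M + 0" by (intro tendsto_intros)
    moreover have "nrm 0 (\<lambda>k. A M t k - B t k) \<le> \<eta> M + nrm 0 (\<lambda>k. A N t k - B t k)" if N: "N \<ge> M" for N
    proof -
      have "nrm 0 (\<lambda>k. A M t k - B t k) \<le> nrm 0 (\<lambda>k. (- 1) *\<^sub>R (A N t k - A M t k)) + nrm 0 (\<lambda>k. A N t k - B t k)"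
        using nrm_triangle[OF rapid_scaleR[OF rapid_diff[OF rA rA], of "- 1" N t M t] rapid_diff[OF rA rBt[OF t]], of 0 N t] by simp
      also have "nrm 0 (\<lambda>k. (- 1) *\<^sub>R (A N t k - A M t k)) = nrm 0 (\<lambda>k. A N t k - A M t k)"
        unfolding nrm_def inn_scaleR_left inn_scaleR_right by simp
      also have "\<dots> \<le> \<eta> M" by (rule diff'[OF t M N])
      finally show ?thesis by simp
    qed
    ultimately have "nrm 0 (\<lambda>k. A M t k - B t k) \<le> \<eta> M + 0"
      by (intro LIMSEQ_le_const) auto
    thus ?thesis by simp
  qed
  obtain C2 where C2: "C2 \<ge> 0" "\<And>a. a \<in> B ` ?I \<Longrightarrow> nrm 0 a \<le> C2" by (rule nrm_bounded[OF rB, where p = 0]) (rule that)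
  have dB: "((\<lambda>s. B s k) has_vector_derivative nsrhs \<nu> (B t) k) (at t within ?I)" if t: "t \<in> ?I" for t k
  proof -
    \<comment> \<open>Lipschitz constant of the right-hand side at mode \<open>k\<close>, uniform in
      time and in the truncation; it gives the uniform convergence of derivatives needed to
      differentiate the limit.\<close>
    define c where "c = \<nu> * (norm (wavevec k))\<^sup>2 + cmod (cvol TYPE('d)) * br k * (C0 + C2)"
    have c0: "c \<ge> 0" unfolding c_def using nu C0 C2 br_pos[of k] by (intro add_nonneg_nonneg mult_nonneg_nonneg) auto
    have "\<exists>g. \<forall>x\<in>?I. (\<lambda>N. A N x k) \<longlonglongrightarrow> g x \<and> (g has_derivative (\<lambda>h. h *\<^sub>R nsrhs \<nu> (B x) k)) (at x within ?I)"
    proof (rule has_derivative_sequence)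
      show "((\<lambda>s. A N s k) has_derivative (\<lambda>h. h *\<^sub>R D N x k)) (at x within ?I)" if "x \<in> ?I" for N x
        using dA[OF that, of N k] by (simp add: has_vector_derivative_def D_def)
      show "(\<lambda>N. A N t k) \<longlonglongrightarrow> B t k" by (rule conv[OF t])
      fix e :: real assume e: "e > 0"
      have "(\<lambda>M. c * \<eta> M) \<longlonglongrightarrow> c * 0" by (intro tendsto_intros \<eta>)
      hence "eventually (\<lambda>M. c * \<eta> M < e) sequentially" using order_tendstoD(2) e by fastforce
      \<comment> \<open>Once the truncation exceeds |k|, it no longer affects mode
        \<open>k\<close>.\<close>
      moreover have "eventually (\<lambda>M. 0 < M \<and> norm (wavevec k) \<le> real M) sequentially"
      proof (rule eventually_sequentiallyI[of "Suc (nat \<lceil>norm (wavevec k)\<rceil>)"])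
        fix M assume "Suc (nat \<lceil>norm (wavevec k)\<rceil>) \<le> M"
        thus "0 < M \<and> norm (wavevec k) \<le> real M" by linarith
      qed
      ultimately show "\<forall>\<^sub>F N in sequentially. \<forall>x\<in>?I. \<forall>h. norm (h *\<^sub>R D N x k - h *\<^sub>R nsrhs \<nu> (B x) k) \<le> e * norm h"
      proof eventually_elim
        case (elim N)
        show ?case
        proof (intro ballI allI)
          fix x h :: real assume x: "x \<in> ?I"
          have "norm (D N x k - nsrhs \<nu> (B x) k) \<le> e"
          proof (cases "k = 0")
            case True
            thus ?thesis using e ns_coeffsD(4)[OF ns_coeffs_nsrhs[OF B[OF x]]] by (simp add: D_def trunc_def zero_notin_modes)
          next
            case False
            hence "D N x k = nsrhs \<nu> (A N x) k" using elim(2) by (simp add: D_def trunc_def modes_def)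
            hence "norm (D N x k - nsrhs \<nu> (B x) k) \<le> (\<nu> * (norm (wavevec k))\<^sup>2 + cmod (cvol TYPE('d)) * br k * (nrm 0 (A N x) + nrm 0 (B x))) * nrm 0 (\<lambda>k. A N x k - B x k)"
              using norm_nsrhs_diff_le[OF A B[OF x] nu, of N x k] by simp
            also have "\<dots> \<le> c * \<eta> N"
              unfolding c_def
            proof (intro mult_mono add_mono mult_left_mono order_refl)
              show "nrm 0 (A N x) \<le> C0" by (rule C0(2)[OF SI[OF x]])
              show "nrm 0 (B x) \<le> C2" by (rule C2(2)) (use x in blast)
              show "nrm 0 (\<lambda>k. A N x k - B x k) \<le> \<eta> N" by (rule diffB[OF x]) (use elim(2) in blast)
            qed (use c0 nu br_pos[of k] nrm_nonneg in \<open>auto simp: c_def less_imp_le intro!: add_nonneg_nonneg\<close>)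
            finally show ?thesis using elim(1) by simp
          qed
          hence "norm h * norm (D N x k - nsrhs \<nu> (B x) k) \<le> norm h * e" by (intro mult_left_mono) auto
          thus "norm (h *\<^sub>R D N x k - h *\<^sub>R nsrhs \<nu> (B x) k) \<le> e * norm h"
            by (simp add: scaleR_right_diff_distrib[symmetric] mult.commute)
        qed
      qed
    qed (use t in auto)
    then obtain g where g: "\<And>x. x \<in> ?I \<Longrightarrow> (\<lambda>N. A N x k) \<longlonglongrightarrow> g x"
      "\<And>x. x \<in> ?I \<Longrightarrow> (g has_derivative (\<lambda>h. h *\<^sub>R nsrhs \<nu> (B x) k)) (at x within ?I)" by blast
    have "B x k = g x" if "x \<in> ?I" for x by (rule LIMSEQ_unique[OF conv[OF that] g(1)[OF that]])
    thus ?thesis using g(2)[OF t] t unfolding has_vector_derivative_def[symmetric]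
      by (intro has_vector_derivative_transform[of t ?I "\<lambda>s. B s k" g])
  qed
  show ?thesis
  proof (rule that[OF B rB _ dB])
    show "B 0 = a0"
    proof
      fix k
      have "eventually (\<lambda>N. A N 0 k = a0 k) sequentially"
      proof (rule eventually_sequentiallyI[of "nat \<lceil>norm (wavevec k)\<rceil>"])
        fix N assume "nat \<lceil>norm (wavevec k)\<rceil> \<le> N"
        hence "norm (wavevec k) \<le> real N" by linarith
        thus "A N 0 k = a0 k" using ns_coeffsD(4)[OF a0] by (auto simp: A0 trunc_def modes_def)
      qed
      hence "(\<lambda>N. A N 0 k) \<longlonglongrightarrow> a0 k" by (rule tendsto_eventually)
      thus "B 0 k = a0 k" using conv[of 0 k] \<tau> LIMSEQ_unique by auto
    qed
  qed
qed

section \<open>Smoothness in time\<close>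

definition comp_deriv :: "real set \<Rightarrow> (real \<Rightarrow> int^'d \<Rightarrow> complex^('d::finite)) \<Rightarrow> (real \<Rightarrow> int^'d \<Rightarrow> complex^'d) \<Rightarrow> bool" where
  "comp_deriv I A D \<longleftrightarrow> (\<forall>t\<in>I. \<forall>k. ((\<lambda>s. A s k) has_vector_derivative D t k) (at t within I))"

definition rapid_curve :: "real set \<Rightarrow> (real \<Rightarrow> int^'d \<Rightarrow> complex^('d::finite)) \<Rightarrow> bool" where
  "rapid_curve I A \<longleftrightarrow> (\<forall>t\<in>I. A t \<in> ns_coeffs) \<and> rapid (A ` I)"

text \<open>Differentiability of order \<open>j\<close> in each coefficient, with all derivatives
  bounded in every norm on \<open>I\<close>; these bounds are what
  \<open>has_cderiv_of_components\<close> needs.\<close>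

primrec smooth_upto :: "nat \<Rightarrow> real set \<Rightarrow> (real \<Rightarrow> int^'d \<Rightarrow> complex^('d::finite)) \<Rightarrow> bool" where
  "smooth_upto 0 I A \<longleftrightarrow> rapid_curve I A"
| "smooth_upto (Suc j) I A \<longleftrightarrow> rapid_curve I A \<and> (\<exists>D. comp_deriv I A D \<and> smooth_upto j I D)"

lemma smooth_upto_rapid: "smooth_upto j I A \<Longrightarrow> rapid_curve I A"
  by (cases j) auto

lemma smooth_upto_SucD: "smooth_upto (Suc j) I A \<Longrightarrow> smooth_upto j I A"
proof (induction j arbitrary: A)
  case (Suc j)
  then obtain D where "rapid_curve I A" "comp_deriv I A D" "smooth_upto (Suc j) I D" by auto
  thus ?case using Suc.IH by auto
qed auto

lemma comp_deriv_cong: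
  assumes "comp_deriv I A D" "\<And>t. t \<in> I \<Longrightarrow> B t = A t"
  shows "comp_deriv I B D"
  unfolding comp_deriv_def
proof (intro ballI allI)
  fix t k assume t: "t \<in> I"
  show "((\<lambda>s. B s k) has_vector_derivative D t k) (at t within I)"
    by (rule has_vector_derivative_transform[OF t, of "\<lambda>s. B s k" "\<lambda>s. A s k"])
      (use assms t in \<open>auto simp: comp_deriv_def\<close>)
qed

lemma smooth_upto_cong:
  assumes "smooth_upto j I A" "\<And>t. t \<in> I \<Longrightarrow> B t = A t"
  shows "smooth_upto j I B"
proof -
  have "rapid_curve I B"
    using smooth_upto_rapid[OF assms(1)] assms(2) image_cong[of I I B A] by (simp add: rapid_curve_def)
  thus ?thesis using assms comp_deriv_cong[of I A _ B] by (cases j) auto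
qed

lemma rapid_curve_combine:
  assumes "rapid_curve I A" "rapid_curve I B"
  shows "rapid_curve I (\<lambda>t k. A t k + B t k)"
  unfolding rapid_curve_def
proof
  show "\<forall>t\<in>I. (\<lambda>k. A t k + B t k) \<in> ns_coeffs" using assms by (auto simp: rapid_curve_def intro: ns_coeffs_add)
  have rA: "rapid (A ` I)" and rB: "rapid (B ` I)" using assms by (auto simp: rapid_curve_def)
  show "rapid ((\<lambda>t k. A t k + B t k) ` I)"
  proof (rule rapidI_add[OF rA rB])
    fix b assume "b \<in> (\<lambda>t k. A t k + B t k) ` I"
    then obtain t where "t \<in> I" "b = (\<lambda>k. A t k + B t k)" by blast
    thus "\<exists>a1\<in>A ` I. \<exists>a2\<in>B ` I. \<forall>k. norm (b k) \<le> norm (a1 k) + norm (a2 k)"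
      by (intro bexI[of _ "A t"] bexI[of _ "B t"]) (auto intro: norm_triangle_ineq)
  qed
qed

lemma smooth_upto_add:
  "smooth_upto j I A \<Longrightarrow> smooth_upto j I B \<Longrightarrow> smooth_upto j I (\<lambda>t k. A t k + B t k)"
proof (induction j arbitrary: A B)
  case (Suc j)
  then obtain D E where D: "comp_deriv I A D" "smooth_upto j I D" and E: "comp_deriv I B E" "smooth_upto j I E" by auto
  have "comp_deriv I (\<lambda>t k. A t k + B t k) (\<lambda>t k. D t k + E t k)"
    using D(1) E(1) unfolding comp_deriv_def by (auto intro: has_vector_derivative_add)
  moreover have "rapid_curve I (\<lambda>t k. A t k + B t k)"
    using Suc.prems by (auto intro: rapid_curve_combine)
  ultimately show ?case using Suc.IH[OF D(2) E(2)] by auto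
qed (simp add: rapid_curve_combine)

lemma rapid_curve_lapl:
  assumes A: "rapid_curve I A"
  shows "rapid_curve I (\<lambda>t k. \<nu> *\<^sub>R lapl (A t) k)"
  unfolding rapid_curve_def
proof
  show "\<forall>t\<in>I. (\<lambda>k. \<nu> *\<^sub>R lapl (A t) k) \<in> ns_coeffs"
    using A by (auto simp: rapid_curve_def intro!: ns_coeffs_scaleR ns_coeffs_lapl)
  have r: "rapid (lapl ` A ` I)" using A by (auto simp: rapid_curve_def intro!: rapid_lapl)
  show "rapid ((\<lambda>t k. \<nu> *\<^sub>R lapl (A t) k) ` I)"
  proof (rule rapidI_mult[OF r, where C = "\<bar>\<nu>\<bar>" and q = 0])
    fix b assume "b \<in> (\<lambda>t k. \<nu> *\<^sub>R lapl (A t) k) ` I"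
    then obtain t where "t \<in> I" "b = (\<lambda>k. \<nu> *\<^sub>R lapl (A t) k)" by blast
    thus "\<exists>a\<in>lapl ` A ` I. \<forall>k. norm (b k) \<le> \<bar>\<nu>\<bar> * br k ^ 0 * norm (a k)"
      by (intro bexI[of _ "lapl (A t)"]) auto
  qed simp
qed

lemma smooth_upto_lapl:
  "smooth_upto j I A \<Longrightarrow> smooth_upto j I (\<lambda>t k. \<nu> *\<^sub>R lapl (A t) k)"
proof (induction j arbitrary: A)
  case 0 thus ?case using rapid_curve_lapl by simp
next
  case (Suc j)
  then obtain D where D: "comp_deriv I A D" "smooth_upto j I D" by auto
  have "comp_deriv I (\<lambda>t k. \<nu> *\<^sub>R lapl (A t) k) (\<lambda>t k. \<nu> *\<^sub>R lapl (D t) k)"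
    using D(1) unfolding comp_deriv_def lapl_def
    by (auto intro!: bounded_linear.has_vector_derivative[OF bounded_linear_scaleR_right] has_vector_derivative_minus)
  thus ?case using Suc.IH[OF D(2)] rapid_curve_lapl Suc.prems by auto
qed

text \<open>Product rule: the error consists of the bilinear map applied to the difference-quotient
  errors \<open>eA\<close> and \<open>eB\<close> with bounded partners, plus a term in
  \<open>B s - B t\<close>. All three arguments tend to 0 in L^2, and
  \<open>norm_Bil_le_nrm0\<close> converts this into a bound at mode \<open>k\<close>.\<close>

lemma has_vector_derivative_Bil:
  fixes A B D E :: "real \<Rightarrow> int^('d::finite) \<Rightarrow> complex^'d"
  assumes I: "convex I" and t: "t \<in> I"
    and rc: "rapid_curve I A" "rapid_curve I B" "rapid_curve I D" "rapid_curve I E"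
    and d: "comp_deriv I A D" "comp_deriv I B E"
  shows "((\<lambda>s. Bil (A s) (B s) k) has_vector_derivative Bil (D t) (B t) k + Bil (A t) (E t) k) (at t within I)"
  unfolding has_vector_derivative_iff_quotient
proof -
  note nc = ns_coeffsD
  have n: "A s \<in> ns_coeffs" "B s \<in> ns_coeffs" "D s \<in> ns_coeffs" "E s \<in> ns_coeffs" if "s \<in> I" for s
    using rc that by (auto simp: rapid_curve_def)
  have rDI: "rapid (D ` I)" and rEI: "rapid (E ` I)" and rBI: "rapid (B ` I)" using rc by (auto simp: rapid_curve_def)
  define eA where "eA = (\<lambda>s k. (1 / (s - t)) *\<^sub>R (A s k - A t k) - D t k)"
  define eB where "eB = (\<lambda>s k. (1 / (s - t)) *\<^sub>R (B s k - B t k) - E t k)"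
  have neA: "eA s \<in> ns_coeffs" and neB: "eB s \<in> ns_coeffs" if "s \<in> I" for s
    unfolding eA_def eB_def by (intro ns_coeffs_diff ns_coeffs_scaleR n that t)+
  have cA: "has_cderiv A (D t) t I" and cB: "has_cderiv B (E t) t I"
    by (rule has_cderiv_of_components[OF I t], use rDI rEI d in \<open>auto simp: comp_deriv_def\<close>)+
  have lA: "((\<lambda>s. nrm 0 (eA s)) \<longlongrightarrow> 0) (at t within I)" and lB: "((\<lambda>s. nrm 0 (eB s)) \<longlongrightarrow> 0) (at t within I)"
    using cA cB unfolding has_cderiv_def eA_def eB_def by blast+
  have lBB: "((\<lambda>s. nrm 0 (\<lambda>k. B s k - B t k)) \<longlongrightarrow> 0) (at t within I)"
  proof (rule nrm_tendsto_0)
    fix k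
    have "continuous (at t within I) (\<lambda>s. B s k)"
      using d(2) t unfolding comp_deriv_def by (intro has_vector_derivative_continuous) blast
    thus "((\<lambda>s. B s k - B t k) \<longlongrightarrow> 0) (at t within I)"
      unfolding continuous_within by (rule LIM_zero)
  next
    show "rapid {\<lambda>k. b k - B t k |b. b \<in> B ` I}"
    proof (rule rapidI_add[OF rBI rBI])
      fix c assume "c \<in> {\<lambda>k. b k - B t k |b. b \<in> B ` I}"
      then obtain b where b: "b \<in> B ` I" "c = (\<lambda>k. b k - B t k)" by blast
      show "\<exists>a1\<in>B ` I. \<exists>a2\<in>B ` I. \<forall>k. norm (c k) \<le> norm (a1 k) + norm (a2 k)"
        unfolding b(2) by (rule bexI[OF _ b(1)], rule bexI[OF _ imageI[OF t]]) (auto intro: norm_triangle_ineq4)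
    qed
    show "\<forall>\<^sub>F s in at t within I. (\<lambda>k. B s k - B t k) \<in> {\<lambda>k. b k - B t k |b. b \<in> B ` I}"
      unfolding eventually_at_filter by (intro always_eventually) blast
  qed
  obtain C where C: "C \<ge> 0" "\<And>b. b \<in> B ` I \<Longrightarrow> nrm 0 b \<le> C" by (rule nrm_bounded[OF rBI, where p = 0]) (rule that)
  define c where "c = cmod (cvol TYPE('d)) * br k"
  have c0: "0 \<le> c" by (simp add: c_def less_imp_le[OF br_pos])
  have bd: "norm (Bil a b k) \<le> c * (nrm 0 a * nrm 0 b)" if "a \<in> ns_coeffs" "b \<in> ns_coeffs" for a b :: "int^'d \<Rightarrow> complex^'d"
    unfolding c_def by (intro norm_Bil_le_nrm0 nc(1)[OF that(1)] nc(1)[OF that(2)] nc(4)[OF that(1)] nc(4)[OF that(2)])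
  show "((\<lambda>s. (1 / (s - t)) *\<^sub>R (Bil (A s) (B s) k - Bil (A t) (B t) k) - (Bil (D t) (B t) k + Bil (A t) (E t) k)) \<longlongrightarrow> 0) (at t within I)"
  proof (rule Lim_null_comparison)
    have "((\<lambda>s. c * (nrm 0 (eA s) * C) + c * (nrm 0 (D t) * nrm 0 (\<lambda>k. B s k - B t k)) + c * (nrm 0 (A t) * nrm 0 (eB s)))
        \<longlongrightarrow> c * (0 * C) + c * (nrm 0 (D t) * 0) + c * (nrm 0 (A t) * 0)) (at t within I)"
      by (intro tendsto_intros lA lB lBB)
    thus "((\<lambda>s. c * (nrm 0 (eA s) * C) + c * (nrm 0 (D t) * nrm 0 (\<lambda>k. B s k - B t k)) + c * (nrm 0 (A t) * nrm 0 (eB s))) \<longlongrightarrow> 0) (at t within I)"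
      by simp
    show "\<forall>\<^sub>F s in at t within I. norm ((1 / (s - t)) *\<^sub>R (Bil (A s) (B s) k - Bil (A t) (B t) k) - (Bil (D t) (B t) k + Bil (A t) (E t) k))
        \<le> c * (nrm 0 (eA s) * C) + c * (nrm 0 (D t) * nrm 0 (\<lambda>k. B s k - B t k)) + c * (nrm 0 (A t) * nrm 0 (eB s))"
      unfolding eventually_at_filter
    proof (intro always_eventually allI impI)
      fix s assume s: "s \<in> I"
      define h where "h = 1 / (s - t)"
      note r = nc(1)[OF n(1)[OF s]] nc(1)[OF n(2)[OF s]] nc(1)[OF n(1)[OF t]] nc(1)[OF n(2)[OF t]] nc(1)[OF n(3)[OF t]] nc(1)[OF n(4)[OF t]]
      have 1: "Bil (eA s) (B s) k = h *\<^sub>R (Bil (A s) (B s) k - Bil (A t) (B s) k) - Bil (D t) (B s) k"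
        unfolding eA_def h_def[symmetric]
        by (simp add: Bil_diff_left[OF rapid_scaleR[OF rapid_diff[OF r(1,3)]] r(5,2)] Bil_scaleR_left Bil_diff_left[OF r(1,3,2)])
      have 2: "Bil (D t) (\<lambda>k. B s k - B t k) k = Bil (D t) (B s) k - Bil (D t) (B t) k"
        by (rule Bil_diff_right[OF r(5,2,4)])
      have 3: "Bil (A t) (eB s) k = h *\<^sub>R (Bil (A t) (B s) k - Bil (A t) (B t) k) - Bil (A t) (E t) k"
        unfolding eB_def h_def[symmetric]
        by (simp add: Bil_diff_right[OF r(3) rapid_scaleR[OF rapid_diff[OF r(2,4)]] r(6)] Bil_scaleR_right Bil_diff_right[OF r(3,2,4)])
      have eq: "h *\<^sub>R (Bil (A s) (B s) k - Bil (A t) (B t) k) - (Bil (D t) (B t) k + Bil (A t) (E t) k)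
          = Bil (eA s) (B s) k + Bil (D t) (\<lambda>k. B s k - B t k) k + Bil (A t) (eB s) k"
        unfolding 1 2 3 by (simp add: scaleR_right_diff_distrib)
      have "norm (Bil (eA s) (B s) k) \<le> c * (nrm 0 (eA s) * C)"
      proof -
        have "nrm 0 (eA s) * nrm 0 (B s) \<le> nrm 0 (eA s) * C"
          by (intro mult_left_mono nrm_nonneg C(2) imageI s)
        hence "c * (nrm 0 (eA s) * nrm 0 (B s)) \<le> c * (nrm 0 (eA s) * C)" using c0 by (rule mult_left_mono)
        thus ?thesis using bd[OF neA[OF s] n(2)[OF s]] by linarith
      qed
      moreover have "norm (Bil (D t) (\<lambda>k. B s k - B t k) k) \<le> c * (nrm 0 (D t) * nrm 0 (\<lambda>k. B s k - B t k))"
        by (rule bd[OF n(3)[OF t] ns_coeffs_diff[OF n(2)[OF s] n(2)[OF t]]])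
      moreover have "norm (Bil (A t) (eB s) k) \<le> c * (nrm 0 (A t) * nrm 0 (eB s))"
        by (rule bd[OF n(1)[OF t] neB[OF s]])
      moreover have "norm (x + y + z) \<le> norm x + norm y + norm z" for x y z :: "complex^'d"
        using norm_triangle_ineq[of "x + y" z] norm_triangle_ineq[of x y] by linarith
      ultimately show "norm ((1 / (s - t)) *\<^sub>R (Bil (A s) (B s) k - Bil (A t) (B t) k) - (Bil (D t) (B t) k + Bil (A t) (E t) k))
        \<le> c * (nrm 0 (eA s) * C) + c * (nrm 0 (D t) * nrm 0 (\<lambda>k. B s k - B t k)) + c * (nrm 0 (A t) * nrm 0 (eB s))"
        unfolding h_def[symmetric] eq by (meson add_mono order_trans)
    qed
  qed
qed

lemma rapid_curve_Bil:
  assumes A: "rapid_curve I A" and B: "rapid_curve I B"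
  shows "rapid_curve I (\<lambda>t. Bil (A t) (B t))"
  unfolding rapid_curve_def
proof
  show "\<forall>t\<in>I. Bil (A t) (B t) \<in> ns_coeffs" using A B by (auto simp: rapid_curve_def intro: ns_coeffs_Bil)
  have "rapid {Bil a b |a b. a \<in> A ` I \<and> b \<in> B ` I}" using A B by (intro rapid_Bil) (auto simp: rapid_curve_def)
  thus "rapid ((\<lambda>t. Bil (A t) (B t)) ` I)" by (rule rapid_subset) blast
qed

lemma smooth_upto_Bil:
  assumes I: "convex I"
  shows "smooth_upto j I A \<Longrightarrow> smooth_upto j I B \<Longrightarrow> smooth_upto j I (\<lambda>t. Bil (A t) (B t))"
proof (induction j arbitrary: A B)
  case 0 thus ?case using rapid_curve_Bil by simp
next
  case (Suc j)
  then obtain D E where D: "comp_deriv I A D" "smooth_upto j I D" and E: "comp_deriv I B E" "smooth_upto j I E" by auto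
  note r = smooth_upto_rapid[OF Suc.prems(1)] smooth_upto_rapid[OF Suc.prems(2)] smooth_upto_rapid[OF D(2)] smooth_upto_rapid[OF E(2)]
  have "comp_deriv I (\<lambda>t. Bil (A t) (B t)) (\<lambda>t k. Bil (D t) (B t) k + Bil (A t) (E t) k)"
    unfolding comp_deriv_def using has_vector_derivative_Bil[OF I _ r D(1) E(1)] by blast
  moreover have "smooth_upto j I (\<lambda>t k. Bil (D t) (B t) k + Bil (A t) (E t) k)"
    by (rule smooth_upto_add[OF Suc.IH[OF D(2) smooth_upto_SucD[OF Suc.prems(2)]] Suc.IH[OF smooth_upto_SucD[OF Suc.prems(1)] E(2)]])
  ultimately show ?case using rapid_curve_Bil[OF r(1,2)] by auto
qed

text \<open>Bootstrap through the equation: if \<open>A\<close> is differentiable to order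
  \<open>j\<close>, so is the right-hand side, which is the derivative of \<open>A\<close>.\<close>

lemma smooth_upto_solution:
  assumes I: "convex I" and A: "rapid_curve I A" and d: "comp_deriv I A (\<lambda>t. nsrhs \<nu> (A t))"
  shows "smooth_upto j I A"
proof (induction j)
  case (Suc j)
  have "smooth_upto j I (\<lambda>t. nsrhs \<nu> (A t))"
    unfolding nsrhs_def[abs_def]
    by (rule smooth_upto_add[OF smooth_upto_lapl[OF Suc] smooth_upto_Bil[OF I Suc Suc]])
  thus ?case using A d by auto
qed (simp add: A)

text \<open>For each order there is some first derivative that is smooth to that order. On a
  nondegenerate interval derivatives are unique, so one derivative serves all orders, and dependent
  choice yields the sequence required by \<open>smooth_curve\<close>.\<close>

lemma smooth_sequence:
  fixes A :: "real \<Rightarrow> int^('d::finite) \<Rightarrow> complex^'d"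
  assumes \<tau>: "0 < \<tau>" and A: "\<And>j. smooth_upto j {0..\<tau>} A"
  obtains V where "V 0 = A" "\<And>j. rapid_curve {0..\<tau>} (V j)" "\<And>j. comp_deriv {0..\<tau>} (V j) (V (Suc j))"
proof -
  let ?I = "{0..\<tau>}"
  have step: "\<exists>D. (\<forall>j. smooth_upto j ?I D) \<and> comp_deriv ?I B D" if B: "\<forall>j. smooth_upto j ?I B" for B :: "real \<Rightarrow> int^'d \<Rightarrow> complex^'d"
  proof -
    have "\<forall>j. \<exists>D. comp_deriv ?I B D \<and> smooth_upto j ?I D" using B smooth_upto.simps(2) by blast
    then obtain D where D: "\<And>j. comp_deriv ?I B (D j)" "\<And>j. smooth_upto j ?I (D j)" by metis
    have "D 0 t = D j t" if t: "t \<in> ?I" for j t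
    proof
      fix k
      show "D 0 t k = D j t k"
        using D(1)[of 0] D(1)[of j] t \<tau>
        by (intro vector_derivative_unique_within_closed_interval[of 0 \<tau> t "\<lambda>s. B s k"]) (auto simp: comp_deriv_def)
    qed
    hence "smooth_upto j ?I (D 0)" for j by (intro smooth_upto_cong[OF D(2)[of j]])
    thus ?thesis using D(1) by blast
  qed
  have "\<exists>V. \<forall>j. (\<forall>i. smooth_upto i ?I (V j)) \<and> (j = 0 \<longrightarrow> V j = A) \<and> comp_deriv ?I (V j) (V (Suc j))"
    using dependent_nat_choice[of "\<lambda>j V. (\<forall>i. smooth_upto i ?I V) \<and> (j = 0 \<longrightarrow> V = A)" "\<lambda>j V W. comp_deriv ?I V W"] A step
    by auto
  then obtain V where V: "\<And>j i. smooth_upto i ?I (V j)" "V 0 = A" "\<And>j. comp_deriv ?I (V j) (V (Suc j))" by blast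
  show ?thesis by (rule that[OF V(2) smooth_upto_rapid[OF V(1)[of 0]] V(3)])
qed

section \<open>From coefficients back to fields\<close>

lemma has_Sob_inf_derivative_iff:
  fixes u :: "real \<Rightarrow> ('d::finite) vfield"
  assumes u: "\<And>s. s \<in> I \<Longrightarrow> u s \<in> Sob_inf" and t: "t \<in> I" and u': "u' \<in> Sob_inf"
  shows "has_Sob_inf_derivative u u' t I \<longleftrightarrow> has_cderiv (\<lambda>s. fourier_coeff (u s)) (fourier_coeff u') t I"
proof -
  have eq: "sob_norm p (\<lambda>x. (1 / (s - t)) *\<^sub>R (u s x - u t x) - u' x)
      = nrm p (\<lambda>k. (1 / (s - t)) *\<^sub>R (fourier_coeff (u s) k - fourier_coeff (u t) k) - fourier_coeff u' k)" if s: "s \<in> I" for s p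
  proof -
    define a where "a = fourier_coeff (u s)"
    define b where "b = fourier_coeff (u t)"
    define d where "d = fourier_coeff u'"
    have n: "a \<in> ns_coeffs" "b \<in> ns_coeffs" "d \<in> ns_coeffs"
      unfolding a_def b_def d_def by (intro Sob_inf_coeffs(1) u u' s t)+
    have v: "u s = synth a" "u t = synth b" "u' = synth d"
      unfolding a_def b_def d_def by (intro Sob_inf_coeffs(2)[symmetric] u u' s t)+
    define q where "q = (\<lambda>k. (1 / (s - t)) *\<^sub>R (a k - b k) - d k)"
    have q: "q \<in> ns_coeffs" unfolding q_def by (intro ns_coeffs_diff ns_coeffs_scaleR n)
    have "(\<lambda>x. (1 / (s - t)) *\<^sub>R (u s x - u t x) - u' x) = synth q"
    proof
      fix x
      show "(1 / (s - t)) *\<^sub>R (u s x - u t x) - u' x = synth q x"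
        unfolding q_def v synth_diff[OF rapid_scaleR[OF rapid_diff[OF ns_coeffsD(1)[OF n(1)] ns_coeffsD(1)[OF n(2)]]] ns_coeffsD(1)[OF n(3)]]
          synth_scaleR synth_diff[OF ns_coeffsD(1)[OF n(1)] ns_coeffsD(1)[OF n(2)]] ..
    qed
    moreover have "fourier_coeff (synth q) = q" by (rule fourier_coeff_synth[OF ns_coeffsD(1,2)[OF q]])
    ultimately show ?thesis using sob_norm_eq_nrm[of "synth q" p] ns_coeffsD(1)[OF q]
      by (simp add: q_def a_def b_def d_def)
  qed
  have "((\<lambda>s. sob_norm p (\<lambda>x. (1 / (s - t)) *\<^sub>R (u s x - u t x) - u' x)) \<longlongrightarrow> 0) (at t within I) \<longleftrightarrow>
      ((\<lambda>s. nrm p (\<lambda>k. (1 / (s - t)) *\<^sub>R (fourier_coeff (u s) k - fourier_coeff (u t) k) - fourier_coeff u' k)) \<longlongrightarrow> 0) (at t within I)" for p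
    by (rule tendsto_cong) (auto simp: eventually_at_filter eq)
  thus ?thesis using u' by (simp add: has_Sob_inf_derivative_def has_cderiv_def)
qed

lemma NS_rhs_synth:
  assumes "a \<in> ns_coeffs"
  shows "(\<lambda>x. \<nu> *\<^sub>R laplacian (synth a) x + NS_bilin (synth a) (synth a) x) = synth (nsrhs \<nu> a)"
proof
  fix x
  show "\<nu> *\<^sub>R laplacian (synth a) x + NS_bilin (synth a) (synth a) x = synth (nsrhs \<nu> a) x"
    unfolding nsrhs_def[abs_def] laplacian_synth[OF ns_coeffsD(1)[OF assms]] NS_bilin_synth[OF assms assms]
      synth_add[OF rapid_scaleR[OF ns_coeffsD(1)[OF ns_coeffs_lapl[OF assms]]] ns_coeffsD(1)[OF ns_coeffs_Bil[OF assms assms]]]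
      synth_scaleR ..
qed

text \<open>Bounds are available on the closed interval, where the derivatives at the end points are
  one-sided; the solution is then restricted to the half-open time domain.\<close>

lemma NS_solution_synth:
  fixes A :: "real \<Rightarrow> int^('d::finite) \<Rightarrow> complex^'d"
  assumes \<tau>: "0 < \<tau>" and A: "rapid_curve {0..\<tau>} A" and d: "comp_deriv {0..\<tau>} A (\<lambda>t. nsrhs \<nu> (A t))"
  shows "NS_solution \<nu> (synth (A 0)) (ereal \<tau>) (\<lambda>t. synth (A t))"
proof -
  let ?I = "{0..\<tau>}"
  obtain V where V: "V 0 = A" "\<And>j. rapid_curve ?I (V j)" "\<And>j. comp_deriv ?I (V j) (V (Suc j))"
    using smooth_sequence[OF \<tau> smooth_upto_solution[OF _ A d]] by auto
  have dom: "time_dom (ereal \<tau>) \<subseteq> ?I" by (auto simp: time_dom_def)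
  have S: "has_Sob_inf_derivative (\<lambda>s. synth (B s)) (synth (D t)) t (time_dom (ereal \<tau>))"
    if B: "rapid_curve ?I B" and D: "rapid_curve ?I D" and BD: "comp_deriv ?I B D" and t: "t \<in> time_dom (ereal \<tau>)" for B D :: "real \<Rightarrow> int^'d \<Rightarrow> complex^'d" and t
  proof -
    have n: "B s \<in> ns_coeffs" "D s \<in> ns_coeffs" if "s \<in> time_dom (ereal \<tau>)" for s
      using B D dom that by (auto simp: rapid_curve_def)
    have fc: "fourier_coeff (synth (B s)) = B s" "fourier_coeff (synth (D s)) = D s" if "s \<in> time_dom (ereal \<tau>)" for s
      by (intro fourier_coeff_synth ns_coeffsD(1,2) n that)+
    have "has_cderiv B (D t) t ?I"
      by (rule has_cderiv_of_components) (use B D BD dom t in \<open>auto simp: rapid_curve_def comp_deriv_def\<close>)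
    hence c: "has_cderiv B (D t) t (time_dom (ereal \<tau>))" by (rule has_cderiv_subset[OF _ dom])
    have "has_cderiv (\<lambda>s. fourier_coeff (synth (B s))) (fourier_coeff (synth (D t))) t (time_dom (ereal \<tau>))"
      unfolding has_cderiv_def fc[OF t]
    proof
      fix p
      have "((\<lambda>s. nrm p (\<lambda>k. (1 / (s - t)) *\<^sub>R (fourier_coeff (synth (B s)) k - B t k) - D t k)) \<longlongrightarrow> 0) (at t within time_dom (ereal \<tau>))
        \<longleftrightarrow> ((\<lambda>s. nrm p (\<lambda>k. (1 / (s - t)) *\<^sub>R (B s k - B t k) - D t k)) \<longlongrightarrow> 0) (at t within time_dom (ereal \<tau>))"
        by (rule tendsto_cong) (auto simp: eventually_at_filter fc)
      thus "((\<lambda>s. nrm p (\<lambda>k. (1 / (s - t)) *\<^sub>R (fourier_coeff (synth (B s)) k - B t k) - D t k)) \<longlongrightarrow> 0) (at t within time_dom (ereal \<tau>))"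
        using c unfolding has_cderiv_def by blast
    qed
    thus ?thesis
      by (subst has_Sob_inf_derivative_iff) (auto intro!: synth_in_Sob n t)
  qed
  have "smooth_curve (time_dom (ereal \<tau>)) (\<lambda>t. synth (A t))"
    unfolding smooth_curve_def
  proof
    show "\<forall>t\<in>time_dom (ereal \<tau>). synth (A t) \<in> Sob_inf"
      using A dom by (auto simp: rapid_curve_def intro!: synth_in_Sob)
    show "\<exists>U. U 0 = (\<lambda>t. synth (A t)) \<and> (\<forall>j. \<forall>t\<in>time_dom (ereal \<tau>). has_Sob_inf_derivative (U j) (U (Suc j) t) t (time_dom (ereal \<tau>)))"
      by (rule exI[of _ "\<lambda>j t. synth (V j t)"]) (auto simp: V(1) intro!: S V)
  qed
  moreover have "has_Sob_inf_derivative (\<lambda>t. synth (A t)) (\<lambda>x. \<nu> *\<^sub>R laplacian (synth (A t)) x + NS_bilin (synth (A t)) (synth (A t)) x) t (time_dom (ereal \<tau>))"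
    if t: "t \<in> time_dom (ereal \<tau>)" for t
  proof -
    have At: "A t \<in> ns_coeffs" using A dom t by (auto simp: rapid_curve_def)
    have "rapid_curve ?I (\<lambda>t. nsrhs \<nu> (A t))"
    proof -
      have "(\<lambda>t. nsrhs \<nu> (A t)) ` ?I = nsrhs \<nu> ` A ` ?I" by auto
      thus ?thesis using A rapid_nsrhs[of "A ` ?I" \<nu>] by (auto simp: rapid_curve_def intro!: ns_coeffs_nsrhs)
    qed
    from S[OF A this d t] show ?thesis unfolding NS_rhs_synth[OF At] .
  qed
  ultimately show ?thesis using \<tau> by (simp add: NS_solution_def)
qed

section \<open>Bounds, uniqueness and decay\<close>

definition coeff_solution :: "real \<Rightarrow> real set \<Rightarrow> (real \<Rightarrow> int^'d \<Rightarrow> complex^('d::finite)) \<Rightarrow> bool" where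
  "coeff_solution \<nu> I A \<longleftrightarrow> (\<forall>t\<in>I. A t \<in> ns_coeffs \<and> has_cderiv A (nsrhs \<nu> (A t)) t I)"

lemma coeff_solutionD:
  assumes "coeff_solution \<nu> I A" "t \<in> I"
  shows "A t \<in> ns_coeffs" "has_cderiv A (nsrhs \<nu> (A t)) t I"
  using assms by (auto simp: coeff_solution_def)

lemma coeff_solution_subset: "coeff_solution \<nu> I A \<Longrightarrow> J \<subseteq> I \<Longrightarrow> coeff_solution \<nu> J A"
  unfolding coeff_solution_def by (blast intro: has_cderiv_subset)

lemma coeff_solution_of_components:
  assumes "convex I" "rapid_curve I A" "comp_deriv I A (\<lambda>t. nsrhs \<nu> (A t))"
  shows "coeff_solution \<nu> I A"
  unfolding coeff_solution_def
proof (intro ballI conjI)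
  fix t assume t: "t \<in> I"
  show "A t \<in> ns_coeffs" using assms(2) t by (simp add: rapid_curve_def)
  have "(\<lambda>t. nsrhs \<nu> (A t)) ` I = nsrhs \<nu> ` A ` I" by (simp add: image_image)
  hence "rapid ((\<lambda>t. nsrhs \<nu> (A t)) ` I)" using assms(2) rapid_nsrhs[of "A ` I" \<nu>] by (simp add: rapid_curve_def)
  thus "has_cderiv A (nsrhs \<nu> (A t)) t I"
    by (rule has_cderiv_of_components[OF assms(1) t]) (use assms(3) in \<open>simp add: comp_deriv_def\<close>)
qed

lemma has_cderiv_diff:
  assumes c: "has_cderiv A D t I" "has_cderiv B E t I"
    and A: "\<And>s. s \<in> I \<Longrightarrow> rapid {A s}" and B: "\<And>s. s \<in> I \<Longrightarrow> rapid {B s}" and t: "t \<in> I" and D: "rapid {D}" and E: "rapid {E}"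
  shows "has_cderiv (\<lambda>s k. A s k - B s k) (\<lambda>k. D k - E k) t I"
  unfolding has_cderiv_def
proof
  fix p
  define a where "a = (\<lambda>s k. (1 / (s - t)) *\<^sub>R (A s k - A t k) - D k)"
  define b where "b = (\<lambda>s k. (1 / (s - t)) *\<^sub>R (B s k - B t k) - E k)"
  show "((\<lambda>s. nrm p (\<lambda>k. (1 / (s - t)) *\<^sub>R (A s k - B s k - (A t k - B t k)) - (D k - E k))) \<longlongrightarrow> 0) (at t within I)"
  proof (rule Lim_null_comparison)
    have "((\<lambda>s. nrm p (a s)) \<longlongrightarrow> 0) (at t within I)" "((\<lambda>s. nrm p (b s)) \<longlongrightarrow> 0) (at t within I)"
      using c unfolding has_cderiv_def a_def b_def by blast+
    hence "((\<lambda>s. nrm p (a s) + nrm p (b s)) \<longlongrightarrow> 0 + 0) (at t within I)" by (rule tendsto_add)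
    thus "((\<lambda>s. nrm p (a s) + nrm p (b s)) \<longlongrightarrow> 0) (at t within I)" by simp
    show "\<forall>\<^sub>F s in at t within I. norm (nrm p (\<lambda>k. (1 / (s - t)) *\<^sub>R (A s k - B s k - (A t k - B t k)) - (D k - E k))) \<le> nrm p (a s) + nrm p (b s)"
      unfolding eventually_at_filter
    proof (intro always_eventually allI impI)
      fix s assume s: "s \<in> I"
      have ra: "rapid {a s}" and rb: "rapid {b s}"
        unfolding a_def b_def by (rule rapid_quotient[OF A[OF s] A[OF t] D], rule rapid_quotient[OF B[OF s] B[OF t] E])
      have eq: "(\<lambda>k. (1 / (s - t)) *\<^sub>R (A s k - B s k - (A t k - B t k)) - (D k - E k)) = (\<lambda>k. a s k + (- 1) *\<^sub>R b s k)"
        by (simp add: a_def b_def scaleR_right_diff_distrib fun_eq_iff)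
      have "nrm p (\<lambda>k. (- 1) *\<^sub>R b s k) = nrm p (b s)"
        unfolding nrm_def inn_scaleR_left inn_scaleR_right by simp
      thus "norm (nrm p (\<lambda>k. (1 / (s - t)) *\<^sub>R (A s k - B s k - (A t k - B t k)) - (D k - E k))) \<le> nrm p (a s) + nrm p (b s)"
        unfolding eq using nrm_triangle[OF ra rapid_scaleR[OF rb, of "- 1"], of p] by (simp add: nrm_nonneg)
    qed
  qed
qed

text \<open>Lets the estimates of this autonomous equation be restarted at a later time
  \<open>t0\<close>.\<close>

lemma has_cderiv_shift:
  assumes "has_cderiv A D (t0 + s) {t0..t0 + r}"
  shows "has_cderiv (\<lambda>s. A (t0 + s)) D s {0..r}"
  unfolding has_cderiv_def
proof
  fix p
  have "((\<lambda>x. nrm p (\<lambda>k. (1 / (x - (t0 + s))) *\<^sub>R (A x k - A (t0 + s) k) - D k)) \<longlongrightarrow> 0) (at (t0 + s) within {t0..t0 + r})"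
    using assms by (simp add: has_cderiv_def)
  moreover have "filterlim (\<lambda>y. t0 + y) (at (t0 + s) within {t0..t0 + r}) (at s within {0..r})"
    unfolding filterlim_at
  proof
    show "\<forall>\<^sub>F y in at s within {0..r}. t0 + y \<in> {t0..t0 + r} \<and> t0 + y \<noteq> t0 + s"
      unfolding eventually_at_filter by (intro always_eventually) auto
    show "((\<lambda>y. t0 + y) \<longlongrightarrow> t0 + s) (at s within {0..r})" by (intro tendsto_intros)
  qed
  ultimately have "((\<lambda>y. nrm p (\<lambda>k. (1 / (t0 + y - (t0 + s))) *\<^sub>R (A (t0 + y) k - A (t0 + s) k) - D k)) \<longlongrightarrow> 0) (at s within {0..r})"
    by (rule filterlim_compose)
  thus "((\<lambda>y. nrm p (\<lambda>k. (1 / (y - s)) *\<^sub>R (A (t0 + y) k - A (t0 + s) k) - D k)) \<longlongrightarrow> 0) (at s within {0..r})"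
    by simp
qed

text \<open>Gronwall at order 0. The constant involves only \<open>B\<close>, so uniform bounds are
  asked of \<open>B\<close> alone: in the application \<open>B\<close> is the constructed solution
  and \<open>A\<close> the given one.\<close>

lemma coeff_solution_unique:
  fixes A B :: "real \<Rightarrow> int^('d::finite) \<Rightarrow> complex^'d"
  assumes t: "0 \<le> t" and nu: "0 \<le> \<nu>" and A: "coeff_solution \<nu> {0..t} A" and B: "coeff_solution \<nu> {0..t} B"
    and rB: "rapid (B ` {0..t})" and init: "A 0 = B 0"
  shows "A t = B t"
proof -
  define w where "w = (\<lambda>s k. A s k - B s k)"
  note nA = coeff_solutionD(1)[OF A] and nB = coeff_solutionD(1)[OF B]
  have n: "nsrhs \<nu> (A s) \<in> ns_coeffs" "nsrhs \<nu> (B s) \<in> ns_coeffs" if "s \<in> {0..t}" for s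
    by (rule ns_coeffs_nsrhs[OF nA[OF that]], rule ns_coeffs_nsrhs[OF nB[OF that]])
  have wn: "w s \<in> ns_coeffs" if "s \<in> {0..t}" for s
    unfolding w_def by (rule ns_coeffs_diff[OF nA[OF that] nB[OF that]])
  obtain L where L: "L \<ge> 0" "\<And>b. b \<in> B ` {0..t} \<Longrightarrow> lip1 b \<le> L" by (rule lip1_bounded[OF rB]) (rule that)
  have "(nrm 0 (w t))\<^sup>2 \<le> ((nrm 0 (w 0))\<^sup>2 + 2 * 0 * t) * exp (2 * L * t)"
  proof (rule difference_gronwall[OF t, where D = "\<lambda>s k. nsrhs \<nu> (A s) k - nsrhs \<nu> (B s) k"])
    fix s assume s: "s \<in> {0..t}"
    show "rapid {w s}" by (rule ns_coeffsD(1)[OF wn[OF s]])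
    show "rapid {\<lambda>k. nsrhs \<nu> (A s) k - nsrhs \<nu> (B s) k}"
      by (rule rapid_diff[OF ns_coeffsD(1)[OF n(1)[OF s]] ns_coeffsD(1)[OF n(2)[OF s]]])
    show "has_cderiv w (\<lambda>k. nsrhs \<nu> (A s) k - nsrhs \<nu> (B s) k) s {0..t}"
      unfolding w_def
      by (rule has_cderiv_diff[OF coeff_solutionD(2)[OF A s] coeff_solutionD(2)[OF B s] ns_coeffsD(1)[OF nA] ns_coeffsD(1)[OF nB] s
        ns_coeffsD(1)[OF n(1)[OF s]] ns_coeffsD(1)[OF n(2)[OF s]]])
    have "inn 0 (w s) (\<lambda>k. nsrhs \<nu> (A s) k - nsrhs \<nu> (B s) k) \<le> lip1 (B s) * (nrm 0 (w s))\<^sup>2"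
      unfolding w_def by (rule inn0_nsrhs_diff_le[OF nA[OF s] nB[OF s] nu])
    also have "\<dots> \<le> L * (nrm 0 (w s))\<^sup>2" by (intro mult_right_mono L imageI s) simp
    finally show "inn 0 (w s) (\<lambda>k. nsrhs \<nu> (A s) k - nsrhs \<nu> (B s) k) \<le> L * (nrm 0 (w s))\<^sup>2 + 0" by simp
  qed (use L in auto)
  also have "w 0 = (\<lambda>k. 0)" by (simp add: w_def init)
  also have "nrm 0 (\<lambda>k::int^'d. 0 :: complex^'d) = 0" by (simp add: nrm_def inn_def)
  finally have "nrm 0 (w t) = 0" by simp
  moreover have tt: "t \<in> {0..t}" using t by simp
  ultimately have "norm (w t k) \<le> 0" for k
    using component_le_nrm0[OF ns_coeffsD(1,4)[OF wn[OF tt]], of k] by simp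
  thus ?thesis by (auto simp: w_def)
qed

lemma coeff_solution_bounds:
  fixes A :: "real \<Rightarrow> int^('d::finite) \<Rightarrow> complex^'d"
  assumes t: "0 \<le> t" and A: "coeff_solution \<nu> {0..t} A"
    and G: "\<And>a :: int^'d \<Rightarrow> complex^'d. a \<in> ns_coeffs \<Longrightarrow> \<bar>inn n (Bil a a) a\<bar> \<le> G * nrm n a * (nrm n a)\<^sup>2"
    and H: "\<And>a :: int^'d \<Rightarrow> complex^'d. a \<in> ns_coeffs \<Longrightarrow> \<bar>inn p (Bil a a) a\<bar> \<le> H * nrm n a * (nrm p a)\<^sup>2"
    and pos: "0 < G" "0 < H" and nu: "0 \<le> \<nu>"
    and init: "nrm n (A 0) \<le> x0" and small: "G * x0 * e_visc \<nu> t < 1"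
  shows "nrm n (A t) \<le> x0 * exp (- \<nu> * t) / (1 - G * x0 * e_visc \<nu> t)"
    and "nrm p (A t) \<le> nrm p (A 0) * exp (- \<nu> * t) / (1 - G * x0 * e_visc \<nu> t) powr (H / G)"
proof -
  note n = coeff_solutionD(1)[OF A]
  have e: "inn q (A s) (nsrhs \<nu> (A s)) \<le> - \<nu> * inn (q + 1) (A s) (A s) + inn q (Bil (A s) (A s)) (A s)" if "s \<in> {0..t}" for s q
    using inn_nsrhs[OF n[OF that], of q \<nu>] by (simp add: inn_commute[of q "A s" "nsrhs \<nu> (A s)"])
  note ap = apriori_bound[OF t n ns_coeffsD(1)[OF ns_coeffs_nsrhs[OF n]] coeff_solutionD(2)[OF A] e G H pos nu init order_refl small]
  show "nrm n (A t) \<le> x0 * exp (- \<nu> * t) / (1 - G * x0 * e_visc \<nu> t)" by (rule ap(1))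
  show "nrm p (A t) \<le> nrm p (A 0) * exp (- \<nu> * t) / (1 - G * x0 * e_visc \<nu> t) powr (H / G)" by (rule ap(2))
qed

section \<open>Exponential decay up to the threshold\<close>

lemma wavevec_norm_cases:
  fixes k :: "int^('d::finite)"
  assumes "k \<noteq> 0" shows "(norm (wavevec k))\<^sup>2 = 1 \<or> 2 \<le> (norm (wavevec k))\<^sup>2"
proof -
  \<comment> \<open>The squared length of a wave vector is an integer.\<close>
  define m where "m = (\<Sum>j\<in>UNIV. (k $ j)\<^sup>2)"
  have "(norm (wavevec k))\<^sup>2 = wavevec k \<bullet> wavevec k" by (rule power2_norm_eq_inner)
  also have "\<dots> = real_of_int m" by (simp add: m_def wavevec_def inner_vec_def power2_eq_square)
  finally have eq: "(norm (wavevec k))\<^sup>2 = real_of_int m" .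
  have "wavevec k \<noteq> 0" using assms by simp
  hence "0 < real_of_int m" unfolding eq[symmetric] by simp
  hence "m = 1 \<or> 2 \<le> m" by linarith
  thus ?thesis unfolding eq by auto
qed

text \<open>Mode by mode. For |k| = 1 both sides agree, which is why the term of order 0 is needed;
  for |k|^2 \<ge> 2 the term of order \<open>n + 1\<close> alone suffices.\<close>

lemma inn_spectral_gap:
  fixes a :: "int^('d::finite) \<Rightarrow> 'b::real_inner"
  assumes "rapid {a}"
  shows "2 * inn n a a \<le> inn (n + 1) a a + inn 0 a a"
proof -
  note s = summable_inn[OF assms assms]
  have "2 * inn n a a = (\<Sum>\<^sub>\<infinity>k. 2 * (norm (wavevec k) powr (2 * n) * (a k \<bullet> a k)))"
    unfolding inn_def by (rule infsum_cmult_right'[symmetric])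
  also have "\<dots> \<le> (\<Sum>\<^sub>\<infinity>k. norm (wavevec k) powr (2 * (n + 1)) * (a k \<bullet> a k) + norm (wavevec k) powr (2 * 0) * (a k \<bullet> a k))"
  proof (rule infsum_mono[OF summable_on_cmult_right[OF s] summable_on_add[OF s s]])
    fix k :: "int^'d"
    have "2 * norm (wavevec k) powr (2 * n) \<le> norm (wavevec k) powr (2 * (n + 1)) + norm (wavevec k) powr (2 * 0)"
    proof (cases "k = 0")
      case False
      define x where "x = norm (wavevec k)"
      have x: "0 < x" using False by (simp add: x_def)
      have pw: "x powr (2 * (n + 1)) = x powr (2 * n) * x\<^sup>2"
        using x by (simp add: distrib_left powr_add)
      from wavevec_norm_cases[OF False] have "x\<^sup>2 = 1 \<or> 2 \<le> x\<^sup>2" by (simp add: x_def)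
      thus ?thesis
      proof
        assume "x\<^sup>2 = 1"
        hence "x = 1" using x by (simp add: power2_eq_1_iff)
        thus ?thesis by (simp add: x_def[symmetric])
      next
        assume "2 \<le> x\<^sup>2"
        hence "x powr (2 * n) * 2 \<le> x powr (2 * n) * x\<^sup>2" by (intro mult_left_mono) auto
        thus ?thesis unfolding x_def[symmetric] pw by simp
      qed
    qed simp
    from mult_right_mono[OF this inner_ge_zero[of "a k"]]
    show "2 * (norm (wavevec k) powr (2 * n) * (a k \<bullet> a k)) \<le> norm (wavevec k) powr (2 * (n + 1)) * (a k \<bullet> a k) + norm (wavevec k) powr (2 * 0) * (a k \<bullet> a k)"
      by (simp only: mult.assoc distrib_right)
  qed
  also have "\<dots> = inn (n + 1) a a + inn 0 a a" unfolding inn_def by (rule infsum_add[OF s s])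
  finally show ?thesis .
qed

text \<open>As long as the norm is at most \<open>\<nu> / G\<close>, the nonlinear term contributes
  at most \<open>\<nu> * h\<close>, where \<open>h\<close> is its square, while the dissipation at
  orders \<open>n\<close> and 0 together is at least \<open>2 * \<nu> * h\<close> by the spectral
  gap.\<close>

lemma norm_becomes_small:
  fixes A :: "real \<Rightarrow> int^('d::finite) \<Rightarrow> complex^'d"
  assumes A: "coeff_solution \<nu> {0..} A" and nu: "0 < \<nu>" and Gpos: "0 < G"
    and G: "\<And>a :: int^'d \<Rightarrow> complex^'d. a \<in> ns_coeffs \<Longrightarrow> \<bar>inn n (Bil a a) a\<bar> \<le> G * nrm n a * (nrm n a)\<^sup>2"
    and le: "\<And>t. 0 \<le> t \<Longrightarrow> nrm n (A t) \<le> \<nu> / G"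
  obtains t0 where "0 \<le> t0" "nrm n (A t0) < \<nu> / G"
proof (rule ccontr)
  assume no: "\<not> thesis"
  note found = that
  have ge: "\<nu> / G \<le> nrm n (A t)" if "0 \<le> t" for t
    using found[OF that] no by (meson not_le)
  define m where "m = (\<nu> / G)\<^sup>2"
  have m: "0 < m" using nu Gpos by (simp add: m_def)
  define f where "f = (\<lambda>t. inn n (A t) (A t) + inn 0 (A t) (A t))"
  \<comment> \<open>Staying at the threshold, \<open>f\<close> would decrease at a rate of at least
    \<open>2 * \<nu> * m\<close>; at this time it would have fallen below 0.\<close>
  define t where "t = f 0 / (2 * \<nu> * m) + 1"
  have f0: "0 \<le> f 0" unfolding f_def by (intro add_nonneg_nonneg inn_self_nonneg)
  have t: "0 \<le> t" using f0 nu m by (simp add: t_def)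
  have At: "coeff_solution \<nu> {0..t} A" by (rule coeff_solution_subset[OF A]) auto
  note nA = coeff_solutionD(1)[OF At]
  have "f t + 2 * \<nu> * m * t \<le> f 0 + 2 * \<nu> * m * 0"
  proof (rule nonpos_derivative_imp_le[OF t])
    fix s assume s: "s \<in> {0..t}"
    note d = energy_has_derivative[OF coeff_solutionD(2)[OF At s] ns_coeffsD(1)[OF nA] s ns_coeffsD(1)[OF ns_coeffs_nsrhs[OF nA[OF s]]]]
    show "((\<lambda>t. f t + 2 * \<nu> * m * t) has_real_derivative
        (2 * inn n (A s) (nsrhs \<nu> (A s)) + 2 * inn 0 (A s) (nsrhs \<nu> (A s))) + 2 * \<nu> * m * 1) (at s within {0..t})"
      unfolding f_def by (intro DERIV_add d DERIV_cmult DERIV_ident)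
    define F where "F = inn (n + 1) (A s) (A s)"
    define g where "g = inn 0 (A s) (A s)"
    define h where "h = inn n (A s) (A s)"
    have "inn n (A s) (nsrhs \<nu> (A s)) = - \<nu> * F + inn n (Bil (A s) (A s)) (A s)"
      unfolding F_def inn_commute[of n "A s" "nsrhs \<nu> (A s)"] by (rule inn_nsrhs[OF nA[OF s]])
    moreover have "inn n (Bil (A s) (A s)) (A s) \<le> \<nu> * h"
    proof -
      have "\<bar>inn n (Bil (A s) (A s)) (A s)\<bar> \<le> G * nrm n (A s) * h" using G[OF nA[OF s]] by (simp add: nrm_sq h_def)
      also have "\<dots> \<le> \<nu> * h"
      proof (rule mult_right_mono)
        show "G * nrm n (A s) \<le> \<nu>" using le[of s] s Gpos by (simp add: pos_le_divide_eq mult.commute)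
        show "0 \<le> h" unfolding h_def by (rule inn_self_nonneg)
      qed
      finally show ?thesis by simp
    qed
    moreover have "inn 0 (A s) (nsrhs \<nu> (A s)) = - \<nu> * inn (0 + 1) (A s) (A s) + inn 0 (Bil (A s) (A s)) (A s)"
      unfolding inn_commute[of 0 "A s" "nsrhs \<nu> (A s)"] by (rule inn_nsrhs[OF nA[OF s]])
    moreover have "\<nu> * g \<le> \<nu> * inn (0 + 1) (A s) (A s)"
      unfolding g_def using nu by (intro mult_left_mono inn_mono ns_coeffsD(1)[OF nA[OF s]]) auto
    moreover have "\<nu> * (2 * h) \<le> \<nu> * (F + g)"
      unfolding h_def F_def g_def using nu by (intro mult_left_mono inn_spectral_gap ns_coeffsD(1)[OF nA[OF s]]) auto
    moreover have "\<nu> * m \<le> \<nu> * h"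
    proof (rule mult_left_mono)
      have "(\<nu> / G)\<^sup>2 \<le> (nrm n (A s))\<^sup>2" using ge[of s] s nu Gpos by (intro power_mono) auto
      thus "m \<le> h" by (simp add: nrm_sq m_def h_def)
    qed (use nu in simp)
    ultimately show "(2 * inn n (A s) (nsrhs \<nu> (A s)) + 2 * inn 0 (A s) (nsrhs \<nu> (A s))) + 2 * \<nu> * m * 1 \<le> 0"
      using Bil_cancel[OF nA[OF s] nA[OF s]] by (simp add: algebra_simps)
  qed
  moreover have "2 * \<nu> * m * t = f 0 + 2 * \<nu> * m" using nu m by (simp add: t_def field_simps)
  moreover have "0 \<le> f t" unfolding f_def by (intro add_nonneg_nonneg inn_self_nonneg)
  moreover have "0 < 2 * \<nu> * m" using nu m by simp
  ultimately show False by simp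
qed

lemma e_visc_le: "0 < \<nu> \<Longrightarrow> e_visc \<nu> t \<le> 1 / \<nu>"
  by (simp add: e_visc_def divide_right_mono)

text \<open>With the threshold as initial bound the denominator tends to 0 for large times, so this
  estimate is used only up to a time \<open>t0\<close> at which the norm is strictly below the
  threshold; after a restart at \<open>t0\<close> the denominator stays above a positive
  constant.\<close>

lemma exponential_decay:
  fixes A :: "real \<Rightarrow> int^('d::finite) \<Rightarrow> complex^'d"
  assumes A: "coeff_solution \<nu> {0..} A" and nu: "0 < \<nu>"
    and G: "\<And>a :: int^'d \<Rightarrow> complex^'d. a \<in> ns_coeffs \<Longrightarrow> \<bar>inn n (Bil a a) a\<bar> \<le> G * nrm n a * (nrm n a)\<^sup>2"
    and H: "\<And>a :: int^'d \<Rightarrow> complex^'d. a \<in> ns_coeffs \<Longrightarrow> \<bar>inn p (Bil a a) a\<bar> \<le> H * nrm n a * (nrm p a)\<^sup>2"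
    and pos: "0 < G" "0 < H" and init: "nrm n (A 0) \<le> \<nu> / G"
  shows "\<exists>C. \<forall>t\<ge>0. nrm p (A t) \<le> C * exp (- \<nu> * t)"
proof -
  \<comment> \<open>Using \<open>\<nu> / G\<close> in place of the actual initial norm treats the
    borderline and the strict case alike.\<close>
  have ev: "1 - G * (\<nu> / G) * e_visc \<nu> t = exp (- \<nu> * t)" for t using nu pos by (simp add: e_visc_def)
  have b0: "nrm n (A t) \<le> \<nu> / G" "nrm p (A t) \<le> nrm p (A 0) * exp (- \<nu> * t) / exp (- \<nu> * t) powr (H / G)" if t: "0 \<le> t" for t
  proof -
    have At: "coeff_solution \<nu> {0..t} A" by (rule coeff_solution_subset[OF A]) auto
    have small: "G * (\<nu> / G) * e_visc \<nu> t < 1" using ev[of t] exp_gt_zero[of "- \<nu> * t"] by linarith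
    note b = coeff_solution_bounds[OF t At G H pos less_imp_le[OF nu] init small, unfolded ev]
    show "nrm n (A t) \<le> \<nu> / G" using b(1) by simp
    show "nrm p (A t) \<le> nrm p (A 0) * exp (- \<nu> * t) / exp (- \<nu> * t) powr (H / G)" by (rule b(2))
  qed
  obtain t0 where t0: "0 \<le> t0" "nrm n (A t0) < \<nu> / G"
    by (rule norm_becomes_small[OF A nu pos(1) G b0(1)])
  \<comment> \<open>Lower bound, uniform in time, for the denominator after the restart, because
    \<open>e_visc\<close> never exceeds \<open>1 / \<nu>\<close>.\<close>
  define c where "c = 1 - G * nrm n (A t0) / \<nu>"
  have c: "0 < c" using t0(2) nu pos by (simp add: c_def field_simps)
  \<comment> \<open>\<open>C1\<close> serves the times up to \<open>t0\<close>; in \<open>C2\<close>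
    the factor \<open>exp (\<nu> * t0)\<close> undoes the shift of time.\<close>
  define C1 where "C1 = nrm p (A 0) / exp (- \<nu> * t0) powr (H / G)"
  define C2 where "C2 = nrm p (A t0) * exp (\<nu> * t0) / c powr (H / G)"
  have C: "0 \<le> C1" "0 \<le> C2" unfolding C1_def C2_def by (auto simp: nrm_nonneg)
  have "nrm p (A t) \<le> (C1 + C2) * exp (- \<nu> * t)" if t: "0 \<le> t" for t
  proof (cases "t \<le> t0")
    case True
    have "nrm p (A t) \<le> nrm p (A 0) * exp (- \<nu> * t) / exp (- \<nu> * t) powr (H / G)" by (rule b0(2)[OF t])
    also have "\<dots> \<le> nrm p (A 0) * exp (- \<nu> * t) / exp (- \<nu> * t0) powr (H / G)"
    proof (rule divide_left_mono)
      show "exp (- \<nu> * t0) powr (H / G) \<le> exp (- \<nu> * t) powr (H / G)"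
        using True nu pos by (intro powr_mono2) auto
    qed (auto simp: nrm_nonneg)
    also have "\<dots> = C1 * exp (- \<nu> * t)" by (simp add: C1_def)
    also have "\<dots> \<le> (C1 + C2) * exp (- \<nu> * t)" using C by (intro mult_right_mono) auto
    finally show ?thesis .
  next
    case False
    define r where "r = t - t0"
    have r: "0 \<le> r" using False by (simp add: r_def)
    define B where "B = (\<lambda>s. A (t0 + s))"
    have At: "coeff_solution \<nu> {t0..t0 + r} A" by (rule coeff_solution_subset[OF A]) (use t0 in auto)
    have B: "coeff_solution \<nu> {0..r} B"
      unfolding coeff_solution_def B_def
    proof (intro ballI conjI)
      fix s assume "s \<in> {0..r}"
      hence s: "t0 + s \<in> {t0..t0 + r}" by auto
      show "A (t0 + s) \<in> ns_coeffs" by (rule coeff_solutionD(1)[OF At s])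
      show "has_cderiv (\<lambda>s. A (t0 + s)) (nsrhs \<nu> (A (t0 + s))) s {0..r}"
        by (rule has_cderiv_shift[OF coeff_solutionD(2)[OF At s]])
    qed
    have "G * nrm n (A t0) * e_visc \<nu> r \<le> G * nrm n (A t0) * (1 / \<nu>)"
      using pos nrm_nonneg[of n "A t0"] by (intro mult_left_mono e_visc_le nu) auto
    hence cle: "c \<le> 1 - G * nrm n (A t0) * e_visc \<nu> r" by (simp add: c_def)
    have "nrm p (B r) \<le> nrm p (B 0) * exp (- \<nu> * r) / (1 - G * nrm n (A t0) * e_visc \<nu> r) powr (H / G)"
      by (rule coeff_solution_bounds(2)[OF r B G H pos less_imp_le[OF nu]]) (use cle c in \<open>auto simp: B_def\<close>)
    also have "\<dots> \<le> nrm p (B 0) * exp (- \<nu> * r) / c powr (H / G)"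
    proof (rule divide_left_mono)
      show "c powr (H / G) \<le> (1 - G * nrm n (A t0) * e_visc \<nu> r) powr (H / G)"
        using cle c pos by (intro powr_mono2) auto
      show "0 < (1 - G * nrm n (A t0) * e_visc \<nu> r) powr (H / G) * c powr (H / G)" using c cle by simp
    qed (auto simp: nrm_nonneg)
    also have "\<dots> = C2 * exp (- \<nu> * t)"
      by (simp add: C2_def B_def r_def right_diff_distrib exp_add[symmetric] mult.assoc)
    also have "\<dots> \<le> (C1 + C2) * exp (- \<nu> * t)" using C by (intro mult_right_mono) auto
    finally show ?thesis by (simp add: B_def r_def)
  qed
  thus ?thesis by blast
qed

lemma NS_solution_coeffs:
  assumes "NS_solution \<nu> u0 T u"
  shows "coeff_solution \<nu> (time_dom T) (\<lambda>t. fourier_coeff (u t))"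
  unfolding coeff_solution_def
proof (intro ballI conjI)
  fix t assume t: "t \<in> time_dom T"
  have S: "u s \<in> Sob_inf" if "s \<in> time_dom T" for s
    using assms that by (simp add: NS_solution_def smooth_curve_def)
  show n: "fourier_coeff (u t) \<in> ns_coeffs" by (rule Sob_inf_coeffs(1)[OF S[OF t]])
  note n' = ns_coeffs_nsrhs[OF n, of \<nu>]
  have "has_Sob_inf_derivative u (\<lambda>x. \<nu> *\<^sub>R laplacian (u t) x + NS_bilin (u t) (u t) x) t (time_dom T)"
    using assms t by (simp add: NS_solution_def)
  also have "(\<lambda>x. \<nu> *\<^sub>R laplacian (u t) x + NS_bilin (u t) (u t) x) = synth (nsrhs \<nu> (fourier_coeff (u t)))"
    using NS_rhs_synth[OF n, of \<nu>] unfolding Sob_inf_coeffs(2)[OF S[OF t]] .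
  finally have "has_cderiv (\<lambda>s. fourier_coeff (u s)) (fourier_coeff (synth (nsrhs \<nu> (fourier_coeff (u t))))) t (time_dom T)"
    using has_Sob_inf_derivative_iff[of "time_dom T" u, OF S t synth_in_Sob(1)[OF n']] by simp
  thus "has_cderiv (\<lambda>s. fourier_coeff (u s)) (nsrhs \<nu> (fourier_coeff (u t))) t (time_dom T)"
    unfolding fourier_coeff_synth[OF ns_coeffsD(1,2)[OF n']] .
qed

text \<open>\<open>T_crit\<close> is the time at which the denominator of the bound reaches 0, or
  infinity if that never happens.\<close>

lemma lt_T_crit_imp_small:
  fixes u0 :: "('d::finite) vfield"
  assumes nu: "0 \<le> \<nu>" and G: "0 < G" and t: "0 \<le> t" and x: "0 \<le> sob_norm n u0" and lt: "ereal t < T_crit \<nu> G n u0"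
  shows "G * sob_norm n u0 * e_visc \<nu> t < 1"
proof (cases "\<nu> = 0")
  case True
  show ?thesis
  proof (cases "u0 = (\<lambda>x. 0)")
    case True
    have "fourier_coeff u0 = (\<lambda>k. 0)" unfolding True by (simp add: fun_eq_iff fourier_coeff_def vec_eq_iff)
    hence "sob_norm n u0 = 0" by (simp add: sob_norm_def sob_inner_def)
    thus ?thesis by simp
  next
    case False
    hence lt: "t < 1 / (G * sob_norm n u0)" using lt \<open>\<nu> = 0\<close> by (simp add: T_crit_def)
    \<comment> \<open>A zero norm would make the quotient 0 by the convention for division,
      contradicting \<open>0 \<le> t\<close>.\<close>
    hence "sob_norm n u0 \<noteq> 0" using t by auto
    hence "0 < G * sob_norm n u0" using x G by simp
    thus ?thesis using lt \<open>\<nu> = 0\<close> by (simp add: e_visc_def pos_less_divide_eq mult.commute)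
  qed
next
  case False
  hence nu: "0 < \<nu>" using nu by simp
  define y where "y = G * sob_norm n u0"
  have ev: "e_visc \<nu> t = (1 - exp (- \<nu> * t)) / \<nu>" using nu by (simp add: e_visc_def)
  have "y * (1 - exp (- \<nu> * t)) < \<nu>"
  proof (cases "sob_norm n u0 \<le> \<nu> / G")
    case True
    hence "y \<le> \<nu>" using G by (simp add: y_def pos_le_divide_eq mult.commute)
    hence "y * (1 - exp (- \<nu> * t)) \<le> \<nu> * (1 - exp (- \<nu> * t))" using nu t by (intro mult_right_mono) auto
    also have "\<dots> < \<nu>" using nu by (simp add: right_diff_distrib)
    finally show ?thesis .
  next
    case False
    hence y: "\<nu> < y" using G by (simp add: y_def pos_le_divide_eq mult.commute)
    hence q: "0 < 1 - \<nu> / y" using nu by (simp add: field_simps)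
    have "t < - (1 / \<nu>) * ln (1 - \<nu> / y)" using lt False nu by (simp add: T_crit_def y_def)
    hence "ln (1 - \<nu> / y) < - \<nu> * t" using nu by (simp add: field_simps)
    hence "1 - \<nu> / y < exp (- \<nu> * t)" using q ln_less_cancel_iff[of "1 - \<nu> / y" "exp (- \<nu> * t)"] by simp
    hence "y * (1 - exp (- \<nu> * t)) < y * (\<nu> / y)" using y nu by (intro mult_strict_left_mono) auto
    thus ?thesis using y nu by simp
  qed
  thus ?thesis unfolding ev y_def[symmetric] using nu by (simp add: pos_divide_less_eq)
qed

lemma nrm_eq_0_imp:
  fixes a :: "int^('d::finite) \<Rightarrow> 'b::real_inner"
  assumes "rapid {a}" "a 0 = 0" "nrm p a = 0" shows "a k = 0"
proof (cases "k = 0")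
  case False
  hence "0 < norm (wavevec k) powr p" by simp
  moreover have "norm (wavevec k) powr p * norm (a k) \<le> 0"
    using component_le_nrm_general[OF summable_inn[OF assms(1,1)], where k = k and p = p] assms(3) by simp
  ultimately show ?thesis by (simp add: mult_le_0_iff)
qed (simp add: assms)

lemma time_dom_downward_closed:
  assumes "t \<in> time_dom T" shows "{0..t} \<subseteq> time_dom T"
proof
  fix s assume s: "s \<in> {0..t}"
  hence "ereal s \<le> ereal t" by simp
  also have "\<dots> < T" using assms by (simp add: time_dom_def)
  finally show "s \<in> time_dom T" using s by (simp add: time_dom_def)
qed

theorem proposition5p1:
  fixes u0 :: "('d::finite) vfield"
    and u :: "real \<Rightarrow> 'd vfield"
    and T :: ereal
    and \<nu> n :: real
    and G :: "real \<Rightarrow> real"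
    and GG :: "real \<Rightarrow> real \<Rightarrow> real"
  assumes dim: "CARD('d) \<ge> 2"
    and nu: "\<nu> \<ge> 0"
    and u0: "u0 \<in> Sob_inf"
    and u: "NS_maximal_solution \<nu> u0 T u"
    and G_pos: "\<And>m. m > real CARD('d) / 2 + 1 \<Longrightarrow> G m > 0"
    and G_ineq: "\<And>m (v :: 'd vfield) w.
      m > real CARD('d) / 2 + 1 \<Longrightarrow> v \<in> Sob m \<Longrightarrow> w \<in> Sob (m + 1) \<Longrightarrow>
      cmod (sob_inner m (NS_bilin v w) w) \<le> G m * sob_norm m v * (sob_norm m w)\<^sup>2"
    and GG_pos: "\<And>p m. m > real CARD('d) / 2 + 1 \<Longrightarrow> p \<ge> m \<Longrightarrow> GG p m > 0"
    and GG_ineq: "\<And>p m (v :: 'd vfield) w.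
      m > real CARD('d) / 2 + 1 \<Longrightarrow> p \<ge> m \<Longrightarrow> v \<in> Sob p \<Longrightarrow> w \<in> Sob (p + 1) \<Longrightarrow>
      cmod (sob_inner p (NS_bilin v w) w)
        \<le> 1 / 2 * GG p m * (sob_norm p v * sob_norm m w + sob_norm m v * sob_norm p w) * sob_norm p w"
    and GG_diag: "\<And>m. m > real CARD('d) / 2 + 1 \<Longrightarrow> GG m m = G m"
    and n: "n > real CARD('d) / 2 + 1"
  shows "T \<ge> T_crit \<nu> (G n) n u0 \<and>
    (\<forall>p t. p \<ge> n \<longrightarrow> t \<ge> 0 \<longrightarrow> ereal t < T_crit \<nu> (G n) n u0 \<longrightarrow>
       sob_norm p (u t) \<le> sob_norm p u0 * exp (- \<nu> * t) /
         (1 - G n * sob_norm n u0 * e_visc \<nu> t) powr (GG p n / G n)) \<and>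
    (sob_norm n u0 \<le> \<nu> / G n \<longrightarrow>
       T = \<infinity> \<and>
       (\<forall>p. \<exists>C. \<exists>\<delta>>0. \<forall>t\<ge>0. sob_norm p (u t) \<le> C * exp (- \<delta> * t)))"
proof -
  define A where "A = (\<lambda>t. fourier_coeff (u t))"
  have sol: "NS_solution \<nu> u0 T u"
    and maximal: "\<And>T' u'. T < T' \<Longrightarrow> NS_solution \<nu> u0 T' u' \<Longrightarrow> \<exists>t\<in>time_dom T. u' t \<noteq> u t"
    using u unfolding NS_maximal_solution_def by blast+
  have u_0: "u 0 = u0" and T0: "0 < T" and uS: "\<And>t. t \<in> time_dom T \<Longrightarrow> u t \<in> Sob_inf"
    using sol by (auto simp: NS_solution_def smooth_curve_def)
  have A: "coeff_solution \<nu> (time_dom T) A" unfolding A_def by (rule NS_solution_coeffs[OF sol])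
  have A0: "A 0 \<in> ns_coeffs" "A 0 = fourier_coeff u0" by (simp_all add: A_def u_0 Sob_inf_coeffs(1)[OF u0])
  have sn0: "sob_norm p u0 = nrm p (A 0)" for p
    using sob_norm_eq_nrm[of u0 p] ns_coeffsD(1)[OF A0(1)] by (simp add: A0(2))
  have sn: "sob_norm p (u t) = nrm p (A t)" if "t \<in> time_dom T" for p t
    unfolding A_def by (rule sob_norm_eq_nrm[OF ns_coeffsD(1)[OF Sob_inf_coeffs(1)[OF uS[OF that]]]])
  \<comment> \<open>The known inequality with both fields equal to the smooth field
    \<open>synth a\<close>: its two products coincide, which cancels the factor 1/2.\<close>
  have H: "\<bar>inn p (Bil a a) a\<bar> \<le> GG p n * nrm n a * (nrm p a)\<^sup>2" if p: "n \<le> p" and a: "a \<in> ns_coeffs" for p and a :: "int^'d \<Rightarrow> complex^'d"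
  proof -
    note fc = fourier_coeff_synth[OF ns_coeffsD(1,2)[OF a]] and fcB = fourier_coeff_synth[OF ns_coeffsD(1,2)[OF ns_coeffs_Bil[OF a a]]]
    note r = ns_coeffsD(1)[OF a] and rB = ns_coeffsD(1)[OF ns_coeffs_Bil[OF a a]]
    have sq: "sob_norm q (synth a) = nrm q a" for q using sob_norm_eq_nrm[of "synth a" q] r by (simp add: fc)
    have "inn p (Bil a a) a = Re (sob_inner p (NS_bilin (synth a) (synth a)) (synth a))"
      unfolding NS_bilin_synth[OF a a] by (simp add: sob_inner_Re fc fcB r rB)
    hence "\<bar>inn p (Bil a a) a\<bar> \<le> cmod (sob_inner p (NS_bilin (synth a) (synth a)) (synth a))"
      by (simp only: abs_Re_le_cmod)
    also have "\<dots> \<le> 1 / 2 * GG p n * (sob_norm p (synth a) * sob_norm n (synth a) + sob_norm n (synth a) * sob_norm p (synth a)) * sob_norm p (synth a)"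
      by (rule GG_ineq[OF n p synth_in_Sob(2)[OF a] synth_in_Sob(2)[OF a]])
    finally show ?thesis by (simp add: sq power2_eq_square mult_ac)
  qed
  have Hpos: "0 < GG p n" if "n \<le> p" for p by (rule GG_pos[OF n that])
  have Gn: "0 < G n" by (rule G_pos[OF n])
  \<comment> \<open>The inequality at order \<open>n\<close> is the diagonal case, where
    \<open>GG n n\<close> equals \<open>G n\<close>.\<close>
  have GH: "\<bar>inn n (Bil a a) a\<bar> \<le> G n * nrm n a * (nrm n a)\<^sup>2" if "a \<in> ns_coeffs" for a :: "int^'d \<Rightarrow> complex^'d"
    using H[OF order_refl that] by (simp add: GG_diag[OF n])
  have small: "G n * nrm n (A 0) * e_visc \<nu> t < 1" if "0 \<le> t" "ereal t < T_crit \<nu> (G n) n u0" for t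
    using lt_T_crit_imp_small[OF nu Gn that(1) _ that(2)] by (simp add: sn0 nrm_nonneg)
  have T_ge: "T_crit \<nu> (G n) n u0 \<le> T"
  proof (rule ccontr)
    assume "\<not> T_crit \<nu> (G n) n u0 \<le> T"
    hence "T < T_crit \<nu> (G n) n u0" by simp
    \<comment> \<open>A time beyond the lifetime of \<open>u\<close> but below
      \<open>T_crit\<close>; the solution constructed on \<open>{0..\<tau>}\<close> extends
      \<open>u\<close>, against maximality.\<close>
    then obtain \<tau> where \<tau>: "T < ereal \<tau>" "ereal \<tau> < T_crit \<nu> (G n) n u0" using ereal_dense2 by blast
    have "0 < ereal \<tau>" using T0 \<tau>(1) by (rule less_trans)
    hence \<tau>0: "0 < \<tau>" by simp
    obtain B where B: "\<And>t. t \<in> {0..\<tau>} \<Longrightarrow> B t \<in> ns_coeffs" "rapid (B ` {0..\<tau>})" "B 0 = A 0"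
      "\<And>t k. t \<in> {0..\<tau>} \<Longrightarrow> ((\<lambda>s. B s k) has_vector_derivative nsrhs \<nu> (B t) k) (at t within {0..\<tau>})"
      by (rule ns_coeffs_exists[OF nu less_imp_le[OF \<tau>0] A0(1) Gn GH Hpos H small[OF less_imp_le[OF \<tau>0] \<tau>(2)]]) (assumption | rule that)+
    have rc: "rapid_curve {0..\<tau>} B" using B by (simp add: rapid_curve_def)
    have cd: "comp_deriv {0..\<tau>} B (\<lambda>t. nsrhs \<nu> (B t))" using B(4) by (simp add: comp_deriv_def)
    have "synth (B 0) = u0" unfolding B(3) A0(2) by (rule Sob_inf_coeffs(2)[OF u0])
    hence "NS_solution \<nu> u0 (ereal \<tau>) (\<lambda>t. synth (B t))" using NS_solution_synth[OF \<tau>0 rc cd] by simp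
    from maximal[OF \<tau>(1) this] obtain t where t: "t \<in> time_dom T" "synth (B t) \<noteq> u t" by blast
    have t0: "0 \<le> t" using t(1) by (simp add: time_dom_def)
    have "ereal t < ereal \<tau>" using t(1) \<tau>(1) less_trans by (fastforce simp: time_dom_def)
    hence sub: "{0..t} \<subseteq> {0..\<tau>}" by auto
    have subT: "{0..t} \<subseteq> time_dom T" by (rule time_dom_downward_closed[OF t(1)])
    have "A t = B t"
    proof (rule coeff_solution_unique[OF t0 nu coeff_solution_subset[OF A subT]])
      show "coeff_solution \<nu> {0..t} B"
        by (rule coeff_solution_subset[OF coeff_solution_of_components[OF _ rc cd] sub]) simp
      show "rapid (B ` {0..t})" by (rule rapid_subset[OF B(2) image_mono[OF sub]])
      show "A 0 = B 0" by (simp add: B(3))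
    qed
    hence "synth (B t) = u t" using Sob_inf_coeffs(2)[OF uS[OF t(1)]] by (simp add: A_def)
    thus False using t(2) by simp
  qed
  have bound: "sob_norm p (u t) \<le> sob_norm p u0 * exp (- \<nu> * t) / (1 - G n * sob_norm n u0 * e_visc \<nu> t) powr (GG p n / G n)"
    if p: "n \<le> p" and t: "0 \<le> t" "ereal t < T_crit \<nu> (G n) n u0" for p t
  proof -
    have tT: "t \<in> time_dom T" using t less_le_trans[OF t(2) T_ge] by (simp add: time_dom_def)
    have sub: "{0..t} \<subseteq> time_dom T" by (rule time_dom_downward_closed[OF tT])
    show ?thesis unfolding sn[OF tT] sn0
      by (rule coeff_solution_bounds(2)[OF t(1) coeff_solution_subset[OF A sub] GH H[OF p] Gn Hpos[OF p] nu order_refl small[OF t]])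
  qed
  have decay: "T = \<infinity> \<and> (\<forall>p. \<exists>C. \<exists>\<delta>>0. \<forall>t\<ge>0. sob_norm p (u t) \<le> C * exp (- \<delta> * t))"
    if le: "sob_norm n u0 \<le> \<nu> / G n"
  proof -
    \<comment> \<open>Without viscosity the smallness condition forces the zero field, for which
      \<open>T_crit\<close> is infinite by definition.\<close>
    have zero: "u0 = (\<lambda>x. 0)" if "\<nu> = 0"
    proof -
      have "nrm n (A 0) = 0" using le that nrm_nonneg[of n "A 0"] by (simp add: sn0)
      hence "A 0 k = 0" for k by (rule nrm_eq_0_imp[OF ns_coeffsD(1,4)[OF A0(1)]])
      hence "A 0 = (\<lambda>k. 0 *\<^sub>R A 0 k)" by (simp add: fun_eq_iff)
      hence "synth (A 0) x = 0 *\<^sub>R synth (A 0) x" for x by (metis synth_scaleR)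
      thus ?thesis using Sob_inf_coeffs(2)[OF u0] by (simp add: A0(2) fun_eq_iff)
    qed
    have crit: "T_crit \<nu> (G n) n u0 = \<infinity>" using le zero nu by (auto simp: T_crit_def)
    hence T: "T = \<infinity>" using T_ge by simp
    have dom: "time_dom T = {0..}" by (auto simp: T time_dom_def)
    have "\<exists>C. \<exists>\<delta>>0. \<forall>t\<ge>0. sob_norm p (u t) \<le> C * exp (- \<delta> * t)" for p
    proof -
      \<comment> \<open>The decay is claimed for every real order; orders below \<open>n\<close> are
        reduced to order \<open>n\<close>.\<close>
      define q where "q = max p n"
      have q: "n \<le> q" "p \<le> q" by (auto simp: q_def)
      have pq: "sob_norm p (u t) \<le> nrm q (A t)" if t: "0 \<le> t" for t
      proof -
        have t: "t \<in> time_dom T" using t dom by simp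
        show ?thesis unfolding sn[OF t] by (rule nrm_mono[OF ns_coeffsD(1)[OF coeff_solutionD(1)[OF A t]] q(2)])
      qed
      show ?thesis
      \<comment> \<open>The decay rate is \<open>\<nu>\<close> for positive viscosity; without
        viscosity the solution is zero and any rate serves, here 1.\<close>
      proof (cases "\<nu> = 0")
        case True
        have z: "nrm q (A 0) = 0"
          using zero[OF True] by (simp add: A0(2) nrm_def inn_def fourier_coeff_def zero_vec_def[symmetric])
        have "nrm q (A t) \<le> 0" if t: "0 \<le> t" for t
          using bound[OF q(1) t] t by (simp add: crit sn[of t] dom sn0 z)
        hence "\<forall>t\<ge>0. sob_norm p (u t) \<le> 0 * exp (- 1 * t)" using pq order_trans by fastforce
        thus ?thesis using zero_less_one by blast
      next
        case False
        hence nu': "0 < \<nu>" using nu by simp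
        obtain C where "\<forall>t\<ge>0. nrm q (A t) \<le> C * exp (- \<nu> * t)"
          using exponential_decay[OF A[unfolded dom] nu' GH H[OF q(1)] Gn Hpos[OF q(1)]] le by (auto simp: sn0)
        hence "\<forall>t\<ge>0. sob_norm p (u t) \<le> C * exp (- \<nu> * t)" using pq order_trans by blast
        thus ?thesis using nu' by blast
      qed
    qed
    thus ?thesis using T by blast
  qed
  show ?thesis using T_ge bound decay by blast
qed

end
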